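(* Let $G$ be a finite solvable group such that $\sigma(G)=2$ and such that for any two distinct primes $p,q\in\pi(G)$ the following conditions hold: (1) $p$ does not divide $q-1$; (2) $pq\in\omega(G)$. Then $|\pi(G)|\le 3$.
   Context: For a finite group $G$: $\pi(G)$ is the set of prime divisors of $|G|$; $\omega(G)$ is the set of all orders of elements of $G$; for $g\in G$, $\pi(g)$ is the set of prime divisors of the order of $g$; and $\sigma(G)=\max\{|\pi(g)| : g\in G\}$. *)

theory Defs
  imports
    "HOL-Algebra.Solvable_Groups"
    "HOL-Algebra.Multiplicative_Group"
    "HOL-Computational_Algebra.Primes"
begin

text \<open>Notation for a finite group \<open>G\<close>: \<open>\<pi>(G)\<close> is \<open>group_primes G\<close>,
  \<open>\<omega>(G)\<close> is \<open>element_orders G\<close>, \<open>\<pi>(g)\<close> is \<open>element_primes G g\<close>, and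
  \<open>\<sigma>(G)\<close> is \<open>group_sigma G\<close>.\<close>

definition group_primes :: "('a, 'b) monoid_scheme \<Rightarrow> nat set" where
  "group_primes G = prime_factors (Coset.order G)"

definition element_orders :: "('a, 'b) monoid_scheme \<Rightarrow> nat set" where
  "element_orders G = group.ord G ` carrier G"

definition element_primes :: "('a, 'b) monoid_scheme \<Rightarrow> 'a \<Rightarrow> nat set" where
  "element_primes G g = prime_factors (group.ord G g)"

definition group_sigma :: "('a, 'b) monoid_scheme \<Rightarrow> nat" where
  "group_sigma G = Max ((\<lambda>g. card (element_primes G g)) ` carrier G)"

end

theory Submission
  imports Defs "HOL-Algebra.Group_Action" "HOL-Algebra.Sylow" "HOL-Number_Theory.Residues"
begin

text \<open>
  Suppose that \<open>|\<pi>(G)| \<ge> 4\<close>. The proof studies commuting elements of prime order: three of them,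
  of distinct orders, never exist, not even modulo a normal subgroup, while every pair of primes is
  realised by a commuting pair; and since \<open>p\<close> does not divide \<open>q - 1\<close>, every cyclic chief
  factor is central.

  Averaging over Frobenius-like configurations shows that two primes \<open>r\<close>, \<open>p\<close> have nontrivial
  radicals \<open>R = O\<^sub>r(G)\<close> and \<open>P = O\<^sub>p(G)\<close>, and that a chief factor above \<open>F = R P\<close>
  is cyclic of order different from \<open>r\<close> and \<open>p\<close>. Hence it is generated by an element \<open>a\<close> of prime
  order \<open>q\<close> that is central modulo \<open>F\<close> and can be chosen with \<open>C\<^sub>F(a) = 1\<close>, so that
  \<open>G = F C\<^sub>G(a)\<close> with \<open>F \<inter> C\<^sub>G(a) = 1\<close>. Let \<open>B = C\<^sub>G(a)\<close> and let \<open>s\<close> be a fourth prime. Some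
  \<open>b \<in> B\<close> of order \<open>s\<close> fixes a nontrivial element of \<open>R\<close>, and such a \<open>b\<close> centralises \<open>O\<^sub>q(B)\<close>. If
  \<open>O\<^sub>s(B) = 1\<close>, then \<open>O\<^sub>q(B)\<close> is the Fitting subgroup of \<open>B\<close> and contains \<open>b\<close>, which is absurd.
  Otherwise the situation is symmetric in \<open>q\<close> and \<open>s\<close>: some \<open>x \<in> B\<close> of order \<open>q\<close> fixes a nontrivial
  element of \<open>R\<close> and centralises \<open>O\<^sub>s(B)\<close>. The commutator of \<open>b\<close> and \<open>x\<close> then centralises the
  Fitting subgroup, which forces \<open>b\<close> and \<open>x\<close> to commute; this makes \<open>x\<close> a power of \<open>a\<close>, contradicting
  \<open>C\<^sub>F(a) = 1\<close>.
\<close>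

section \<open>Conjugation and elements of prime order\<close>

text \<open>One dichotomy drives every step. An abelian section of prime exponent \<open>t\<close>,
  coprime to what lies below it, is either cyclic or contains an \<open>indep\<close> pair. If it is
  cyclic, the arithmetic condition makes it central, and it lifts to elements that commute with a
  given one. Otherwise some element of order \<open>t\<close> in the span of the pair fixes a
  nontrivial element of every \<open>r\<close>-group that the pair normalises, for
  \<open>r \<noteq> t\<close>. Both cases produce commuting elements of prime order, and three
  distinct orders are fatal. Two obstacles shape the text. Commutation lifts through a kernel only
  if its order avoids the primes involved, so chief factors are taken above a largest invariant
  subgroup avoiding those primes. And a commuting pair may collapse in a quotient, so the arguments
  about quotients take the few pairs they need as hypotheses (\<open>edge\<close>,
  \<open>epu\<close>). Once both radicals exist, an element of prime order other than
  \<open>r\<close>, \<open>p\<close> cannot fix nontrivial elements in both; facts are therefore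
  proved for \<open>R\<close>, exchanged by \<open>swap\<close>, and played against each other. The
  fourth prime supplies the pairs that force regular action.\<close>

context group
begin

definition commutes :: "'a \<Rightarrow> 'a \<Rightarrow> bool" where
  "commutes x y \<longleftrightarrow> x \<otimes> y = y \<otimes> x"

definition cnj :: "'a \<Rightarrow> 'a \<Rightarrow> 'a" where
  "cnj g x = g \<otimes> x \<otimes> inv g"

lemma mult_inv_cancel [simp]:
  assumes "x \<in> carrier G" "y \<in> carrier G"
  shows "x \<otimes> (inv x \<otimes> y) = y" and "inv x \<otimes> (x \<otimes> y) = y"
  using assms by (simp_all flip: m_assoc)

lemma commutes_sym: "commutes x y \<Longrightarrow> commutes y x"
  by (simp add: commutes_def)

lemma commutes_refl [simp]: "commutes x x"
  by (simp add: commutes_def)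

lemma commutes_one [simp]: "x \<in> carrier G \<Longrightarrow> commutes x \<one>"
  by (simp add: commutes_def)

lemma commutes_mult:
  assumes "commutes x y" "commutes x z" "x \<in> carrier G" "y \<in> carrier G" "z \<in> carrier G"
  shows "commutes x (y \<otimes> z)"
  using assms unfolding commutes_def by (metis m_assoc)

lemma commutes_inv:
  assumes "commutes x y" "x \<in> carrier G" "y \<in> carrier G"
  shows "commutes x (inv y)"
  using assms unfolding commutes_def by (metis inv_closed inv_solve_left inv_solve_right m_assoc m_closed)

lemma commutes_pow:
  assumes "commutes x y" "x \<in> carrier G" "y \<in> carrier G"
  shows "commutes x (y [^] (n::nat))"
  using assms by (induction n) (auto intro: commutes_mult)

lemma commutes_pow2:
  assumes "commutes x y" "x \<in> carrier G" "y \<in> carrier G"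
  shows "commutes (x [^] (m::nat)) (y [^] (n::nat))"
  using assms by (meson commutes_pow commutes_sym nat_pow_closed)

lemma pow_mult_commutes:
  assumes "commutes x y" "x \<in> carrier G" "y \<in> carrier G"
  shows "(x \<otimes> y) [^] (n::nat) = x [^] n \<otimes> y [^] n"
  using assms pow_mult_distrib[of x y n] by (simp add: commutes_def)

lemma cnj_closed [simp]: "g \<in> carrier G \<Longrightarrow> x \<in> carrier G \<Longrightarrow> cnj g x \<in> carrier G"
  by (simp add: cnj_def)

lemma cnj_one [simp]: "g \<in> carrier G \<Longrightarrow> cnj g \<one> = \<one>"
  by (simp add: cnj_def)

lemma one_cnj [simp]: "x \<in> carrier G \<Longrightarrow> cnj \<one> x = x"
  by (simp add: cnj_def)

lemma cnj_mult:
  "g \<in> carrier G \<Longrightarrow> x \<in> carrier G \<Longrightarrow> y \<in> carrier G \<Longrightarrow> cnj g (x \<otimes> y) = cnj g x \<otimes> cnj g y"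
  by (simp add: cnj_def m_assoc)

lemma cnj_inv:
  "g \<in> carrier G \<Longrightarrow> x \<in> carrier G \<Longrightarrow> cnj g (inv x) = inv (cnj g x)"
  by (simp add: cnj_def m_assoc inv_mult_group)

lemma cnj_cnj:
  "g \<in> carrier G \<Longrightarrow> h \<in> carrier G \<Longrightarrow> x \<in> carrier G \<Longrightarrow> cnj g (cnj h x) = cnj (g \<otimes> h) x"
  by (simp add: cnj_def m_assoc inv_mult_group)

lemma cnj_inv_cnj [simp]:
  "g \<in> carrier G \<Longrightarrow> x \<in> carrier G \<Longrightarrow> cnj (inv g) (cnj g x) = x"
  "g \<in> carrier G \<Longrightarrow> x \<in> carrier G \<Longrightarrow> cnj g (cnj (inv g) x) = x"
  by (simp_all add: cnj_cnj)

lemma cnj_pow: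
  "g \<in> carrier G \<Longrightarrow> x \<in> carrier G \<Longrightarrow> cnj g (x [^] (n::nat)) = cnj g x [^] n"
  by (induction n) (auto simp: cnj_mult)

lemma cnj_eq_iff:
  assumes "g \<in> carrier G" "x \<in> carrier G"
  shows "cnj g x = x \<longleftrightarrow> commutes g x"
proof -
  have "cnj g x = x \<longleftrightarrow> g \<otimes> x = x \<otimes> g"
    unfolding cnj_def using assms by (metis inv_closed inv_solve_right' m_closed)
  then show ?thesis by (simp add: commutes_def)
qed

lemma cnj_commutes_iff:
  assumes "g \<in> carrier G" "x \<in> carrier G" "y \<in> carrier G"
  shows "commutes (cnj g x) (cnj g y) \<longleftrightarrow> commutes x y"
  using assms unfolding commutes_def
  by (metis cnj_inv_cnj(1) cnj_mult m_closed)

text \<open>Since \<open>b\<close> fixes the commutator \<open>n\<close>, iterated conjugation only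
  accumulates powers of \<open>n\<close>. If \<open>b\<close> has order \<open>s\<close>, this
  forces \<open>n [^] s = \<one>\<close>; in coprime action the commutator is then trivial.\<close>

lemma cnj_pow_shift:
  assumes b: "b \<in> carrier G" and x: "x \<in> carrier G" and n: "n \<in> carrier G"
    and bx: "cnj b x = x \<otimes> n" and bn: "commutes b n"
  shows "cnj (b [^] (i::nat)) x = x \<otimes> n [^] i"
proof (induction i)
  case (Suc i)
  have "cnj (b [^] Suc i) x = cnj b (cnj (b [^] i) x)"
    using b x by (metis cnj_cnj nat_pow_Suc2 nat_pow_closed)
  also have "\<dots> = cnj b x \<otimes> cnj b (n [^] i)" using Suc b x n by (simp add: cnj_mult)
  also have "cnj b (n [^] i) = n [^] i" using bn b n by (simp add: cnj_eq_iff commutes_pow)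
  also have "cnj b x \<otimes> n [^] i = x \<otimes> (n \<otimes> n [^] i)" using bx x n by (simp add: m_assoc)
  finally show ?case using n by (metis nat_pow_Suc2)
qed (use x in simp)

lemma cnj_inj: "g \<in> carrier G \<Longrightarrow> inj_on (cnj g) (carrier G)"
  by (metis cnj_inv_cnj(1) inj_on_inverseI)

lemma ord_cnj [simp]:
  assumes "g \<in> carrier G" "x \<in> carrier G"
  shows "ord (cnj g x) = ord x"
proof -
  have "cnj g x [^] n = \<one> \<longleftrightarrow> x [^] n = \<one>" for n :: nat
    using assms by (metis cnj_inv_cnj(1) cnj_one cnj_pow inv_closed nat_pow_closed)
  then show ?thesis
    using assms by (metis cnj_closed ord_unique pow_eq_id)
qed

lemma subgroup_pow: "subgroup H G \<Longrightarrow> x \<in> H \<Longrightarrow> x [^] (n::nat) \<in> H"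
  by (induction n) (auto simp: subgroup.one_closed subgroup.m_closed)

definition cent :: "'a set \<Rightarrow> 'a set" where
  "cent S = {g \<in> carrier G. \<forall>s\<in>S. commutes g s}"

lemma cent_subgroup:
  assumes "S \<subseteq> carrier G" shows "subgroup (cent S) G"
proof (rule subgroupI)
  show "cent S \<subseteq> carrier G" by (auto simp: cent_def)
  have "\<one> \<in> cent S" using assms by (auto simp: cent_def commutes_def)
  then show "cent S \<noteq> {}" by blast
  show "inv a \<in> cent S" if "a \<in> cent S" for a
  proof -
    have "commutes (inv a) s" if "s \<in> S" for s
    proof -
      have "commutes s (inv a)"
        using that assms \<open>a \<in> cent S\<close> by (intro commutes_inv) (auto simp: cent_def intro: commutes_sym)
      then show ?thesis by (rule commutes_sym)
    qed
    then show ?thesis using that by (simp add: cent_def)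
  qed
  show "a \<otimes> b \<in> cent S" if "a \<in> cent S" "b \<in> cent S" for a b
  proof -
    have "commutes (a \<otimes> b) s" if "s \<in> S" for s
    proof -
      have "commutes s (a \<otimes> b)"
        using that assms \<open>a \<in> cent S\<close> \<open>b \<in> cent S\<close>
        by (intro commutes_mult) (auto simp: cent_def intro: commutes_sym)
      then show ?thesis by (rule commutes_sym)
    qed
    then show ?thesis using that by (simp add: cent_def)
  qed
qed

lemma rcoset_mem_iff:
  assumes "subgroup N G" "x \<in> carrier G" "y \<in> carrier G"
  shows "y \<in> N #> x \<longleftrightarrow> y \<otimes> inv x \<in> N"
  using assms by (simp add: subgroup.rcos_module group_axioms)

lemma card_rcoset:
  assumes "N \<subseteq> carrier G" "g \<in> carrier G"
  shows "card (N #> g) = card N"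
  using card_cosets_equal[OF rcosetsI[OF assms] assms(1)] bij_betw_same_card by metis

text \<open>Orbits of a \<open>p\<close>-group have \<open>p\<close>-power length, so a set of size
  prime to \<open>p\<close> contains an orbit of length one. The action is a bare function with its
  laws on \<open>P\<close> and \<open>\<Omega>\<close>, so that conjugation, translation of cosets
  and actions on sections all fit directly.\<close>

lemma pgroup_fixpoint:
  assumes P: "subgroup P G" and cP: "card P = p ^ k" and p: "prime (p::nat)"
    and fin: "finite \<Omega>" and nd: "\<not> p dvd card \<Omega>"
    and cl: "\<And>x w. x \<in> P \<Longrightarrow> w \<in> \<Omega> \<Longrightarrow> f x w \<in> \<Omega>"
    and one: "\<And>w. w \<in> \<Omega> \<Longrightarrow> f \<one> w = w"
    and comp: "\<And>x y w. x \<in> P \<Longrightarrow> y \<in> P \<Longrightarrow> w \<in> \<Omega> \<Longrightarrow> f (x \<otimes> y) w = f x (f y w)"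
  shows "\<exists>w\<in>\<Omega>. \<forall>x\<in>P. f x w = w"
proof (rule ccontr)
  assume no: "\<not> ?thesis"
  \<comment> \<open>\<open>Bij\<close> admits only functions that are undefined outside
    \<open>\<Omega>\<close>, hence the restriction.\<close>
  let ?P = "G\<lparr>carrier := P\<rparr>" and ?f = "\<lambda>x. restrict (f x) \<Omega>"
  interpret P: group ?P using P by (rule subgroup_imp_group)
  have bij: "?f x \<in> Bij \<Omega>" if "x \<in> P" for x
  proof -
    have ix: "inv x \<in> P" using P that by (simp add: subgroup.m_inv_closed)
    have xc: "x \<in> carrier G" using P that subgroup.mem_carrier by metis
    have "bij_betw (f x) \<Omega> \<Omega>"
    proof (rule bij_betwI[where g = "f (inv x)"])
      show "f x \<in> \<Omega> \<rightarrow> \<Omega>" "f (inv x) \<in> \<Omega> \<rightarrow> \<Omega>" using cl that ix by auto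
      show "f (inv x) (f x w) = w" if "w \<in> \<Omega>" for w
        using comp[OF ix \<open>x \<in> P\<close> that] one[OF that] xc by simp
      show "f x (f (inv x) w) = w" if "w \<in> \<Omega>" for w
        using comp[OF \<open>x \<in> P\<close> ix that] one[OF that] xc by simp
    qed
    then show ?thesis by (auto simp: Bij_def bij_betw_def inj_on_def)
  qed
  have hom: "?f \<in> hom ?P (BijGroup \<Omega>)"
    using comp cl by (auto simp: hom_def BijGroup_def bij compose_def fun_eq_iff)
  interpret group_action ?P \<Omega> ?f
    unfolding group_action_def group_hom_def group_hom_axioms_def
    using hom group_BijGroup P.is_group by blast
  have "card \<Omega> = sum card (orbits ?P \<Omega> ?f)"
  proof -
    have part: "partition \<Omega> (orbits ?P \<Omega> ?f)" by (rule orbit_partition)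
    have "\<Omega> = \<Union>(orbits ?P \<Omega> ?f)"
      using partition.partition_coverture[OF part] by simp
    moreover have "pairwise disjnt (orbits ?P \<Omega> ?f)"
      using partition.disjoint_union[OF part] by (auto simp: pairwise_def disjnt_def)
    moreover have "finite o'" if "o' \<in> orbits ?P \<Omega> ?f" for o'
      using fin calculation(1) that by (metis Union_upper finite_subset)
    ultimately show ?thesis by (metis card_Union_disjoint)
  qed
  moreover have "p dvd card o'" if "o' \<in> orbits ?P \<Omega> ?f" for o'
  proof -
    obtain w where w: "w \<in> \<Omega>" "o' = orbit ?P ?f w"
      using \<open>o' \<in> _\<close> by (auto simp: orbits_def)
    have "card o' * card (stabilizer ?P ?f w) = p ^ k"
      using orbit_stabilizer_theorem[OF w(1)] w(2) cP by (simp add: order_def)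
    then have "card o' dvd p ^ k" by (metis dvd_triv_left)
    then obtain j where j: "card o' = p ^ j" using p by (auto simp: divides_primepow_nat)
    have "card o' \<noteq> 1"
    proof
      assume "card o' = 1"
      then obtain z where z: "o' = {z}" by (auto simp: card_1_singleton_iff)
      have "w \<in> o'" using w orbit_refl by auto
      then have "z = w" using z by auto
      have "f x w = w" if "x \<in> P" for x
      proof -
        have "f x w \<in> o'" using w that by (auto simp: orbit_def)
        then show ?thesis using z \<open>z = w\<close> by auto
      qed
      then show False using no w(1) by blast
    qed
    then have "j \<noteq> 0" using j by (metis power_0)
    then show ?thesis using j by (simp add: dvd_power)
  qed
  ultimately have "p dvd card \<Omega>" by (simp add: dvd_sum)
  then show False using nd by simp
qed


text \<open>The conjugating set \<open>U\<close> is arbitrary: the same predicate expresses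
  normality (\<open>U = carrier G\<close>), normalisation by a subgroup and normalisation by a
  single element.\<close>

definition invariant :: "'a set \<Rightarrow> 'a set \<Rightarrow> bool" where
  "invariant U N \<longleftrightarrow> (\<forall>u\<in>U. \<forall>x\<in>N. cnj u x \<in> N)"

text \<open>For prime \<open>q\<close> such a pair generates an elementary abelian group of order
  \<open>q^2\<close>; natural exponents suffice because the orders are finite.\<close>

definition indep :: "nat \<Rightarrow> 'a \<Rightarrow> 'a \<Rightarrow> bool" where
  "indep q x y \<longleftrightarrow> x \<in> carrier G \<and> y \<in> carrier G \<and> ord x = q \<and> ord y = q \<and> commutes x y
     \<and> (\<forall>i::nat. y \<noteq> x [^] i)"

lemma invariantD: "invariant U N \<Longrightarrow> u \<in> U \<Longrightarrow> x \<in> N \<Longrightarrow> cnj u x \<in> N"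
  by (simp add: invariant_def)

lemma invariant_mono: "invariant U N \<Longrightarrow> U' \<subseteq> U \<Longrightarrow> invariant U' N"
  by (auto simp: invariant_def)

lemma invariant_self: "subgroup H G \<Longrightarrow> invariant H H"
  by (auto simp: invariant_def cnj_def subgroup.m_closed subgroup.m_inv_closed)

lemma invariant_one: "U \<subseteq> carrier G \<Longrightarrow> invariant U {\<one>}"
  by (auto simp: invariant_def)

lemma normal_iff_invariant: "N \<lhd> G \<longleftrightarrow> subgroup N G \<and> invariant (carrier G) N"
  by (simp add: normal_inv_iff invariant_def cnj_def)

lemma ord_eq_prime:
  assumes "prime p" "x \<in> carrier G" "x [^] p = \<one>" "x \<noteq> \<one>"
  shows "ord x = p"
proof -
  have "ord x dvd p" using assms pow_eq_id by blast
  moreover have "ord x \<noteq> 1" using assms ord_eq_1 by blast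
  ultimately show ?thesis using assms(1) prime_nat_iff by blast
qed

text \<open>Modulo \<open>X\<close> the element \<open>e\<close> has order exactly \<open>t\<close>:
  by Bezout, an exponent prime to \<open>t\<close> would bring \<open>e\<close> itself into
  \<open>X\<close>.\<close>

lemma pow_mem_imp_dvd:
  assumes X: "subgroup X G" and t: "prime (t::nat)" and e: "e \<in> carrier G" "e \<notin> X" "e [^] t \<in> X"
    and m: "e [^] (m::nat) \<in> X"
  shows "t dvd m"
proof (rule ccontr)
  assume "\<not> t dvd m"
  then have "coprime m t" using t prime_imp_coprime[of t m] coprime_commute by blast
  moreover have "m \<noteq> 0" using \<open>\<not> t dvd m\<close> by (metis dvd_0_right)
  ultimately obtain a b where "m * a = t * b + 1"
    using bezout_nat[of m t] by auto
  then have "(e [^] m) [^] a = (e [^] t) [^] b \<otimes> e"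
    using e by (simp add: nat_pow_pow)
  moreover have "(e [^] m) [^] a \<in> X" "(e [^] t) [^] b \<in> X"
    using X m e(3) subgroup_pow by blast+
  ultimately have "inv ((e [^] t) [^] b) \<otimes> ((e [^] t) [^] b \<otimes> e) \<in> X"
    using X by (metis subgroup.m_closed subgroup.m_inv_closed)
  then show False using e by simp
qed

lemma prime_ord_pow_eq:
  assumes "prime (p::nat)" "ord x = p" "x \<in> carrier G" "x [^] (i::nat) \<noteq> \<one>"
  shows "ord (x [^] i) = p" and "\<exists>k::nat. (x [^] i) [^] k = x"
proof -
  show "ord (x [^] i) = p"
    by (rule ord_eq_prime) (use assms in \<open>auto simp: nat_pow_pow pow_eq_id\<close>)
  have "\<not> p dvd i" using assms pow_eq_id by blast
  then have "coprime i p" "i \<noteq> 0"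
    using assms(1) prime_imp_coprime[of p i] coprime_commute by (blast, metis dvd_0_right)
  then obtain a b where ab: "i * a = p * b + 1" using bezout_nat[of i p] by auto
  have "x [^] (p * b) = \<one>" using assms pow_eq_id by auto
  then have "(x [^] i) [^] a = x"
    using assms ab by (simp add: nat_pow_pow)
  then show "\<exists>k::nat. (x [^] i) [^] k = x" by blast
qed

text \<open>The listed elements represent all subgroups of order \<open>q\<close> in the span of the
  pair. This is the form in which averaging later delivers an element.\<close>

lemma indep_ord:
  assumes q: "prime q" and xy: "indep q x y" and e: "e = y \<or> (\<exists>i::nat. e = x \<otimes> y [^] i)"
  shows "ord e = q"
proof (cases "e = y")
  case False
  then obtain i :: nat where i: "e = x \<otimes> y [^] i" using e by auto
  have x: "x \<in> carrier G" "ord x = q" and y: "y \<in> carrier G" "ord y = q" and cxy: "commutes x y"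
    and ne: "\<And>i::nat. y \<noteq> x [^] i" using xy by (auto simp: indep_def)
  have q1: "x [^] q = \<one>" "y [^] q = \<one>" using x y by (auto simp: pow_eq_id)
  have "commutes x (y [^] i)" using cxy x y commutes_pow by blast
  then have "e [^] q = x [^] q \<otimes> (y [^] i) [^] q"
    using i x y pow_mult_commutes[of x "y [^] i" q] by simp
  moreover have "(y [^] i) [^] q = (y [^] q) [^] i" using y by (metis nat_pow_pow mult.commute)
  ultimately have eq: "e [^] q = \<one>" using q1 by simp
  have e1: "e \<noteq> \<one>"
  proof
    assume e1: "e = \<one>"
    then have "inv (y [^] i) = x" using i x y by (intro inv_equality) auto
    moreover have "x \<noteq> \<one>" using x(2) q by auto
    ultimately have "y [^] i \<noteq> \<one>" by auto
    then obtain k :: nat where k: "(y [^] i) [^] k = y" using prime_ord_pow_eq(2)[OF q y(2,1)] by blast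
    \<comment> \<open>\<open>indep\<close> excludes natural powers only, so the inverse of
      \<open>x\<close> is rewritten as one.\<close>
    have "x [^] (q - 1) \<otimes> x = \<one>" using q1 q prime_gt_0_nat by (metis Suc_diff_1 nat_pow_Suc)
    then have "inv x = x [^] (q - 1)" using x by (intro inv_equality) auto
    moreover have "inv x = y [^] i" using \<open>inv (y [^] i) = x\<close> y inv_inv[of "y [^] i"] by simp
    ultimately have "y = x [^] ((q - 1) * k)" using k x by (metis nat_pow_pow)
    then show False using ne by blast
  qed
  have "e \<in> carrier G" using i x y by simp
  then show ?thesis using ord_eq_prime[OF q] eq e1 by blast
qed (use xy in \<open>auto simp: indep_def\<close>)

text \<open>A Chinese remainder exponent: the \<open>m\<close>-th power kills elements whose order
  divides \<open>c\<close> and fixes those whose order divides \<open>t\<close>.\<close>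

lemma exists_unit_multiple:
  assumes "coprime c (t::nat)" "1 < t"
  shows "\<exists>m j. m = t * j + 1 \<and> c dvd m"
proof -
  obtain m where "[c * m = 1] (mod t)" using assms cong_solve_coprime_nat by auto
  moreover have "1 \<le> c * m"
  proof (rule ccontr)
    assume "\<not> 1 \<le> c * m"
    then have "c * m = 0" by linarith
    then have "[0 = 1] (mod t)" using calculation by metis
    then show False using assms by (simp add: cong_def)
  qed
  ultimately have "t dvd c * m - 1" using cong_to_1_nat by blast
  then obtain j where "c * m - 1 = t * j" by (auto elim: dvdE)
  then show ?thesis using \<open>1 \<le> c * m\<close> by (metis dvd_triv_left le_add_diff_inverse2)
qed

end

section \<open>Finite groups: Cauchy, Sylow, and lifting through coprime sections\<close>

locale fin_group = group G for G (structure) +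
  assumes fin [simp]: "finite (carrier G)"
begin

lemma finite_subgroup [simp]: "subgroup H G \<Longrightarrow> finite H"
  using fin finite_subset subgroup.subset by blast

lemma ord_pos: "x \<in> carrier G \<Longrightarrow> 0 < ord x"
  using ord_ge_1[OF fin] by force

lemma card_subgroup_pos: "subgroup H G \<Longrightarrow> 0 < card H"
  by (metis card_gt_0_iff empty_iff finite_subgroup subgroup.one_closed)

lemma restrict_fin_group: "subgroup H G \<Longrightarrow> fin_group (G\<lparr>carrier := H\<rparr>)"
  by (simp add: fin_group.intro fin_group_axioms.intro subgroup_imp_group)

lemma card_subgroup_dvd:
  assumes "subgroup H G" "subgroup K G" "H \<subseteq> K"
  shows "card H dvd card K"
proof -
  interpret K: group "G\<lparr>carrier := K\<rparr>" using assms(2) by (rule subgroup_imp_group)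
  have "subgroup H (G\<lparr>carrier := K\<rparr>)" using assms subgroup_incl by blast
  then have "card (rcosets\<^bsub>G\<lparr>carrier := K\<rparr>\<^esub> H) * card H = card K"
    using K.lagrange by (simp add: order_def)
  then show ?thesis by (metis dvd_triv_right)
qed

lemma mem_generate_pow:
  assumes "y \<in> carrier G" "x \<in> generate G {y}"
  shows "\<exists>i::nat. x = y [^] i"
  using generate_pow_on_finite_carrier[OF fin assms(1)] assms(2) by blast

lemma generate_single_subset: "subgroup H G \<Longrightarrow> y \<in> H \<Longrightarrow> generate G {y} \<subseteq> H"
  by (simp add: generate_subgroup_incl)

lemma ord_dvd_card:
  assumes "subgroup H G" "x \<in> H" shows "ord x dvd card H"
proof -
  have x: "x \<in> carrier G" using assms subgroup.mem_carrier by metis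
  have "ord x = card (generate G {x})" by (rule generate_pow_card[OF x])
  moreover have "subgroup (generate G {x}) G" using x by (simp add: generate_is_subgroup)
  ultimately show ?thesis
    using card_subgroup_dvd[OF _ assms(1)] generate_single_subset[OF assms] by simp
qed

lemma pow_card_eq_one: "subgroup H G \<Longrightarrow> x \<in> H \<Longrightarrow> card H dvd n \<Longrightarrow> x [^] (n::nat) = \<one>"
  by (meson dvd_trans ord_dvd_card pow_eq_id subgroup.mem_carrier)

lemma sylow_subgroup:
  assumes "prime p" "subgroup H G" "p ^ a dvd card H"
  shows "\<exists>P. subgroup P G \<and> P \<subseteq> H \<and> card P = p ^ a"
proof -
  interpret H: fin_group "G\<lparr>carrier := H\<rparr>" using assms(2) by (rule restrict_fin_group)
  obtain m where "card H = p ^ a * m" using assms(3) by (auto elim: dvdE)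
  then obtain P where "subgroup P (G\<lparr>carrier := H\<rparr>)" "card P = p ^ a"
    using sylow_thm[OF assms(1) H.is_group, of a m] H.fin by (auto simp: order_def)
  then show ?thesis using incl_subgroup[OF assms(2)] subgroup.subset by fastforce
qed

lemma cauchy:
  assumes "prime p" "subgroup H G" "p dvd card H"
  shows "\<exists>x\<in>H. ord x = p"
proof -
  obtain P where P: "subgroup P G" "P \<subseteq> H" "card P = p"
    using sylow_subgroup[of p H 1] assms by auto
  have "P \<noteq> {\<one>}" using P(3) assms(1) by auto
  then obtain x where x: "x \<in> P" "x \<noteq> \<one>" using P(1) subgroup.one_closed by blast
  then have "x [^] p = \<one>" "x \<in> carrier G"
    using P pow_card_eq_one subgroup.mem_carrier by (force, metis)
  then show ?thesis using x P assms(1) ord_eq_prime by blast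
qed

lemma prime_power_card:
  assumes p: "prime p" and H: "subgroup H G" and e: "\<And>x. x \<in> H \<Longrightarrow> \<exists>k. x [^] (p ^ k) = \<one>"
  shows "\<exists>n. card H = p ^ n"
proof -
  have "q = p" if q: "prime q" "q dvd card H" for q
  proof -
    obtain x where x: "x \<in> H" "ord x = q" using cauchy[OF q(1) H q(2)] by blast
    obtain k where "x [^] (p ^ k) = \<one>" using e x by blast
    then have "q dvd p ^ k" using x H pow_eq_id subgroup.mem_carrier by metis
    then show ?thesis using q(1) p prime_dvd_power primes_dvd_imp_eq by blast
  qed
  moreover obtain k n where kn: "\<not> p dvd n" "card H = n * p ^ k"
    using prime_power_canonical[OF p card_subgroup_pos[OF H]] by blast
  ultimately have "n = 1" by (metis dvd_mult2 dvd_refl prime_factor_nat)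
  then show ?thesis using kn by auto
qed

lemma ord_pow_div:
  assumes "x \<in> carrier G" "prime p" "p dvd ord x"
  shows "ord (x [^] (ord x div p)) = p"
proof -
  have "ord x div p dvd ord x" using assms by (metis div_dvd_iff_mult dvd_div_mult_self dvd_triv_left)
  moreover have "ord x div p \<noteq> 0" using assms ord_pos[OF assms(1)] by (auto elim!: dvdE)
  ultimately have "ord (x [^] (ord x div p)) = ord x div (ord x div p)" using ord_pow assms by blast
  then show ?thesis using assms ord_pos[OF assms(1)] by (auto elim!: dvdE)
qed

text \<open>The coset \<open>N #> g\<close> is stable under conjugation by \<open>y\<close> and has
  size prime to \<open>u\<close>, so the \<open>u\<close>-group generated by \<open>y\<close> fixes
  one of its elements.\<close>

lemma lift_commutes:
  assumes N: "subgroup N G" "invariant {y} N" and y: "y \<in> carrier G" "ord y = u" "prime u"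
    and u: "\<not> u dvd card N" and g: "g \<in> carrier G" and yg: "cnj y g \<otimes> inv g \<in> N"
  shows "\<exists>n\<in>N. commutes y (n \<otimes> g)"
proof -
  let ?P = "generate G {y}" and ?W = "N #> g"
  have P: "subgroup ?P G" "card ?P = u ^ 1"
    using y generate_is_subgroup[of "{y}"] generate_pow_card[OF y(1)] by auto
  have Nc: "N \<subseteq> carrier G" using N(1) subgroup.subset by blast
  have Wc: "w \<in> carrier G" if "w \<in> ?W" for w using that Nc g r_coset_subset_G by blast
  have step: "cnj y w \<in> ?W" if w: "w \<in> ?W" for w
  proof -
    obtain n where n: "n \<in> N" "w = n \<otimes> g" using w by (auto simp: r_coset_def)
    have "cnj y w \<otimes> inv g = cnj y n \<otimes> (cnj y g \<otimes> inv g)"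
      using n Nc g y by (auto simp: cnj_mult m_assoc subset_iff)
    also have "\<dots> \<in> N" using N n yg by (auto simp: invariant_def subgroup.m_closed)
    finally show ?thesis using rcoset_mem_iff[OF N(1) g] Wc[OF w] y by simp
  qed
  have stepn: "cnj (y [^] (i::nat)) w \<in> ?W" if "w \<in> ?W" for i w
    using that
  proof (induction i arbitrary: w)
    case 0
    then show ?case using Wc by simp
  next
    case (Suc i)
    have "cnj (y [^] Suc i) w = cnj (y [^] i) (cnj y w)" using y Wc[OF Suc.prems] by (simp add: cnj_cnj)
    then show ?case using Suc step by simp
  qed
  have "\<exists>w\<in>?W. \<forall>x\<in>?P. cnj x w = w"
  proof (rule pgroup_fixpoint[OF P \<open>prime u\<close>])
    show "finite ?W" using Wc finite_subset[OF _ fin] by blast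
    show "\<not> u dvd card ?W" using u card_rcoset[OF Nc g] by simp
    show "cnj x w \<in> ?W" if "x \<in> ?P" "w \<in> ?W" for x w
      using mem_generate_pow[OF y(1) that(1)] stepn[OF that(2)] by blast
    show "cnj (x \<otimes> z) w = cnj x (cnj z w)" if "x \<in> ?P" "z \<in> ?P" "w \<in> ?W" for x z w
      using that Wc P(1) subgroup.mem_carrier by (metis cnj_cnj)
  qed (use Wc in simp)
  then obtain w where w: "w \<in> ?W" "cnj y w = w" by (metis generate.incl singletonI)
  then obtain n where "n \<in> N" "w = n \<otimes> g" by (auto simp: r_coset_def)
  then show ?thesis using w y Wc cnj_eq_iff by blast
qed

text \<open>Take \<open>m\<close> congruent to 1 modulo \<open>t\<close> and divisible by
  \<open>card X\<close>. Then \<open>g [^] m\<close> agrees with \<open>g\<close> modulo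
  \<open>X\<close>, while its \<open>t\<close>-th power is \<open>(g [^] t) [^] m\<close>, trivial
  by Lagrange in \<open>X\<close>.\<close>

lemma lift_prime_order:
  assumes X: "subgroup X G" and t: "prime t" "\<not> t dvd card X"
    and g: "g \<in> carrier G" "g \<notin> X" "g [^] t \<in> X"
  shows "\<exists>m::nat. ord (g [^] m) = t \<and> g [^] m \<otimes> inv g \<in> X \<and> g [^] m \<notin> X"
proof -
  have "coprime (card X) t" using t by (simp add: prime_imp_coprime coprime_commute)
  then obtain m j where m: "m = t * j + 1" "card X dvd m"
    using exists_unit_multiple t prime_gt_1_nat by blast
  have gm: "g [^] m = (g [^] t) [^] j \<otimes> g" using m g by (simp add: nat_pow_pow)
  have gj: "(g [^] t) [^] j \<in> X" using X g subgroup_pow by blast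
  have in1: "g [^] m \<otimes> inv g \<in> X" using gm gj g by (simp add: m_assoc)
  have out: "g [^] m \<notin> X"
  proof
    assume "g [^] m \<in> X"
    then have "inv ((g [^] t) [^] j) \<otimes> ((g [^] t) [^] j \<otimes> g) \<in> X"
      using X gj gm by (metis subgroup.m_closed subgroup.m_inv_closed)
    then show False using g by simp
  qed
  have "(g [^] m) [^] t = (g [^] t) [^] m" using g by (simp add: nat_pow_pow mult.commute)
  then have "(g [^] m) [^] t = \<one>" using pow_card_eq_one[OF X g(3) m(2)] by simp
  then have "ord (g [^] m) = t"
    using ord_eq_prime[OF t(1)] g out X subgroup.one_closed by (metis nat_pow_closed)
  then show ?thesis using in1 out by blast
qed

lemma mult_pow_mod:
  assumes X: "subgroup X G" "invariant {f} X" and f: "f \<in> carrier G" and x: "x \<in> X"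
  shows "\<exists>x'\<in>X. (x \<otimes> f) [^] (m::nat) = x' \<otimes> f [^] m"
proof (induction m)
  case 0
  then show ?case using X subgroup.one_closed by force
next
  case (Suc m)
  then obtain x' where x': "x' \<in> X" "(x \<otimes> f) [^] m = x' \<otimes> f [^] m" by blast
  have inv: "cnj (f [^] i) y \<in> X" if "y \<in> X" for i::nat and y
  proof (induction i)
    case (Suc i)
    have yc: "y \<in> carrier G" using that X(1) subgroup.mem_carrier by metis
    have "cnj (f [^] Suc i) y = cnj f (cnj (f [^] i) y)"
      using f yc by (metis cnj_cnj nat_pow_Suc2 nat_pow_closed)
    then show ?case using Suc X(2) by (simp add: invariant_def)
  qed (use that X(1) subgroup.mem_carrier in fastforce)
  have c: "x \<in> carrier G" "x' \<in> carrier G" using x x' X(1) subgroup.mem_carrier by metis+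
  have "(x \<otimes> f) [^] Suc m = x' \<otimes> cnj (f [^] m) x \<otimes> f [^] Suc m"
    using x' c f by (simp add: cnj_def m_assoc)
  then show ?case using X(1) x' inv[OF x] subgroup.m_closed by metis
qed

text \<open>A representative of the coset of \<open>g\<close> that commutes with \<open>y\<close>
  comes first; a suitable power of it then has order \<open>t\<close> and keeps both the coset and
  the commutation.\<close>

lemma lift_commutes_prime:
  assumes N: "subgroup N G" "invariant {y, g} N" and y: "y \<in> carrier G" "ord y = u" "prime u"
    and u: "\<not> u dvd card N" and g: "g \<in> carrier G" "g \<notin> N" "g [^] t \<in> N"
    and t: "prime t" "\<not> t dvd card N" and yg: "cnj y g \<otimes> inv g \<in> N"
  shows "\<exists>g'. g' \<in> carrier G \<and> ord g' = t \<and> commutes y g' \<and> g' \<otimes> inv g \<in> N \<and> g' \<notin> N"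
proof -
  have Ny: "invariant {y} N" and Ng: "invariant {g} N" using N(2) by (auto intro: invariant_mono)
  obtain n where n: "n \<in> N" "commutes y (n \<otimes> g)"
    using lift_commutes[OF N(1) Ny y u g(1) yg] by blast
  have nc: "n \<in> carrier G" using n N(1) subgroup.mem_carrier by metis
  obtain x' where x': "x' \<in> N" "(n \<otimes> g) [^] t = x' \<otimes> g [^] t"
    using mult_pow_mod[OF N(1) Ng g(1) n(1)] by blast
  have ng: "n \<otimes> g \<in> carrier G" "(n \<otimes> g) [^] t \<in> N"
    using nc g x' N(1) by (simp_all add: subgroup.m_closed)
  have "n \<otimes> g \<notin> N"
  proof
    assume "n \<otimes> g \<in> N"
    then have "inv n \<otimes> (n \<otimes> g) \<in> N" using N(1) n by (metis subgroup.m_closed subgroup.m_inv_closed)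
    then show False using nc g by simp
  qed
  then obtain m :: nat where m: "ord ((n \<otimes> g) [^] m) = t" "(n \<otimes> g) [^] m \<otimes> inv (n \<otimes> g) \<in> N"
      "(n \<otimes> g) [^] m \<notin> N"
    using lift_prime_order[OF N(1) t ng(1) _ ng(2)] by blast
  let ?h = "(n \<otimes> g) [^] m"
  have "?h \<otimes> inv g = ?h \<otimes> inv (n \<otimes> g) \<otimes> n"
    using nc g by (simp add: inv_mult_group m_assoc)
  then have "?h \<otimes> inv g \<in> N" using m(2) n(1) N(1) by (simp add: subgroup.m_closed)
  moreover have "commutes y ?h" using n(2) y ng(1) commutes_pow by blast
  ultimately show ?thesis using m ng by blast
qed

text \<open>As \<open>p\<close> divides \<open>card T\<close>, the set \<open>T - {\<one>}\<close>
  has size prime to \<open>p\<close>, and \<open>P\<close> fixes a point of it. The case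
  \<open>T = P\<close> is the nontrivial centre of a \<open>p\<close>-group.\<close>

lemma pgroup_centre:
  assumes P: "subgroup P G" "card P = p ^ k" and p: "prime p"
    and T: "subgroup T G" "card T = p ^ j" "T \<noteq> {\<one>}" "invariant P T"
  shows "\<exists>z\<in>T. z \<noteq> \<one> \<and> (\<forall>x\<in>P. commutes x z)"
proof -
  have Tc: "T \<subseteq> carrier G" and Pc: "P \<subseteq> carrier G" using T P subgroup.subset by blast+
  have one: "\<one> \<in> T" using T(1) subgroup.one_closed by blast
  have "card T \<noteq> 1" using T(3) one by (metis card_1_singletonE singletonD)
  then have pT: "p dvd card T" using T(2) by (cases j) auto
  have cT: "card T = Suc (card (T - {\<one>}))"
    using one finite_subgroup[OF T(1)] by (metis card.remove)
  have "\<exists>z\<in>T - {\<one>}. \<forall>x\<in>P. cnj x z = z"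
  proof (rule pgroup_fixpoint[OF P p])
    show "\<not> p dvd card (T - {\<one>})"
      using pT cT p by (metis dvd_add_right_iff plus_1_eq_Suc add.commute not_prime_unit)
    show "cnj x w \<in> T - {\<one>}" if "x \<in> P" "w \<in> T - {\<one>}" for x w
    proof -
      have c: "x \<in> carrier G" "w \<in> carrier G" using that Pc Tc by auto
      have "cnj x w \<noteq> \<one>" using that c by (metis DiffD2 cnj_inv_cnj(1) cnj_one inv_closed singletonI)
      then show ?thesis using T(4) that by (auto simp: invariant_def)
    qed
    show "cnj (x \<otimes> y) w = cnj x (cnj y w)" if "x \<in> P" "y \<in> P" "w \<in> T - {\<one>}" for x y w
      using that Pc Tc by (metis DiffD1 cnj_cnj subsetD)
  qed (use Tc finite_subgroup[OF T(1)] in auto)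
  then obtain z where "z \<in> T" "z \<noteq> \<one>" "\<forall>x\<in>P. cnj x z = z" by auto
  then show ?thesis using Pc Tc cnj_eq_iff by (metis subsetD)
qed

text \<open>Modulo \<open>X\<close>, conjugation by \<open>g\<close> is the power map with exponent
  \<open>k\<close> on a cyclic group of order \<open>t\<close>. Both \<open>k ^ ord g\<close> and
  \<open>k ^ (t - 1)\<close> are 1 modulo \<open>t\<close>; the exponents are coprime, so
  \<open>k\<close> is 1 modulo \<open>t\<close>.\<close>

lemma cyclic_quotient_central:
  assumes X: "subgroup X G" "invariant {e, g} X" and g: "g \<in> carrier G"
    and e: "e \<in> carrier G" "e \<notin> X" "e [^] t \<in> X" and t: "prime t"
    and k: "cnj g e \<otimes> inv (e [^] (k::nat)) \<in> X" and cop: "coprime (ord g) (t - 1)"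
  shows "cnj g e \<otimes> inv e \<in> X"
proof -
  have Xc: "X \<subseteq> carrier G" using X(1) subgroup.subset by blast
  have Xen: "invariant {e [^] (n::nat)} X" for n
  proof (induction n)
    case 0
    then show ?case using Xc by (auto simp: invariant_def)
  next
    case (Suc n)
    have "cnj (e [^] Suc n) x = cnj (e [^] n) (cnj e x)" if "x \<in> X" for x
      using that Xc e by (auto simp: cnj_cnj)
    then show ?case using Suc X(2) by (simp add: invariant_def)
  qed
  define x1 where "x1 = cnj g e \<otimes> inv (e [^] k)"
  have x1: "x1 \<in> X" "cnj g e = x1 \<otimes> e [^] k"
    using k e g by (simp_all add: x1_def m_assoc)
  have iter: "\<exists>x\<in>X. cnj (g [^] (n::nat)) e = x \<otimes> e [^] (k ^ n)" for n
  proof (induction n)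
    case 0
    then show ?case using X(1) e subgroup.one_closed by force
  next
    case (Suc n)
    then obtain x where x: "x \<in> X" "cnj (g [^] n) e = x \<otimes> e [^] (k ^ n)" by blast
    obtain y where y: "y \<in> X" "(x1 \<otimes> e [^] k) [^] (k ^ n) = y \<otimes> (e [^] k) [^] (k ^ n)"
      using mult_pow_mod[OF X(1) Xen _ x1(1)] e by blast
    have "cnj (g [^] Suc n) e = cnj g (cnj (g [^] n) e)"
      using g e by (metis cnj_cnj nat_pow_Suc2 nat_pow_closed)
    also have "\<dots> = cnj g x \<otimes> cnj g e [^] (k ^ n)"
      using x g e Xc by (simp add: cnj_mult cnj_pow subset_iff)
    also have "\<dots> = (cnj g x \<otimes> y) \<otimes> e [^] (k ^ Suc n)"
      using x1 y x g e Xc by (auto simp: nat_pow_pow m_assoc subset_iff)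
    finally show ?case using X x y by (metis insertI1 insertI2 invariantD subgroup.m_closed)
  qed
  obtain x where x: "x \<in> X" "cnj (g [^] ord g) e = x \<otimes> e [^] (k ^ ord g)" using iter by blast
  let ?K = "k ^ ord g"
  have eK: "x \<otimes> e [^] ?K = e" using x g e by simp
  have "?K \<noteq> 0"
  proof
    assume "?K = 0"
    then have "x \<otimes> \<one> = e" using eK by (metis nat_pow_0)
    then have "e = x" using x Xc by auto
    then show False using x e by simp
  qed
  then obtain K where K: "?K = Suc K" by (cases ?K) auto
  \<comment> \<open>Cancelling one factor \<open>e\<close> from \<open>eK\<close> shows that
    \<open>e [^] K\<close> lies in \<open>X\<close>, so \<open>t\<close> divides
    \<open>K = k ^ ord g - 1\<close>.\<close>
  have "\<one> = x \<otimes> e [^] K"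
  proof -
    have xc: "x \<in> carrier G" using x Xc by auto
    have "x \<otimes> e [^] Suc K = (x \<otimes> e [^] K) \<otimes> e" using xc e by (simp add: m_assoc)
    then have "(x \<otimes> e [^] K) \<otimes> e = e" using eK unfolding K by metis
    moreover have "x \<otimes> e [^] K \<in> carrier G" using xc e(1) by simp
    ultimately show ?thesis using r_cancel_one[OF e(1)] by metis
  qed
  then have "inv (e [^] K) = x" using x Xc e(1) by (intro inv_equality) auto
  then have "e [^] K = inv x" using e(1) inv_inv[of "e [^] K"] by simp
  then have "e [^] K \<in> X" using X(1) x by (simp add: subgroup.m_inv_closed)
  then have "t dvd K" using pow_mem_imp_dvd[OF X(1) t e] by blast
  then have kn: "[k ^ ord g = 1] (mod t)" using K by (metis cong_altdef_nat diff_Suc_1 le_add1 plus_1_eq_Suc)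
  then have "\<not> t dvd k"
    using t ord_pos[OF g] by (metis cong_dvd_iff dvd_power not_prime_unit dvd_trans)
  then have fer: "[k ^ (t - 1) = 1] (mod t)" using fermat_theorem t by blast
  have "[k = 1] (mod t)"
  proof (cases "t = 2")
    case True
    then show ?thesis using \<open>\<not> t dvd k\<close> by (simp add: cong_def odd_iff_mod_2_eq_one)
  next
    case False
    then have "t - 1 \<noteq> 0" using t prime_gt_1_nat by force
    obtain a b where ab: "ord g * a = (t - 1) * b + 1"
      using bezout_nat[of "ord g" "t - 1"] cop ord_pos[OF g] by auto
    have "[k ^ (ord g * a) = 1] (mod t)" using cong_pow[OF kn, of a] by (simp add: power_mult)
    moreover have "[k ^ ((t - 1) * b + 1) = 1 * k] (mod t)"
      using cong_mult[OF cong_pow[OF fer, of b] cong_refl[of k]]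
      by (simp only: power_mult power_add power_one power_one_right mult_1)
    ultimately show ?thesis using ab by (metis cong_sym cong_trans mult_1)
  qed
  moreover have "k \<ge> 1" using \<open>\<not> t dvd k\<close> by (cases k) auto
  ultimately obtain j where j: "k = t * j + 1"
    by (metis add.commute cong_altdef_nat dvdE le_add_diff_inverse)
  have "cnj g e \<otimes> inv e = x1 \<otimes> (e [^] t) [^] j"
    using x1 Xc e j by (auto simp: m_assoc nat_pow_pow subset_iff)
  then show ?thesis using x1(1) X(1) e(3) subgroup_pow subgroup.m_closed by metis
qed

text \<open>The case split behind most later arguments. If an element \<open>e\<close> of order
  \<open>t\<close> does not generate \<open>N2\<close> modulo \<open>N1\<close>, some
  \<open>g\<close> is missed; it commutes with \<open>e\<close> modulo \<open>N1\<close> and can be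
  corrected inside its coset to commute with \<open>e\<close> exactly, giving an independent pair of
  genuine elements.\<close>

lemma elementary_quotient:
  assumes N: "subgroup N1 G" "subgroup N2 G" "N1 \<subseteq> N2" "N1 \<noteq> N2" "invariant N2 N1"
    and t: "prime t" "\<not> t dvd card N1" and ex: "\<And>x. x \<in> N2 \<Longrightarrow> x [^] t \<in> N1"
    and ab: "\<And>x y. x \<in> N2 \<Longrightarrow> y \<in> N2 \<Longrightarrow> cnj x y \<otimes> inv y \<in> N1"
  shows "(\<exists>x\<in>N2. \<exists>y\<in>N2. indep t x y) \<or>
    (\<exists>e\<in>N2. ord e = t \<and> e \<notin> N1 \<and> (\<forall>g\<in>N2. \<exists>i::nat. g \<otimes> inv (e [^] i) \<in> N1))"
proof (rule disjCI)
  assume no: "\<not> (\<exists>e\<in>N2. ord e = t \<and> e \<notin> N1 \<and> (\<forall>g\<in>N2. \<exists>i::nat. g \<otimes> inv (e [^] i) \<in> N1))"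
  have N2c: "N2 \<subseteq> carrier G" using N(2) subgroup.subset by blast
  obtain g0 where g0: "g0 \<in> N2" "g0 \<notin> N1" using N by blast
  obtain m :: nat where m: "ord (g0 [^] m) = t" "g0 [^] m \<notin> N1"
    using lift_prime_order[OF N(1) t, of g0] g0 N2c ex by blast
  define e where "e = g0 [^] m"
  have e: "e \<in> N2" "ord e = t" "e \<notin> N1" using m g0 N(2) subgroup_pow by (auto simp: e_def)
  then obtain g where g: "g \<in> N2" "\<And>i::nat. g \<otimes> inv (e [^] i) \<notin> N1" using no by blast
  have gN: "g \<notin> N1" using g(2)[of 0] g(1) N2c by auto
  have inv: "invariant {e, g} N1" using N(5) e g by (auto intro: invariant_mono)
  obtain g' where g': "g' \<in> carrier G" "ord g' = t" "commutes e g'" "g' \<otimes> inv g \<in> N1"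
    using lift_commutes_prime[OF N(1) inv _ e(2) t(1) t(2) _ gN _ t] e g N2c ex ab by blast
  have "g' \<in> N2"
  proof -
    have "g' \<otimes> inv g \<otimes> g \<in> N2" using g' g N by (meson subgroup.m_closed subsetD)
    then show ?thesis using g' g N2c by (auto simp: m_assoc)
  qed
  moreover have "g' \<noteq> e [^] i" for i :: nat
  proof
    assume "g' = e [^] i"
    then have "inv (e [^] i \<otimes> inv g) \<in> N1" using g'(4) N(1) by (simp add: subgroup.m_inv_closed)
    then show False using g e N2c by (auto simp: inv_mult_group subset_iff)
  qed
  ultimately have "indep t e g'" using g' e N2c by (auto simp: indep_def)
  then show "\<exists>x\<in>N2. \<exists>y\<in>N2. indep t x y" using e \<open>g' \<in> N2\<close> by blast
qed

lemma conj_into_sylow: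
  assumes S: "subgroup S G" "\<not> s dvd card (rcosets S)" and s: "prime s" and x: "x \<in> carrier G" "ord x = s"
  shows "\<exists>g\<in>carrier G. cnj g x \<in> S"
proof -
  let ?P = "generate G {x}"
  have P: "subgroup ?P G" "card ?P = s ^ 1"
    using x generate_is_subgroup[of "{x}"] generate_pow_card[OF x(1)] by auto
  have Sc: "S \<subseteq> carrier G" using S(1) subgroup.subset by blast
  have Pc: "?P \<subseteq> carrier G" using P(1) subgroup.subset by blast
  \<comment> \<open>Right translation of right cosets by inverses is a left action of the group
    generated by \<open>x\<close>.\<close>
  have "\<exists>C\<in>rcosets S. \<forall>h\<in>?P. C #> inv h = C"
  proof (rule pgroup_fixpoint[OF P s _ S(2)])
    show "finite (rcosets S)" using fin rcosets_subset_PowG[OF S(1)] by (meson finite_Pow_iff finite_subset)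
    show "C #> inv h \<in> rcosets S" if "h \<in> ?P" "C \<in> rcosets S" for h C
      using that Sc Pc by (auto simp: RCOSETS_def coset_mult_assoc subset_iff)
    show "C #> inv \<one> = C" if "C \<in> rcosets S" for C
      using that rcosets_subset_PowG[OF S(1)] by auto
    show "C #> inv (h \<otimes> k) = C #> inv k #> inv h" if "h \<in> ?P" "k \<in> ?P" "C \<in> rcosets S" for h k C
    proof -
      have "C \<subseteq> carrier G" using that rcosets_subset_PowG[OF S(1)] by auto
      then show ?thesis using that Pc by (simp add: coset_mult_assoc inv_mult_group subset_iff)
    qed
  qed
  then obtain g where g: "g \<in> carrier G" "S #> g #> inv x = S #> g"
    using generate.incl[of x "{x}" G] by (auto simp: RCOSETS_def)
  then have "S #> (g \<otimes> inv x) = S #> g" using x Sc by (simp add: coset_mult_assoc)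
  then have "g \<otimes> inv x \<in> S #> g" using rcos_self[OF _ S(1)] x g by (metis inv_closed m_closed)
  then have "g \<otimes> inv x \<otimes> inv g \<in> S" using rcoset_mem_iff[OF S(1)] g x by simp
  then have "inv (g \<otimes> inv x \<otimes> inv g) \<in> S" using S(1) subgroup.m_inv_closed by metis
  then show ?thesis using g x by (auto simp: cnj_def inv_mult_group m_assoc)
qed

text \<open>A Sylow \<open>s\<close>-subgroup has a central element \<open>w\<close> of order
  \<open>s\<close>. Without independent pairs every element of order \<open>s\<close> in it is a
  power of \<open>w\<close>, so all subgroups of order \<open>s\<close> are conjugate.\<close>

lemma prime_order_conjugate:
  assumes s: "prime s" and no: "\<And>x y. \<not> indep s x y"
    and x: "x \<in> carrier G" "ord x = s" and y: "y \<in> carrier G" "ord y = s"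
  shows "\<exists>g\<in>carrier G. \<exists>i::nat. y = cnj g (x [^] i)"
proof -
  define a where "a = multiplicity s (card (carrier G))"
  have sa: "s ^ a dvd card (carrier G)" by (simp add: a_def multiplicity_dvd)
  obtain S where S: "subgroup S G" "card S = s ^ a"
    using sylow_subgroup[OF s subgroup_self sa] by blast
  have lag: "card (rcosets S) * s ^ a = card (carrier G)"
    using lagrange[OF S(1)] S(2) by (simp add: order_def)
  have nd: "\<not> s dvd card (rcosets S)"
  proof
    assume "s dvd card (rcosets S)"
    then have "s * s ^ a dvd card (carrier G)" using lag by (metis mult_dvd_mono dvd_refl)
    then have "s ^ Suc a dvd card (carrier G)" by simp
    then have "Suc a \<le> a" unfolding a_def using s fin
      by (metis card_gt_0_iff empty_iff multiplicity_geI not_prime_unit one_closed less_numeral_extra(3))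
    then show False by simp
  qed
  obtain g h where g: "g \<in> carrier G" "cnj g x \<in> S" and h: "h \<in> carrier G" "cnj h y \<in> S"
    using conj_into_sylow[OF S(1) nd s x] conj_into_sylow[OF S(1) nd s y] by blast
  have Sc: "S \<subseteq> carrier G" using S(1) subgroup.subset by blast
  have "cnj g x \<noteq> \<one>" using x g s by (metis ord_cnj ord_id not_prime_1)
  then have "S \<noteq> {\<one>}" using g by auto
  then obtain z where z: "z \<in> S" "z \<noteq> \<one>" "\<forall>x\<in>S. commutes x z"
    using pgroup_centre[OF S s S _ invariant_self[OF S(1)]] by blast
  have "s dvd ord z"
  proof -
    have "ord z dvd s ^ a" using ord_dvd_card[OF S(1) z(1)] S by simp
    moreover have "ord z \<noteq> 1" using z Sc ord_eq_1 by blast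
    ultimately show ?thesis using s by (metis divides_primepow_nat dvd_power power_0 not_gr_zero)
  qed
  define w where "w = z [^] (ord z div s)"
  have zc: "z \<in> carrier G" using z Sc by blast
  have w: "w \<in> carrier G" "ord w = s" "\<forall>x\<in>S. commutes x w"
    using ord_pow_div[OF zc s \<open>s dvd ord z\<close>] zc z Sc by (auto simp: w_def intro: commutes_pow)
  have pw: "\<exists>i::nat. u = w [^] i" if "u \<in> S" "ord u = s" for u
    using no[of w u] w that Sc by (auto simp: indep_def intro: commutes_sym)
  obtain i j :: nat where i: "cnj g x = w [^] i" and j: "cnj h y = w [^] j"
    using pw g h x y by (metis ord_cnj)
  obtain k :: nat where k: "(w [^] i) [^] k = w"
    using prime_ord_pow_eq(2)[OF s w(2,1)] \<open>cnj g x \<noteq> \<one>\<close> i by metis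
  have "cnj h y = cnj g (x [^] (k * j))"
  proof -
    have "cnj g (x [^] (k * j)) = (w [^] i) [^] (k * j)" using i x g by (simp add: cnj_pow)
    also have "\<dots> = ((w [^] i) [^] k) [^] j" using w by (simp add: nat_pow_pow mult.assoc)
    finally show ?thesis using j k by simp
  qed
  then have "y = cnj (inv h) (cnj g (x [^] (k * j)))" using h y by (metis cnj_inv_cnj(1))
  then have "y = cnj (inv h \<otimes> g) (x [^] (k * j))" using g h x by (simp add: cnj_cnj)
  then show ?thesis using g h by blast
qed

end

section \<open>Coprime action on an abelian group\<close>

lemma (in comm_monoid) finprod_swap:
  assumes "finite A" "finite B" "\<And>a b. a \<in> A \<Longrightarrow> b \<in> B \<Longrightarrow> f a b \<in> carrier G"
  shows "(\<Otimes>a\<in>A. \<Otimes>b\<in>B. f a b) = (\<Otimes>b\<in>B. \<Otimes>a\<in>A. f a b)"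
  using assms(1,3)
proof (induction A)
  case empty
  then show ?case by simp
next
  case (insert a A)
  have "(\<Otimes>b\<in>B. \<Otimes>a\<in>insert a A. f a b) = (\<Otimes>b\<in>B. f a b \<otimes> (\<Otimes>a\<in>A. f a b))"
    using insert by (intro finprod_cong') (auto simp: Pi_def intro!: finprod_closed)
  also have "\<dots> = (\<Otimes>b\<in>B. f a b) \<otimes> (\<Otimes>b\<in>B. \<Otimes>a\<in>A. f a b)"
    using insert by (intro finprod_multf) (auto simp: Pi_def intro!: finprod_closed)
  finally show ?case using insert by (auto simp: Pi_def intro!: finprod_closed)
qed

text \<open>A finite \<open>K\<close>-module, written multiplicatively. It is instantiated with
  abelian subgroups and with sections of \<open>G\<close>, acted on by subgroups of \<open>G\<close>
  or by quotients \<open>G Mod F\<close>.\<close>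

locale aut_action = K: group K + V: comm_group V
  for K :: "('k, 'm) monoid_scheme" and V :: "('v, 'n) monoid_scheme" +
  fixes act :: "'k \<Rightarrow> 'v \<Rightarrow> 'v"
  assumes fin_V [simp]: "finite (carrier V)"
    and act_closed [simp]: "k \<in> carrier K \<Longrightarrow> v \<in> carrier V \<Longrightarrow> act k v \<in> carrier V"
    and act_mult: "k \<in> carrier K \<Longrightarrow> v \<in> carrier V \<Longrightarrow> w \<in> carrier V \<Longrightarrow>
      act k (v \<otimes>\<^bsub>V\<^esub> w) = act k v \<otimes>\<^bsub>V\<^esub> act k w"
    and act_one_left [simp]: "v \<in> carrier V \<Longrightarrow> act \<one>\<^bsub>K\<^esub> v = v"
    and act_comp: "k \<in> carrier K \<Longrightarrow> l \<in> carrier K \<Longrightarrow> v \<in> carrier V \<Longrightarrow>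
      act (k \<otimes>\<^bsub>K\<^esub> l) v = act k (act l v)"
begin

lemma act_one [simp]: "k \<in> carrier K \<Longrightarrow> act k \<one>\<^bsub>V\<^esub> = \<one>\<^bsub>V\<^esub>"
  using act_mult[of k "\<one>\<^bsub>V\<^esub>" "\<one>\<^bsub>V\<^esub>"] by simp

lemma act_inv:
  assumes "k \<in> carrier K" "v \<in> carrier V"
  shows "act k (inv\<^bsub>V\<^esub> v) = inv\<^bsub>V\<^esub> act k v"
  using act_mult[of k "inv\<^bsub>V\<^esub> v" v] assms by (simp add: V.inv_equality)

lemma act_pow: "k \<in> carrier K \<Longrightarrow> v \<in> carrier V \<Longrightarrow> act k (v [^]\<^bsub>V\<^esub> (n::nat)) = act k v [^]\<^bsub>V\<^esub> n"
  by (induction n) (auto simp: act_mult)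

lemma act_finprod:
  assumes "k \<in> carrier K" "f \<in> A \<rightarrow> carrier V"
  shows "act k (\<Otimes>\<^bsub>V\<^esub>a\<in>A. f a) = (\<Otimes>\<^bsub>V\<^esub>a\<in>A. act k (f a))"
proof (cases "finite A")
  case True
  then show ?thesis using assms(2)
  proof (induction A)
    case (insert a A)
    then show ?case using assms(1) by (auto simp: act_mult Pi_def)
  qed (use assms in simp)
qed (use assms in simp)

lemma act_swap:
  assumes "K.commutes k l" "k \<in> carrier K" "l \<in> carrier K" "v \<in> carrier V"
  shows "act k (act l v) = act l (act k v)"
  using assms by (metis K.commutes_def act_comp)

text \<open>The norm of \<open>v\<close> along the first \<open>n\<close> powers of
  \<open>e\<close>. When \<open>e [^] n\<close> is trivial it is fixed by \<open>e\<close>: a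
  nontrivial norm exhibits a fixed point, and a fixed-point-free \<open>e\<close> annihilates all
  norms.\<close>

definition nrm :: "'k \<Rightarrow> nat \<Rightarrow> 'v \<Rightarrow> 'v" where
  "nrm e n v = (\<Otimes>\<^bsub>V\<^esub>j\<in>{..<n}. act (e [^]\<^bsub>K\<^esub> j) v)"

lemma nrm_closed [simp]: "e \<in> carrier K \<Longrightarrow> v \<in> carrier V \<Longrightarrow> nrm e n v \<in> carrier V"
  by (simp add: nrm_def)

lemma act_nrm:
  assumes "k \<in> carrier K" "e \<in> carrier K" "v \<in> carrier V" "K.commutes k e"
  shows "act k (nrm e n v) = nrm e n (act k v)"
proof -
  have "act k (nrm e n v) = (\<Otimes>\<^bsub>V\<^esub>j\<in>{..<n}. act k (act (e [^]\<^bsub>K\<^esub> j) v))"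
    unfolding nrm_def using assms by (intro act_finprod) auto
  also have "\<dots> = nrm e n (act k v)"
    unfolding nrm_def using assms
    by (intro V.finprod_cong') (auto intro: act_swap K.commutes_pow)
  finally show ?thesis .
qed

lemma nrm_fixed:
  assumes e: "e \<in> carrier K" "e [^]\<^bsub>K\<^esub> n = \<one>\<^bsub>K\<^esub>" and v: "v \<in> carrier V"
  shows "act e (nrm e n v) = nrm e n v"
proof (cases n)
  case (Suc m)
  let ?f = "\<lambda>j. act (e [^]\<^bsub>K\<^esub> j) v"
  have "nrm e n v \<otimes>\<^bsub>V\<^esub> v = v \<otimes>\<^bsub>V\<^esub> nrm e n v"
    using e v by (simp add: V.m_comm)
  \<comment> \<open>Acting by \<open>e\<close> shifts the index by one; the term with index
    \<open>n\<close> is again \<open>v\<close>, because \<open>e [^] n\<close> is trivial.\<close>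
  have "v \<otimes>\<^bsub>V\<^esub> nrm e n v = (\<Otimes>\<^bsub>V\<^esub>j\<in>insert n {..<n}. ?f j)"
    using e v by (subst V.finprod_insert) (auto simp: nrm_def)
  also have "insert n {..<n} = insert 0 (Suc ` {..<n})"
    using lessThan_Suc_eq_insert_0 lessThan_Suc by metis
  also have "(\<Otimes>\<^bsub>V\<^esub>j\<in>insert 0 (Suc ` {..<n}). ?f j) = v \<otimes>\<^bsub>V\<^esub> (\<Otimes>\<^bsub>V\<^esub>j\<in>Suc ` {..<n}. ?f j)"
    using e v by (subst V.finprod_insert) auto
  also have "(\<Otimes>\<^bsub>V\<^esub>j\<in>Suc ` {..<n}. ?f j) = (\<Otimes>\<^bsub>V\<^esub>j\<in>{..<n}. ?f (Suc j))"
    using e v by (intro V.finprod_reindex) auto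
  also have "\<dots> = (\<Otimes>\<^bsub>V\<^esub>j\<in>{..<n}. act e (?f j))"
  proof (rule V.finprod_cong')
    show "?f (Suc j) = act e (?f j)" for j
      using e v by (metis K.nat_pow_Suc2 K.nat_pow_closed act_comp)
  qed (use e v in auto)
  also have "\<dots> = act e (nrm e n v)"
    unfolding nrm_def using e v by (intro act_finprod[symmetric]) auto
  finally show ?thesis using e v by simp
qed (use e v in \<open>simp add: nrm_def\<close>)

lemma coprime_pow_one:
  assumes "w \<in> carrier V" "w [^]\<^bsub>V\<^esub> (c::nat) = \<one>\<^bsub>V\<^esub>" "coprime c (card (carrier V))"
  shows "w = \<one>\<^bsub>V\<^esub>"
proof -
  have "w [^]\<^bsub>V\<^esub> card (carrier V) = \<one>\<^bsub>V\<^esub>"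
    using V.pow_order_eq_1[OF assms(1)] by (simp add: order_def)
  then have "V.ord w dvd card (carrier V)" "V.ord w dvd c" using assms V.pow_eq_id by blast+
  then have "V.ord w = 1" using assms(3) by (metis coprime_common_divisor_nat coprime_commute)
  then show ?thesis using V.ord_eq_1 assms(1) by blast
qed

text \<open>The sum over \<open>x \<in> A\<close> of the norms of \<open>v\<close> along the conjugates \<open>x\<inverse> y x\<close> vanishes. For \<open>0 < j < n\<close>
  the elements \<open>x\<inverse> y\<^sup>j x\<close> run over the coset \<open>A y\<^sup>j\<close>, so these terms are fixed by \<open>A\<close>,
  and hence so is the remaining one, \<open>|A| v\<close>.\<close>

lemma frobenius_average:
  assumes A: "subgroup A K" "finite A" and y: "y \<in> carrier K" "y [^]\<^bsub>K\<^esub> n = \<one>\<^bsub>K\<^esub>" "0 < n"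
    and inv: "K.invariant {y} A"
    and fpf: "\<And>j x. 0 < j \<Longrightarrow> j < n \<Longrightarrow> x \<in> A \<Longrightarrow> K.commutes (y [^]\<^bsub>K\<^esub> j) x \<Longrightarrow> x = \<one>\<^bsub>K\<^esub>"
    and v: "v \<in> carrier V" and nrm1: "\<And>x. x \<in> A \<Longrightarrow> nrm y n (act x v) = \<one>\<^bsub>V\<^esub>"
    and cop: "coprime (card A) (card (carrier V))"
    and h: "h \<in> A"
  shows "act h v = v"
proof -
  have Ac: "x \<in> carrier K" if "x \<in> A" for x using that A(1) subgroup.mem_carrier by metis
  have invA: "inv\<^bsub>K\<^esub> x \<in> A" if "x \<in> A" for x using that A(1) by (simp add: subgroup.m_inv_closed)
  have mA: "x \<otimes>\<^bsub>K\<^esub> z \<in> A" if "x \<in> A" "z \<in> A" for x z using that A(1) by (simp add: subgroup.m_closed)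
  have one: "\<one>\<^bsub>K\<^esub> \<in> A" using A(1) by (simp add: subgroup.one_closed)
  \<comment> \<open>The trace over \<open>A\<close>; its values are fixed by \<open>A\<close>, which
    is shown at the end for \<open>T v\<close>.\<close>
  define T where "T u = (\<Otimes>\<^bsub>V\<^esub>h\<in>A. act h u)" for u
  have Tc [simp]: "T u \<in> carrier V" if "u \<in> carrier V" for u
    using that Ac by (auto simp: T_def intro!: V.finprod_closed)
  have T_inv: "T (inv\<^bsub>V\<^esub> v) = inv\<^bsub>V\<^esub> T v"
  proof -
    have "T (inv\<^bsub>V\<^esub> v) \<otimes>\<^bsub>V\<^esub> T v = (\<Otimes>\<^bsub>V\<^esub>h\<in>A. act h (inv\<^bsub>V\<^esub> v) \<otimes>\<^bsub>V\<^esub> act h v)"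
      unfolding T_def using v Ac by (intro V.finprod_multf[symmetric]) auto
    also have "\<dots> = \<one>\<^bsub>V\<^esub>" using v Ac by (intro V.finprod_one_eqI) (simp add: act_inv)
    finally show ?thesis using v by (simp add: V.inv_equality)
  qed
  have cj: "K.cnj (y [^]\<^bsub>K\<^esub> (j::nat)) x \<in> A" if "x \<in> A" for j x
  proof (induction j)
    case (Suc j)
    have "K.cnj (y [^]\<^bsub>K\<^esub> Suc j) x = K.cnj y (K.cnj (y [^]\<^bsub>K\<^esub> j) x)"
      using y Ac[OF that] by (metis K.cnj_cnj K.nat_pow_Suc2 K.nat_pow_closed)
    then show ?case using Suc inv by (simp add: K.invariant_def)
  qed (use that Ac in simp)
  have line: "(\<Otimes>\<^bsub>V\<^esub>x\<in>A. act (inv\<^bsub>K\<^esub> x \<otimes>\<^bsub>K\<^esub> y [^]\<^bsub>K\<^esub> j \<otimes>\<^bsub>K\<^esub> x) v) = T (act (y [^]\<^bsub>K\<^esub> j) v)"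
    if j: "0 < j" "j < n" for j
  proof -
    let ?g = "y [^]\<^bsub>K\<^esub> j"
    let ?b = "\<lambda>x. inv\<^bsub>K\<^esub> x \<otimes>\<^bsub>K\<^esub> K.cnj ?g x"
    have g: "?g \<in> carrier K" using y by simp
    \<comment> \<open>The conjugate of \<open>?g\<close> by the inverse of \<open>x\<close> is
      \<open>?b x\<close> times \<open>?g\<close>. Equal values of \<open>?b\<close> at
      \<open>x\<close> and \<open>z\<close> produce an element of \<open>A\<close> commuting with
      \<open>?g\<close>, which is trivial by \<open>fpf\<close>; so \<open>?b\<close> permutes the
      finite set \<open>A\<close>.\<close>
    have inj: "inj_on ?b A"
    proof (rule inj_onI)
      fix x z assume xz: "x \<in> A" "z \<in> A" "?b x = ?b z"
      have c: "x \<in> carrier K" "z \<in> carrier K" using xz Ac by auto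
      let ?w = "z \<otimes>\<^bsub>K\<^esub> inv\<^bsub>K\<^esub> x"
      have "z \<otimes>\<^bsub>K\<^esub> ?b x = z \<otimes>\<^bsub>K\<^esub> ?b z" using xz by simp
      then have "?w \<otimes>\<^bsub>K\<^esub> K.cnj ?g x = K.cnj ?g z" using c g by (simp add: K.m_assoc)
      then have "K.cnj ?g z \<otimes>\<^bsub>K\<^esub> inv\<^bsub>K\<^esub> K.cnj ?g x = ?w" using c g
        by (metis K.cnj_closed K.inv_closed K.inv_solve_right K.m_closed)
      then have "K.cnj ?g ?w = ?w" using c g by (simp add: K.cnj_mult K.cnj_inv)
      then have "K.commutes ?g ?w" using c g K.cnj_eq_iff by simp
      then have "?w = \<one>\<^bsub>K\<^esub>" using fpf[OF j] mA invA xz by simp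
      then show "x = z" using c by (metis K.inv_closed K.inv_equality K.inv_inv K.r_inv K.inv_comm)
    qed
    have bij: "?b ` A = A"
      using inj A(2) cj mA invA by (intro endo_inj_surj) auto
    have "(\<Otimes>\<^bsub>V\<^esub>x\<in>A. act (inv\<^bsub>K\<^esub> x \<otimes>\<^bsub>K\<^esub> ?g \<otimes>\<^bsub>K\<^esub> x) v) = (\<Otimes>\<^bsub>V\<^esub>x\<in>A. act (?b x) (act ?g v))"
    proof (rule V.finprod_cong')
      fix x assume x: "x \<in> A"
      have "inv\<^bsub>K\<^esub> x \<otimes>\<^bsub>K\<^esub> ?g \<otimes>\<^bsub>K\<^esub> x = ?b x \<otimes>\<^bsub>K\<^esub> ?g"
        using Ac[OF x] g by (simp add: K.cnj_def K.m_assoc)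
      then show "act (inv\<^bsub>K\<^esub> x \<otimes>\<^bsub>K\<^esub> ?g \<otimes>\<^bsub>K\<^esub> x) v = act (?b x) (act ?g v)"
        using Ac[OF x] g v by (simp add: act_comp)
    qed (use Ac y v g in auto)
    also have "\<dots> = (\<Otimes>\<^bsub>V\<^esub>h\<in>?b ` A. act h (act ?g v))"
      using Ac g v inj by (intro V.finprod_reindex[symmetric]) auto
    finally show ?thesis unfolding T_def bij .
  qed
  have "\<one>\<^bsub>V\<^esub> = (\<Otimes>\<^bsub>V\<^esub>x\<in>A. act (inv\<^bsub>K\<^esub> x) (nrm y n (act x v)))"
    using nrm1 Ac by (intro V.finprod_one_eqI[symmetric]) auto
  also have "\<dots> = (\<Otimes>\<^bsub>V\<^esub>x\<in>A. \<Otimes>\<^bsub>V\<^esub>j\<in>{..<n}. act (inv\<^bsub>K\<^esub> x \<otimes>\<^bsub>K\<^esub> y [^]\<^bsub>K\<^esub> j \<otimes>\<^bsub>K\<^esub> x) v)"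
  proof (rule V.finprod_cong')
    fix x assume x: "x \<in> A"
    have "act (inv\<^bsub>K\<^esub> x) (nrm y n (act x v)) = (\<Otimes>\<^bsub>V\<^esub>j\<in>{..<n}. act (inv\<^bsub>K\<^esub> x) (act (y [^]\<^bsub>K\<^esub> j) (act x v)))"
      unfolding nrm_def using Ac[OF x] y v by (intro act_finprod) auto
    then show "act (inv\<^bsub>K\<^esub> x) (nrm y n (act x v)) =
        (\<Otimes>\<^bsub>V\<^esub>j\<in>{..<n}. act (inv\<^bsub>K\<^esub> x \<otimes>\<^bsub>K\<^esub> y [^]\<^bsub>K\<^esub> j \<otimes>\<^bsub>K\<^esub> x) v)"
      using Ac[OF x] y v by (simp add: act_comp K.m_assoc)
  qed (use Ac y v in \<open>auto intro!: V.finprod_closed\<close>)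
  also have "\<dots> = (\<Otimes>\<^bsub>V\<^esub>j\<in>{..<n}. \<Otimes>\<^bsub>V\<^esub>x\<in>A. act (inv\<^bsub>K\<^esub> x \<otimes>\<^bsub>K\<^esub> y [^]\<^bsub>K\<^esub> j \<otimes>\<^bsub>K\<^esub> x) v)"
    using A(2) Ac y v by (intro V.finprod_swap) auto
  \<comment> \<open>The index \<open>0\<close> contributes \<open>v\<close> once for every element
    of \<open>A\<close>; it is separated from the traces belonging to the other indices.\<close>
  also have "{..<n} = insert 0 {1..<n}" using y(3) by auto
  also have "(\<Otimes>\<^bsub>V\<^esub>j\<in>insert 0 {1..<n}. \<Otimes>\<^bsub>V\<^esub>x\<in>A. act (inv\<^bsub>K\<^esub> x \<otimes>\<^bsub>K\<^esub> y [^]\<^bsub>K\<^esub> j \<otimes>\<^bsub>K\<^esub> x) v) =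
     (\<Otimes>\<^bsub>V\<^esub>x\<in>A. act (inv\<^bsub>K\<^esub> x \<otimes>\<^bsub>K\<^esub> y [^]\<^bsub>K\<^esub> (0::nat) \<otimes>\<^bsub>K\<^esub> x) v) \<otimes>\<^bsub>V\<^esub>
     (\<Otimes>\<^bsub>V\<^esub>j\<in>{1..<n}. \<Otimes>\<^bsub>V\<^esub>x\<in>A. act (inv\<^bsub>K\<^esub> x \<otimes>\<^bsub>K\<^esub> y [^]\<^bsub>K\<^esub> j \<otimes>\<^bsub>K\<^esub> x) v)"
    using Ac y v by (intro V.finprod_insert) (auto intro!: V.finprod_closed)
  also have "(\<Otimes>\<^bsub>V\<^esub>x\<in>A. act (inv\<^bsub>K\<^esub> x \<otimes>\<^bsub>K\<^esub> y [^]\<^bsub>K\<^esub> (0::nat) \<otimes>\<^bsub>K\<^esub> x) v) = (\<Otimes>\<^bsub>V\<^esub>x\<in>A. v)"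
    using Ac y v by (intro V.finprod_cong') auto
  also have "\<dots> = v [^]\<^bsub>V\<^esub> card A" using v by (rule V.finprod_const)
  also have "(\<Otimes>\<^bsub>V\<^esub>j\<in>{1..<n}. \<Otimes>\<^bsub>V\<^esub>x\<in>A. act (inv\<^bsub>K\<^esub> x \<otimes>\<^bsub>K\<^esub> y [^]\<^bsub>K\<^esub> j \<otimes>\<^bsub>K\<^esub> x) v) =
      (\<Otimes>\<^bsub>V\<^esub>j\<in>{1..<n}. T (act (y [^]\<^bsub>K\<^esub> j) v))"
    using y v by (intro V.finprod_cong') (auto simp: line)
  also have "\<dots> = (\<Otimes>\<^bsub>V\<^esub>h\<in>A. \<Otimes>\<^bsub>V\<^esub>j\<in>{1..<n}. act h (act (y [^]\<^bsub>K\<^esub> j) v))"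
    unfolding T_def using A(2) Ac y v by (intro V.finprod_swap) auto
  also have "\<dots> = T (\<Otimes>\<^bsub>V\<^esub>j\<in>{1..<n}. act (y [^]\<^bsub>K\<^esub> j) v)"
    unfolding T_def using Ac y v by (intro V.finprod_cong') (auto simp: act_finprod intro!: V.finprod_closed)
  \<comment> \<open>The norm of \<open>v\<close> itself is trivial, so the terms with
    \<open>j > 0\<close> multiply to the inverse of \<open>v\<close>. Hence the power
    \<open>card A\<close> of \<open>v\<close> equals \<open>T v\<close> and is fixed by
    \<open>A\<close>.\<close>
  also have "(\<Otimes>\<^bsub>V\<^esub>j\<in>{1..<n}. act (y [^]\<^bsub>K\<^esub> j) v) = inv\<^bsub>V\<^esub> v"
  proof -
    have "nrm y n v = (\<Otimes>\<^bsub>V\<^esub>j\<in>insert 0 {1..<n}. act (y [^]\<^bsub>K\<^esub> j) v)"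
      unfolding nrm_def using y(3) by (intro arg_cong[where f = "finprod V _"]) auto
    also have "\<dots> = v \<otimes>\<^bsub>V\<^esub> (\<Otimes>\<^bsub>V\<^esub>j\<in>{1..<n}. act (y [^]\<^bsub>K\<^esub> j) v)"
      using y v by (subst V.finprod_insert) (auto intro!: V.finprod_closed)
    finally have "v \<otimes>\<^bsub>V\<^esub> (\<Otimes>\<^bsub>V\<^esub>j\<in>{1..<n}. act (y [^]\<^bsub>K\<^esub> j) v) = \<one>\<^bsub>V\<^esub>"
      using nrm1[OF one] v by simp
    moreover have "(\<Otimes>\<^bsub>V\<^esub>j\<in>{1..<n}. act (y [^]\<^bsub>K\<^esub> j) v) \<in> carrier V"
      using y v by (auto intro!: V.finprod_closed)
    ultimately show ?thesis using v by (metis V.inv_equality V.m_comm)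
  qed
  finally have "\<one>\<^bsub>V\<^esub> = v [^]\<^bsub>V\<^esub> card A \<otimes>\<^bsub>V\<^esub> inv\<^bsub>V\<^esub> T v" by (simp only: T_inv)
  then have vT: "v [^]\<^bsub>V\<^esub> card A = T v" using v
    by (metis Tc V.inv_closed V.inv_equality V.inv_inv V.nat_pow_closed)
  have hc: "h \<in> carrier K" using h Ac by simp
  have "act h (T v) = T v"
  proof -
    have "act h (T v) = (\<Otimes>\<^bsub>V\<^esub>x\<in>A. act h (act x v))"
      unfolding T_def using Ac h v by (intro act_finprod) auto
    also have "\<dots> = (\<Otimes>\<^bsub>V\<^esub>x\<in>A. act (h \<otimes>\<^bsub>K\<^esub> x) v)"
      using Ac h v by (intro V.finprod_cong') (auto simp: act_comp)
    also have "\<dots> = (\<Otimes>\<^bsub>V\<^esub>x\<in>(\<lambda>x. h \<otimes>\<^bsub>K\<^esub> x) ` A. act x v)"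
      using Ac h v by (intro V.finprod_reindex[symmetric]) (auto simp: inj_on_def)
    also have "(\<lambda>x. h \<otimes>\<^bsub>K\<^esub> x) ` A = A"
      using A(2) h mA Ac by (intro endo_inj_surj) (auto simp: inj_on_def)
    finally show ?thesis by (simp add: T_def)
  qed
  then have "act h v [^]\<^bsub>V\<^esub> card A = v [^]\<^bsub>V\<^esub> card A" using vT act_pow[OF hc v] by metis
  then have "(act h v \<otimes>\<^bsub>V\<^esub> inv\<^bsub>V\<^esub> v) [^]\<^bsub>V\<^esub> card A = \<one>\<^bsub>V\<^esub>"
    using hc v by (simp add: V.pow_mult_distrib V.m_comm V.nat_pow_inv)
  then have "act h v \<otimes>\<^bsub>V\<^esub> inv\<^bsub>V\<^esub> v = \<one>\<^bsub>V\<^esub>" using coprime_pow_one cop hc v by simp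
  then show ?thesis using hc v by (metis V.inv_equality V.inv_inv V.inv_closed act_closed)
qed

text \<open>Suppose all these norms are trivial and multiply those along \<open>x y^i\<close> over
  \<open>i < q\<close>. The terms with exponent 0 give the \<open>q\<close>-th power of
  \<open>v\<close>; those with a fixed exponent \<open>j > 0\<close> give the image under
  \<open>x^j\<close> of the norm along \<open>y\<close>, which is trivial. So \<open>v\<close> has
  trivial \<open>q\<close>-th power, against coprimeness.\<close>

lemma noncyclic_fixed_point:
  assumes q: "prime q" "\<not> q dvd card (carrier V)"
    and x: "x \<in> carrier K" "x [^]\<^bsub>K\<^esub> q = \<one>\<^bsub>K\<^esub>" and y: "y \<in> carrier K" "y [^]\<^bsub>K\<^esub> q = \<one>\<^bsub>K\<^esub>"
    and xy: "K.commutes x y" and v: "v \<in> carrier V" "v \<noteq> \<one>\<^bsub>V\<^esub>"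
  shows "\<exists>e. (e = y \<or> (\<exists>i::nat. e = x \<otimes>\<^bsub>K\<^esub> y [^]\<^bsub>K\<^esub> i)) \<and> nrm e q v \<noteq> \<one>\<^bsub>V\<^esub>"
proof (rule ccontr)
  assume "\<not> ?thesis"
  then have ny: "nrm y q v = \<one>\<^bsub>V\<^esub>" and nx: "nrm (x \<otimes>\<^bsub>K\<^esub> y [^]\<^bsub>K\<^esub> (i::nat)) q v = \<one>\<^bsub>V\<^esub>" for i by auto
  have q0: "0 < q" using q(1) prime_gt_0_nat by blast
  let ?f = "\<lambda>(i::nat) (j::nat). act ((x \<otimes>\<^bsub>K\<^esub> y [^]\<^bsub>K\<^esub> i) [^]\<^bsub>K\<^esub> j) v"
  have fc: "?f i j \<in> carrier V" for i j using x y v by simp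
  have feq: "?f i j = act (x [^]\<^bsub>K\<^esub> j) (act (y [^]\<^bsub>K\<^esub> (i * j)) v)" for i j
  proof -
    have "K.commutes x (y [^]\<^bsub>K\<^esub> i)" using xy x y by (simp add: K.commutes_pow)
    then have "(x \<otimes>\<^bsub>K\<^esub> y [^]\<^bsub>K\<^esub> i) [^]\<^bsub>K\<^esub> j = x [^]\<^bsub>K\<^esub> j \<otimes>\<^bsub>K\<^esub> y [^]\<^bsub>K\<^esub> (i * j)"
      using K.pow_mult_commutes[of x "y [^]\<^bsub>K\<^esub> i" j] x y by (simp add: K.nat_pow_pow)
    then show ?thesis using x y v by (simp add: act_comp)
  qed
  \<comment> \<open>For \<open>0 < j < q\<close>, multiplication by \<open>j\<close> permutes the
    residues modulo \<open>q\<close>, so the powers of \<open>y\<close> that occur run through all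
    of them once.\<close>
  have col: "(\<Otimes>\<^bsub>V\<^esub>i\<in>{..<q}. ?f i j) = \<one>\<^bsub>V\<^esub>" if j: "0 < j" "j < q" for j
  proof -
    have cop: "coprime j q" using j q(1) by (metis coprime_commute dvd_imp_le leD prime_imp_coprime)
    have inj: "inj_on (\<lambda>i. (i * j) mod q) {..<q}"
    proof (rule inj_onI)
      fix a b assume ab: "a \<in> {..<q}" "b \<in> {..<q}" "(a * j) mod q = (b * j) mod q"
      then have "[a = b] (mod q)" using cop cong_mult_rcancel_nat by (metis cong_def)
      then show "a = b" using ab by (simp add: cong_def)
    qed
    have bij: "(\<lambda>i. (i * j) mod q) ` {..<q} = {..<q}"
      using inj q0 by (intro endo_inj_surj) auto
    have ymod: "y [^]\<^bsub>K\<^esub> (i * j) = y [^]\<^bsub>K\<^esub> ((i * j) mod q)" for i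
    proof -
      have "y [^]\<^bsub>K\<^esub> (i * j) = (y [^]\<^bsub>K\<^esub> q) [^]\<^bsub>K\<^esub> (i * j div q) \<otimes>\<^bsub>K\<^esub> y [^]\<^bsub>K\<^esub> ((i * j) mod q)"
        using y(1) by (metis K.nat_pow_mult K.nat_pow_pow div_mult_mod_eq mult.commute)
      then show ?thesis using y by simp
    qed
    have "(\<Otimes>\<^bsub>V\<^esub>i\<in>{..<q}. ?f i j) = (\<Otimes>\<^bsub>V\<^esub>i\<in>{..<q}. act (x [^]\<^bsub>K\<^esub> j) (act (y [^]\<^bsub>K\<^esub> ((i * j) mod q)) v))"
      using x y v feq ymod by (intro V.finprod_cong') auto
    also have "\<dots> = act (x [^]\<^bsub>K\<^esub> j) (\<Otimes>\<^bsub>V\<^esub>i\<in>{..<q}. act (y [^]\<^bsub>K\<^esub> ((i * j) mod q)) v)"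
      using x y v by (intro act_finprod[symmetric]) auto
    also have "(\<Otimes>\<^bsub>V\<^esub>i\<in>{..<q}. act (y [^]\<^bsub>K\<^esub> ((i * j) mod q)) v) =
        (\<Otimes>\<^bsub>V\<^esub>i\<in>(\<lambda>i. (i * j) mod q) ` {..<q}. act (y [^]\<^bsub>K\<^esub> i) v)"
      using inj y v by (intro V.finprod_reindex[symmetric]) auto
    also have "\<dots> = nrm y q v" unfolding bij nrm_def ..
    finally show ?thesis using ny x by simp
  qed
  have "\<one>\<^bsub>V\<^esub> = (\<Otimes>\<^bsub>V\<^esub>i\<in>{..<q}. \<Otimes>\<^bsub>V\<^esub>j\<in>{..<q}. ?f i j)"
    using nx by (intro V.finprod_one_eqI[symmetric]) (simp add: nrm_def)
  also have "\<dots> = (\<Otimes>\<^bsub>V\<^esub>j\<in>{..<q}. \<Otimes>\<^bsub>V\<^esub>i\<in>{..<q}. ?f i j)"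
    using fc by (intro V.finprod_swap) auto
  also have "{..<q} = insert 0 {1..<q}" using q0 by auto
  also have "(\<Otimes>\<^bsub>V\<^esub>j\<in>insert 0 {1..<q}. \<Otimes>\<^bsub>V\<^esub>i\<in>insert 0 {1..<q}. ?f i j) =
      (\<Otimes>\<^bsub>V\<^esub>i\<in>insert 0 {1..<q}. ?f i 0) \<otimes>\<^bsub>V\<^esub> (\<Otimes>\<^bsub>V\<^esub>j\<in>{1..<q}. \<Otimes>\<^bsub>V\<^esub>i\<in>insert 0 {1..<q}. ?f i j)"
    by (intro V.finprod_insert) (use fc v in \<open>auto simp del: V.finprod_insert intro!: V.finprod_closed\<close>)
  also have "insert 0 {1..<q} = {..<q}" using q0 by auto
  also have "(\<Otimes>\<^bsub>V\<^esub>j\<in>{1..<q}. \<Otimes>\<^bsub>V\<^esub>i\<in>{..<q}. ?f i j) = \<one>\<^bsub>V\<^esub>"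
    by (rule V.finprod_one_eqI) (use col in auto)
  also have "(\<Otimes>\<^bsub>V\<^esub>i\<in>{..<q}. ?f i 0) = (\<Otimes>\<^bsub>V\<^esub>i\<in>{..<q}. v)"
    using v by (intro V.finprod_cong') auto
  also have "\<dots> = v [^]\<^bsub>V\<^esub> q" using V.finprod_const[OF v(1), of "{..<q}"] by simp
  finally have "v [^]\<^bsub>V\<^esub> q = \<one>\<^bsub>V\<^esub>" using v by simp
  moreover have "coprime q (card (carrier V))" using q prime_imp_coprime by blast
  ultimately show False using coprime_pow_one v by blast
qed

text \<open>For abelian \<open>A\<close> the map \<open>?b\<close> sending \<open>z\<close> to its
  commutator with \<open>x\<close> is an endomorphism; its image \<open>B = [A, x]\<close> contains
  no nontrivial fixed point of \<open>x\<close>, as \<open>s\<close> does not divide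
  \<open>card A\<close>. So \<open>x\<close> and \<open>B\<close> form a Frobenius configuration;
  all norms along \<open>x\<close> vanish by \<open>fpf\<close>, and averaging makes
  \<open>B\<close> act trivially.\<close>

lemma commutator_acts_trivially:
  assumes A: "subgroup A K" "finite A" and ab: "\<And>a b. a \<in> A \<Longrightarrow> b \<in> A \<Longrightarrow> K.commutes a b"
    and x: "x \<in> carrier K" "K.ord x = s" "prime s" and inv: "K.invariant {x} A"
    and s: "\<not> s dvd card A" and cop: "coprime (card A) (card (carrier V))"
    and fpf: "\<And>v. v \<in> carrier V \<Longrightarrow> act x v = v \<Longrightarrow> v = \<one>\<^bsub>V\<^esub>"
    and a: "a \<in> A" and v: "v \<in> carrier V"
  shows "act (inv\<^bsub>K\<^esub> a \<otimes>\<^bsub>K\<^esub> K.cnj x a) v = v"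
proof -
  have Ac: "z \<in> carrier K" if "z \<in> A" for z using that A(1) subgroup.mem_carrier by metis
  have invA: "inv\<^bsub>K\<^esub> z \<in> A" if "z \<in> A" for z using that A(1) by (simp add: subgroup.m_inv_closed)
  have mA: "z \<otimes>\<^bsub>K\<^esub> z' \<in> A" if "z \<in> A" "z' \<in> A" for z z' using that A(1) by (simp add: subgroup.m_closed)
  have cA: "K.cnj x z \<in> A" if "z \<in> A" for z using inv that by (simp add: K.invariant_def)
  let ?b = "\<lambda>z. inv\<^bsub>K\<^esub> z \<otimes>\<^bsub>K\<^esub> K.cnj x z"
  have bA: "?b z \<in> A" if "z \<in> A" for z using that mA invA cA by simp
  have bm: "?b (z \<otimes>\<^bsub>K\<^esub> w) = ?b z \<otimes>\<^bsub>K\<^esub> ?b w" if "z \<in> A" "w \<in> A" for z w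
  proof -
    have "?b (z \<otimes>\<^bsub>K\<^esub> w) = inv\<^bsub>K\<^esub> w \<otimes>\<^bsub>K\<^esub> (?b z \<otimes>\<^bsub>K\<^esub> K.cnj x w)"
      using that Ac x by (simp add: K.inv_mult_group K.cnj_mult K.m_assoc)
    also have "?b z \<otimes>\<^bsub>K\<^esub> K.cnj x w = K.cnj x w \<otimes>\<^bsub>K\<^esub> ?b z"
      using ab[OF bA[OF that(1)] cA[OF that(2)]] by (simp add: K.commutes_def)
    also have "inv\<^bsub>K\<^esub> w \<otimes>\<^bsub>K\<^esub> (K.cnj x w \<otimes>\<^bsub>K\<^esub> ?b z) = ?b w \<otimes>\<^bsub>K\<^esub> ?b z"
      using that Ac x by (simp add: K.m_assoc)
    also have "\<dots> = ?b z \<otimes>\<^bsub>K\<^esub> ?b w"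
      using ab[OF bA[OF that(1)] bA[OF that(2)]] by (simp add: K.commutes_def)
    finally show ?thesis .
  qed
  define B where "B = ?b ` A"
  have BA: "B \<subseteq> A" using bA by (auto simp: B_def)
  have B: "subgroup B K"
  proof (rule K.subgroupI)
    show "B \<subseteq> carrier K" using BA Ac by auto
    show "B \<noteq> {}" using a by (auto simp: B_def)
    show "z \<otimes>\<^bsub>K\<^esub> w \<in> B" if zw: "z \<in> B" "w \<in> B" for z w
    proof -
      obtain z' w' where "z' \<in> A" "z = ?b z'" "w' \<in> A" "w = ?b w'"
        using zw unfolding B_def by blast
      then have "z \<otimes>\<^bsub>K\<^esub> w = ?b (z' \<otimes>\<^bsub>K\<^esub> w')" "z' \<otimes>\<^bsub>K\<^esub> w' \<in> A" using bm mA by simp_all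
      then show ?thesis unfolding B_def by blast
    qed
    show "inv\<^bsub>K\<^esub> z \<in> B" if zB: "z \<in> B" for z
    proof -
      obtain w where w: "w \<in> A" "z = ?b w" using zB by (auto simp: B_def)
      have "?b (inv\<^bsub>K\<^esub> w) \<otimes>\<^bsub>K\<^esub> ?b w = ?b (inv\<^bsub>K\<^esub> w \<otimes>\<^bsub>K\<^esub> w)" using bm[OF invA[OF w(1)] w(1)] by simp
      also have "\<dots> = \<one>\<^bsub>K\<^esub>" using Ac[OF w(1)] x by simp
      finally have "inv\<^bsub>K\<^esub> z = ?b (inv\<^bsub>K\<^esub> w)"
        using w Ac[OF bA] Ac invA by (metis K.inv_equality)
      then show ?thesis using invA w by (auto simp: B_def)
    qed
  qed
  have fB: "finite B" using A(2) BA finite_subset by blast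
  have Binv: "K.invariant {x} B"
  proof -
    have "K.cnj x (?b z) = ?b (K.cnj x z)" if "z \<in> A" for z
      using that Ac x by (simp add: K.cnj_mult K.cnj_inv)
    then show ?thesis using cA by (auto simp: K.invariant_def B_def)
  qed
  have cardB: "card B dvd card A"
  proof -
    interpret A: group "K\<lparr>carrier := A\<rparr>" using A(1) by (rule K.subgroup_imp_group)
    have "subgroup B (K\<lparr>carrier := A\<rparr>)" using B A(1) BA K.subgroup_incl by blast
    then have "card (rcosets\<^bsub>K\<lparr>carrier := A\<rparr>\<^esub> B) * card B = card A"
      using A.lagrange by (simp add: order_def)
    then show ?thesis by (metis dvd_triv_right)
  qed
  have xs: "x [^]\<^bsub>K\<^esub> s = \<one>\<^bsub>K\<^esub>" using x K.pow_ord_eq_1 by blast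
  have s0: "0 < s" using x(3) prime_gt_0_nat by blast
  \<comment> \<open>A fixed commutator satisfies \<open>cnj x z = z w\<close> with \<open>w\<close>
    fixed by \<open>x\<close>; after \<open>s\<close> steps the \<open>s\<close>-th power of
    \<open>w\<close> is trivial.\<close>
  have fB1: "w = \<one>\<^bsub>K\<^esub>" if w: "w \<in> B" "K.commutes x w" for w
  proof -
    obtain z where z: "z \<in> A" "w = ?b z" using w by (auto simp: B_def)
    have wc: "w \<in> carrier K" using w BA Ac by auto
    have xz: "K.cnj x z = z \<otimes>\<^bsub>K\<^esub> w" using z Ac x by simp
    have "z = z \<otimes>\<^bsub>K\<^esub> w [^]\<^bsub>K\<^esub> s"
      using K.cnj_pow_shift[OF x(1) Ac[OF z(1)] wc xz w(2), of s] xs Ac[OF z(1)] by simp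
    then have "w [^]\<^bsub>K\<^esub> s = \<one>\<^bsub>K\<^esub>" using Ac[OF z(1)] wc by (metis K.l_cancel_one' K.nat_pow_closed)
    then have "w \<noteq> \<one>\<^bsub>K\<^esub> \<Longrightarrow> K.ord w = s" using K.ord_eq_prime x(3) wc by blast
    moreover have "K.ord w dvd card A"
    proof -
      have wA: "w \<in> carrier (K\<lparr>carrier := A\<rparr>)" using w BA by auto
      interpret A: group "K\<lparr>carrier := A\<rparr>" using A(1) by (rule K.subgroup_imp_group)
      have "w [^]\<^bsub>K\<lparr>carrier := A\<rparr>\<^esub> card A = \<one>\<^bsub>K\<^esub>"
        using A.pow_order_eq_1[OF wA] by (simp add: order_def)
      then have "w [^]\<^bsub>K\<^esub> card A = \<one>\<^bsub>K\<^esub>" by (simp add: nat_pow_def)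
      then show ?thesis using K.pow_eq_id wc by blast
    qed
    ultimately show ?thesis using s by blast
  qed
  show ?thesis
  proof (rule frobenius_average[OF B fB x(1) xs s0 Binv _ v])
    show "z = \<one>\<^bsub>K\<^esub>" if "0 < j" "j < s" "z \<in> B" "K.commutes (x [^]\<^bsub>K\<^esub> j) z" for j z
    proof -
      \<comment> \<open>A nontrivial power of \<open>x\<close> generates the same group of prime
        order as \<open>x\<close>, so it has the same fixed points.\<close>
      have "x [^]\<^bsub>K\<^esub> j \<noteq> \<one>\<^bsub>K\<^esub>" using that x K.pow_eq_id by (metis dvd_imp_le leD)
      then obtain k :: nat where "(x [^]\<^bsub>K\<^esub> j) [^]\<^bsub>K\<^esub> k = x" using K.prime_ord_pow_eq(2)[OF x(3,2,1)] by blast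
      then have "K.commutes x z" using that x BA Ac
        by (metis K.commutes_pow K.commutes_sym K.nat_pow_closed subsetD)
      then show ?thesis using fB1 that by blast
    qed
    show "nrm x s (act z v) = \<one>\<^bsub>V\<^esub>" if "z \<in> B" for z
    proof -
      have "z \<in> carrier K" using that BA Ac by blast
      then show ?thesis using fpf nrm_fixed[OF x(1) xs] x v by (metis act_closed nrm_closed)
    qed
    show "coprime (card B) (card (carrier V))" using cop cardB coprime_divisors dvd_refl by blast
    show "?b a \<in> B" using a by (auto simp: B_def)
  qed
qed

end

section \<open>Conjugation on abelian normal subgroups\<close>

context fin_group
begin

text \<open>Conjugation maps the finite set \<open>N\<close> injectively into itself, hence onto;
  this is why invariance passes to inverses of the generators.\<close>

lemma invariant_generate:
  assumes S: "S \<subseteq> carrier G" and N: "finite N" "N \<subseteq> carrier G" "invariant S N"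
  shows "invariant (generate G S) N"
proof -
  have cinv: "cnj (inv u) x \<in> N" if u: "u \<in> carrier G" "\<And>y. y \<in> N \<Longrightarrow> cnj u y \<in> N" and x: "x \<in> N" for u x
  proof -
    have "cnj u ` N = N"
      using N u cnj_inj[OF u(1)] by (intro endo_inj_surj) (auto intro: inj_on_subset)
    then obtain y where y: "y \<in> N" "x = cnj u y" using x by auto
    then show ?thesis using u N by auto
  qed
  have "cnj g x \<in> N" if "g \<in> generate G S" "x \<in> N" for g x
    using that
  proof (induction arbitrary: x)
    case one
    then show ?case using N by auto
  next
    case (incl h)
    then show ?case using N by (simp add: invariant_def)
  next
    case (inv h)
    then show ?case using cinv[of h x] N S by (auto simp: invariant_def)
  next
    case (eng h1 h2)
    have "h1 \<in> carrier G" "h2 \<in> carrier G" using eng S generate_in_carrier by auto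
    then show ?case using eng N by (metis cnj_cnj subsetD)
  qed
  then show ?thesis by (simp add: invariant_def)
qed

lemma conj_aut_action:
  assumes N: "subgroup N G" and Z: "subgroup Z G" "invariant N Z"
    and ab: "\<And>x y. x \<in> Z \<Longrightarrow> y \<in> Z \<Longrightarrow> commutes x y"
  shows "aut_action (G\<lparr>carrier := N\<rparr>) (G\<lparr>carrier := Z\<rparr>) cnj"
proof -
  interpret N: group "G\<lparr>carrier := N\<rparr>" using N by (rule subgroup_imp_group)
  interpret Z: group "G\<lparr>carrier := Z\<rparr>" using Z(1) by (rule subgroup_imp_group)
  have Nc: "N \<subseteq> carrier G" and Zc: "Z \<subseteq> carrier G" using N Z subgroup.subset by blast+
  have "comm_group (G\<lparr>carrier := Z\<rparr>)"
    using ab by (intro Z.group_comm_groupI) (simp add: commutes_def)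
  then show ?thesis
    using Z Nc Zc finite_subgroup
    by (auto simp: aut_action_def aut_action_axioms_def N.is_group invariant_def cnj_mult cnj_cnj subset_iff)
qed

text \<open>Averaging needs an abelian module, so it is applied to the centre of \<open>T\<close>,
  which is nontrivial and stable under whatever normalises \<open>T\<close>.\<close>

lemma noncyclic_fixes_pgroup:
  assumes T: "subgroup T G" "card T = r ^ k" "T \<noteq> {\<one>}" and r: "prime r" and q: "prime q" "q \<noteq> r"
    and xy: "indep q x y" "invariant {x, y} T"
  shows "\<exists>e w. (e = y \<or> (\<exists>i::nat. e = x \<otimes> y [^] i)) \<and> e \<in> carrier G \<and> ord e = q
     \<and> w \<in> T \<and> w \<noteq> \<one> \<and> commutes e w"
proof -
  have x: "x \<in> carrier G" "ord x = q" and y: "y \<in> carrier G" "ord y = q" and cxy: "commutes x y" using xy(1) by (auto simp: indep_def)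
  have Tc: "T \<subseteq> carrier G" using T(1) subgroup.subset by blast
  define Z where "Z = T \<inter> cent T"
  have Z: "subgroup Z G" unfolding Z_def using T(1) cent_subgroup[OF Tc] by (rule subgroups_Inter_pair)
  have Zc: "Z \<subseteq> carrier G" using Z subgroup.subset by blast
  obtain z where z: "z \<in> T" "z \<noteq> \<one>" "\<forall>t\<in>T. commutes t z"
    using pgroup_centre[OF T(1,2) r T(1,2,3) invariant_self[OF T(1)]] by blast
  have zZ: "z \<in> Z" using z Tc by (auto simp: Z_def cent_def intro: commutes_sym)
  have fix_inv: "cnj u w \<in> Z" if u: "u \<in> {x, y}" and w: "w \<in> Z" for u w
  proof -
    have uc: "u \<in> carrier G" using u x y by auto
    have wc: "w \<in> carrier G" using w Zc by auto
    have uT: "cnj u ` T = T"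
      using finite_subgroup[OF T(1)] u xy(2) inj_on_subset[OF cnj_inj[OF uc] Tc]
      by (intro endo_inj_surj) (auto simp: invariant_def)
    have "commutes (cnj u w) t" if t: "t \<in> T" for t
    proof -
      obtain t' where t': "t' \<in> T" "t = cnj u t'" using uT t by auto
      have "commutes w t'" using w t' by (simp add: Z_def cent_def)
      then show ?thesis using t' Tc cnj_commutes_iff[OF uc wc] by auto
    qed
    moreover have "cnj u w \<in> T" using w uT by (auto simp: Z_def)
    ultimately show ?thesis using uc wc by (simp add: Z_def cent_def)
  qed
  let ?N = "generate G {x, y}"
  have N: "subgroup ?N G" using x y by (simp add: generate_is_subgroup)
  have inv: "invariant ?N Z"
    using invariant_generate[of "{x, y}" Z] x y Zc finite_subgroup[OF Z] fix_inv by (auto simp: invariant_def)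
  interpret aut_action "G\<lparr>carrier := ?N\<rparr>" "G\<lparr>carrier := Z\<rparr>" cnj
    by (rule conj_aut_action[OF N Z inv]) (simp add: Z_def cent_def)
  have powN: "u [^]\<^bsub>G\<lparr>carrier := ?N\<rparr>\<^esub> (i::nat) = u [^] i" for u i by (simp add: nat_pow_def)
  have comN: "K.commutes u w \<longleftrightarrow> commutes u w" for u w by (simp add: K.commutes_def commutes_def)
  have xN: "x \<in> ?N" and yN: "y \<in> ?N" by (auto intro: generate.incl)
  have "\<not> q dvd card Z"
  proof
    assume "q dvd card Z"
    moreover have "card Z dvd r ^ k" using card_subgroup_dvd[OF Z T(1)] T(2) by (simp add: Z_def)
    ultimately have "q dvd r ^ k" by (rule dvd_trans)
    then show False using q r prime_dvd_power primes_dvd_imp_eq by blast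
  qed
  then obtain e where e: "e = y \<or> (\<exists>i::nat. e = x \<otimes> y [^] i)" and ew: "nrm e q z \<noteq> \<one>"
    using noncyclic_fixed_point[of q x y z] q xN yN x y cxy z zZ
    by (auto simp: powN comN pow_eq_id)
  have eN: "e \<in> ?N" using e xN yN N by (auto intro: subgroup.m_closed subgroup_pow)
  have ec: "e \<in> carrier G" using eN N subgroup.mem_carrier by metis
  have oe: "ord e = q" using indep_ord[OF q(1) xy(1) e] .
  have eq: "e [^] q = \<one>" using oe ec by auto
  define w where "w = nrm e q z"
  have wZ: "w \<in> Z" using nrm_closed[of e z q] eN zZ by (simp add: w_def)
  have "cnj e w = w"
    using nrm_fixed[of e q z] eN eq zZ by (simp add: powN w_def)
  moreover have wc: "w \<in> carrier G" using wZ Zc by blast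
  ultimately have "commutes e w" using cnj_eq_iff[OF ec wc] by simp
  moreover have "w \<in> T" using wZ by (simp add: Z_def)
  moreover have "w \<noteq> \<one>" using ew by (simp add: w_def)
  ultimately show ?thesis using e ec oe by blast
qed

end

section \<open>Chief factors and the Fitting subgroup\<close>

lemma (in group) solvable_subgroup:
  assumes "solvable G" "subgroup H G" shows "solvable (G\<lparr>carrier := H\<rparr>)"
proof -
  interpret H: group "G\<lparr>carrier := H\<rparr>" using assms(2) by (rule subgroup_imp_group)
  obtain n where n: "(derived G ^^ n) (carrier G) = {\<one>}"
    using assms(1) solvable_iff_trivial_derived_seq by blast
  have Hc: "H \<subseteq> carrier G" using assms(2) subgroup.subset by blast
  have eq: "(derived (G\<lparr>carrier := H\<rparr>) ^^ m) H = (derived G ^^ m) H \<and> (derived G ^^ m) H \<subseteq> H" for m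
  proof (induction m)
    case (Suc m)
    then show ?case
      using derived_consistent[of "(derived G ^^ m) H" H] assms(2)
        derived_incl[of "(derived G ^^ m) H" H] by simp
  qed simp
  have "(derived G ^^ n) H \<subseteq> {\<one>}" using mono_exp_of_derived[OF Hc, of n] n by simp
  moreover have "\<one> \<in> (derived G ^^ n) H"
    using exp_of_derived_is_subgroup[OF assms(2)] subgroup.one_closed by blast
  ultimately have "(derived G ^^ n) H = {\<one>}" by blast
  then have "(derived (G\<lparr>carrier := H\<rparr>) ^^ n) (carrier (G\<lparr>carrier := H\<rparr>)) = {\<one>\<^bsub>G\<lparr>carrier := H\<rparr>\<^esub>}"
    using eq by simp
  then show ?thesis using H.solvable_iff_trivial_derived_seq by blast
qed

lemma (in normal) solvable_quotient:
  assumes "solvable G" shows "solvable (G Mod H)"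
proof -
  interpret Q: group "G Mod H" by (rule factorgroup_is_group)
  interpret group_hom G "G Mod H" "\<lambda>a. H #> a"
    using r_coset_hom_Mod by unfold_locales
  have "solvable_seq (G Mod H) ((\<lambda>a. H #> a) ` carrier G)"
    using assms solvable_imp_solvable_img by (simp add: solvable_def)
  then show ?thesis by (simp add: solvable_def carrier_FactGroup)
qed

context fin_group
begin

lemma normal_in_subgroup:
  assumes "subgroup N2 G" "subgroup N1 G" "N1 \<subseteq> N2" "invariant N2 N1"
  shows "N1 \<lhd> (G\<lparr>carrier := N2\<rparr>)"
proof -
  interpret N2: group "G\<lparr>carrier := N2\<rparr>" using assms(1) by (rule subgroup_imp_group)
  have "subgroup N1 (G\<lparr>carrier := N2\<rparr>)" using assms subgroup_incl by blast
  then show ?thesis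
    using assms by (auto simp: N2.normal_inv_iff invariant_def cnj_def m_inv_consistent)
qed

lemma rcoset_eq_self_iff: "subgroup N G \<Longrightarrow> x \<in> carrier G \<Longrightarrow> N #> x = N \<longleftrightarrow> x \<in> N"
  using coset_join1 coset_join2 by (meson subgroup.subset)

lemma rcoset_eq_iff:
  assumes "subgroup N G" "x \<in> carrier G" "y \<in> carrier G"
  shows "N #> x = N #> y \<longleftrightarrow> x \<otimes> inv y \<in> N"
  using assms rcoset_mem_iff repr_independence rcos_self by metis

lemma section_quotient:
  assumes N: "subgroup N2 G" "subgroup N1 G" "N1 \<subseteq> N2" "invariant N2 N1"
  shows "group_hom (G\<lparr>carrier := N2\<rparr>) (G\<lparr>carrier := N2\<rparr> Mod N1) (\<lambda>x. N1 #> x)"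
    and "carrier (G\<lparr>carrier := N2\<rparr> Mod N1) = (\<lambda>x. N1 #> x) ` N2"
    and "(\<forall>x\<in>N2. \<forall>y\<in>N2. cnj x y \<otimes> inv y \<in> N1) \<Longrightarrow> comm_group (G\<lparr>carrier := N2\<rparr> Mod N1)"
proof -
  have nrm: "N1 \<lhd> (G\<lparr>carrier := N2\<rparr>)" using assms by (rule normal_in_subgroup)
  interpret N: normal N1 "G\<lparr>carrier := N2\<rparr>" by (rule nrm)
  interpret Q: group "G\<lparr>carrier := N2\<rparr> Mod N1" by (rule N.factorgroup_is_group)
  have N2c: "N2 \<subseteq> carrier G" using N(1) subgroup.subset by blast
  show hom: "group_hom (G\<lparr>carrier := N2\<rparr>) (G\<lparr>carrier := N2\<rparr> Mod N1) (\<lambda>x. N1 #> x)"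
    using N.r_coset_hom_Mod by (simp add: group_hom_def group_hom_axioms_def N.is_group Q.is_group)
  show car: "carrier (G\<lparr>carrier := N2\<rparr> Mod N1) = (\<lambda>x. N1 #> x) ` N2"
    by (simp add: carrier_FactGroup)
  interpret h: group_hom "G\<lparr>carrier := N2\<rparr>" "G\<lparr>carrier := N2\<rparr> Mod N1" "\<lambda>x. N1 #> x" by (rule hom)
  show "comm_group (G\<lparr>carrier := N2\<rparr> Mod N1)" if c: "\<forall>x\<in>N2. \<forall>y\<in>N2. cnj x y \<otimes> inv y \<in> N1"
  proof (rule Q.group_comm_groupI)
    fix X Y assume "X \<in> carrier (G\<lparr>carrier := N2\<rparr> Mod N1)" "Y \<in> carrier (G\<lparr>carrier := N2\<rparr> Mod N1)"
    then obtain x y where xy: "x \<in> N2" "X = N1 #> x" "y \<in> N2" "Y = N1 #> y" using car by auto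
    have "x \<otimes> y \<otimes> inv (y \<otimes> x) = cnj x y \<otimes> inv y"
      using xy N2c by (simp add: cnj_def inv_mult_group m_assoc subset_iff)
    then have "N1 #> (x \<otimes> y) = N1 #> (y \<otimes> x)"
      using rcoset_eq_iff[OF N(2)] xy N2c c by (simp add: subset_iff)
    then show "X \<otimes>\<^bsub>G\<lparr>carrier := N2\<rparr> Mod N1\<^esub> Y = Y \<otimes>\<^bsub>G\<lparr>carrier := N2\<rparr> Mod N1\<^esub> X"
      using h.hom_mult[of x y] h.hom_mult[of y x] xy by simp
  qed
qed

lemma card_section:
  assumes N: "subgroup N2 G" "subgroup N1 G" "N1 \<subseteq> N2" "invariant N2 N1"
  shows "card (carrier (G\<lparr>carrier := N2\<rparr> Mod N1)) * card N1 = card N2"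
proof -
  interpret N2: group "G\<lparr>carrier := N2\<rparr>" using N(1) by (rule subgroup_imp_group)
  have "subgroup N1 (G\<lparr>carrier := N2\<rparr>)" using N subgroup_incl by blast
  then show ?thesis using N2.lagrange by (simp add: order_def FactGroup_def)
qed

text \<open>Elements of the section are cosets, that is sets, so \<open>g\<close> acts by taking the
  image under conjugation and no representative has to be chosen.\<close>

lemma section_aut_action:
  assumes V: "subgroup V1 G" "subgroup V2 G" "V2 \<subseteq> V1"
    and inv: "invariant (carrier G) V1" "invariant (carrier G) V2"
    and ab: "\<forall>x\<in>V1. \<forall>y\<in>V1. cnj x y \<otimes> inv y \<in> V2"
  shows "aut_action G (G\<lparr>carrier := V1\<rparr> Mod V2) (\<lambda>g X. cnj g ` X)"
    and "g \<in> carrier G \<Longrightarrow> v \<in> carrier G \<Longrightarrow> cnj g ` (V2 #> v) = V2 #> cnj g v"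
proof -
  have V1c: "V1 \<subseteq> carrier G" and V2c: "V2 \<subseteq> carrier G" using V subgroup.subset by blast+
  have inv12: "invariant V1 V2" using inv(2) V1c by (rule invariant_mono)
  note sq = section_quotient[OF V(1,2,3) inv12]
  interpret Q: comm_group "G\<lparr>carrier := V1\<rparr> Mod V2" using sq(3) ab by blast
  interpret h: group_hom "G\<lparr>carrier := V1\<rparr>" "G\<lparr>carrier := V1\<rparr> Mod V2" "\<lambda>x. V2 #> x" by (rule sq(1))
  have cj: "cnj g ` (V2 #> v) = V2 #> cnj g v" if g: "g \<in> carrier G" and v: "v \<in> carrier G" for g v
  proof -
    have "cnj g ` V2 = V2"
      using inv(2) g finite_subgroup[OF V(2)] inj_on_subset[OF cnj_inj[OF g] V2c]
      by (intro endo_inj_surj) (auto simp: invariant_def)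
    moreover have "cnj g ` (V2 #> v) = (cnj g ` V2) #> cnj g v"
      using g v V2c by (force simp: r_coset_def image_UN cnj_mult subset_iff)
    ultimately show ?thesis by simp
  qed
  show "cnj g ` (V2 #> v) = V2 #> cnj g v" if "g \<in> carrier G" "v \<in> carrier G" using cj that by blast
  show "aut_action G (G\<lparr>carrier := V1\<rparr> Mod V2) (\<lambda>g X. cnj g ` X)"
  proof (intro aut_action.intro aut_action_axioms.intro is_group Q.comm_group_axioms)
    let ?Q = "G\<lparr>carrier := V1\<rparr> Mod V2"
    show "finite (carrier ?Q)" unfolding sq(2) using finite_subgroup[OF V(1)] by blast
    show "cnj k ` X \<in> carrier ?Q" if "k \<in> carrier G" "X \<in> carrier ?Q" for k X
      using that sq(2) cj inv(1) V1c by (auto simp: invariant_def subset_iff)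
    show "cnj k ` (X \<otimes>\<^bsub>?Q\<^esub> Y) = cnj k ` X \<otimes>\<^bsub>?Q\<^esub> cnj k ` Y"
      if k: "k \<in> carrier G" and XY: "X \<in> carrier ?Q" "Y \<in> carrier ?Q" for k X Y
    proof -
      obtain x y where xy: "x \<in> V1" "X = V2 #> x" "y \<in> V1" "Y = V2 #> y" using XY sq(2) by auto
      have "X \<otimes>\<^bsub>?Q\<^esub> Y = V2 #> (x \<otimes> y)" using h.hom_mult[of x y] xy by simp
      then have "cnj k ` (X \<otimes>\<^bsub>?Q\<^esub> Y) = V2 #> (cnj k x \<otimes> cnj k y)"
        using cj xy V1c k by (simp add: cnj_mult subset_iff)
      also have "\<dots> = (V2 #> cnj k x) \<otimes>\<^bsub>?Q\<^esub> (V2 #> cnj k y)"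
        using h.hom_mult[of "cnj k x" "cnj k y"] xy inv(1) k by (simp add: invariant_def)
      finally show ?thesis using cj xy V1c k by (simp add: subset_iff)
    qed
    show "cnj \<one> ` X = X" if X: "X \<in> carrier ?Q" for X
    proof -
      obtain x where x: "x \<in> V1" "X = V2 #> x" using X sq(2) by auto
      then show ?thesis using cj[of \<one> x] V1c by (simp add: subset_iff)
    qed
    show "cnj (k \<otimes> l) ` X = cnj k ` cnj l ` X"
      if kl: "k \<in> carrier G" "l \<in> carrier G" and X: "X \<in> carrier ?Q" for k l X
    proof -
      obtain x where x: "x \<in> V1" "X = V2 #> x" using X sq(2) by auto
      then show ?thesis using cj kl V1c by (simp add: subset_iff cnj_cnj)
    qed
  qed
qed

text \<open>Minimality of \<open>N2\<close> is applied to two invariant subgroups: the one generated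
  by \<open>N1\<close> and all commutators of \<open>N2\<close>, and the elements whose
  \<open>t\<close>-th power lies in \<open>N1\<close>. Solvability keeps the first down to
  \<open>N1\<close>; the choice of \<open>t\<close> pushes the second up to \<open>N2\<close>. As
  \<open>U\<close> contains \<open>W\<close>, the subgroup \<open>N2\<close> normalises
  \<open>N1\<close>.\<close>

lemma chief_factor:
  assumes solv: "solvable G" and U: "U \<subseteq> carrier G" "W \<subseteq> U"
    and N1: "subgroup N1 G" "invariant U N1" and W: "subgroup W G" "invariant U W" and sub: "N1 \<subset> W"
  obtains N2 t where "subgroup N2 G" "invariant U N2" "N1 \<subset> N2" "N2 \<subseteq> W" "prime (t::nat)"
    "\<And>x. x \<in> N2 \<Longrightarrow> x [^] t \<in> N1" "\<And>x y. x \<in> N2 \<Longrightarrow> y \<in> N2 \<Longrightarrow> cnj x y \<otimes> inv y \<in> N1"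
    "\<And>N. subgroup N G \<Longrightarrow> invariant U N \<Longrightarrow> N1 \<subseteq> N \<Longrightarrow> N \<subseteq> N2 \<Longrightarrow> N = N1 \<or> N = N2"
proof -
  let ?P = "\<lambda>N. subgroup N G \<and> invariant U N \<and> N1 \<subset> N \<and> N \<subseteq> W"
  have "?P W" using W sub by blast
  then obtain N2 where N2: "?P N2" and least: "\<And>N. ?P N \<Longrightarrow> card N2 \<le> card N"
    using ex_has_least_nat[of ?P W card] by blast
  have minimal: "N = N1 \<or> N = N2" if "subgroup N G" "invariant U N" "N1 \<subseteq> N" "N \<subseteq> N2" for N
  proof (rule ccontr)
    assume c: "\<not> (N = N1 \<or> N = N2)"
    then have "?P N" using that N2 by blast
    then have "card N2 \<le> card N" by (rule least)
    then show False using c that N2 finite_subgroup[of N2] by (metis card_seteq)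
  qed
  have s2: "subgroup N2 G" and i2: "invariant U N2" using N2 by auto
  have N2c: "N2 \<subseteq> carrier G" and N1c: "N1 \<subseteq> carrier G" using N2 N1 subgroup.subset by blast+
  have N12: "N1 \<subseteq> N2" using N2 by blast
  have i12: "invariant N2 N1" using N1(2) N2 U by (meson invariant_mono subset_trans)
  note sq = section_quotient[OF s2 N1(1) N12 i12]
  let ?H = "G\<lparr>carrier := N2\<rparr>" and ?Q = "G\<lparr>carrier := N2\<rparr> Mod N1"
  interpret H: group ?H using s2 by (rule subgroup_imp_group)
  interpret h: group_hom ?H ?Q "\<lambda>x. N1 #> x" by (rule sq(1))
  interpret N: normal N1 ?H using normal_in_subgroup[OF s2 N1(1) N12 i12] .
  define C where "C = {cnj x y \<otimes> inv y | x y. x \<in> N2 \<and> y \<in> N2}"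
  have C2: "C \<subseteq> N2"
    using s2 invariant_self[OF s2] unfolding C_def
    by (auto intro!: subgroup.m_closed subgroup.m_inv_closed simp: invariant_def)
  define D where "D = generate G (N1 \<union> C)"
  have Dsub: "subgroup D G" unfolding D_def using N1c C2 N2c by (intro generate_is_subgroup) auto
  have D2: "D \<subseteq> N2" unfolding D_def using N12 C2 s2 by (intro generate_subgroup_incl) auto
  have D1: "N1 \<subseteq> D" unfolding D_def by (auto intro: generate.incl)
  have CinC: "cnj u c \<in> C" if u: "u \<in> U" and c: "c \<in> C" for u c
  proof -
    obtain x y where xy: "x \<in> N2" "y \<in> N2" "c = cnj x y \<otimes> inv y" using c by (auto simp: C_def)
    have uc: "u \<in> carrier G" and xc: "x \<in> carrier G" and yc: "y \<in> carrier G" using u U xy N2c by auto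
    have "cnj u c = cnj (cnj u x) (cnj u y) \<otimes> inv (cnj u y)"
      unfolding xy(3) using uc xc yc by (simp add: cnj_def inv_mult_group m_assoc)
    then show ?thesis using xy u i2 unfolding C_def by (auto simp: invariant_def)
  qed
  have Dinv: "invariant U D"
  proof -
    have "cnj u d \<in> D" if u: "u \<in> U" and d: "d \<in> D" for u d
    proof -
      have uc: "u \<in> carrier G" using u U by blast
      have genc: "z \<in> carrier G" if "z \<in> generate G (N1 \<union> C)" for z
        using that Dsub subgroup.mem_carrier unfolding D_def by metis
      from d show ?thesis unfolding D_def
      proof (induction rule: generate.induct)
        case one
        then show ?case using uc by (simp add: generate.one)
      next
        case (incl z)
        then show ?case using u N1(2) CinC by (auto simp: invariant_def intro: generate.incl)
      next
        case (inv z)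
        have "z \<in> carrier G" using inv N1c C2 N2c by auto
        then have "cnj u (inv z) = inv (cnj u z)" using uc by (simp add: cnj_inv)
        then show ?case using inv u N1(2) CinC by (auto simp: invariant_def intro: generate.inv)
      next
        case (eng a b)
        then show ?case using uc genc by (simp add: cnj_mult generate.eng)
      qed
    qed
    then show ?thesis by (simp add: invariant_def)
  qed
  \<comment> \<open>Otherwise the quotient of \<open>N2\<close> by \<open>N1\<close> is perfect;
    being solvable it is then trivial.\<close>
  have "D \<noteq> N2"
  proof
    assume D: "D = N2"
    have solQ: "solvable ?Q" using N.solvable_quotient solvable_subgroup[OF solv s2] by blast
    have phiC: "(\<lambda>x. N1 #> x) ` (N1 \<union> C) \<subseteq> derived ?Q (carrier ?Q)"
    proof
      fix X assume "X \<in> (\<lambda>x. N1 #> x) ` (N1 \<union> C)"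
      then consider (a) n where "n \<in> N1" "X = N1 #> n" | (b) c where "c \<in> C" "X = N1 #> c" by blast
      then show "X \<in> derived ?Q (carrier ?Q)"
      proof cases
        case a
        then have "X = \<one>\<^bsub>?Q\<^esub>" using rcoset_eq_self_iff[OF N1(1)] N1c by auto
        then show ?thesis by (simp only: derived_def generate.one)
      next
        case b
        then obtain x y where xy: "x \<in> N2" "y \<in> N2" "c = cnj x y \<otimes> inv y" by (auto simp: C_def)
        have iy: "inv\<^bsub>?H\<^esub> y = inv y" "inv\<^bsub>?H\<^esub> x = inv x" using xy s2 by (simp_all add: m_inv_consistent)
        have ii: "inv y \<in> N2" "inv x \<in> N2" using xy s2 by (simp_all add: subgroup.m_inv_closed)
        have "X = (N1 #> x) \<otimes>\<^bsub>?Q\<^esub> (N1 #> y) \<otimes>\<^bsub>?Q\<^esub> inv\<^bsub>?Q\<^esub> (N1 #> x) \<otimes>\<^bsub>?Q\<^esub> inv\<^bsub>?Q\<^esub> (N1 #> y)"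
          using h.hom_mult h.hom_inv[of x] h.hom_inv[of y] xy ii iy s2 b
          by (simp add: cnj_def subgroup.m_closed del: mult_FactGroup)
        then show ?thesis using xy sq(2) unfolding derived_def by (blast intro: generate.incl)
      qed
    qed
    have "generate ?Q ((\<lambda>x. N1 #> x) ` (N1 \<union> C)) = (\<lambda>x. N1 #> x) ` generate ?H (N1 \<union> C)"
      using h.generate_img[of "N1 \<union> C"] N12 C2 by simp
    also have "generate ?H (N1 \<union> C) = N2"
      using generate_consistent[of "N1 \<union> C" N2] N12 C2 s2 D D_def by simp
    finally have "generate ?Q ((\<lambda>x. N1 #> x) ` (N1 \<union> C)) = carrier ?Q" using sq(2) by simp
    moreover have sd: "subgroup (derived ?Q (carrier ?Q)) ?Q"
      by (rule h.H.derived_is_subgroup) simp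
    ultimately have "carrier ?Q \<subseteq> derived ?Q (carrier ?Q)"
      using h.H.generate_subgroup_incl[OF phiC sd] by simp
    then have der: "derived ?Q (carrier ?Q) = carrier ?Q" using sd subgroup.subset by blast
    have "(derived ?Q ^^ n) (carrier ?Q) = carrier ?Q" for n by (induction n) (simp_all add: der)
    then have "carrier ?Q = {\<one>\<^bsub>?Q\<^esub>}" using solQ h.H.solvable_iff_trivial_derived_seq by metis
    then have "N1 #> x = N1" if "x \<in> N2" for x using that sq(2) by auto
    then have "N2 \<subseteq> N1" using rcoset_eq_self_iff[OF N1(1)] N2c by blast
    then show False using N2 by blast
  qed
  then have "D = N1" using minimal[OF Dsub Dinv D1 D2] by blast
  then have comm: "cnj x y \<otimes> inv y \<in> N1" if "x \<in> N2" "y \<in> N2" for x y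
    using that unfolding D_def C_def by (blast intro: generate.incl)
  interpret Q: comm_group ?Q using sq(3) comm by blast
  have inN1: "x \<in> N1 \<longleftrightarrow> N1 #> x = \<one>\<^bsub>?Q\<^esub>" if "x \<in> N2" for x
    using that rcoset_eq_self_iff[OF N1(1)] N2c by auto
  have hpow: "N1 #> (x [^] (n::nat)) = (N1 #> x) [^]\<^bsub>?Q\<^esub> n" if "x \<in> N2" for x n
    using h.hom_nat_pow[of x n] that by (simp add: nat_pow_def)
  have hm: "N1 #> (x \<otimes> y) = (N1 #> x) \<otimes>\<^bsub>?Q\<^esub> (N1 #> y)" if "x \<in> N2" "y \<in> N2" for x y
    using h.hom_mult[of x y] that by simp
  have hc: "N1 #> x \<in> carrier ?Q" if "x \<in> N2" for x using that sq(2) by blast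
  obtain g where g: "g \<in> N2" "g \<notin> N1" using N2 by blast
  have gc: "g \<in> carrier G" using g N2c by blast
  have "g [^] ord g \<in> N1" using gc N1(1) subgroup.one_closed by fastforce
  then have ex: "\<exists>m::nat. 0 < m \<and> g [^] m \<in> N1" using ord_pos[OF gc] by blast
  \<comment> \<open>The order of \<open>g\<close> modulo \<open>N1\<close>. For a prime
    \<open>t\<close> dividing it, \<open>g [^] (m div t)\<close> has order \<open>t\<close> modulo
    \<open>N1\<close>.\<close>
  define m where "m = (LEAST m::nat. 0 < m \<and> g [^] m \<in> N1)"
  have m: "0 < m" "g [^] m \<in> N1" using LeastI_ex[OF ex] by (auto simp: m_def)
  have mleast: "m \<le> k" if "0 < k" "g [^] k \<in> N1" for k unfolding m_def using that by (intro Least_le) auto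
  have "m \<noteq> 1" using m g gc by auto
  then obtain t where t: "prime t" "t dvd m" using prime_factor_nat by blast
  obtain k where k: "m = t * k" using t by (auto elim: dvdE)
  have "0 < k" using k m(1) by simp
  moreover from this have "k < m" unfolding k using prime_gt_1_nat[OF t(1)] by simp
  ultimately have gk: "g [^] k \<notin> N1" using mleast leD by blast
  have gkt: "(g [^] k) [^] t \<in> N1" using m k gc by (simp add: nat_pow_pow mult.commute)
  have gk2: "g [^] k \<in> N2" using s2 g subgroup_pow by blast
  define T where "T = {x \<in> N2. x [^] t \<in> N1}"
  have Tsub: "subgroup T G"
  proof (rule subgroupI)
    show "T \<subseteq> carrier G" using N2c by (auto simp: T_def)
    show "T \<noteq> {}" using gkt gk2 by (auto simp: T_def)
    show "inv a \<in> T" if "a \<in> T" for a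
      using that s2 N1(1) N2c by (auto simp: T_def subgroup.m_inv_closed nat_pow_inv subset_iff)
    show "a \<otimes> b \<in> T" if ab: "a \<in> T" "b \<in> T" for a b
    proof -
      have m2: "a \<in> N2" "b \<in> N2" "a \<otimes> b \<in> N2" using ab s2 by (auto simp: T_def subgroup.m_closed)
      have "N1 #> ((a \<otimes> b) [^] t) = (N1 #> (a [^] t)) \<otimes>\<^bsub>?Q\<^esub> (N1 #> (b [^] t))"
        using hpow hm hc m2 by (simp add: Q.nat_pow_distrib del: mult_FactGroup)
      also have "\<dots> = \<one>\<^bsub>?Q\<^esub>"
        using ab inN1 m2 s2 subgroup_pow[OF s2] unfolding T_def by (simp del: mult_FactGroup one_FactGroup)
      finally show ?thesis using m2 inN1 subgroup_pow[OF s2] by (auto simp: T_def)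
    qed
  qed
  have Tinv: "invariant U T"
    using i2 N1(2) U N2c by (auto simp: T_def invariant_def cnj_pow[symmetric] subset_iff)
  have "N1 \<subseteq> T" using N12 N1(1) subgroup_pow by (auto simp: T_def)
  then have "T = N2" using minimal[OF Tsub Tinv] gkt gk2 gk by (auto simp: T_def)
  then have exp: "x [^] t \<in> N1" if "x \<in> N2" for x using that by (auto simp: T_def)
  show thesis
    by (rule that[OF s2 i2 _ _ t(1) exp comm minimal]) (use N2 in auto)
qed

text \<open>\<open>N1\<close> is a largest invariant subgroup whose order involves only primes of
  \<open>\<tau>\<close>; a chief factor above it for a prime of \<open>\<tau>\<close> would yield a
  larger one. In particular \<open>t\<close> does not divide \<open>card N1\<close>, which is the
  coprimeness that lifting requires.\<close>

lemma chief_factor_above: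
  assumes solv: "solvable G" and U: "U \<subseteq> carrier G" "W \<subseteq> U"
    and W: "subgroup W G" "invariant U W" and v: "prime v" "v dvd card W" "v \<notin> \<tau>"
    and N0: "subgroup N0 G" "invariant U N0" "N0 \<subseteq> W" "\<And>u. prime u \<Longrightarrow> u dvd card N0 \<Longrightarrow> u \<in> \<tau>"
  obtains N1 N2 t where "subgroup N1 G" "invariant U N1" "N0 \<subseteq> N1" "N1 \<subset> N2" "subgroup N2 G"
    "invariant U N2" "N2 \<subseteq> W" "\<And>u. prime u \<Longrightarrow> u dvd card N1 \<Longrightarrow> u \<in> \<tau>" "prime (t::nat)" "t \<notin> \<tau>"
    "t dvd card N2"
    "\<And>x. x \<in> N2 \<Longrightarrow> x [^] t \<in> N1" "\<And>x y. x \<in> N2 \<Longrightarrow> y \<in> N2 \<Longrightarrow> cnj x y \<otimes> inv y \<in> N1"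
    "\<And>N. subgroup N G \<Longrightarrow> invariant U N \<Longrightarrow> N1 \<subseteq> N \<Longrightarrow> N \<subseteq> N2 \<Longrightarrow> N = N1 \<or> N = N2"
proof -
  let ?P = "\<lambda>N. subgroup N G \<and> invariant U N \<and> N0 \<subseteq> N \<and> N \<subseteq> W \<and> (\<forall>u. prime u \<longrightarrow> u dvd card N \<longrightarrow> u \<in> \<tau>)"
  have "?P N0" using N0 by blast
  moreover have "\<forall>N. ?P N \<longrightarrow> card N < Suc (card (carrier G))"
    using fin card_mono subgroup.subset by (metis less_Suc_eq_le)
  ultimately obtain N1 where N1: "?P N1" and greatest: "\<And>N. ?P N \<Longrightarrow> card N \<le> card N1"
    using ex_has_greatest_nat[of ?P N0 card "Suc (card (carrier G))"] by blast
  have "N1 \<noteq> W" using N1 v by blast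
  then have sub: "N1 \<subset> W" using N1 by blast
  have s1: "subgroup N1 G" and i1: "invariant U N1" using N1 by auto
  show thesis
  proof (rule chief_factor[OF solv U s1 i1 W sub])
    fix N2 t assume N2: "subgroup N2 G" "invariant U N2" "N1 \<subset> N2" "N2 \<subseteq> W" "prime (t::nat)"
      and ex: "\<And>x. x \<in> N2 \<Longrightarrow> x [^] t \<in> N1" and co: "\<And>x y. x \<in> N2 \<Longrightarrow> y \<in> N2 \<Longrightarrow> cnj x y \<otimes> inv y \<in> N1"
      and mi: "\<And>N. subgroup N G \<Longrightarrow> invariant U N \<Longrightarrow> N1 \<subseteq> N \<Longrightarrow> N \<subseteq> N2 \<Longrightarrow> N = N1 \<or> N = N2"
    have N2c: "N2 \<subseteq> carrier G" using N2 subgroup.subset by blast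
    have "t \<notin> \<tau>"
    proof
      assume tt: "t \<in> \<tau>"
      have "u \<in> \<tau>" if u: "prime u" "u dvd card N2" for u
      proof (cases "u = t")
        case False
        obtain y where y: "y \<in> N2" "ord y = u" using cauchy[OF u(1) N2(1) u(2)] by blast
        have yc: "y \<in> carrier G" using y N2c by blast
        have "y [^] t \<noteq> \<one>" using y yc u N2(5) False pow_eq_id primes_dvd_imp_eq by metis
        then obtain k :: nat where "(y [^] t) [^] k = y" using prime_ord_pow_eq(2)[OF u(1) y(2) yc] by blast
        then have "y \<in> N1" using ex[OF y(1)] s1 subgroup_pow by metis
        then have "u dvd card N1" using ord_dvd_card[OF s1] y by blast
        then show ?thesis using N1 u by blast
      qed (use tt in simp)
      then have "?P N2" using N2 N1 by blast
      then have "card N2 \<le> card N1" by (rule greatest)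
      then show False using N2(1,3) finite_subgroup by (metis card_seteq psubset_imp_subset less_irrefl)
    qed
    have "\<not> t dvd card N1" using N1 N2(5) \<open>t \<notin> \<tau>\<close> by blast
    obtain g where g: "g \<in> N2" "g \<notin> N1" using N2 by blast
    obtain m :: nat where "ord (g [^] m) = t"
      using lift_prime_order[OF s1 N2(5) \<open>\<not> t dvd card N1\<close> _ g(2) ex[OF g(1)]] g N2c by blast
    then have "t dvd card N2" using ord_dvd_card[OF N2(1)] subgroup_pow[OF N2(1) g(1)] by metis
    then show thesis
      using that[of N1 N2 t] N1 N2 \<open>t \<notin> \<tau>\<close> ex co mi by blast
  qed
qed

end

section \<open>Direct decompositions and the centraliser of the Fitting subgroup\<close>

context fin_group
begin

lemma ord_mult_commutes:
  assumes "x \<in> carrier G" "y \<in> carrier G" "commutes x y" "coprime (ord x) (ord y)"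
  shows "ord (x \<otimes> y) = ord x * ord y"
proof (rule dvd_antisym)
  show "ord (x \<otimes> y) dvd ord x * ord y"
    using assms ord_mul_divides by (simp add: commutes_def)
  let ?n = "ord (x \<otimes> y)"
  have *: "ord a dvd ord (a \<otimes> b)"
    if ab: "a \<in> carrier G" "b \<in> carrier G" "commutes a b" "coprime (ord a) (ord b)" for a b
  proof -
    let ?m = "ord (a \<otimes> b) * ord b"
    have "ord (a \<otimes> b) dvd ?m" by simp
    then have "(a \<otimes> b) [^] ?m = \<one>" using pow_eq_id[OF m_closed[OF ab(1,2)]] by blast
    moreover have "(a \<otimes> b) [^] ?m = a [^] ?m \<otimes> b [^] ?m"
      using ab pow_mult_commutes by blast
    moreover have "b [^] ?m = \<one>" using pow_eq_id[OF ab(2)] by (metis dvd_triv_right)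
    ultimately have "a [^] ?m = \<one>" using ab(1) by (metis nat_pow_closed r_one)
    then have "ord a dvd ?m" using pow_eq_id[OF ab(1)] by blast
    then show ?thesis using ab(4) coprime_dvd_mult_left_iff by blast
  qed
  have "ord x dvd ?n" using * assms by blast
  moreover have "ord y dvd ?n"
    using *[of y x] assms unfolding commutes_def by (metis coprime_commute)
  ultimately show "ord x * ord y dvd ?n" using assms(4) divides_mult by blast
qed

text \<open>A Sylow \<open>t\<close>-subgroup of \<open>N\<close> commutes with \<open>Z\<close> and
  meets it trivially, and an order count shows that the two exhaust \<open>N\<close>. So
  \<open>N\<close> is their direct product, and \<open>T\<close> is the set of all
  \<open>t\<close>-elements of \<open>N\<close>, which inherits every invariance of
  \<open>N\<close>.\<close>

lemma central_p_complement:
  assumes N: "subgroup N G" and Z: "subgroup Z G" "Z \<subseteq> N" "invariant N Z"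
    and t: "prime t" "\<not> t dvd card Z" and ex: "\<And>x. x \<in> N \<Longrightarrow> x [^] (t ^ k) \<in> Z"
    and c: "\<And>x z j. x \<in> N \<Longrightarrow> x [^] (t ^ j) = \<one> \<Longrightarrow> z \<in> Z \<Longrightarrow> commutes x z"
  obtains T n where "subgroup T G" "T \<subseteq> N" "card T = t ^ n"
    "\<And>x j. x \<in> N \<Longrightarrow> x [^] (t ^ j) = \<one> \<Longrightarrow> x \<in> T"
    "\<And>x. x \<in> N \<Longrightarrow> \<exists>z\<in>Z. \<exists>y\<in>T. x = z \<otimes> y"
proof -
  have Nc: "N \<subseteq> carrier G" using N subgroup.subset by blast
  have card0: "card N \<noteq> 0" "card Z \<noteq> 0" using card_subgroup_pos N Z by force+
  define a where "a = multiplicity t (card N)"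
  obtain P where P: "subgroup P G" "P \<subseteq> N" "card P = t ^ a"
    using sylow_subgroup[OF t(1) N, of a] multiplicity_dvd a_def by metis
  have Pord: "x [^] (t ^ a) = \<one>" if "x \<in> P" for x
    using pow_card_eq_one[OF P(1) that, of "t ^ a"] P(3) by simp
  have Zdis: "z = \<one>" if "z \<in> Z" "z [^] (t ^ j) = \<one>" for z j
  proof -
    have zc: "z \<in> carrier G" using that Z Nc by auto
    have "ord z dvd card Z" using ord_dvd_card Z that by blast
    moreover have "ord z dvd t ^ j" using that zc pow_eq_id by blast
    moreover have "coprime (card Z) (t ^ j)"
      using t prime_imp_coprime by (metis coprime_commute coprime_power_right_iff)
    ultimately have "ord z = 1" by (metis coprime_common_divisor_nat)
    then show ?thesis using ord_eq_1 zc by blast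
  qed
  \<comment> \<open>Multiplicities are compared prime by prime: for \<open>u \<noteq> t\<close> a
    Sylow \<open>u\<close>-subgroup of \<open>N\<close> already lies in \<open>Z\<close>.\<close>
  have "card N dvd card Z * t ^ a"
  proof (rule multiplicity_le_imp_dvd)
    show "card N \<noteq> 0" by (rule card0)
    show "multiplicity u (card N) \<le> multiplicity u (card Z * t ^ a)" if u: "prime u" for u
    proof (cases "u = t")
      case True
      have "t ^ a dvd card Z * t ^ a" by simp
      then show ?thesis using True a_def card0 t(1)
        by (metis mult_eq_0_iff multiplicity_geI not_prime_unit power_not_zero not_prime_0)
    next
      case False
      define b where "b = multiplicity u (card N)"
      obtain Y where Y: "subgroup Y G" "Y \<subseteq> N" "card Y = u ^ b"
        using sylow_subgroup[OF u N, of b] multiplicity_dvd b_def by metis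
      have "Y \<subseteq> Z"
      proof
        fix y assume y: "y \<in> Y"
        have yc: "y \<in> carrier G" using y Y Nc by auto
        have "ord y dvd u ^ b" using ord_dvd_card[OF Y(1) y] Y(3) by simp
        moreover have "coprime (u ^ b) (t ^ k)" using False u t(1) primes_coprime[of u t] by simp
        ultimately have cop: "coprime (t ^ k) (ord y)" by (metis coprime_commute coprime_divisors dvd_refl)
        \<comment> \<open>An inverse of \<open>t ^ k\<close> modulo \<open>ord y\<close> recovers
          \<open>y\<close> from its power \<open>y [^] (t ^ k)\<close>, which lies in
          \<open>Z\<close>.\<close>
        obtain i where i: "[t ^ k * i = 1] (mod (ord y))" using cong_solve_coprime_nat[OF cop] unfolding One_nat_def by blast
        have "(y [^] (t ^ k)) [^] i = y"
        proof (cases "ord y = 1")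
          case True
          then show ?thesis using yc ord_eq_1 by (metis nat_pow_one)
        next
          case False
          have "t ^ k * i \<noteq> 0"
          proof
            assume "t ^ k * i = 0"
            then have "[0 = 1] (mod (ord y))" using i by metis
            then show False using False by (simp add: cong_def ord_pos[OF yc] mod_eq_self_iff_div_eq_0)
          qed
          then have "ord y dvd t ^ k * i - 1" using i cong_to_1_nat by blast
          then obtain l where "t ^ k * i = ord y * l + 1" using \<open>t ^ k * i \<noteq> 0\<close>
            by (metis Suc_eq_plus1 Suc_pred' dvdE neq0_conv minus_nat.diff_0 One_nat_def)
          then have "y [^] (t ^ k * i) = (y [^] ord y) [^] l \<otimes> y"
            using yc by (simp add: nat_pow_pow pow_eq_id)
          then show ?thesis using yc by (simp add: nat_pow_pow)
        qed
        then show "y \<in> Z" using ex y Y subgroup_pow[OF Z(1)] by (metis subsetD)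
      qed
      then have "u ^ b dvd card Z * t ^ a" using card_subgroup_dvd[OF Y(1) Z(1)] Y(3) by simp
      then show ?thesis using card0 u t(1) unfolding b_def[symmetric]
        by (metis mult_eq_0_iff multiplicity_geI not_prime_unit power_not_zero not_prime_0)
    qed
  qed
  then have le: "card N \<le> card Z * card P" using card0 P(3) t(1) by (simp add: dvd_imp_le prime_gt_0_nat)
  let ?f = "\<lambda>(z, p). z \<otimes> p"
  have inj: "inj_on ?f (Z \<times> P)"
  proof (rule inj_onI, clarsimp)
    fix z p z' p' assume A: "z \<in> Z" "p \<in> P" "z' \<in> Z" "p' \<in> P" "z \<otimes> p = z' \<otimes> p'"
    have cc: "z \<in> carrier G" "p \<in> carrier G" "z' \<in> carrier G" "p' \<in> carrier G" using A Z P Nc by auto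
    have "inv z' \<otimes> z = p' \<otimes> inv p"
    proof -
      have "inv z' \<otimes> (z \<otimes> p) \<otimes> inv p = inv z' \<otimes> (z' \<otimes> p') \<otimes> inv p" using A by simp
      then show ?thesis using cc by (simp add: m_assoc)
    qed
    moreover have "p' \<otimes> inv p \<in> P" using A P(1) by (simp add: subgroup.m_closed subgroup.m_inv_closed)
    moreover have "inv z' \<otimes> z \<in> Z" using A Z(1) by (simp add: subgroup.m_closed subgroup.m_inv_closed)
    ultimately have "inv z' \<otimes> z = \<one>" "p' \<otimes> inv p = \<one>" using Zdis Pord by metis+
    then show "z = z' \<and> p = p'" using cc
      by (metis inv_closed inv_equality inv_inv)
  qed
  have img: "?f ` (Z \<times> P) \<subseteq> N" using Z(2) P(2) N by (auto intro: subgroup.m_closed)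
  have "card (?f ` (Z \<times> P)) = card Z * card P" using card_image[OF inj] by (simp add: card_cartesian_product)
  then have eq: "?f ` (Z \<times> P) = N"
    using img le finite_subgroup[OF N] by (metis card_seteq)
  show thesis
  proof (rule that[OF P])
    show "\<exists>z\<in>Z. \<exists>y\<in>P. x = z \<otimes> y" if "x \<in> N" for x
      using that eq by force
    show "x \<in> P" if x: "x \<in> N" "x [^] (t ^ j) = \<one>" for x j
    proof -
      obtain z y where zy: "z \<in> Z" "y \<in> P" "x = z \<otimes> y" using x eq by force
      have cc: "z \<in> carrier G" "y \<in> carrier G" using zy Z P Nc by auto
      have com: "commutes z y" using c[of y a z] Pord zy P(2) by (blast intro: commutes_sym)
      have "x [^] (t ^ (j + a)) = (x [^] (t ^ j)) [^] (t ^ a)"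
        using nat_pow_pow[of x "t ^ j" "t ^ a"] x(1) Nc by (simp add: power_add subset_iff)
      then have "\<one> = x [^] (t ^ (j + a))" using x by simp
      also have "\<dots> = z [^] (t ^ (j + a)) \<otimes> y [^] (t ^ (j + a))"
        using zy(3) pow_mult_commutes[OF com cc] by simp
      also have "y [^] (t ^ (j + a)) = (y [^] (t ^ a)) [^] (t ^ j)"
        using cc by (simp add: nat_pow_pow power_add mult.commute)
      finally have "z [^] (t ^ (j + a)) = \<one>" using Pord[OF zy(2)] cc by simp
      then have "z = \<one>" using Zdis[OF zy(1)] by blast
      then show ?thesis using zy cc by simp
    qed
  qed
qed

lemma p_elements_invariant:
  assumes T: "T \<subseteq> N" "N \<subseteq> carrier G" "\<And>x j. x \<in> N \<Longrightarrow> x [^] (t ^ j) = \<one> \<Longrightarrow> x \<in> T"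
    and cT: "subgroup T G" "card T = t ^ n" and inv: "invariant U N" "U \<subseteq> carrier G"
  shows "invariant U T"
proof -
  have "cnj u x \<in> T" if ux: "u \<in> U" "x \<in> T" for u x
  proof -
    have c: "u \<in> carrier G" "x \<in> carrier G" using ux T inv by auto
    have "x [^] (t ^ n) = \<one>" using pow_card_eq_one[OF cT(1) ux(2)] cT(2) by simp
    then have "cnj u x [^] (t ^ n) = \<one>" using c by (simp add: cnj_pow[symmetric])
    then show ?thesis using T(3) inv ux T(1) by (meson invariantD subsetD)
  qed
  then show ?thesis by (simp add: invariant_def)
qed

lemma invariant_cent:
  assumes "S \<subseteq> carrier G" "invariant (carrier G) S" shows "invariant (carrier G) (cent S)"
proof -
  have "commutes (cnj u x) s" if "u \<in> carrier G" "x \<in> cent S" "s \<in> S" for u x s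
  proof -
    have xc: "x \<in> carrier G" using that by (simp add: cent_def)
    have sc: "s \<in> carrier G" using that assms by auto
    have "cnj (inv u) s \<in> S" using assms that by (simp add: invariant_def)
    then have "commutes x (cnj (inv u) s)" using that by (simp add: cent_def)
    then have "commutes (cnj u x) (cnj u (cnj (inv u) s))"
      using cnj_commutes_iff[of u x "cnj (inv u) s"] that xc sc by (metis cnj_closed inv_closed)
    then show ?thesis using that sc by simp
  qed
  then show ?thesis by (auto simp: invariant_def cent_def)
qed

lemma invariant_Int: "invariant U A \<Longrightarrow> invariant U B \<Longrightarrow> invariant U (A \<inter> B)"
  by (simp add: invariant_def)

lemma invariant_Un: "invariant U A \<Longrightarrow> invariant U B \<Longrightarrow> invariant U (A \<union> B)"
  by (auto simp: invariant_def)

lemma subgroup_set_mult: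
  assumes A: "subgroup A G" and B: "subgroup B G" "invariant A B"
  shows "subgroup {a \<otimes> b | a b. a \<in> A \<and> b \<in> B} G"
proof (rule subgroupI)
  let ?S = "{a \<otimes> b | a b. a \<in> A \<and> b \<in> B}"
  have Ac: "A \<subseteq> carrier G" and Bc: "B \<subseteq> carrier G" using A B subgroup.subset by blast+
  have cj: "inv a \<otimes> b \<otimes> a \<in> B" if "a \<in> A" "b \<in> B" for a b
  proof -
    have "cnj (inv a) b \<in> B" using that A B(2) by (simp add: invariant_def subgroup.m_inv_closed)
    then show ?thesis using that Ac by (auto simp: cnj_def)
  qed
  show "?S \<subseteq> carrier G" using Ac Bc by auto
  show "?S \<noteq> {}" using A B subgroup.one_closed by blast
  show "x \<otimes> y \<in> ?S" if xy: "x \<in> ?S" "y \<in> ?S" for x y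
  proof -
    obtain a b c d where e: "a \<in> A" "b \<in> B" "x = a \<otimes> b" "c \<in> A" "d \<in> B" "y = c \<otimes> d" using xy by blast
    have "x \<otimes> y = (a \<otimes> c) \<otimes> ((inv c \<otimes> b \<otimes> c) \<otimes> d)"
      using e Ac Bc by (simp add: m_assoc subset_iff)
    moreover have "a \<otimes> c \<in> A" "(inv c \<otimes> b \<otimes> c) \<otimes> d \<in> B"
      using e cj A B by (simp_all add: subgroup.m_closed)
    ultimately show ?thesis by blast
  qed
  show "inv x \<in> ?S" if x: "x \<in> ?S" for x
  proof -
    obtain a b where e: "a \<in> A" "b \<in> B" "x = a \<otimes> b" using x by blast
    have ia: "inv a \<in> A" "inv b \<in> B" using e A B by (simp_all add: subgroup.m_inv_closed)
    have "inv x = inv a \<otimes> (inv (inv a) \<otimes> inv b \<otimes> inv a)"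
      using e Ac Bc by (simp add: m_assoc inv_mult_group subset_iff)
    then show ?thesis using ia cj by blast
  qed
qed

text \<open>The section form of \<open>noncyclic_fixes_pgroup\<close>: the fixed point is found in
  the quotient of \<open>V1\<close> by \<open>V2\<close>, so it is fixed only modulo
  \<open>V2\<close>.\<close>

lemma noncyclic_fixes_section:
  assumes V: "subgroup V1 G" "subgroup V2 G" "V2 \<subset> V1"
    and inv: "invariant (carrier G) V1" "invariant (carrier G) V2"
    and ab: "\<And>x y. x \<in> V1 \<Longrightarrow> y \<in> V1 \<Longrightarrow> cnj x y \<otimes> inv y \<in> V2"
    and p: "prime p" "\<And>x. x \<in> V1 \<Longrightarrow> x [^] p \<in> V2" and q: "prime q" "q \<noteq> p" "\<not> q dvd card V2"
    and xy: "indep q x y"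
  shows "\<exists>e v. e \<in> generate G {x, y} \<and> ord e = q \<and> v \<in> V1 \<and> v \<notin> V2 \<and> cnj e v \<otimes> inv v \<in> V2"
proof -
  have V1c: "V1 \<subseteq> carrier G" using V(1) subgroup.subset by blast
  let ?Q = "G\<lparr>carrier := V1\<rparr> Mod V2"
  interpret aut_action G ?Q "\<lambda>g X. cnj g ` X"
    using section_aut_action(1)[OF V(1,2) _ inv] V(3) ab by blast
  have inv12: "invariant V1 V2" using inv(2) V1c by (rule invariant_mono)
  note cj = section_aut_action(2)[OF V(1,2) _ inv]
  have car: "carrier ?Q = (\<lambda>x. V2 #> x) ` V1" using section_quotient(2)[OF V(1,2) _ inv12] V(3) by blast
  \<comment> \<open>An element of order \<open>q\<close> in \<open>V1\<close> is a power of its own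
    \<open>p\<close>-th power, hence lies in \<open>V2\<close>.\<close>
  have q1: "\<not> q dvd card V1"
  proof
    assume "q dvd card V1"
    then obtain z where z: "z \<in> V1" "ord z = q" using cauchy[OF q(1) V(1)] by blast
    have zc: "z \<in> carrier G" using z V1c by blast
    have "z [^] p \<noteq> \<one>" using z zc p(1) q(1,2) pow_eq_id primes_dvd_imp_eq by metis
    then obtain k :: nat where "(z [^] p) [^] k = z" using prime_ord_pow_eq(2)[OF q(1) z(2) zc] by blast
    then have "z \<in> V2" using p(2)[OF z(1)] subgroup_pow[OF V(2)] by metis
    then show False using ord_dvd_card[OF V(2)] z q(3) by blast
  qed
  have nd: "\<not> q dvd card (carrier ?Q)"
    using card_section[OF V(1,2) _ inv12] V(3) q1 by (metis dvd_mult2 psubset_imp_subset)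
  obtain v where v: "v \<in> V1" "v \<notin> V2" using V(3) by blast
  have vc: "v \<in> carrier G" using v V1c by blast
  have v1: "V2 #> v \<noteq> \<one>\<^bsub>?Q\<^esub>" using v vc rcoset_eq_self_iff[OF V(2)] by simp
  have x: "x \<in> carrier G" "x [^] q = \<one>" and y: "y \<in> carrier G" "y [^] q = \<one>" and cxy: "commutes x y"
    using xy by (auto simp: indep_def pow_eq_id)
  obtain e where e: "e = y \<or> (\<exists>i::nat. e = x \<otimes> y [^] i)" "nrm e q (V2 #> v) \<noteq> \<one>\<^bsub>?Q\<^esub>"
    using noncyclic_fixed_point[OF q(1) nd x y cxy _ v1] car v by blast
  have gs: "subgroup (generate G {x, y}) G" using x y by (simp add: generate_is_subgroup)
  have xg: "x \<in> generate G {x, y}" "y \<in> generate G {x, y}" by (auto intro: generate.incl)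
  have eg: "e \<in> generate G {x, y}" using e(1) xg gs by (auto intro: subgroup.m_closed subgroup_pow)
  then have ec: "e \<in> carrier G" using gs subgroup.mem_carrier by metis
  have oe: "ord e = q" using indep_ord[OF q(1) xy e(1)] .
  have eq: "e [^] q = \<one>" using oe ec by auto
  have vQ: "V2 #> v \<in> carrier ?Q" using car v by blast
  have "nrm e q (V2 #> v) \<in> carrier ?Q" using ec vQ by simp
  then obtain w where w: "w \<in> V1" "nrm e q (V2 #> v) = V2 #> w" using car by auto
  have wc: "w \<in> carrier G" using w V1c by blast
  have "w \<notin> V2" using e(2) w rcoset_eq_self_iff[OF V(2) wc] by auto
  moreover have "V2 #> cnj e w = V2 #> w"
    using nrm_fixed[OF ec eq vQ] w cj[OF _ _ ec wc] V(3) ab by (metis psubset_imp_subset)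
  then have "cnj e w \<otimes> inv w \<in> V2" using rcoset_eq_iff[OF V(2)] ec wc by simp
  ultimately show ?thesis using eg oe w by blast
qed

text \<open>Here \<open>F = Q S\<close> is the Fitting subgroup, and in a solvable group it contains
  its centraliser. Otherwise take a chief factor from \<open>Z = C \<inter> F\<close> to some
  \<open>N\<close> inside the centraliser \<open>C\<close>. As \<open>N\<close> centralises
  \<open>F\<close>, its \<open>t\<close>-elements form a normal \<open>t\<close>-subgroup
  complementing the part of \<open>Z\<close> prime to \<open>t\<close>; that subgroup lies in a
  radical, so \<open>N\<close> lies in \<open>F\<close>, a contradiction.\<close>

lemma fitting_centralizer:
  assumes solv: "solvable G" and Q: "subgroup Q G" "invariant (carrier G) Q" "card Q = q ^ i" "prime q"
    and S: "subgroup S G" "invariant (carrier G) S" "card S = s ^ j" "prime s" and qs: "q \<noteq> s"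
    and maxQ: "\<And>N k. subgroup N G \<Longrightarrow> invariant (carrier G) N \<Longrightarrow> card N = q ^ k \<Longrightarrow> N \<subseteq> Q"
    and maxS: "\<And>N k. subgroup N G \<Longrightarrow> invariant (carrier G) N \<Longrightarrow> card N = s ^ k \<Longrightarrow> N \<subseteq> S"
    and other: "\<And>N k t. prime t \<Longrightarrow> t \<noteq> q \<Longrightarrow> t \<noteq> s \<Longrightarrow> subgroup N G \<Longrightarrow> invariant (carrier G) N \<Longrightarrow>
      card N = t ^ k \<Longrightarrow> N = {\<one>}"
    and x: "x \<in> carrier G" "\<And>a. a \<in> Q \<Longrightarrow> commutes x a" "\<And>a. a \<in> S \<Longrightarrow> commutes x a"
  shows "\<exists>a\<in>Q. \<exists>b\<in>S. x = a \<otimes> b"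
proof (rule ccontr)
  assume no: "\<not> ?thesis"
  define C where "C = cent (Q \<union> S)"
  define F where "F = {a \<otimes> b | a b. a \<in> Q \<and> b \<in> S}"
  have Qc: "Q \<subseteq> carrier G" and Sc: "S \<subseteq> carrier G" using Q S subgroup.subset by blast+
  have C: "subgroup C G" unfolding C_def using Qc Sc by (intro cent_subgroup) auto
  have Cc: "C \<subseteq> carrier G" using C subgroup.subset by blast
  have Ci: "invariant (carrier G) C" unfolding C_def
    using Q S Qc Sc by (intro invariant_cent invariant_Un) auto
  have F: "subgroup F G" unfolding F_def using Q S Qc by (intro subgroup_set_mult) (auto intro: invariant_mono)
  have Fi: "invariant (carrier G) F"
  proof -
    have "cnj u (a \<otimes> b) \<in> F" if "u \<in> carrier G" "a \<in> Q" "b \<in> S" for u a b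
    proof -
      have "cnj u (a \<otimes> b) = cnj u a \<otimes> cnj u b" using that Qc Sc by (simp add: cnj_mult subset_iff)
      moreover have "cnj u a \<in> Q" "cnj u b \<in> S" using that Q(2) S(2) by (simp_all add: invariant_def)
      ultimately show ?thesis unfolding F_def by blast
    qed
    then show ?thesis by (auto simp: invariant_def F_def)
  qed
  define Z where "Z = C \<inter> F"
  have Z: "subgroup Z G" unfolding Z_def using C F by (rule subgroups_Inter_pair)
  have Zi: "invariant (carrier G) Z" unfolding Z_def using Ci Fi by (rule invariant_Int)
  have xC: "x \<in> C" using x by (auto simp: C_def cent_def)
  have "x \<notin> F" using no by (auto simp: F_def)
  then have sub: "Z \<subset> C" using xC by (auto simp: Z_def)
  show False
  proof (rule chief_factor[OF solv _ Cc Z Zi C Ci sub])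
    show "carrier G \<subseteq> carrier G" by simp
    fix N t assume N: "subgroup N G" "invariant (carrier G) N" "Z \<subset> N" "N \<subseteq> C" "prime (t::nat)"
      and ex: "\<And>x. x \<in> N \<Longrightarrow> x [^] t \<in> Z"
    have Nc: "N \<subseteq> carrier G" using N(1) subgroup.subset by blast
    have central: "commutes n z" if n: "n \<in> N" and z: "z \<in> F" for n z
    proof -
      obtain a b where ab: "a \<in> Q" "b \<in> S" "z = a \<otimes> b" using z by (auto simp: F_def)
      have "commutes n a" "commutes n b" using n N ab by (auto simp: C_def cent_def)
      then show ?thesis using ab Qc Sc n Nc by (auto intro!: commutes_mult)
    qed
    have comQS: "commutes a b" if "a \<in> Q" "b \<in> S" for a b
    proof -
      have c: "a \<in> carrier G" "b \<in> carrier G" using that Qc Sc by auto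
      let ?w = "cnj a b \<otimes> inv b"
      have w1: "?w \<in> S" using that S c by (simp add: invariant_def subgroup.m_closed subgroup.m_inv_closed)
      have "?w = a \<otimes> cnj b (inv a)" using c by (simp add: cnj_def m_assoc)
      moreover have "cnj b (inv a) \<in> Q" using that c Q by (simp add: invariant_def subgroup.m_inv_closed)
      ultimately have w2: "?w \<in> Q" using that Q(1) subgroup.m_closed by metis
      have "ord ?w dvd q ^ i" "ord ?w dvd s ^ j"
        using ord_dvd_card[OF Q(1) w2] ord_dvd_card[OF S(1) w1] Q(3) S(3) by simp_all
      moreover have "coprime (q ^ i) (s ^ j)" using Q(4) S(4) qs primes_coprime[of q s] by simp
      ultimately have "ord ?w = 1" by (metis coprime_common_divisor_nat)
      then have "?w = \<one>" using ord_eq_1 c by simp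
      then have "cnj a b = b" using c by (metis cnj_closed inv_closed inv_equality inv_inv)
      then show ?thesis using c cnj_eq_iff by blast
    qed
    \<comment> \<open>\<open>Q'\<close> and \<open>S'\<close> stand for \<open>Q\<close> and
      \<open>S\<close> in either order, so that \<open>t = q\<close> and \<open>t = s\<close> are
      handled once. The normal subgroup prime to \<open>t\<close> is
      \<open>N \<inter> S'\<close>.\<close>
    have part: False
      if t: "t = q'" "prime q'" "prime s'" "q' \<noteq> s'"
        and Q': "subgroup Q' G" "card Q' = q' ^ i'" and S': "subgroup S' G" "invariant (carrier G) S'" "card S' = s' ^ j'"
        and max: "\<And>N k. subgroup N G \<Longrightarrow> invariant (carrier G) N \<Longrightarrow> card N = q' ^ k \<Longrightarrow> N \<subseteq> Q'"
        and QF: "Q' \<subseteq> F" "S' \<subseteq> F" and dec: "\<And>z. z \<in> F \<Longrightarrow> \<exists>a\<in>Q'. \<exists>b\<in>S'. z = a \<otimes> b"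
        and com: "\<And>a b. a \<in> Q' \<Longrightarrow> b \<in> S' \<Longrightarrow> commutes a b"
      for Q' S' q' s' i' j'
    proof -
      have Q'c: "Q' \<subseteq> carrier G" and S'c: "S' \<subseteq> carrier G" using Q' S' subgroup.subset by blast+
      have ZS: "subgroup (N \<inter> S') G" using N(1) S'(1) by (rule subgroups_Inter_pair)
      \<comment> \<open>One factor \<open>t\<close> brings \<open>y\<close> into \<open>F\<close>;
        the remaining \<open>t ^ i'\<close> kills the component in \<open>Q'\<close>.\<close>
      have pw: "y [^] (t ^ Suc i') \<in> N \<inter> S'" if y: "y \<in> N" for y
      proof -
        have yc: "y \<in> carrier G" using y Nc by blast
        have "y [^] t \<in> F" using ex[OF y] by (simp add: Z_def)
        then obtain a b where ab: "a \<in> Q'" "b \<in> S'" "y [^] t = a \<otimes> b" using dec by blast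
        have c: "a \<in> carrier G" "b \<in> carrier G" using ab Q'c S'c by auto
        have "y [^] (t ^ Suc i') = (y [^] t) [^] (t ^ i')" using yc by (simp add: nat_pow_pow)
        also have "\<dots> = a [^] (t ^ i') \<otimes> b [^] (t ^ i')"
          using ab com c by (simp add: pow_mult_commutes)
        also have "a [^] (t ^ i') = \<one>" using pow_card_eq_one[OF Q'(1) ab(1)] Q'(2) t(1) by simp
        finally have "y [^] (t ^ Suc i') = b [^] (t ^ i')" using c by simp
        then have "y [^] (t ^ Suc i') \<in> S'" using subgroup_pow[OF S'(1) ab(2)] by metis
        then show ?thesis using subgroup_pow[OF N(1) y] by blast
      qed
      have ndS: "\<not> t dvd card (N \<inter> S')"
      proof
        assume "t dvd card (N \<inter> S')"
        moreover have "card (N \<inter> S') dvd s' ^ j'" using card_subgroup_dvd[OF ZS S'(1)] S'(3) by simp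
        ultimately have "t dvd s' ^ j'" by (rule dvd_trans)
        then show False using t prime_dvd_power primes_dvd_imp_eq by blast
      qed
      have ZSi: "invariant N (N \<inter> S')"
        using invariant_Int[OF N(2) S'(2)] Nc by (rule invariant_mono)
      show False
      proof (rule central_p_complement[OF N(1) ZS Int_lower1 ZSi N(5) ndS pw])
        show "commutes x z" if "x \<in> N" "x [^] (t ^ j) = \<one>" "z \<in> N \<inter> S'" for x z j
          using central QF that by blast
        fix T n assume T: "subgroup T G" "T \<subseteq> N" "card T = t ^ n"
          "\<And>x j. x \<in> N \<Longrightarrow> x [^] (t ^ j) = \<one> \<Longrightarrow> x \<in> T"
          "\<And>x. x \<in> N \<Longrightarrow> \<exists>z\<in>N \<inter> S'. \<exists>y\<in>T. x = z \<otimes> y"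
        have "invariant (carrier G) T"
          using p_elements_invariant[OF T(2) Nc T(4) T(1,3) N(2)] by simp
        then have "T \<subseteq> Q'" using max T t by blast
        have "N \<subseteq> F"
        proof
          fix y assume "y \<in> N"
          then obtain z w where "z \<in> N \<inter> S'" "w \<in> T" "y = z \<otimes> w" using T(5) by blast
          then show "y \<in> F" using QF \<open>T \<subseteq> Q'\<close> subgroup.m_closed[OF F, of z w] by blast
        qed
        then show False using N by (auto simp: Z_def)
      qed
    qed
    have QF: "Q \<subseteq> F" "S \<subseteq> F"
    proof -
      have "a \<in> F" if "a \<in> Q" for a
        using that Qc subgroup.one_closed[OF S(1)] unfolding F_def by (force intro: exI[of _ a] exI[of _ \<one>])
      moreover have "b \<in> F" if "b \<in> S" for b
        using that Sc subgroup.one_closed[OF Q(1)] unfolding F_def by (force intro: exI[of _ \<one>] exI[of _ b])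
      ultimately show "Q \<subseteq> F" "S \<subseteq> F" by blast+
    qed
    show False
    proof (cases "t = q \<or> t = s")
      case True
      then show False
      proof
        assume "t = q"
        show False
          by (rule part[OF \<open>t = q\<close> Q(4) S(4) qs Q(1,3) S(1,2,3) maxQ QF _ comQS])
            (auto simp: F_def C_def cent_def)
      next
        assume "t = s"
        have dec: "\<exists>a\<in>S. \<exists>b\<in>Q. z = a \<otimes> b" if "z \<in> F" for z
          using that comQS unfolding F_def commutes_def by blast
        show False
          by (rule part[OF \<open>t = s\<close> S(4) Q(4) qs[symmetric] S(1,3) Q(1,2,3) maxS QF(2,1) dec])
            (use comQS in \<open>auto simp: C_def cent_def intro: commutes_sym\<close>)
      qed
    next
      case False
      have ndZ: "\<not> t dvd card Z"
      proof
        assume "t dvd card Z"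
        then obtain z where z: "z \<in> Z" "ord z = t" using cauchy[OF N(5) Z] by blast
        then obtain a b where ab: "a \<in> Q" "b \<in> S" "z = a \<otimes> b" by (auto simp: Z_def F_def)
        have c: "a \<in> carrier G" "b \<in> carrier G" using ab Qc Sc by auto
        have "z [^] (q ^ i * s ^ j) = a [^] (q ^ i * s ^ j) \<otimes> b [^] (q ^ i * s ^ j)"
          using ab comQS c by (simp add: pow_mult_commutes)
        also have "\<dots> = \<one>" using pow_card_eq_one[OF Q(1) ab(1)] pow_card_eq_one[OF S(1) ab(2)] Q(3) S(3) by simp
        finally have "t dvd q ^ i * s ^ j" using z c ab pow_eq_id by auto
        then show False using False N(5) Q(4) S(4) by (metis prime_dvd_mult_iff prime_dvd_power primes_dvd_imp_eq)
      qed
      have Zi': "invariant N Z" using Zi Nc by (rule invariant_mono)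
      show False
      proof (rule central_p_complement[OF N(1) Z _ Zi' N(5) ndZ])
        show "Z \<subseteq> N" using N by blast
        show "x [^] (t ^ 1) \<in> Z" if "x \<in> N" for x using ex[OF that] by simp
        show "commutes x z" if "x \<in> N" "x [^] (t ^ j) = \<one>" "z \<in> Z" for x z j
          using central that by (auto simp: Z_def)
        fix T n assume T: "subgroup T G" "T \<subseteq> N" "card T = t ^ n"
          "\<And>x j. x \<in> N \<Longrightarrow> x [^] (t ^ j) = \<one> \<Longrightarrow> x \<in> T"
          "\<And>x. x \<in> N \<Longrightarrow> \<exists>z\<in>Z. \<exists>y\<in>T. x = z \<otimes> y"
        have "invariant (carrier G) T"
          using p_elements_invariant[OF T(2) Nc T(4) T(1,3) N(2)] by simp
        then have "T = {\<one>}" using other[OF N(5)] False T by blast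
        then have "N \<subseteq> Z" using T(5) Z subgroup.mem_carrier by fastforce
        then show False using N by blast
      qed
    qed
  qed
qed

end

section \<open>Groups without elements of three prime divisors\<close>

text \<open>Only the conditions that pass to subgroups and quotients are collected here; the condition
  \<open>pq \<in> \<omega>(G)\<close> does not.\<close>

locale good_group = fin_group +
  assumes solv: "solvable G"
    and prime_cond: "\<And>p q. prime p \<Longrightarrow> prime q \<Longrightarrow> p \<noteq> q \<Longrightarrow> p dvd card (carrier G) \<Longrightarrow>
      q dvd card (carrier G) \<Longrightarrow> \<not> p dvd q - 1"
    and no_triple: "\<And>g. g \<in> carrier G \<Longrightarrow> card (prime_factors (ord g)) \<le> 2"
begin

lemma ord_dvd_order: "g \<in> carrier G \<Longrightarrow> ord g dvd card (carrier G)"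
  using ord_dvd_card[OF subgroup_self] .

lemma three_primes_ord:
  assumes "g \<in> carrier G" "prime p" "prime q" "prime r" "p \<noteq> q" "p \<noteq> r" "q \<noteq> r"
    "p dvd ord g" "q dvd ord g" "r dvd ord g"
  shows False
proof -
  have "{p, q, r} \<subseteq> prime_factors (ord g)"
    using assms ord_pos[OF assms(1)] by (auto simp: in_prime_factors_iff)
  then have "card {p, q, r} \<le> card (prime_factors (ord g))" by (intro card_mono) auto
  then show False using no_triple[OF assms(1)] assms by simp
qed

lemma triple_commuting:
  assumes xyz: "x \<in> carrier G" "y \<in> carrier G" "z \<in> carrier G"
    and ord: "ord x = p" "ord y = q" "ord z = r" "prime p" "prime q" "prime r"
    and ne: "p \<noteq> q" "p \<noteq> r" "q \<noteq> r" and c: "commutes x y" "commutes x z" "commutes y z"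
  shows False
proof -
  have o1: "ord (x \<otimes> y) = p * q"
    using ord_mult_commutes[of x y] xyz c ord ne primes_coprime[of p q] by simp
  have "commutes z (x \<otimes> y)" using xyz c by (auto intro: commutes_mult commutes_sym)
  moreover have "coprime (p * q) r" using ord ne primes_coprime[of p r] primes_coprime[of q r] by simp
  ultimately have "ord (x \<otimes> y \<otimes> z) = p * q * r"
    using ord_mult_commutes[of "x \<otimes> y" z] xyz o1 ord(3) commutes_sym by simp
  then show False
    using three_primes_ord[of "x \<otimes> y \<otimes> z" p q r] xyz ord ne by simp
qed

text \<open>A common prime divisor of \<open>ord g\<close> and \<open>t - 1\<close> would be smaller
  than \<open>t\<close>, divide the group order and divide \<open>t - 1\<close>, which
  \<open>prime_cond\<close> forbids.\<close>

lemma coprime_ord_pred: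
  assumes g: "g \<in> carrier G" and t: "prime t" "t dvd card (carrier G)"
  shows "coprime (ord g) (t - 1)"
proof (rule ccontr)
  assume "\<not> coprime (ord g) (t - 1)"
  then have "gcd (ord g) (t - 1) \<noteq> 1" by (simp add: coprime_iff_gcd_eq_1)
  then obtain u where "prime u" "u dvd gcd (ord g) (t - 1)" using prime_factor_nat by blast
  then have u: "prime u" "u dvd ord g" "u dvd t - 1" using dvd_gcdD1 dvd_gcdD2 by blast+
  have "u dvd card (carrier G)" using u ord_dvd_order[OF g] dvd_trans by blast
  moreover have "u \<noteq> t"
  proof
    assume "u = t"
    then have "t \<le> t - 1" using u(3) prime_gt_1_nat[OF t(1)] by (intro dvd_imp_le) auto
    then show False using prime_gt_1_nat[OF t(1)] by linarith
  qed
  ultimately show False using prime_cond u t by blast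
qed

lemma cyclic_section_central:
  assumes X: "subgroup X G" "invariant {e, g} X" and g: "g \<in> carrier G"
    and e: "e \<in> carrier G" "e \<notin> X" "ord e = t" "prime t" and k: "cnj g e \<otimes> inv (e [^] (k::nat)) \<in> X"
  shows "cnj g e \<otimes> inv e \<in> X"
proof (rule cyclic_quotient_central[OF X g e(1,2) _ e(4) k])
  have "e [^] t = \<one>" using e(1,3) pow_ord_eq_1 by blast
  then show "e [^] t \<in> X" using subgroup.one_closed[OF X(1)] by simp
  show "coprime (ord g) (t - 1)" using coprime_ord_pred[OF g e(4)] ord_dvd_order[OF e(1)] e(3) by simp
qed

lemma good_subgroup:
  assumes H: "subgroup H G" shows "good_group (G\<lparr>carrier := H\<rparr>)"
proof -
  interpret H: fin_group "G\<lparr>carrier := H\<rparr>" using H by (rule restrict_fin_group)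
  have Hc: "H \<subseteq> carrier G" using H subgroup.subset by blast
  have ordH: "H.ord g = ord g" if "g \<in> H" for g
  proof -
    have "g [^]\<^bsub>G\<lparr>carrier := H\<rparr>\<^esub> n = g [^] n" for n :: nat by (simp add: nat_pow_def)
    then show ?thesis using that Hc H.ord_unique[of g "ord g"] pow_eq_id[of g] by auto
  qed
  have "card H dvd card (carrier G)" using card_subgroup_dvd[OF H subgroup_self] Hc by simp
  then show ?thesis
    using solvable_subgroup[OF solv H] prime_cond no_triple Hc ordH
    by (intro good_group.intro good_group_axioms.intro H.fin_group_axioms) (auto dest: dvd_trans)
qed

lemma quotient_ord_dvd:
  assumes "group_hom G Q h" "g \<in> carrier G" shows "group.ord Q (h g) dvd ord g"
proof -
  interpret h: group_hom G Q h by (rule assms)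
  have "h g [^]\<^bsub>Q\<^esub> ord g = h (g [^] ord g)" using assms(2) by (rule h.hom_nat_pow[symmetric])
  then show ?thesis using assms(2) h.H.pow_eq_id[of "h g" "ord g"] by simp
qed

lemma good_quotient:
  assumes N: "subgroup N G" "invariant (carrier G) N"
  shows "good_group (G Mod N)" and "group_hom G (G Mod N) (\<lambda>x. N #> x)"
    and "card (carrier (G Mod N)) * card N = card (carrier G)"
proof -
  interpret N: normal N G using N normal_iff_invariant by blast
  interpret Q: group "G Mod N" by (rule N.factorgroup_is_group)
  show hom: "group_hom G (G Mod N) (\<lambda>x. N #> x)"
    using N.r_coset_hom_Mod by (simp add: group_hom_def group_hom_axioms_def Q.is_group)
  show cards: "card (carrier (G Mod N)) * card N = card (carrier G)"
    using lagrange[OF N(1)] by (simp add: order_def FactGroup_def)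
  have dv: "card (carrier (G Mod N)) dvd card (carrier G)" using cards by (metis dvd_triv_left)
  have fQ: "finite (carrier (G Mod N))" by (simp add: carrier_FactGroup)
  have nt: "card (prime_factors (Q.ord X)) \<le> 2" if X: "X \<in> carrier (G Mod N)" for X
  proof -
    obtain g where g: "g \<in> carrier G" "X = N #> g" using X by (auto simp: carrier_FactGroup)
    have "prime_factors (Q.ord X) \<subseteq> prime_factors (ord g)"
      using quotient_ord_dvd[OF hom g(1)] g ord_pos[OF g(1)] by (auto simp: in_prime_factors_iff intro: dvd_trans)
    then have "card (prime_factors (Q.ord X)) \<le> card (prime_factors (ord g))" by (intro card_mono) auto
    then show ?thesis using no_triple[OF g(1)] by simp
  qed
  show "good_group (G Mod N)"
    using N.solvable_quotient[OF solv] prime_cond dv fQ nt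
    by (intro good_group.intro good_group_axioms.intro fin_group.intro fin_group_axioms.intro Q.is_group)
      (auto dest: dvd_trans)
qed

text \<open>Elements of prime order outside \<open>N\<close> keep their orders in
  \<open>G Mod N\<close>, which is again a good group, so the triple is excluded there.\<close>

lemma triple_modulo:
  assumes N: "subgroup N G" "invariant (carrier G) N"
    and xyz: "x \<in> carrier G" "y \<in> carrier G" "z \<in> carrier G" "x \<notin> N" "y \<notin> N" "z \<notin> N"
    and ord: "ord x = p" "ord y = q" "ord z = r" "prime p" "prime q" "prime r"
    and ne: "p \<noteq> q" "p \<noteq> r" "q \<noteq> r"
    and c: "cnj x y \<otimes> inv y \<in> N" "cnj x z \<otimes> inv z \<in> N" "cnj y z \<otimes> inv z \<in> N"
  shows False
proof -
  interpret Q: good_group "G Mod N" by (rule good_quotient(1)[OF N])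
  interpret h: group_hom G "G Mod N" "\<lambda>x. N #> x" by (rule good_quotient(2)[OF N])
  let ?h = "\<lambda>x. N #> x"
  have hord: "Q.ord (?h g) = l" if "g \<in> carrier G" "ord g = l" "prime l" "g \<notin> N" for g l
  proof (rule Q.ord_eq_prime[OF that(3)])
    show "?h g \<in> carrier (G Mod N)" using that(1) by (rule h.hom_closed)
    show "?h g [^]\<^bsub>G Mod N\<^esub> l = \<one>\<^bsub>G Mod N\<^esub>"
      using h.hom_nat_pow[OF that(1), of l] that(1,2) pow_ord_eq_1 h.hom_one by metis
    show "?h g \<noteq> \<one>\<^bsub>G Mod N\<^esub>" using that rcoset_eq_self_iff[OF N(1)] by simp
  qed
  have hcom: "Q.commutes (?h g) (?h g')" if "g \<in> carrier G" "g' \<in> carrier G" "cnj g g' \<otimes> inv g' \<in> N" for g g'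
  proof -
    have "g \<otimes> g' \<otimes> inv (g' \<otimes> g) \<in> N"
      using that by (simp add: cnj_def inv_mult_group m_assoc)
    then have "?h (g \<otimes> g') = ?h (g' \<otimes> g)"
      using rcoset_eq_iff[OF N(1) m_closed[OF that(1,2)] m_closed[OF that(2,1)]] by blast
    then show ?thesis unfolding Q.commutes_def using h.hom_mult that by metis
  qed
  show False
    using Q.triple_commuting[of "?h x" "?h y" "?h z" p q r] hord hcom xyz ord ne c h.hom_closed by blast
qed

lemma commutes_imp_mem:
  assumes "subgroup N G" "x \<in> carrier G" "y \<in> carrier G" "commutes x y"
  shows "cnj x y \<otimes> inv y \<in> N"
proof -
  have "cnj x y = y" using assms cnj_eq_iff by blast
  then show ?thesis using assms subgroup.one_closed by simp
qed

text \<open>Take the lowest chief factor whose prime \<open>p\<close> lies in \<open>S\<close>, and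
  above it the lowest one whose prime \<open>q\<close> lies in \<open>S - {p}\<close>. If the upper
  one contains an independent pair, an element of order \<open>q\<close> fixes a point of the lower
  one, which links \<open>q\<close> and \<open>p\<close>. Otherwise it is cyclic, hence central, and
  links \<open>q\<close> with the third prime \<open>r\<close>.\<close>

lemma two_of_three_primes:
  assumes S: "card S = 3" "\<And>p. p \<in> S \<Longrightarrow> prime p \<and> p dvd card (carrier G)"
  shows "\<exists>h\<in>carrier G. \<exists>p\<in>S. \<exists>q\<in>S. p \<noteq> q \<and> p dvd ord h \<and> q dvd ord h"
proof -
  have cc: "invariant (carrier G) (carrier G)" by (simp add: invariant_def)
  have one_in: "invariant (carrier G) {\<one>}" by (simp add: invariant_one)
  have card1: "u \<in> \<tau>" if "prime u" "u dvd card {\<one>}" for u \<tau> using that by simp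
  have "S \<noteq> {}" using S(1) by auto
  then obtain v where v: "v \<in> S" by blast
  have vp: "prime v" "v dvd card (carrier G)" "v \<notin> {u. u \<notin> S}" using v S(2) by auto
  obtain N1 N2 p where N: "subgroup N1 G" "invariant (carrier G) N1" "N1 \<subset> N2" "subgroup N2 G"
    "invariant (carrier G) N2" and N1p: "\<And>u. prime u \<Longrightarrow> u dvd card N1 \<Longrightarrow> u \<in> {u. u \<notin> S}" and p: "prime p" "p \<notin> {u. u \<notin> S}"
    and exN: "\<And>x. x \<in> N2 \<Longrightarrow> x [^] p \<in> N1" and coN: "\<And>x y. x \<in> N2 \<Longrightarrow> y \<in> N2 \<Longrightarrow> cnj x y \<otimes> inv y \<in> N1"
    by (rule chief_factor_above[OF solv subset_refl subset_refl subgroup_self cc vp triv_subgroup one_in _ card1])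
      auto
  have pS: "p \<in> S" using p by simp
  \<comment> \<open>An element of prime order \<open>u \<noteq> p\<close> in \<open>N2\<close> is a
    power of its own \<open>p\<close>-th power and thus lies in \<open>N1\<close>.\<close>
  have N2p: "u \<in> insert p {u. u \<notin> S}" if u: "prime u" "u dvd card N2" for u
  proof (rule ccontr)
    assume c: "u \<notin> insert p {u. u \<notin> S}"
    obtain y where y: "y \<in> N2" "ord y = u" using cauchy[OF u(1) N(4) u(2)] by blast
    have yc: "y \<in> carrier G" using y N(4) subgroup.mem_carrier by metis
    have "y [^] p \<noteq> \<one>" using y yc u p c pow_eq_id primes_dvd_imp_eq by (metis insertI1)
    then obtain k :: nat where "(y [^] p) [^] k = y" using prime_ord_pow_eq(2)[OF u(1) y(2) yc] by blast
    then have "y \<in> N1" using exN[OF y(1)] N(1) subgroup_pow by metis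
    then have "u dvd card N1" using ord_dvd_card[OF N(1)] y by blast
    then show False using N1p u c by blast
  qed
  have "card (S - {p}) = 2" using S(1) pS by simp
  then have "S - {p} \<noteq> {}" by (metis card.empty zero_neq_numeral)
  then obtain v' where v': "v' \<in> S" "v' \<noteq> p" by blast
  have vp': "prime v'" "v' dvd card (carrier G)" "v' \<notin> insert p {u. u \<notin> S}" using v' S(2) by auto
  obtain M1 M2 q where M: "subgroup M1 G" "invariant (carrier G) M1" "N2 \<subseteq> M1" "M1 \<subset> M2" "subgroup M2 G"
    "invariant (carrier G) M2" and M1p: "\<And>u. prime u \<Longrightarrow> u dvd card M1 \<Longrightarrow> u \<in> insert p {u. u \<notin> S}"
    and q: "prime q" "q \<notin> insert p {u. u \<notin> S}"
    and exM: "\<And>x. x \<in> M2 \<Longrightarrow> x [^] q \<in> M1" and coM: "\<And>x y. x \<in> M2 \<Longrightarrow> y \<in> M2 \<Longrightarrow> cnj x y \<otimes> inv y \<in> M1"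
    by (rule chief_factor_above[OF solv subset_refl subset_refl subgroup_self cc vp' N(4,5)
          subgroup.subset[OF N(4)] N2p]) auto
  have qS: "q \<in> S" "q \<noteq> p" using q by auto
  have M2c: "M2 \<subseteq> carrier G" and N2c: "N2 \<subseteq> carrier G" using M N subgroup.subset by blast+
  have qM1: "\<not> q dvd card M1" using M1p q by blast
  have pN1: "\<not> p dvd card N1" using N1p p by blast
  have qN1: "\<not> q dvd card N1" using N1p[of q] q by blast
  have invM: "invariant M2 M1" using M(2) M2c by (rule invariant_mono)
  have "\<exists>r. r \<in> S \<and> r \<noteq> p \<and> r \<noteq> q"
  proof (rule ccontr)
    assume "\<not> ?thesis"
    then have "S \<subseteq> {p, q}" by blast
    then have "card S \<le> card {p, q}" by (intro card_mono) auto
    also have "\<dots> \<le> 2" by (simp add: card_insert_if)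
    finally show False using S(1) by simp
  qed
  then obtain r where r: "r \<in> S" "r \<noteq> p" "r \<noteq> q" by blast
  have rp: "prime r" "r dvd card (carrier G)" using r S(2) by auto
  have rM1: "\<not> r dvd card M1" using M1p rp r by blast
  consider (a) x y where "x \<in> M2" "y \<in> M2" "indep q x y"
    | (b) e where "e \<in> M2" "ord e = q" "e \<notin> M1" "\<forall>g\<in>M2. \<exists>i::nat. g \<otimes> inv (e [^] i) \<in> M1"
    using elementary_quotient[OF M(1,5) _ _ invM q(1) qM1 exM coM] M(4) by blast
  then show ?thesis
  proof cases
    case a
    obtain e w where ew: "e \<in> generate G {x, y}" "ord e = q" "w \<in> N2" "w \<notin> N1" "cnj e w \<otimes> inv w \<in> N1"
      using noncyclic_fixes_section[OF N(4,1,3,5,2) coN p(1) exN q(1) qS(2) qN1 a(3)] by blast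
    have ec: "e \<in> carrier G" using ew(1) a M2c generate_in_carrier[of "{x, y}" e] by auto
    have wc: "w \<in> carrier G" using ew N2c by auto
    have "invariant {e, w} N1" using N(2) ec wc by (auto intro: invariant_mono)
    then obtain g where g: "g \<in> carrier G" "ord g = p" "commutes e g"
      using lift_commutes_prime[OF N(1) _ ec ew(2) q(1) qN1 wc ew(4) exN[OF ew(3)] p(1) pN1 ew(5)] by blast
    have "ord (e \<otimes> g) = q * p"
      using ord_mult_commutes[OF ec g(1,3)] ew(2) g(2) primes_coprime[of q p] q p qS by simp
    then have "p dvd ord (e \<otimes> g)" "q dvd ord (e \<otimes> g)" by simp_all
    then show ?thesis using m_closed[OF ec g(1)] pS qS by blast
  next
    case b
    have ec: "e \<in> carrier G" using b M2c by auto
    obtain g where g: "g \<in> carrier G" "ord g = r" using cauchy[OF rp(1) subgroup_self rp(2)] by blast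
    have inv: "invariant {e, g} M1" "invariant {g, e} M1" using M(2) ec g by (auto intro: invariant_mono)
    have "cnj g e \<in> M2" using M(6) g b by (simp add: invariant_def)
    then obtain k :: nat where "cnj g e \<otimes> inv (e [^] k) \<in> M1" using b by blast
    then have "cnj g e \<otimes> inv e \<in> M1"
      using cyclic_section_central[OF M(1) inv(1) g(1) ec b(3,2) q(1)] by blast
    then obtain f where f: "f \<in> carrier G" "ord f = q" "commutes g f"
      using lift_commutes_prime[OF M(1) inv(2) g rp(1) rM1 ec b(3) exM[OF b(1)] q(1) qM1] by blast
    have "ord (g \<otimes> f) = r * q"
      using ord_mult_commutes[OF g(1) f(1,3)] f g primes_coprime[of r q] q rp r by simp
    then have "r dvd ord (g \<otimes> f)" "q dvd ord (g \<otimes> f)" by simp_all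
    then show ?thesis using m_closed[OF g(1) f(1)] r qS by blast
  qed
qed

end

text \<open>The last assumption is what remains of the absence of elements with three prime divisors
  when \<open>V\<close> is an \<open>r\<close>-section: an element of \<open>K\<close> fixing a
  nontrivial \<open>v\<close> has at most one prime divisor besides \<open>r\<close>.\<close>

locale good_action = aut_action K V act + K: good_group K
  for K :: "('k, 'm) monoid_scheme" and V :: "('v, 'n) monoid_scheme" and act +
  fixes r :: nat
  assumes r_prime: "prime r" and r_group: "\<exists>k. card (carrier V) = r ^ k" and nontriv: "carrier V \<noteq> {\<one>\<^bsub>V\<^esub>}"
    and fixed_prime_power: "\<And>g v t u. g \<in> carrier K \<Longrightarrow> v \<in> carrier V \<Longrightarrow> v \<noteq> \<one>\<^bsub>V\<^esub> \<Longrightarrow> act g v = v \<Longrightarrow>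
      prime t \<Longrightarrow> prime u \<Longrightarrow> t \<noteq> r \<Longrightarrow> u \<noteq> r \<Longrightarrow> t \<noteq> u \<Longrightarrow> t dvd K.ord g \<Longrightarrow> u dvd K.ord g \<Longrightarrow> False"
begin

lemma fixed_commuting:
  assumes "g \<in> carrier K" "h \<in> carrier K" "K.commutes g h" "K.ord g = t" "K.ord h = u"
    "prime t" "prime u" "t \<noteq> r" "u \<noteq> r" "t \<noteq> u" "v \<in> carrier V" "act g v = v" "act h v = v"
  shows "v = \<one>\<^bsub>V\<^esub>"
proof -
  have "K.ord (g \<otimes>\<^bsub>K\<^esub> h) = t * u"
    using K.ord_mult_commutes[OF assms(1-3)] assms primes_coprime[of t u] by simp
  moreover have "act (g \<otimes>\<^bsub>K\<^esub> h) v = v" using assms by (simp add: act_comp)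
  ultimately show ?thesis using fixed_prime_power[of "g \<otimes>\<^bsub>K\<^esub> h" v t u] assms by auto
qed

lemma coprime_card_V: "prime t \<Longrightarrow> t \<noteq> r \<Longrightarrow> \<not> t dvd card (carrier V)"
  using r_group r_prime by (metis prime_dvd_power primes_dvd_imp_eq)

text \<open>The witness \<open>w\<close> is the norm of \<open>v\<close> along \<open>e\<close>.
  Whatever commutes with \<open>x\<close> and \<open>y\<close> commutes with \<open>e\<close>, so if
  it fixes \<open>v\<close> it also fixes this norm; hence the last clause.\<close>

lemma noncyclic_fixes:
  assumes t: "prime t" "t \<noteq> r" and xy: "K.indep t x y" and v: "v \<in> carrier V" "v \<noteq> \<one>\<^bsub>V\<^esub>"
  shows "\<exists>e w. (e = y \<or> (\<exists>i::nat. e = x \<otimes>\<^bsub>K\<^esub> y [^]\<^bsub>K\<^esub> i)) \<and> e \<in> carrier K \<and> K.ord e = t \<and>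
    w \<in> carrier V \<and> w \<noteq> \<one>\<^bsub>V\<^esub> \<and> act e w = w \<and>
    (\<forall>c\<in>carrier K. K.commutes c x \<longrightarrow> K.commutes c y \<longrightarrow> act c v = v \<longrightarrow> act c w = w)"
proof -
  have x: "x \<in> carrier K" "x [^]\<^bsub>K\<^esub> t = \<one>\<^bsub>K\<^esub>" and y: "y \<in> carrier K" "y [^]\<^bsub>K\<^esub> t = \<one>\<^bsub>K\<^esub>" and cxy: "K.commutes x y"
    using xy by (auto simp: K.indep_def K.pow_eq_id)
  obtain e where e: "e = y \<or> (\<exists>i::nat. e = x \<otimes>\<^bsub>K\<^esub> y [^]\<^bsub>K\<^esub> i)" "nrm e t v \<noteq> \<one>\<^bsub>V\<^esub>"
    using noncyclic_fixed_point[OF t(1) coprime_card_V[OF t] x y cxy v] by blast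
  have ec: "e \<in> carrier K" using e(1) x y by auto
  have oe: "K.ord e = t" using K.indep_ord[OF t(1) xy e(1)] .
  have "act e (nrm e t v) = nrm e t v" using nrm_fixed[OF ec _ v(1)] oe ec by auto
  moreover have "act c (nrm e t v) = nrm e t v"
    if c: "c \<in> carrier K" "K.commutes c x" "K.commutes c y" "act c v = v" for c
  proof -
    have "K.commutes c e" using e(1) c x y by (auto intro: K.commutes_mult K.commutes_pow)
    then show ?thesis using act_nrm[OF c(1) ec v(1)] c(4) by simp
  qed
  ultimately show ?thesis using e ec oe v by (intro exI[of _ e] exI[of _ "nrm e t v"]) auto
qed

end

context good_action
begin

text \<open>Averaging yields an element of prime order outside \<open>{p, r}\<close> that
  centralises \<open>A\<close>. Such elements act without fixed points on \<open>V\<close>, so the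
  lowest suitable chief factor of the centraliser of \<open>A\<close> is cyclic, hence central;
  combined with \<open>edge\<close> it gives a commuting triple. The alternative in
  \<open>edge\<close> covers a quotient in which the element of order \<open>p\<close> commuting
  with \<open>d\<close> has become trivial: there \<open>d\<close> acts without fixed
  points.\<close>

lemma no_faithful_chief_factor:
  assumes p: "prime p" "p \<noteq> r" and A: "subgroup A K" "K.invariant (carrier K) A" "A \<noteq> {\<one>\<^bsub>K\<^esub>}"
    and ab: "\<And>a b. a \<in> A \<Longrightarrow> b \<in> A \<Longrightarrow> K.commutes a b"
    and ex: "\<And>a. a \<in> A \<Longrightarrow> a [^]\<^bsub>K\<^esub> p = \<one>\<^bsub>K\<^esub>"
    and faith: "\<And>a. a \<in> A \<Longrightarrow> (\<And>v. v \<in> carrier V \<Longrightarrow> act a v = v) \<Longrightarrow> a = \<one>\<^bsub>K\<^esub>"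
    and q: "prime q" "q \<noteq> p" "q \<noteq> r" and s: "prime s" "s \<noteq> p" "s \<noteq> r" "s \<noteq> q"
    and y0: "y0 \<in> carrier K" "K.ord y0 = q * s"
    and edge: "\<And>u. u \<in> {q, s} \<Longrightarrow> \<exists>d\<in>carrier K. K.ord d = u \<and>
      ((\<forall>v\<in>carrier V. act d v = v \<longrightarrow> v = \<one>\<^bsub>V\<^esub>) \<or> (\<exists>c\<in>carrier K. K.ord c = p \<and> K.commutes d c))"
  shows False
proof -
  have Ac: "A \<subseteq> carrier K" using A(1) subgroup.subset by blast
  have fA: "finite A" using A(1) by simp
  have oA: "K.ord a = p" if "a \<in> A" "a \<noteq> \<one>\<^bsub>K\<^esub>" for a
    using K.ord_eq_prime[OF p(1)] that Ac ex by blast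
  have invA: "K.invariant {g} A" if "g \<in> carrier K" for g using A(2) that by (auto intro: K.invariant_mono)
  obtain n where cA: "card A = p ^ n"
    using K.prime_power_card[OF p(1) A(1)] ex by (metis power_one_right)
  have copA: "coprime (card A) (card (carrier V))"
    using cA r_group p r_prime primes_coprime[of p r] by auto
  have cop_sub: "coprime (card D) (card (carrier V))" if "subgroup D K" "D \<subseteq> A" for D
    using copA K.card_subgroup_dvd[OF that(1) A(1) that(2)] coprime_divisors dvd_refl by blast
  have ndA: "\<not> t dvd card A" if "prime t" "t \<noteq> p" for t
    using cA p(1) that by (metis prime_dvd_power primes_dvd_imp_eq)
  obtain a0 where a0: "a0 \<in> A" "a0 \<noteq> \<one>\<^bsub>K\<^esub>" using A(1,3) subgroup.one_closed by blast
  \<comment> \<open>The commutators of \<open>A\<close> with \<open>d\<close> act trivially on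
    \<open>V\<close>, and \<open>A\<close> acts faithfully.\<close>
  have centralises: "K.commutes d x"
    if d: "d \<in> carrier K" "K.ord d = t" "prime t" "t \<noteq> p" "t \<noteq> r" and x: "x \<in> A"
      and fpf: "\<And>v. v \<in> carrier V \<Longrightarrow> act d v = v \<Longrightarrow> v = \<one>\<^bsub>V\<^esub>" for d t x
  proof -
    have xc: "x \<in> carrier K" using x Ac by blast
    let ?w = "inv\<^bsub>K\<^esub> x \<otimes>\<^bsub>K\<^esub> K.cnj d x"
    have "?w \<in> A" using x A(1) invA[OF d(1)]
      by (simp add: K.invariant_def subgroup.m_closed subgroup.m_inv_closed)
    moreover have "act ?w v = v" if "v \<in> carrier V" for v
      using commutator_acts_trivially[OF A(1) fA ab d(1-3) invA[OF d(1)] ndA[OF d(3,4)] copA fpf x that] .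
    ultimately have "?w = \<one>\<^bsub>K\<^esub>" by (rule faith)
    then have "x \<otimes>\<^bsub>K\<^esub> ?w = x" using xc by simp
    then have "K.cnj d x = x" using xc d(1) by simp
    then show ?thesis using K.cnj_eq_iff d(1) xc by blast
  qed
  have pair_fix_A: "x = \<one>\<^bsub>K\<^esub>"
    if "g \<in> carrier K" "h \<in> carrier K" "K.commutes g h" "K.ord g = t" "K.ord h = u" "prime t" "prime u"
      "t \<noteq> p" "u \<noteq> p" "t \<noteq> u" "x \<in> A" "K.commutes g x" "K.commutes h x" for g h t u x
    using K.triple_commuting[of g h x t u p] that oA p Ac by (metis subsetD)
  \<comment> \<open>It is enough that \<open>a\<close> acts without fixed points on
    \<open>V\<close>. Suppose \<open>a\<close> fixes a nontrivial \<open>v\<close>. On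
    \<open>D\<close>, the centraliser of \<open>a\<close> in \<open>A\<close>, the element
    \<open>b\<close> has no fixed points, and norms along \<open>b\<close> of translates of
    \<open>v\<close> under \<open>D\<close> are fixed by \<open>a\<close> and \<open>b\<close>,
    hence trivial. Averaging makes \<open>D\<close> fix \<open>v\<close>, so \<open>a\<close> and
    \<open>x0\<close>, of orders \<open>t\<close> and \<open>p\<close>, both fix
    \<open>v\<close>.\<close>
  have one_central: "\<forall>x\<in>A. K.commutes a x"
    if gh: "a \<in> carrier K" "b \<in> carrier K" "K.commutes a b" "K.ord a = t" "K.ord b = u" "prime t" "prime u"
      "t \<noteq> p" "u \<noteq> p" "t \<noteq> u" "t \<noteq> r" "u \<noteq> r" and D: "x0 \<in> A" "x0 \<noteq> \<one>\<^bsub>K\<^esub>" "K.commutes a x0" for a b t u x0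
  proof -
    define D where "D = A \<inter> K.cent {a}"
    have Ds: "subgroup D K" unfolding D_def using A(1) K.cent_subgroup[of "{a}"] gh(1) by (intro K.subgroups_Inter_pair) auto
    have DA: "D \<subseteq> A" by (auto simp: D_def)
    have Dcom: "K.commutes a x" if "x \<in> D" for x using that by (auto simp: D_def K.cent_def intro: K.commutes_sym)
    have bD: "x = \<one>\<^bsub>K\<^esub>" if "x \<in> D" "K.commutes b x" for x
      using pair_fix_A[OF gh(1-10)] that DA Dcom by blast
    have Dinv: "K.invariant {b} D"
    proof -
      have "K.commutes (K.cnj b x) a" if "x \<in> D" for x
      proof -
        have "K.cnj b a = a" using K.cnj_eq_iff gh(1-3) K.commutes_sym by blast
        then show ?thesis
          using K.cnj_commutes_iff[of b x a] Dcom[OF that] gh that DA Ac by (metis K.commutes_sym subsetD)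
      qed
      then show ?thesis using A(2) gh(2) Ac DA
        by (auto simp: K.invariant_def D_def K.cent_def)
    qed
    have "v = \<one>\<^bsub>V\<^esub>" if v: "v \<in> carrier V" "act a v = v" for v
    proof (rule ccontr)
      assume v1: "v \<noteq> \<one>\<^bsub>V\<^esub>"
      have bu: "b [^]\<^bsub>K\<^esub> u = \<one>\<^bsub>K\<^esub>" using gh(2,5) by auto
      have "act x v = v" if x: "x \<in> D" for x
      proof (rule frobenius_average[OF Ds _ gh(2) bu _ Dinv _ v(1) _ cop_sub[OF Ds DA] x])
        show "finite D" using Ds by simp
        show "0 < u" using gh(7) prime_gt_0_nat by blast
        show "z = \<one>\<^bsub>K\<^esub>" if jz: "0 < j" "j < u" "z \<in> D" "K.commutes (b [^]\<^bsub>K\<^esub> j) z" for j z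
        proof -
          have "b [^]\<^bsub>K\<^esub> j \<noteq> \<one>\<^bsub>K\<^esub>" using jz gh(2,5) K.pow_eq_id by (metis dvd_imp_le leD)
          then obtain k :: nat where k: "(b [^]\<^bsub>K\<^esub> j) [^]\<^bsub>K\<^esub> k = b"
            using K.prime_ord_pow_eq(2)[OF gh(7,5,2)] by blast
          have zc: "z \<in> carrier K" using jz DA Ac by blast
          have "K.commutes z ((b [^]\<^bsub>K\<^esub> j) [^]\<^bsub>K\<^esub> k)"
            using jz(4) gh(2) zc by (intro K.commutes_pow K.commutes_sym[OF jz(4)]) auto
          then show ?thesis using bD[OF jz(3)] k K.commutes_sym by metis
        qed
        show "nrm b u (act z v) = \<one>\<^bsub>V\<^esub>" if z: "z \<in> D" for z
        proof -
          have zc: "z \<in> carrier K" using z DA Ac by blast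
          have zv: "act z v \<in> carrier V" using zc v by simp
          let ?w = "nrm b u (act z v)"
          have "act b ?w = ?w" using nrm_fixed[OF gh(2) bu zv] .
          moreover have "act a ?w = ?w"
          proof -
            have "act a ?w = nrm b u (act a (act z v))" using act_nrm[OF gh(1,2) zv gh(3)] .
            also have "act a (act z v) = act z v" using act_swap[OF Dcom[OF z] gh(1) zc v(1)] v(2) by simp
            finally show ?thesis .
          qed
          ultimately show ?thesis
            using fixed_commuting[OF gh(1-7,11,12,10), of ?w] gh(2) zv by simp
        qed
      qed
      moreover have "x0 \<in> D" using D Ac by (auto simp: D_def K.cent_def intro: K.commutes_sym)
      ultimately have "act x0 v = v" by blast
      then show False
        using fixed_commuting[OF gh(1) _ D(3) gh(4) oA[OF D(1,2)] gh(6) p(1) gh(11) p(2) gh(8) v(1,2)] D Ac v1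
        by blast
    qed
    then show ?thesis using centralises[OF gh(1,4,6,8,11)] by blast
  qed
  \<comment> \<open>Split \<open>y0\<close> into its commuting parts of orders \<open>q\<close> and
    \<open>s\<close>. If one of them has a nontrivial fixed point in \<open>A\<close>, it
    centralises \<open>A\<close>, and then the other has none.\<close>
  have "\<exists>a b t. a \<in> carrier K \<and> b \<in> carrier K \<and> K.commutes a b \<and> K.ord a = t \<and> prime t \<and> t \<noteq> p \<and> t \<noteq> r
      \<and> (\<forall>x\<in>A. K.commutes a x) \<and> (\<forall>x\<in>A. K.commutes b x \<longrightarrow> x = \<one>\<^bsub>K\<^esub>)"
  proof -
    define a where "a = y0 [^]\<^bsub>K\<^esub> s"
    define b where "b = y0 [^]\<^bsub>K\<^esub> q"
    have pos: "0 < q" "0 < s" using q(1) s(1) prime_gt_0_nat by blast+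
    have a: "a \<in> carrier K" "K.ord a = q"
      using K.ord_pow[OF y0(1), of s] y0 pos by (simp_all add: a_def)
    have b: "b \<in> carrier K" "K.ord b = s"
      using K.ord_pow[OF y0(1), of q] y0 pos by (simp_all add: b_def)
    have cab: "K.commutes a b" unfolding a_def b_def using y0(1) by (intro K.commutes_pow2) auto
    have bfpf: "\<forall>x\<in>A. K.commutes b x \<longrightarrow> x = \<one>\<^bsub>K\<^esub>" if "\<forall>x\<in>A. K.commutes a x"
      using pair_fix_A[OF a(1) b(1) cab a(2) b(2) q(1) s(1) q(2) s(2) s(4)[symmetric]] that by blast
    have afpf: "\<forall>x\<in>A. K.commutes a x \<longrightarrow> x = \<one>\<^bsub>K\<^esub>" if "\<forall>x\<in>A. K.commutes b x"
      using pair_fix_A[OF a(1) b(1) cab a(2) b(2) q(1) s(1) q(2) s(2) s(4)[symmetric]] that by blast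
    show ?thesis
    proof (cases "\<exists>x\<in>A. x \<noteq> \<one>\<^bsub>K\<^esub> \<and> K.commutes a x")
      case True
      then have "\<forall>x\<in>A. K.commutes a x"
        using one_central[OF a(1) b(1) cab a(2) b(2) q(1) s(1) q(2) s(2) s(4)[symmetric] q(3) s(3)] by blast
      then show ?thesis using a b cab bfpf q by blast
    next
      case na: False
      show ?thesis
      proof (cases "\<exists>x\<in>A. x \<noteq> \<one>\<^bsub>K\<^esub> \<and> K.commutes b x")
        case True
        then have "\<forall>x\<in>A. K.commutes b x"
          using one_central[OF b(1) a(1) K.commutes_sym[OF cab] b(2) a(2) s(1) q(1) s(2) q(2) s(4) s(3) q(3)] by blast
        then show ?thesis using a b cab afpf s K.commutes_sym by blast
      next
        case nb: False
        have yn: "y0 [^]\<^bsub>K\<^esub> (q * s) = \<one>\<^bsub>K\<^esub>" using y0 K.pow_ord_eq_1 by metis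
        \<comment> \<open>If neither part has fixed points in \<open>A\<close>, then no nontrivial
          power of \<open>y0\<close> has any. Norms along all \<open>q * s\<close> powers are fixed
          by \<open>y0\<close>, whose order has two prime divisors, and so vanish; averaging makes
          \<open>A\<close> act trivially, against faithfulness.\<close>
        have "act x v = v" if x: "x \<in> A" and v: "v \<in> carrier V" for x v
        proof (rule frobenius_average[OF A(1) fA y0(1) yn _ invA[OF y0(1)] _ v _ copA x])
          show "0 < q * s" using pos by simp
          show "z = \<one>\<^bsub>K\<^esub>" if jz: "0 < j" "j < q * s" "z \<in> A" "K.commutes (y0 [^]\<^bsub>K\<^esub> j) z" for j z
          proof -
            have zc: "z \<in> carrier K" using jz Ac by blast
            have nd: "\<not> q * s dvd j" using jz by (metis dvd_imp_le leD)
            have com: "K.commutes z (y0 [^]\<^bsub>K\<^esub> (j * m))" for m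
            proof -
              have "K.commutes z ((y0 [^]\<^bsub>K\<^esub> j) [^]\<^bsub>K\<^esub> m)"
                using jz zc y0 by (intro K.commutes_pow K.commutes_sym[OF jz(4)]) auto
              then show ?thesis using y0(1) by (simp add: K.nat_pow_pow)
            qed
            have "\<not> q dvd j \<or> \<not> s dvd j"
              using nd q(1) s(1,4) primes_coprime[of q s] divides_mult by blast
            then show ?thesis
            proof
              assume "\<not> q dvd j"
              then have "a [^]\<^bsub>K\<^esub> j \<noteq> \<one>\<^bsub>K\<^esub>" using a K.pow_eq_id by metis
              then obtain k :: nat where k: "(a [^]\<^bsub>K\<^esub> j) [^]\<^bsub>K\<^esub> k = a"
                using K.prime_ord_pow_eq(2)[OF q(1) a(2,1)] by blast
              have "(a [^]\<^bsub>K\<^esub> j) [^]\<^bsub>K\<^esub> k = y0 [^]\<^bsub>K\<^esub> (j * (s * k))"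
                using y0(1) by (simp add: a_def K.nat_pow_pow ac_simps)
              then have "K.commutes z a" using com[of "s * k"] k by simp
              then show ?thesis using na jz(3) K.commutes_sym by blast
            next
              assume "\<not> s dvd j"
              then have "b [^]\<^bsub>K\<^esub> j \<noteq> \<one>\<^bsub>K\<^esub>" using b K.pow_eq_id by metis
              then obtain k :: nat where k: "(b [^]\<^bsub>K\<^esub> j) [^]\<^bsub>K\<^esub> k = b"
                using K.prime_ord_pow_eq(2)[OF s(1) b(2,1)] by blast
              have "(b [^]\<^bsub>K\<^esub> j) [^]\<^bsub>K\<^esub> k = y0 [^]\<^bsub>K\<^esub> (j * (q * k))"
                using y0(1) by (simp add: b_def K.nat_pow_pow ac_simps)
              then have "K.commutes z b" using com[of "q * k"] k by simp
              then show ?thesis using nb jz(3) K.commutes_sym by blast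
            qed
          qed
          show "nrm y0 (q * s) (act z v) = \<one>\<^bsub>V\<^esub>" if z: "z \<in> A" for z
          proof (rule ccontr)
            assume "nrm y0 (q * s) (act z v) \<noteq> \<one>\<^bsub>V\<^esub>"
            moreover have "act y0 (nrm y0 (q * s) (act z v)) = nrm y0 (q * s) (act z v)"
              using nrm_fixed[OF y0(1) yn] z Ac v by (metis act_closed subsetD)
            moreover have "nrm y0 (q * s) (act z v) \<in> carrier V" using y0(1) z Ac v by auto
            ultimately show False
              using fixed_prime_power[OF y0(1) _ _ _ q(1) s(1) q(3) s(3) s(4)[symmetric]] y0(2) by simp
          qed
        qed
        then have "a0 = \<one>\<^bsub>K\<^esub>" using faith a0 by blast
        then show ?thesis using a0 by blast
      qed
    qed
  qed
  then obtain a b t0 where abt: "a \<in> carrier K" "b \<in> carrier K" "K.commutes a b" "K.ord a = t0" "prime t0" "t0 \<noteq> p" "t0 \<noteq> r"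
      "\<forall>x\<in>A. K.commutes a x" and bA: "\<And>x. x \<in> A \<Longrightarrow> K.commutes b x \<Longrightarrow> x = \<one>\<^bsub>K\<^esub>" by blast
  have a0c: "a0 \<in> carrier K" using a0 Ac by blast
  have oa0: "K.ord a0 = p" using oA a0 by blast
  obtain a1 where a1: "a1 \<in> A" "K.indep p a0 a1"
  proof -
    \<comment> \<open>If \<open>a0\<close> generated \<open>A\<close>, the arithmetic condition
      would force \<open>b\<close> to centralise it.\<close>
    have "\<exists>a1\<in>A. \<forall>i::nat. a1 \<noteq> a0 [^]\<^bsub>K\<^esub> i"
    proof (rule ccontr)
      assume "\<not> ?thesis"
      then obtain k :: nat where k: "K.cnj b a0 = a0 [^]\<^bsub>K\<^esub> k"
        using invA[OF abt(2)] a0 by (auto simp: K.invariant_def)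
      have "K.cnj b a0 \<otimes>\<^bsub>K\<^esub> inv\<^bsub>K\<^esub> a0 \<in> {\<one>\<^bsub>K\<^esub>}"
        by (rule K.cyclic_section_central[OF K.triv_subgroup _ abt(2) a0c _ oa0 p(1), where k = k])
          (use a0 k a0c abt(2) in \<open>auto simp: K.invariant_def\<close>)
      then have "K.cnj b a0 = a0" using a0c abt(2) by (metis K.cnj_closed K.inv_closed K.inv_equality K.inv_inv singletonD)
      then have "K.commutes b a0" using K.cnj_eq_iff abt(2) a0c by blast
      then show False using bA a0 by blast
    qed
    then obtain a1 where a1: "a1 \<in> A" "\<And>i::nat. a1 \<noteq> a0 [^]\<^bsub>K\<^esub> i" by blast
    then have "a1 \<noteq> \<one>\<^bsub>K\<^esub>" by (metis K.nat_pow_0)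
    then have "K.indep p a0 a1" using a1 oA a0 oa0 a0c ab Ac by (auto simp: K.indep_def)
    then show thesis using that a1 by blast
  qed
  define C where "C = K.cent A"
  have Cs: "subgroup C K" unfolding C_def using Ac by (rule K.cent_subgroup)
  have Cc: "C \<subseteq> carrier K" using Cs subgroup.subset by blast
  have Ci: "K.invariant (carrier K) C" unfolding C_def using Ac A(2) by (rule K.invariant_cent)
  have Ccom: "K.commutes c x" if "c \<in> C" "x \<in> A" for c x using that by (auto simp: C_def K.cent_def)
  \<comment> \<open>An independent pair of \<open>A\<close> commutes with \<open>c\<close>, so
    averaging a fixed point of \<open>c\<close> over it leaves a vector fixed by \<open>c\<close>
    and by an element of order \<open>p\<close>.\<close>
  have C_fpf: "v = \<one>\<^bsub>V\<^esub>"
    if c: "c \<in> C" "K.ord c = t" "prime t" "t \<noteq> p" "t \<noteq> r" and v: "v \<in> carrier V" "act c v = v" for c t v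
  proof (rule ccontr)
    assume v1: "v \<noteq> \<one>\<^bsub>V\<^esub>"
    have cc: "c \<in> carrier K" using c Cc by blast
    obtain e w where ew: "e = a1 \<or> (\<exists>i::nat. e = a0 \<otimes>\<^bsub>K\<^esub> a1 [^]\<^bsub>K\<^esub> i)" "e \<in> carrier K" "K.ord e = p"
        "w \<in> carrier V" "w \<noteq> \<one>\<^bsub>V\<^esub>" "act e w = w" "act c w = w"
      using noncyclic_fixes[OF p a1(2) v(1) v1] cc Ccom[OF c(1)] a0(1) a1(1) v(2) by blast
    have "e \<in> A" using ew(1) a0 a1 A(1) by (auto intro: subgroup.m_closed K.subgroup_pow)
    then show False
      using fixed_commuting[OF cc ew(2) Ccom[OF c(1)] c(2) ew(3) c(3) p(1) c(5) p(2) c(4) ew(4,7,6)] ew(5) by blast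
  qed
  have aC: "a \<in> C" using abt by (auto simp: C_def K.cent_def)
  have vC: "prime t0" "t0 dvd card C" "t0 \<notin> {p, r}"
    using abt K.ord_dvd_card[OF Cs aC] by auto
  have one_inv: "K.invariant (carrier K) {\<one>\<^bsub>K\<^esub>}" by (simp add: K.invariant_one)
  have one_sub: "{\<one>\<^bsub>K\<^esub>} \<subseteq> C" using Cs subgroup.one_closed by blast
  obtain X Y t where X: "subgroup X K" "K.invariant (carrier K) X" "X \<subset> Y" and Y: "subgroup Y K"
    "K.invariant (carrier K) Y" "Y \<subseteq> C" and Xp: "\<And>u. prime u \<Longrightarrow> u dvd card X \<Longrightarrow> u \<in> {p, r}"
    and t: "prime t" "t \<notin> {p, r}"
    and exY: "\<And>x. x \<in> Y \<Longrightarrow> x [^]\<^bsub>K\<^esub> t \<in> X"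
    and coY: "\<And>x y. x \<in> Y \<Longrightarrow> y \<in> Y \<Longrightarrow> K.cnj x y \<otimes>\<^bsub>K\<^esub> inv\<^bsub>K\<^esub> y \<in> X"
    by (rule K.chief_factor_above[OF K.solv subset_refl Cc Cs Ci vC K.triv_subgroup one_inv one_sub]) auto
  have Yc: "Y \<subseteq> carrier K" using Y subgroup.subset by blast
  have tX: "\<not> t dvd card X" using Xp t by blast
  have invX: "K.invariant S X" if "S \<subseteq> carrier K" for S using X(2) that by (rule K.invariant_mono)
  obtain v0 where v0: "v0 \<in> carrier V" "v0 \<noteq> \<one>\<^bsub>V\<^esub>" using nontriv V.one_closed by blast
  \<comment> \<open>An independent pair in \<open>Y\<close> would contain an element of order
    \<open>t\<close> with a fixed point on \<open>V\<close>, contrary to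
    \<open>C_fpf\<close>.\<close>
  have "\<not> (\<exists>x\<in>Y. \<exists>y\<in>Y. K.indep t x y)"
  proof
    assume "\<exists>x\<in>Y. \<exists>y\<in>Y. K.indep t x y"
    then obtain x y where xy: "x \<in> Y" "y \<in> Y" "K.indep t x y" by blast
    obtain e w where ew: "e = y \<or> (\<exists>i::nat. e = x \<otimes>\<^bsub>K\<^esub> y [^]\<^bsub>K\<^esub> i)" "e \<in> carrier K" "K.ord e = t"
        "w \<in> carrier V" "w \<noteq> \<one>\<^bsub>V\<^esub>" "act e w = w"
      using noncyclic_fixes[OF t(1) _ xy(3) v0] t(2) by blast
    have "e \<in> C" using ew(1) xy Y by (auto intro: subgroup.m_closed K.subgroup_pow)
    then show False using C_fpf[OF _ ew(3) t(1) _ _ ew(4,6)] t(2) ew(5) by blast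
  qed
  then obtain e where e: "e \<in> Y" "K.ord e = t" "e \<notin> X" and eY: "\<And>g. g \<in> Y \<Longrightarrow> \<exists>i::nat. g \<otimes>\<^bsub>K\<^esub> inv\<^bsub>K\<^esub> (e [^]\<^bsub>K\<^esub> i) \<in> X"
    using K.elementary_quotient[OF X(1) Y(1) _ _ invX[OF Yc] t(1) tX exY coY] X(3) by blast
  have ec: "e \<in> carrier K" using e Yc by blast
  have central: "K.cnj g e \<otimes>\<^bsub>K\<^esub> inv\<^bsub>K\<^esub> e \<in> X" if g: "g \<in> carrier K" for g
  proof -
    have "K.cnj g e \<in> Y" using Y(2) g e by (simp add: K.invariant_def)
    then obtain k :: nat where "K.cnj g e \<otimes>\<^bsub>K\<^esub> inv\<^bsub>K\<^esub> (e [^]\<^bsub>K\<^esub> k) \<in> X" using eY by blast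
    then show ?thesis using K.cyclic_section_central[OF X(1) invX g ec e(3,2) t(1)] ec g by blast
  qed
  \<comment> \<open>One of the two primes differs from \<open>t\<close>; this is why two of them are
    supplied.\<close>
  obtain u where u: "u \<in> {q, s}" "u \<noteq> t" using s(4) by blast
  have up: "prime u" "u \<noteq> p" "u \<noteq> r" using u q s by auto
  have uX: "\<not> u dvd card X" using Xp up by blast
  obtain d where d: "d \<in> carrier K" "K.ord d = u" and dalt: "(\<forall>v\<in>carrier V. act d v = v \<longrightarrow> v = \<one>\<^bsub>V\<^esub>) \<or>
      (\<exists>c\<in>carrier K. K.ord c = p \<and> K.commutes d c)" using edge[OF u(1)] by blast
  obtain f where f: "f \<in> carrier K" "K.ord f = t" "K.commutes d f" "f \<otimes>\<^bsub>K\<^esub> inv\<^bsub>K\<^esub> e \<in> X" "f \<notin> X"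
    using K.lift_commutes_prime[OF X(1) invX d up(1) uX ec e(3) exY[OF e(1)] t(1) tX central[OF d(1)]] d ec by auto
  have fY: "f \<in> Y"
  proof -
    have "f \<otimes>\<^bsub>K\<^esub> inv\<^bsub>K\<^esub> e \<otimes>\<^bsub>K\<^esub> e \<in> Y" using f(4) e X Y by (meson psubset_imp_subset subgroup.m_closed subsetD)
    then show ?thesis using f ec by (simp add: K.m_assoc)
  qed
  have fC: "f \<in> C" using fY Y by blast
  have tp: "t \<noteq> p" "t \<noteq> r" using t by auto
  obtain x1 where x1: "x1 \<in> A" "\<not> K.commutes d x1"
  proof -
    have "\<not> (\<forall>x\<in>A. K.commutes d x)"
    proof
      assume "\<forall>x\<in>A. K.commutes d x"
      then have "a0 = \<one>\<^bsub>K\<^esub>"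
        using pair_fix_A[OF d(1) f(1,3) d(2) f(2) up(1) t(1) up(2) tp(1) u(2) a0(1)] a0(1) Ccom[OF fC] by blast
      then show False using a0 by blast
    qed
    then show thesis using that by blast
  qed
  then have "\<not> (\<forall>v\<in>carrier V. act d v = v \<longrightarrow> v = \<one>\<^bsub>V\<^esub>)"
    using centralises[OF d up x1(1)] by blast
  then obtain v1 c where v1: "v1 \<in> carrier V" "act d v1 = v1" "v1 \<noteq> \<one>\<^bsub>V\<^esub>"
    and c: "c \<in> carrier K" "K.ord c = p" "K.commutes d c" using dalt by blast
  \<comment> \<open>Outside \<open>X\<close> the elements \<open>d\<close>, \<open>c\<close>,
    \<open>e\<close> would commute pairwise modulo \<open>X\<close>.\<close>
  have cX: "c \<in> X"
  proof (rule ccontr)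
    assume cX: "c \<notin> X"
    have dX: "d \<notin> X" using K.ord_dvd_card[OF X(1), of d] d(2) uX by blast
    show False
      using K.triple_modulo[OF X(1,2) d(1) c(1) ec dX cX e(3) d(2) c(2) e(2) up(1) p(1) t(1) up(2) u(2) tp(1)[symmetric]
          K.commutes_imp_mem[OF X(1) d(1) c(1,3)] central[OF d(1)] central[OF c(1)]] .
  qed
  \<comment> \<open>The remaining work takes place in the centraliser of \<open>d\<close>. The
    lowest \<open>p\<close>-factor of \<open>W\<close> under \<open>U\<close> is cyclic, since an
    independent pair would fix, together with \<open>d\<close>, a nontrivial vector. So
    \<open>f\<close> centralises it, and lifting yields an element of order \<open>p\<close>
    commuting with both \<open>d\<close> and \<open>f\<close>.\<close>
  define U where "U = K.cent {d} \<inter> Y"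
  define W where "W = K.cent {d} \<inter> X"
  have cd: "subgroup (K.cent {d}) K" using d(1) by (intro K.cent_subgroup) auto
  have Us: "subgroup U K" unfolding U_def using cd Y(1) by (rule K.subgroups_Inter_pair)
  have Ws: "subgroup W K" unfolding W_def using cd X(1) by (rule K.subgroups_Inter_pair)
  have Uc: "U \<subseteq> carrier K" using Us subgroup.subset by blast
  have WU: "W \<subseteq> U" using X(3) by (auto simp: W_def U_def)
  have Wi: "K.invariant U W"
  proof -
    have "K.invariant (K.cent {d}) (K.cent {d})" using K.invariant_self[OF cd] .
    then have "K.invariant U (K.cent {d})" by (rule K.invariant_mono) (auto simp: U_def)
    then show ?thesis unfolding W_def using invX[OF Uc] by (rule K.invariant_Int)
  qed
  have cW: "c \<in> W" using c cX by (auto simp: W_def K.cent_def intro: K.commutes_sym)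
  have fU: "f \<in> U" using f fY by (auto simp: U_def K.cent_def intro: K.commutes_sym)
  have Wd: "K.commutes x d" if "x \<in> W" for x using that by (auto simp: W_def K.cent_def)
  have pW: "prime p" "p dvd card W" "p \<notin> {u. u \<noteq> p}" using p K.ord_dvd_card[OF Ws cW] c(2) by auto
  have one_U: "K.invariant U {\<one>\<^bsub>K\<^esub>}" using Uc by (rule K.invariant_one)
  have one_W: "{\<one>\<^bsub>K\<^esub>} \<subseteq> W" using Ws subgroup.one_closed by blast
  obtain N1 N2 p' where N: "subgroup N1 K" "K.invariant U N1" "N1 \<subset> N2" "subgroup N2 K" "K.invariant U N2" "N2 \<subseteq> W"
    and N1p: "\<And>u. prime u \<Longrightarrow> u dvd card N1 \<Longrightarrow> u \<in> {u. u \<noteq> p}" and p': "prime p'" "p' \<notin> {u. u \<noteq> p}"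
    and exN: "\<And>x. x \<in> N2 \<Longrightarrow> x [^]\<^bsub>K\<^esub> p' \<in> N1"
    and coN: "\<And>x y. x \<in> N2 \<Longrightarrow> y \<in> N2 \<Longrightarrow> K.cnj x y \<otimes>\<^bsub>K\<^esub> inv\<^bsub>K\<^esub> y \<in> N1"
    by (rule K.chief_factor_above[OF K.solv Uc WU Ws Wi pW K.triv_subgroup one_U one_W]) auto
  have pp: "p' = p" using p' by simp
  have pN1: "\<not> p dvd card N1" using N1p p(1) by blast
  have N2U: "N2 \<subseteq> U" using N(6) WU by blast
  have N12: "K.invariant N2 N1" using N(2) N2U by (rule K.invariant_mono)
  have "\<not> (\<exists>x\<in>N2. \<exists>y\<in>N2. K.indep p x y)"
  proof
    assume "\<exists>x\<in>N2. \<exists>y\<in>N2. K.indep p x y"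
    then obtain x y where xy: "x \<in> N2" "y \<in> N2" "K.indep p x y" by blast
    have dxy: "K.commutes d x" "K.commutes d y" using Wd xy N(6) K.commutes_sym by blast+
    obtain g w where gw: "g = y \<or> (\<exists>i::nat. g = x \<otimes>\<^bsub>K\<^esub> y [^]\<^bsub>K\<^esub> i)" "g \<in> carrier K" "K.ord g = p"
        "w \<in> carrier V" "w \<noteq> \<one>\<^bsub>V\<^esub>" "act g w = w" "act d w = w"
      using noncyclic_fixes[OF p xy(3) v1(1,3)] d(1) v1(2) dxy by blast
    have "g \<in> N2" using gw(1) xy N(4) by (auto intro: subgroup.m_closed K.subgroup_pow)
    then have "K.commutes g d" using Wd N(6) by blast
    then show False
      using fixed_commuting[OF gw(2) d(1) _ gw(3) d(2) p(1) up(1) p(2) up(3) up(2)[symmetric] gw(4,6,7)] gw(5) by blast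
  qed
  then obtain g where g: "g \<in> N2" "K.ord g = p" "g \<notin> N1" and gN: "\<And>h. h \<in> N2 \<Longrightarrow> \<exists>i::nat. h \<otimes>\<^bsub>K\<^esub> inv\<^bsub>K\<^esub> (g [^]\<^bsub>K\<^esub> i) \<in> N1"
    using K.elementary_quotient[OF N(1,4) _ _ N12 p(1) pN1 exN[unfolded pp] coN] N(3) by blast
  have gc: "g \<in> carrier K" using g N2U Uc by blast
  have "K.cnj f g \<in> N2" using N(5) fU g by (simp add: K.invariant_def)
  then obtain k :: nat where k: "K.cnj f g \<otimes>\<^bsub>K\<^esub> inv\<^bsub>K\<^esub> (g [^]\<^bsub>K\<^esub> k) \<in> N1" using gN by blast
  have ifg: "K.invariant {g, f} N1" "K.invariant {f, g} N1" using N(2) fU g N2U by (auto intro: K.invariant_mono)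
  have tN1: "\<not> t dvd card N1"
  proof
    assume "t dvd card N1"
    moreover have "N1 \<subseteq> X" using N(3,6) by (auto simp: W_def)
    ultimately show False using K.card_subgroup_dvd[OF N(1) X(1)] tX dvd_trans by blast
  qed
  have "K.cnj f g \<otimes>\<^bsub>K\<^esub> inv\<^bsub>K\<^esub> g \<in> N1"
    using K.cyclic_section_central[OF N(1) ifg(1) f(1) gc g(3,2) p(1) k] .
  then obtain z where z: "z \<in> carrier K" "K.ord z = p" "K.commutes f z" "z \<otimes>\<^bsub>K\<^esub> inv\<^bsub>K\<^esub> g \<in> N1"
    using K.lift_commutes_prime[OF N(1) ifg(2) f(1,2) t(1) tN1 gc g(3) exN[OF g(1), unfolded pp] p(1) pN1] by blast
  have "z \<in> N2"
  proof -
    have "z \<otimes>\<^bsub>K\<^esub> inv\<^bsub>K\<^esub> g \<otimes>\<^bsub>K\<^esub> g \<in> N2" using z(4) g N by (meson psubset_imp_subset subgroup.m_closed subsetD)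
    then show ?thesis using z gc by (simp add: K.m_assoc)
  qed
  then have "K.commutes d z" using Wd N(6) K.commutes_sym by blast
  then show False
    using K.triple_commuting[OF d(1) f(1) z(1) d(2) f(2) z(2) up(1) t(1) p(1) u(2) up(2) tp(1) f(3) _ z(3)] by blast
qed

end

section \<open>Chief factors over the radicals\<close>

context fin_group
begin

text \<open>The choice dual to \<open>chief_factor\<close>: the elementary abelian factor sits at
  the top of \<open>W\<close>.\<close>

lemma maximal_invariant_below:
  assumes solv: "solvable G" and U: "U \<subseteq> carrier G" "W \<subseteq> U"
    and W: "subgroup W G" "invariant U W" "W \<noteq> {\<one>}"
  obtains D t where "subgroup D G" "invariant U D" "D \<subset> W" "prime (t::nat)"
    "\<And>x. x \<in> W \<Longrightarrow> x [^] t \<in> D" "\<And>x y. x \<in> W \<Longrightarrow> y \<in> W \<Longrightarrow> cnj x y \<otimes> inv y \<in> D"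
    "\<And>N. subgroup N G \<Longrightarrow> invariant U N \<Longrightarrow> D \<subseteq> N \<Longrightarrow> N \<subseteq> W \<Longrightarrow> N = D \<or> N = W"
proof -
  let ?P = "\<lambda>N. subgroup N G \<and> invariant U N \<and> N \<subset> W"
  have "?P {\<one>}" using W triv_subgroup subgroup.one_closed[OF W(1)] U by (auto simp: invariant_one)
  moreover have "\<forall>N. ?P N \<longrightarrow> card N < Suc (card W)"
    using finite_subgroup[OF W(1)] card_mono by (metis less_Suc_eq_le psubset_imp_subset)
  ultimately obtain D where D: "?P D" and greatest: "\<And>N. ?P N \<Longrightarrow> card N \<le> card D"
    using ex_has_greatest_nat[of ?P "{\<one>}" card "Suc (card W)"] by blast
  have maxi: "N = D \<or> N = W" if "subgroup N G" "invariant U N" "D \<subseteq> N" "N \<subseteq> W" for N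
  proof (rule ccontr)
    assume c: "\<not> (N = D \<or> N = W)"
    then have "?P N" using that by blast
    then have "card N \<le> card D" by (rule greatest)
    then show False using c that finite_subgroup[OF that(1)] by (metis card_seteq)
  qed
  have sD: "subgroup D G" and iD: "invariant U D" and DW: "D \<subset> W" using D by auto
  show thesis
  proof (rule chief_factor[OF solv U sD iD W(1,2) DW])
    fix N t assume N: "subgroup N G" "invariant U N" "D \<subset> N" "N \<subseteq> W" "prime (t::nat)"
      and e: "\<And>x. x \<in> N \<Longrightarrow> x [^] t \<in> D" and c: "\<And>x y. x \<in> N \<Longrightarrow> y \<in> N \<Longrightarrow> cnj x y \<otimes> inv y \<in> D"
    have "N = W" using maxi[OF N(1,2)] N(3,4) by blast
    then show thesis using that[OF sD iD DW N(5)] e c maxi by blast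
  qed
qed

lemma p_element_power:
  assumes H: "subgroup H G" "card H = r ^ i" "prime r" and v: "v \<in> H" "v \<noteq> \<one>"
  shows "\<exists>m::nat. ord (v [^] m) = r"
proof -
  have vc: "v \<in> carrier G" using H(1) v subgroup.mem_carrier by metis
  have "ord v dvd r ^ i" using ord_dvd_card[OF H(1) v(1)] H(2) by simp
  moreover have "ord v \<noteq> 1" using v vc ord_eq_1 by blast
  ultimately have "r dvd ord v" using H(3) by (metis divides_primepow_nat dvd_power power_0 not_gr_zero)
  then show ?thesis using ord_pow_div[OF vc H(3)] by blast
qed

lemma cnj_section_pow:
  assumes V2: "subgroup V2 G" "invariant {g} V2" and g: "g \<in> carrier G" and v: "v \<in> carrier G"
    and f: "cnj g v \<otimes> inv v \<in> V2"
  shows "cnj (g [^] (n::nat)) v \<otimes> inv v \<in> V2"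
proof (induction n)
  case 0
  then show ?case using v V2(1) subgroup.one_closed by force
next
  case (Suc n)
  have "cnj (g [^] Suc n) v = cnj g (cnj (g [^] n) v)"
    using g v by (metis cnj_cnj nat_pow_Suc2 nat_pow_closed)
  also have "\<dots> \<otimes> inv v = cnj g (cnj (g [^] n) v \<otimes> inv v) \<otimes> (cnj g v \<otimes> inv v)"
    using g v by (simp add: cnj_mult cnj_inv m_assoc)
  finally show ?case using Suc f V2 by (simp add: invariant_def subgroup.m_closed)
qed

end

context good_group
begin

text \<open>A point fixed modulo \<open>V2\<close> is lifted twice: within \<open>V2 #> v\<close> to
  a point fixed by \<open>g1\<close>, then within \<open>V2 \<inter> cent {g1}\<close>, which
  \<open>g2\<close> normalises, to a point fixed by both. A power of it has order \<open>r\<close>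
  and completes a commuting triple.\<close>

lemma section_fixed_triple:
  assumes V: "subgroup V1 G" "subgroup V2 G" "V2 \<subseteq> V1" "card V1 = r ^ i" "prime r"
    and inv: "invariant (carrier G) V2" and v: "v \<in> V1" "v \<notin> V2"
    and g: "g \<in> carrier G" "cnj g v \<otimes> inv v \<in> V2"
    and tu: "prime t" "prime u" "t \<noteq> r" "u \<noteq> r" "t \<noteq> u" "t dvd ord g" "u dvd ord g"
  shows False
proof -
  have V1c: "V1 \<subseteq> carrier G" and V2c: "V2 \<subseteq> carrier G" using V subgroup.subset by blast+
  have vc: "v \<in> carrier G" using v V1c by blast
  define g1 where "g1 = g [^] (ord g div t)"
  define g2 where "g2 = g [^] (ord g div u)"
  have g1: "g1 \<in> carrier G" "ord g1 = t" and g2: "g2 \<in> carrier G" "ord g2 = u"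
    using ord_pow_div[OF g(1)] tu g by (simp_all add: g1_def g2_def)
  have c12: "commutes g1 g2" unfolding g1_def g2_def using g(1) by (intro commutes_pow2) auto
  have iv: "invariant {h} V2" if "h \<in> carrier G" for h using inv that by (auto intro: invariant_mono)
  have f1: "cnj g1 v \<otimes> inv v \<in> V2" and f2: "cnj g2 v \<otimes> inv v \<in> V2"
    unfolding g1_def g2_def using cnj_section_pow[OF V(2) iv[OF g(1)] g(1) vc g(2)] by blast+
  have nd: "\<not> l dvd card N" if "prime l" "l \<noteq> r" "subgroup N G" "N \<subseteq> V1" for l N
  proof
    assume "l dvd card N"
    moreover have "card N dvd r ^ i" using card_subgroup_dvd[OF that(3) V(1) that(4)] V(4) by simp
    ultimately have "l dvd r ^ i" by (rule dvd_trans)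
    then show False using that V(5) prime_dvd_power primes_dvd_imp_eq by blast
  qed
  obtain n where n: "n \<in> V2" "commutes g1 (n \<otimes> v)"
    using lift_commutes[OF V(2) iv[OF g1(1)] g1 tu(1) nd[OF tu(1,3) V(2,3)] vc f1] by blast
  define v1 where "v1 = n \<otimes> v"
  have nc: "n \<in> carrier G" using n V2c by blast
  have v1c: "v1 \<in> carrier G" using nc vc by (simp add: v1_def)
  have v1V: "v1 \<in> V1" using n v V by (auto simp: v1_def intro: subgroup.m_closed)
  have v1n: "v1 \<notin> V2"
  proof
    assume "v1 \<in> V2"
    then have "inv n \<otimes> v1 \<in> V2" using n V(2) by (simp add: subgroup.m_closed subgroup.m_inv_closed)
    then show False using nc vc v(2) by (simp add: v1_def)
  qed
  define N where "N = V2 \<inter> cent {g1}"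
  have Ns: "subgroup N G" unfolding N_def using V(2) cent_subgroup[of "{g1}"] g1 by (intro subgroups_Inter_pair) auto
  have NV: "N \<subseteq> V1" using V by (auto simp: N_def)
  have cg: "cnj g2 g1 = g1" using c12 g1 g2 cnj_eq_iff commutes_sym by blast
  have Ni: "invariant {g2} N"
  proof -
    have "commutes (cnj g2 x) g1" if "x \<in> N" for x
      using cnj_commutes_iff[OF g2(1) _ g1(1), of x] that V2c cg by (auto simp: N_def cent_def)
    then show ?thesis using inv g2(1) V2c by (auto simp: invariant_def N_def cent_def)
  qed
  have f: "cnj g2 v1 \<otimes> inv v1 \<in> N"
  proof -
    have "cnj g2 v1 \<otimes> inv v1 = cnj g2 n \<otimes> (cnj g2 v \<otimes> inv v) \<otimes> inv n"
      using nc vc g2 by (simp add: v1_def cnj_mult inv_mult_group m_assoc)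
    also have "\<dots> \<in> V2"
      using f2 n V(2) iv[OF g2(1)] by (simp add: invariant_def subgroup.m_closed subgroup.m_inv_closed)
    finally have in2: "cnj g2 v1 \<otimes> inv v1 \<in> V2" .
    have "commutes g1 (cnj g2 v1)"
      using cnj_commutes_iff[OF g2(1) g1(1) v1c] cg n(2) by (simp add: v1_def)
    then have "commutes g1 (cnj g2 v1 \<otimes> inv v1)"
      using n(2) g1 g2 v1c by (intro commutes_mult commutes_inv) (auto simp: v1_def)
    then show ?thesis using in2 V2c by (auto simp: N_def cent_def intro: commutes_sym)
  qed
  obtain m where m: "m \<in> N" "commutes g2 (m \<otimes> v1)"
    using lift_commutes[OF Ns Ni g2 tu(2) nd[OF tu(2,4) Ns NV] v1c f] by blast
  have mc: "m \<in> carrier G" using m Ns subgroup.mem_carrier by metis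
  define w where "w = m \<otimes> v1"
  have wV: "w \<in> V1" using m NV v1V V(1) by (auto simp: w_def intro: subgroup.m_closed)
  have wc: "w \<in> carrier G" using wV V1c by blast
  have w1: "commutes g1 w"
    using m n(2) g1 mc v1c unfolding w_def v1_def[symmetric] by (intro commutes_mult) (auto simp: N_def cent_def intro: commutes_sym)
  have wn: "w \<noteq> \<one>"
  proof
    assume "w = \<one>"
    then have "inv m \<otimes> w = inv m" using mc by simp
    then have "v1 = inv m" using mc v1c by (simp add: w_def)
    then show False using m v1n V(2) by (auto simp: N_def subgroup.m_inv_closed)
  qed
  obtain k :: nat where k: "ord (w [^] k) = r" using p_element_power[OF V(1,4,5) wV wn] by blast
  show False
    using triple_commuting[OF g1(1) g2(1) _ g1(2) g2(2) k tu(1,2) V(5) tu(5,3,4) c12]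
      commutes_pow[OF w1 g1(1) wc] commutes_pow[OF m(2)[folded w_def] g2(1) wc] wc by blast
qed

lemma quotient_ord_coprime:
  assumes N: "subgroup N G" "invariant (carrier G) N" and g: "g \<in> carrier G" "coprime (ord g) (card N)"
  shows "group.ord (G Mod N) (N #> g) = ord g"
proof -
  interpret Q: good_group "G Mod N" by (rule good_quotient(1)[OF N])
  interpret h: group_hom G "G Mod N" "\<lambda>x. N #> x" by (rule good_quotient(2)[OF N])
  have "Q.ord (N #> g) dvd ord g" using quotient_ord_dvd[OF good_quotient(2)[OF N] g(1)] .
  moreover have "ord g dvd Q.ord (N #> g)"
  proof -
    let ?n = "Q.ord (N #> g)"
    have "N #> (g [^] ?n) = \<one>\<^bsub>G Mod N\<^esub>"
      using h.hom_nat_pow[OF g(1), of ?n] Q.pow_ord_eq_1[of "N #> g"] h.hom_closed[OF g(1)] by simp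
    then have "g [^] ?n \<in> N" using rcoset_eq_self_iff[OF N(1)] g(1) by simp
    then have "ord (g [^] ?n) dvd card N" using ord_dvd_card[OF N(1)] by blast
    moreover have "ord (g [^] ?n) dvd ord g"
    proof -
      have "(g [^] ?n) [^] ord g = (g [^] ord g) [^] ?n" using g(1) by (metis mult.commute nat_pow_pow)
      then show ?thesis using g(1) pow_eq_id[of "g [^] ?n"] by simp
    qed
    ultimately have "ord (g [^] ?n) = 1" using g(2) by (metis coprime_common_divisor_nat)
    then have "g [^] ?n = \<one>" using ord_eq_1 g(1) by (meson nat_pow_closed)
    then show ?thesis using pow_eq_id g(1) by blast
  qed
  ultimately show ?thesis by (rule dvd_antisym)
qed

text \<open>A coset of \<open>F\<close> acts through an arbitrary representative. As
  \<open>F\<close> acts trivially on the section the choice is immaterial; the second conclusion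
  records this.\<close>

lemma section_quotient_action:
  fixes act defines "act \<equiv> \<lambda>X Y. cnj (SOME g. g \<in> X) ` Y"
  assumes V: "subgroup V1 G" "subgroup V2 G" "V2 \<subseteq> V1"
    and inv: "invariant (carrier G) V1" "invariant (carrier G) V2"
    and ab: "\<forall>x\<in>V1. \<forall>y\<in>V1. cnj x y \<otimes> inv y \<in> V2"
    and F: "subgroup F G" "invariant (carrier G) F" and triv: "\<And>f v. f \<in> F \<Longrightarrow> v \<in> V1 \<Longrightarrow> cnj f v \<otimes> inv v \<in> V2"
  shows "aut_action (G Mod F) (G\<lparr>carrier := V1\<rparr> Mod V2) act"
    and "\<And>g v. g \<in> carrier G \<Longrightarrow> v \<in> V1 \<Longrightarrow> act (F #> g) (V2 #> v) = V2 #> cnj g v"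
proof -
  let ?Q = "G\<lparr>carrier := V1\<rparr> Mod V2"
  have V1c: "V1 \<subseteq> carrier G" using V(1) subgroup.subset by blast
  interpret S: aut_action G ?Q "\<lambda>g X. cnj g ` X" by (rule section_aut_action(1)[OF V inv ab])
  note cj = section_aut_action(2)[OF V inv ab]
  interpret K: good_group "G Mod F" by (rule good_quotient(1)[OF F])
  interpret h: group_hom G "G Mod F" "\<lambda>x. F #> x" by (rule good_quotient(2)[OF F])
  have car: "carrier ?Q = (\<lambda>x. V2 #> x) ` V1"
    using section_quotient(2)[OF V invariant_mono[OF inv(2) V1c]] .
  show actD: "act (F #> g) (V2 #> v) = V2 #> cnj g v" if g: "g \<in> carrier G" and v: "v \<in> V1" for g v
  proof -
    define g' where "g' = (SOME x. x \<in> F #> g)"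
    have "g' \<in> F #> g" unfolding g'_def using rcos_self[OF g F(1)] by (rule someI)
    then obtain f where f: "f \<in> F" "g' = f \<otimes> g" by (auto simp: r_coset_def)
    have fc: "f \<in> carrier G" using f F(1) subgroup.mem_carrier by metis
    have vc: "v \<in> carrier G" using v V1c by blast
    have gv: "cnj g v \<in> V1" using inv(1) g v by (simp add: invariant_def)
    have "act (F #> g) (V2 #> v) = V2 #> cnj g' v"
      using cj[of g' v] f fc g vc by (simp add: act_def g'_def[symmetric])
    also have "cnj g' v = cnj f (cnj g v)" using f fc g vc by (simp add: cnj_cnj)
    also have "V2 #> \<dots> = V2 #> cnj g v"
      using triv[OF f(1) gv] rcoset_eq_iff[OF V(2)] fc g vc by simp
    finally show ?thesis .
  qed
  have act_eq: "act (F #> g) X = cnj g ` X" if "g \<in> carrier G" "X \<in> carrier ?Q" for g X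
  proof -
    obtain x where x: "x \<in> V1" "X = V2 #> x" using \<open>X \<in> carrier ?Q\<close> car by auto
    then show ?thesis using actD[OF \<open>g \<in> carrier G\<close> x(1)] cj[OF \<open>g \<in> carrier G\<close>, of x] V1c by auto
  qed
  have carK: "carrier (G Mod F) = (\<lambda>x. F #> x) ` carrier G" by (simp add: carrier_FactGroup)
  show "aut_action (G Mod F) ?Q act"
  proof (intro aut_action.intro aut_action_axioms.intro K.is_group S.V.comm_group_axioms)
    show "finite (carrier ?Q)" by simp
    show "act X v \<in> carrier ?Q" if "X \<in> carrier (G Mod F)" "v \<in> carrier ?Q" for X v
      using that act_eq S.act_closed unfolding carK by auto
    show "act X (v \<otimes>\<^bsub>?Q\<^esub> w) = act X v \<otimes>\<^bsub>?Q\<^esub> act X w"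
      if X: "X \<in> carrier (G Mod F)" and vw: "v \<in> carrier ?Q" "w \<in> carrier ?Q" for X v w
    proof -
      obtain g where "g \<in> carrier G" "X = F #> g" using X carK by auto
      then show ?thesis using act_eq S.act_mult vw S.V.m_closed by metis
    qed
    show "act \<one>\<^bsub>G Mod F\<^esub> v = v" if "v \<in> carrier ?Q" for v
      using act_eq[of \<one> v] that S.act_one_left h.hom_one by simp
    show "act (X \<otimes>\<^bsub>G Mod F\<^esub> Y) v = act X (act Y v)"
      if XY: "X \<in> carrier (G Mod F)" "Y \<in> carrier (G Mod F)" and v: "v \<in> carrier ?Q" for X Y v
    proof -
      obtain g k where gk: "g \<in> carrier G" "X = F #> g" "k \<in> carrier G" "Y = F #> k" using XY carK by auto
      have "X \<otimes>\<^bsub>G Mod F\<^esub> Y = F #> (g \<otimes> k)" using h.hom_mult gk by simp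
      then show ?thesis using act_eq[of "g \<otimes> k" v] act_eq[of k v] act_eq[of g "cnj k ` v"]
          S.act_comp[of g k v] S.act_closed[of k v] gk v by simp
    qed
  qed
qed

lemma section_good_action:
  fixes act defines "act \<equiv> \<lambda>X Y. cnj (SOME g. g \<in> X) ` Y"
  assumes V: "subgroup V1 G" "subgroup V2 G" "V2 \<subset> V1"
    and inv: "invariant (carrier G) V1" "invariant (carrier G) V2"
    and ab: "\<forall>x\<in>V1. \<forall>y\<in>V1. cnj x y \<otimes> inv y \<in> V2"
    and F: "subgroup F G" "invariant (carrier G) F" and triv: "\<And>f v. f \<in> F \<Longrightarrow> v \<in> V1 \<Longrightarrow> cnj f v \<otimes> inv v \<in> V2"
    and r: "card V1 = r ^ i" "prime r"
  shows "good_action (G Mod F) (G\<lparr>carrier := V1\<rparr> Mod V2) act r"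
proof -
  let ?Q = "G\<lparr>carrier := V1\<rparr> Mod V2"
  have V1c: "V1 \<subseteq> carrier G" using V(1) subgroup.subset by blast
  have V21: "V2 \<subseteq> V1" using V(3) by blast
  interpret A: aut_action "G Mod F" ?Q act
    unfolding act_def by (rule section_quotient_action(1)[OF V(1,2) V21 inv ab F triv])
  have actD: "act (F #> g) (V2 #> v) = V2 #> cnj g v" if "g \<in> carrier G" "v \<in> V1" for g v
    unfolding act_def by (rule section_quotient_action(2)[OF V(1,2) V21 inv ab F triv that])
  interpret K: good_group "G Mod F" by (rule good_quotient(1)[OF F])
  have i12: "invariant V1 V2" using inv(2) V1c by (rule invariant_mono)
  have car: "carrier ?Q = (\<lambda>x. V2 #> x) ` V1" using section_quotient(2)[OF V(1,2) V21 i12] .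
  have "card (carrier ?Q) dvd r ^ i" using card_section[OF V(1,2) V21 i12] r(1) by (metis dvd_triv_left)
  then have pw: "\<exists>k. card (carrier ?Q) = r ^ k" using r(2) by (auto simp: divides_primepow_nat)
  obtain v where v: "v \<in> V1" "v \<notin> V2" using V(3) by blast
  then have "V2 #> v \<noteq> \<one>\<^bsub>?Q\<^esub>" using rcoset_eq_self_iff[OF V(2)] V1c by auto
  then have nt: "carrier ?Q \<noteq> {\<one>\<^bsub>?Q\<^esub>}" using car v by blast
  have fp: False
    if X: "X \<in> carrier (G Mod F)" and w: "w \<in> carrier ?Q" "w \<noteq> \<one>\<^bsub>?Q\<^esub>" "act X w = w"
      and tu: "prime t" "prime u" "t \<noteq> r" "u \<noteq> r" "t \<noteq> u" "t dvd A.K.ord X" "u dvd A.K.ord X" for X w t u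
  proof -
    obtain g where g: "g \<in> carrier G" "X = F #> g" using X by (auto simp: carrier_FactGroup)
    obtain z where z: "z \<in> V1" "w = V2 #> z" using w car by auto
    have zc: "z \<in> carrier G" using z V1c by blast
    have "z \<notin> V2" using w(2) z rcoset_eq_self_iff[OF V(2) zc] by auto
    moreover have "V2 #> cnj g z = V2 #> z" using actD[OF g(1) z(1)] w(3) g z by simp
    then have "cnj g z \<otimes> inv z \<in> V2" using rcoset_eq_iff[OF V(2)] g zc by simp
    moreover have "A.K.ord X dvd ord g" using quotient_ord_dvd[OF good_quotient(2)[OF F] g(1)] g by simp
    ultimately show False
      using section_fixed_triple[OF V(1,2) V21 r inv(2) z(1) _ g(1) _ tu(1-5)] tu(6,7) dvd_trans by blast
  qed
  show ?thesis
    by (intro good_action.intro good_action_axioms.intro A.aut_action_axioms K.good_group_axioms r(2) pw nt)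
      (use fp in blast)
qed

end

context good_group
begin

text \<open>A section of \<open>R\<close> is chosen on which \<open>F\<close> acts trivially and the
  quotient of \<open>M\<close> by \<open>F\<close> acts faithfully; then
  \<open>no_faithful_chief_factor\<close> applies to \<open>G Mod F\<close>.\<close>

lemma no_chief_factor_over_radicals:
  assumes rp: "prime r" "prime p" "r \<noteq> p"
    and R: "subgroup R G" "invariant (carrier G) R" "card R = r ^ i"
    and S: "subgroup S G" "card S = p ^ j" and RS: "\<And>x y. x \<in> R \<Longrightarrow> y \<in> S \<Longrightarrow> commutes x y"
    and F: "subgroup F G" "invariant (carrier G) F" "F = {x \<otimes> y | x y. x \<in> R \<and> y \<in> S}"
    and M: "subgroup M G" "invariant (carrier G) M" "F \<subset> M"
    and exM: "\<And>x. x \<in> M \<Longrightarrow> x [^] p \<in> F" and coM: "\<And>x y. x \<in> M \<Longrightarrow> y \<in> M \<Longrightarrow> cnj x y \<otimes> inv y \<in> F"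
    and minM: "\<And>N. subgroup N G \<Longrightarrow> invariant (carrier G) N \<Longrightarrow> F \<subseteq> N \<Longrightarrow> N \<subseteq> M \<Longrightarrow> N = F \<or> N = M"
    and nc: "x0 \<in> M" "x0 [^] (p ^ l) = \<one>" "z0 \<in> R" "\<not> commutes x0 z0"
    and qs: "prime q" "prime s" "q \<noteq> s" "q \<noteq> r" "q \<noteq> p" "s \<noteq> r" "s \<noteq> p"
    and eqs: "y0 \<in> carrier G" "ord y0 = q * s"
    and epu: "\<And>u. u \<in> {q, s} \<Longrightarrow> \<exists>y\<in>carrier G. ord y = p * u"
  shows False
proof -
  have Rc: "R \<subseteq> carrier G" and Sc: "S \<subseteq> carrier G" and Mc: "M \<subseteq> carrier G" and Fc: "F \<subseteq> carrier G"
    using R S M F subgroup.subset by blast+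
  have FM: "F \<subseteq> M" using M by blast
  \<comment> \<open>\<open>cen N\<close>: the \<open>p\<close>-elements of \<open>M\<close>
    centralise \<open>N\<close>. \<open>V1\<close> is a smallest normal subgroup inside
    \<open>R\<close> where this fails, and \<open>V2\<close> is maximal below it, so it still holds
    for \<open>V2\<close>.\<close>
  define cen where "cen N \<longleftrightarrow> (\<forall>x\<in>M. \<forall>m. x [^] (p ^ m) = \<one> \<longrightarrow> (\<forall>z\<in>N. commutes x z))" for N
  let ?P = "\<lambda>N. subgroup N G \<and> invariant (carrier G) N \<and> N \<subseteq> R \<and> \<not> cen N"
  have "\<not> cen R" using nc by (auto simp: cen_def)
  then have "?P R" using R by blast
  then obtain V1 where V1: "?P V1" and least: "\<And>N. ?P N \<Longrightarrow> card V1 \<le> card N"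
    using ex_has_least_nat[of ?P R card] by blast
  have sV1: "subgroup V1 G" and iV1: "invariant (carrier G) V1" and V1R: "V1 \<subseteq> R" and ncV1: "\<not> cen V1" using V1 by auto
  have V1c: "V1 \<subseteq> carrier G" using V1R Rc by blast
  have V1n: "V1 \<noteq> {\<one>}"
  proof
    assume "V1 = {\<one>}"
    then have "cen V1" using Mc by (auto simp: cen_def)
    then show False using ncV1 by blast
  qed
  obtain V2 t where V2: "subgroup V2 G" "invariant (carrier G) V2" "V2 \<subset> V1"
    and abV: "\<And>x y. x \<in> V1 \<Longrightarrow> y \<in> V1 \<Longrightarrow> cnj x y \<otimes> inv y \<in> V2"
    and maxV: "\<And>N. subgroup N G \<Longrightarrow> invariant (carrier G) N \<Longrightarrow> V2 \<subseteq> N \<Longrightarrow> N \<subseteq> V1 \<Longrightarrow> N = V2 \<or> N = V1"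
    by (rule maximal_invariant_below[OF solv subset_refl V1c sV1 iV1 V1n]) auto
  have V2c: "V2 \<subseteq> carrier G" and V21: "V2 \<subseteq> V1" using V2 V1c by auto
  have cV2: "cen V2"
  proof (rule ccontr)
    assume "\<not> cen V2"
    then have "card V1 \<le> card V2" using least V2 V1R by blast
    then show False using V2(3) finite_subgroup[OF sV1] by (metis psubset_card_mono leD)
  qed
  have "card V1 dvd r ^ i" using card_subgroup_dvd[OF sV1 R(1) V1R] R(3) by simp
  then obtain k where cV1: "card V1 = r ^ k" using rp(1) by (auto simp: divides_primepow_nat)
  have i12: "invariant V1 V2" using V2(2) V1c by (rule invariant_mono)
  let ?Q = "G\<lparr>carrier := V1\<rparr> Mod V2"
  have car: "carrier ?Q = (\<lambda>x. V2 #> x) ` V1" using section_quotient(2)[OF sV1 V2(1) V21 i12] .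
  have abV': "\<forall>x\<in>V1. \<forall>y\<in>V1. cnj x y \<otimes> inv y \<in> V2" using abV by blast
  interpret SA: aut_action G ?Q "\<lambda>g X. cnj g ` X"
    by (rule section_aut_action(1)[OF sV1 V2(1) V21 iV1 V2(2) abV'])
  note cj = section_aut_action(2)[OF sV1 V2(1) V21 iV1 V2(2) abV']
  \<comment> \<open>The preimage of the points that \<open>R\<close> fixes on the quotient of
    \<open>V1\<close> by \<open>V2\<close>. An \<open>r\<close>-group fixes a nontrivial point of an
    \<open>r\<close>-group, so \<open>C\<close> exceeds \<open>V2\<close> and equals
    \<open>V1\<close> by maximality.\<close>
  define C where "C = {v \<in> V1. \<forall>x\<in>R. cnj x v \<otimes> inv v \<in> V2}"
  have V2i: "cnj g v \<in> V2" if "g \<in> carrier G" "v \<in> V2" for g v using V2(2) that by (simp add: invariant_def)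
  have Cs: "subgroup C G"
  proof (rule subgroupI)
    show "C \<subseteq> carrier G" using V1c by (auto simp: C_def)
    have "\<one> \<in> C" using subgroup.one_closed[OF sV1] subgroup.one_closed[OF V2(1)] Rc by (auto simp: C_def)
    then show "C \<noteq> {}" by blast
    show "inv a \<in> C" if a: "a \<in> C" for a
    proof -
      have ac: "a \<in> carrier G" using a V1c by (auto simp: C_def)
      have "cnj x (inv a) \<otimes> inv (inv a) \<in> V2" if x: "x \<in> R" for x
      proof -
        have xc: "x \<in> carrier G" using x Rc by blast
        have "cnj x (inv a) \<otimes> inv (inv a) = cnj (inv a) (inv (cnj x a \<otimes> inv a))"
          using ac xc by (simp add: cnj_def inv_mult_group m_assoc)
        moreover have "inv (cnj x a \<otimes> inv a) \<in> V2" using a x V2(1) by (simp add: C_def subgroup.m_inv_closed)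
        ultimately show ?thesis using V2i ac by simp
      qed
      then show ?thesis using a sV1 by (simp add: C_def subgroup.m_inv_closed)
    qed
    show "a \<otimes> b \<in> C" if ab: "a \<in> C" "b \<in> C" for a b
    proof -
      have c: "a \<in> carrier G" "b \<in> carrier G" using ab V1c by (auto simp: C_def)
      have "cnj x (a \<otimes> b) \<otimes> inv (a \<otimes> b) \<in> V2" if x: "x \<in> R" for x
      proof -
        have xc: "x \<in> carrier G" using x Rc by blast
        have "cnj x (a \<otimes> b) \<otimes> inv (a \<otimes> b) = (cnj x a \<otimes> inv a) \<otimes> cnj a (cnj x b \<otimes> inv b)"
          using c xc by (simp add: cnj_def inv_mult_group m_assoc)
        then show ?thesis using ab x V2(1) V2i c by (simp add: C_def subgroup.m_closed)
      qed
      then show ?thesis using ab sV1 by (simp add: C_def subgroup.m_closed)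
    qed
  qed
  have Ci: "invariant (carrier G) C"
  proof -
    have "cnj x (cnj g v) \<otimes> inv (cnj g v) \<in> V2" if gv: "g \<in> carrier G" "v \<in> C" "x \<in> R" for g v x
    proof -
      have c: "v \<in> carrier G" "x \<in> carrier G" using gv V1c Rc by (auto simp: C_def)
      have "cnj (inv g) x \<in> R" using R(2) gv by (simp add: invariant_def)
      then have "cnj g (cnj (cnj (inv g) x) v \<otimes> inv v) \<in> V2" using gv V2i by (simp add: C_def)
      moreover have "cnj g (cnj (cnj (inv g) x) v \<otimes> inv v) = cnj x (cnj g v) \<otimes> inv (cnj g v)"
        using c gv(1) by (simp add: cnj_def inv_mult_group m_assoc)
      ultimately show ?thesis by simp
    qed
    then show ?thesis using iV1 by (auto simp: invariant_def C_def)
  qed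
  have V2C: "V2 \<subseteq> C"
    using V21 V2i Rc V2(1) by (auto simp: C_def subgroup.m_closed subgroup.m_inv_closed)
  have "C \<noteq> V2"
  proof -
    let ?O = "carrier ?Q - {\<one>\<^bsub>?Q\<^esub>}"
    have "card (carrier ?Q) dvd r ^ k" using card_section[OF sV1 V2(1) V21 i12] cV1 by (metis dvd_triv_left)
    then obtain k' where k': "card (carrier ?Q) = r ^ k'" using rp(1) by (auto simp: divides_primepow_nat)
    obtain v where v: "v \<in> V1" "v \<notin> V2" using V2 by blast
    then have vQ: "V2 #> v \<in> ?O" using car rcoset_eq_self_iff[OF V2(1)] V1c by auto
    have cO: "card (carrier ?Q) = Suc (card ?O)"
      using SA.V.one_closed by (metis card.remove SA.fin_V)
    have "card ?O \<noteq> 0" using vQ by (metis SA.fin_V card_0_eq empty_iff finite_Diff)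
    then have "r dvd card (carrier ?Q)" using k' cO by (cases k') auto
    then have nd: "\<not> r dvd card ?O"
      using cO rp(1) by (metis dvd_add_right_iff plus_1_eq_Suc add.commute not_prime_unit)
    have "\<exists>X\<in>?O. \<forall>x\<in>R. cnj x ` X = X"
    proof (rule pgroup_fixpoint[OF R(1,3) rp(1) _ nd])
      show "finite ?O" by simp
      show "cnj x ` X \<in> ?O" if "x \<in> R" "X \<in> ?O" for x X
      proof -
        have xc: "x \<in> carrier G" using that Rc by blast
        have "cnj x ` X \<noteq> \<one>\<^bsub>?Q\<^esub>"
        proof
          assume "cnj x ` X = \<one>\<^bsub>?Q\<^esub>"
          then have "cnj (inv x) ` cnj x ` X = \<one>\<^bsub>?Q\<^esub>" using SA.act_one[of "inv x"] xc by simp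
          moreover have "cnj (inv x) ` cnj x ` X = X"
            using SA.act_comp[of "inv x" x X] xc that by simp
          ultimately show False using that by simp
        qed
        then show ?thesis using SA.act_closed[OF xc, of X] that by blast
      qed
      show "cnj \<one> ` X = X" if "X \<in> ?O" for X using SA.act_one_left that by blast
      show "cnj (x \<otimes> y) ` X = cnj x ` cnj y ` X" if "x \<in> R" "y \<in> R" "X \<in> ?O" for x y X
        using SA.act_comp[of x y X] that Rc by blast
    qed
    then obtain X where X: "X \<in> ?O" "\<And>x. x \<in> R \<Longrightarrow> cnj x ` X = X" by blast
    obtain w where w: "w \<in> V1" "X = V2 #> w" using X car by auto
    have wc: "w \<in> carrier G" using w V1c by blast
    have "w \<notin> V2" using X w rcoset_eq_self_iff[OF V2(1) wc] by auto
    moreover have "cnj x w \<otimes> inv w \<in> V2" if x: "x \<in> R" for x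
    proof -
      have xc: "x \<in> carrier G" using x Rc by blast
      have "V2 #> cnj x w = V2 #> w" using X(2)[OF x] w cj[OF xc wc] by simp
      then show ?thesis using rcoset_eq_iff[OF V2(1)] xc wc by simp
    qed
    ultimately show ?thesis using w by (auto simp: C_def)
  qed
  then have "C = V1" using maxV[OF Cs Ci V2C] by (auto simp: C_def)
  then have Rtriv: "cnj x v \<otimes> inv v \<in> V2" if "x \<in> R" "v \<in> V1" for x v using that by (auto simp: C_def)
  have Ftriv: "cnj f v \<otimes> inv v \<in> V2" if f: "f \<in> F" and v: "v \<in> V1" for f v
  proof -
    obtain x y where xy: "x \<in> R" "y \<in> S" "f = x \<otimes> y" using f F(3) by blast
    have c: "x \<in> carrier G" "y \<in> carrier G" "v \<in> carrier G" using xy v Rc Sc V1c by auto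
    have "cnj y v = v" using RS[of v y] xy v V1R c by (simp add: cnj_eq_iff commutes_sym subset_iff)
    then have "cnj f v = cnj x v" using xy c by (metis cnj_cnj)
    then show ?thesis using Rtriv xy v by simp
  qed
  define act where "act = (\<lambda>X Y. cnj (SOME g. g \<in> X) ` Y)"
  interpret GA: good_action "G Mod F" ?Q act r
    unfolding act_def by (rule section_good_action[OF sV1 V2(1,3) iV1 V2(2) abV' F(1,2) Ftriv cV1 rp(1)])
  have actD: "act (F #> g) (V2 #> v) = V2 #> cnj g v" if "g \<in> carrier G" "v \<in> V1" for g v
    unfolding act_def by (rule section_quotient_action(2)[OF sV1 V2(1) V21 iV1 V2(2) abV' F(1,2) Ftriv that])
  interpret h: group_hom G "G Mod F" "\<lambda>x. F #> x" by (rule good_quotient(2)[OF F(1,2)])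
  let ?h = "\<lambda>x. F #> x"
  have carK: "carrier (G Mod F) = ?h ` carrier G" by (simp add: carrier_FactGroup)
  have fix_iff: "cnj g v \<otimes> inv v \<in> V2" if "g \<in> carrier G" "v \<in> V1" "act (?h g) (V2 #> v) = V2 #> v" for g v
    using that actD rcoset_eq_iff[OF V2(1), of "cnj g v" v] V1c by auto
  have in_F: "f \<in> F \<longleftrightarrow> ?h f = \<one>\<^bsub>G Mod F\<^esub>" if "f \<in> carrier G" for f
    using rcoset_eq_self_iff[OF F(1) that] by simp
  have prime_F: "u = r \<or> u = p" if u: "prime u" "u dvd card F" for u
  proof -
    obtain f where f: "f \<in> F" "ord f = u" using cauchy[OF u(1) F(1) u(2)] by blast
    obtain x y where xy: "x \<in> R" "y \<in> S" "f = x \<otimes> y" using f F(3) by blast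
    have c: "x \<in> carrier G" "y \<in> carrier G" using xy Rc Sc by auto
    have "f [^] (r ^ i * p ^ j) = x [^] (r ^ i * p ^ j) \<otimes> y [^] (r ^ i * p ^ j)"
      using xy RS c by (simp add: pow_mult_commutes)
    also have "\<dots> = \<one>" using pow_card_eq_one[OF R(1) xy(1)] pow_card_eq_one[OF S(1) xy(2)] R(3) S(2) by simp
    finally have "u dvd r ^ i * p ^ j" using f Fc pow_eq_id by blast
    then show ?thesis using u rp by (metis prime_dvd_mult_iff prime_dvd_power primes_dvd_imp_eq)
  qed
  have nd_F: "\<not> q dvd card F" "\<not> s dvd card F" using prime_F qs by blast+
  define A where "A = ?h ` M"
  have AQ: "X \<in> carrier (G Mod F)" if "X \<in> A" for X using that Mc carK by (auto simp: A_def)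
  have A1: "subgroup A (G Mod F)" unfolding A_def using h.subgroup_img_is_subgroup[OF M(1)] .
  have hcnj: "GA.K.cnj (?h g) (?h x) = ?h (cnj g x)" if "g \<in> carrier G" "x \<in> carrier G" for g x
    using that by (simp add: GA.K.cnj_def cnj_def h.hom_mult h.hom_inv del: mult_FactGroup)
  have A2: "GA.K.invariant (carrier (G Mod F)) A"
  proof -
    have "GA.K.cnj X Y \<in> A" if XY: "X \<in> carrier (G Mod F)" "Y \<in> A" for X Y
    proof -
      obtain g x where gx: "g \<in> carrier G" "X = ?h g" "x \<in> M" "Y = ?h x" using XY carK by (auto simp: A_def)
      then show ?thesis using hcnj[of g x] M(2) Mc by (auto simp: A_def invariant_def)
    qed
    then show ?thesis by (simp add: GA.K.invariant_def)
  qed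
  have A3: "A \<noteq> {\<one>\<^bsub>G Mod F\<^esub>}"
  proof
    assume "A = {\<one>\<^bsub>G Mod F\<^esub>}"
    then have "?h x = \<one>\<^bsub>G Mod F\<^esub>" if "x \<in> M" for x using that unfolding A_def by blast
    then have "x \<in> F" if "x \<in> M" for x using that in_F Mc by blast
    then show False using M(3) by blast
  qed
  have Aab: "GA.K.commutes X Y" if XY: "X \<in> A" "Y \<in> A" for X Y
  proof -
    obtain x y where xy: "x \<in> M" "X = ?h x" "y \<in> M" "Y = ?h y" using XY by (auto simp: A_def)
    have c: "x \<in> carrier G" "y \<in> carrier G" using xy Mc by auto
    have "?h (cnj x y) = ?h y" using rcoset_eq_iff[OF F(1)] coM[OF xy(1,3)] c by simp
    then have "GA.K.cnj X Y = Y" using hcnj c xy by simp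
    then show ?thesis using GA.K.cnj_eq_iff AQ XY by blast
  qed
  have Aex: "X [^]\<^bsub>G Mod F\<^esub> p = \<one>\<^bsub>G Mod F\<^esub>" if X: "X \<in> A" for X
  proof -
    obtain x where x: "x \<in> M" "X = ?h x" using X by (auto simp: A_def)
    then have "?h (x [^] p) = \<one>\<^bsub>G Mod F\<^esub>" using in_F exM Mc by (metis nat_pow_closed subsetD)
    then show ?thesis using h.hom_nat_pow x Mc by (metis subsetD)
  qed
  \<comment> \<open>The kernel of \<open>M\<close> on the section. It contains \<open>F\<close>, so
    by minimality of the chief factor it is \<open>F\<close> or \<open>M\<close>; the first
    alternative is faithfulness.\<close>
  define M0 where "M0 = {x \<in> M. \<forall>v\<in>V1. cnj x v \<otimes> inv v \<in> V2}"
  have M0_iff: "x \<in> M0 \<longleftrightarrow> x \<in> M \<and> (\<forall>X\<in>carrier ?Q. cnj x ` X = X)" for x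
  proof (cases "x \<in> M")
    case True
    have "(cnj x v \<otimes> inv v \<in> V2) = (cnj x ` (V2 #> v) = V2 #> v)" if v: "v \<in> V1" for v
    proof -
      have c: "x \<in> carrier G" "v \<in> carrier G" using True v Mc V1c by auto
      show ?thesis unfolding cj[OF c] using rcoset_eq_iff[OF V2(1) _ c(2)] c by simp
    qed
    then have "(\<forall>v\<in>V1. cnj x v \<otimes> inv v \<in> V2) = (\<forall>v\<in>V1. cnj x ` (V2 #> v) = V2 #> v)"
      by (intro ball_cong refl)
    also have "\<dots> = (\<forall>X\<in>carrier ?Q. cnj x ` X = X)" unfolding car by (simp only: ball_simps)
    finally show ?thesis using True by (simp only: M0_def mem_Collect_eq)
  next
    case False
    then show ?thesis by (simp only: M0_def mem_Collect_eq simp_thms)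
  qed
  have M0s: "subgroup M0 G"
  proof (rule subgroupI)
    show "M0 \<subseteq> carrier G" using Mc by (auto simp: M0_def)
    have "\<one> \<in> M0" unfolding M0_iff using subgroup.one_closed[OF M(1)] SA.act_one_left by blast
    then show "M0 \<noteq> {}" by blast
    show "inv a \<in> M0" if "a \<in> M0" for a
    proof -
      have a: "a \<in> M" "a \<in> carrier G" "\<And>X. X \<in> carrier ?Q \<Longrightarrow> cnj a ` X = X" using that Mc unfolding M0_iff by auto
      have "cnj (inv a) ` X = X" if X: "X \<in> carrier ?Q" for X
        using SA.act_comp[of "inv a" a X] SA.act_one_left[OF X] a X by simp
      then show ?thesis unfolding M0_iff using a M(1) by (simp add: subgroup.m_inv_closed)
    qed
    show "a \<otimes> b \<in> M0" if "a \<in> M0" "b \<in> M0" for a b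
      using that SA.act_comp Mc M(1) unfolding M0_iff by (simp add: subgroup.m_closed subset_iff)
  qed
  have M0i: "invariant (carrier G) M0"
  proof -
    have "cnj (cnj g x) v \<otimes> inv v \<in> V2" if gx: "g \<in> carrier G" "x \<in> M0" and v: "v \<in> V1" for g x v
    proof -
      have c: "x \<in> carrier G" "v \<in> carrier G" using gx v Mc V1c by (auto simp: M0_def)
      have "cnj (inv g) v \<in> V1" using iV1 gx v by (simp add: invariant_def)
      then have "cnj x (cnj (inv g) v) \<otimes> inv (cnj (inv g) v) \<in> V2" using gx by (simp add: M0_def)
      then have "cnj g (cnj x (cnj (inv g) v) \<otimes> inv (cnj (inv g) v)) \<in> V2" using V2i gx by blast
      moreover have "cnj g (cnj x (cnj (inv g) v) \<otimes> inv (cnj (inv g) v)) = cnj (cnj g x) v \<otimes> inv v"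
        using c gx(1) by (simp add: cnj_def inv_mult_group m_assoc)
      ultimately show ?thesis by simp
    qed
    then show ?thesis using M(2) by (auto simp: invariant_def M0_def)
  qed
  have FM0: "F \<subseteq> M0" using FM Ftriv by (auto simp: M0_def)
  \<comment> \<open>If \<open>M\<close> acted trivially, a \<open>p\<close>-element \<open>x\<close>
    would shift \<open>z\<close> by an element \<open>w\<close> of \<open>V2\<close>, which
    \<open>x\<close> fixes. Then the order of \<open>w\<close> is both a power of \<open>p\<close>
    and a power of \<open>r\<close>, so \<open>x\<close> would centralise \<open>V1\<close>.\<close>
  have "M0 \<noteq> M"
  proof
    assume M0: "M0 = M"
    have "cen V1" unfolding cen_def
    proof (intro ballI allI impI)
      fix x m z assume x: "x \<in> M" "x [^] (p ^ m) = \<one>" and z: "z \<in> V1"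
      have c: "x \<in> carrier G" "z \<in> carrier G" using x z Mc V1c by auto
      define w where "w = cnj x z \<otimes> inv z"
      have w: "w \<in> V2" using M0 x z by (auto simp: w_def M0_def)
      have wc: "w \<in> carrier G" using w V2c by blast
      have xw: "cnj x w = w" using cV2[unfolded cen_def] x w cnj_eq_iff[OF c(1) wc] by blast
      have xz: "cnj x z = w \<otimes> z" using c by (simp add: w_def m_assoc)
      have "cnj (x [^] (n::nat)) z = w [^] n \<otimes> z" for n
      proof (induction n)
        case (Suc n)
        have "cnj (x [^] Suc n) z = cnj x (cnj (x [^] n) z)"
          using c by (metis cnj_cnj nat_pow_Suc2 nat_pow_closed)
        also have "\<dots> = cnj x (w [^] n) \<otimes> cnj x z" using Suc c wc by (simp add: cnj_mult)
        also have "cnj x (w [^] n) = w [^] n" using xw c wc by (simp add: cnj_pow)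
        finally show ?case using xz c wc by (simp add: m_assoc)
      qed (use c in simp)
      from this[of "p ^ m"] have "w [^] (p ^ m) \<otimes> z = z" using x c by simp
      then have "w [^] (p ^ m) = \<one>" using c wc r_cancel_one by (metis nat_pow_closed)
      then have "ord w dvd p ^ m" using pow_eq_id wc by blast
      moreover have "ord w dvd r ^ k" using ord_dvd_card[OF sV1, of w] w V21 cV1 by auto
      moreover have "coprime (p ^ m) (r ^ k)" using rp primes_coprime[of p r] by simp
      ultimately have "ord w = 1" by (metis coprime_common_divisor_nat)
      then have "w = \<one>" using ord_eq_1 wc by blast
      then have "cnj x z = z" using xz c by simp
      then show "commutes x z" using cnj_eq_iff c by blast
    qed
    then show False using ncV1 by blast
  qed
  then have M0F: "M0 = F" using minM[OF M0s M0i FM0] by (auto simp: M0_def)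
  have faith: "X = \<one>\<^bsub>G Mod F\<^esub>" if X: "X \<in> A" and tr: "\<And>v. v \<in> carrier ?Q \<Longrightarrow> act X v = v" for X
  proof -
    obtain x where x: "x \<in> M" "X = ?h x" using X by (auto simp: A_def)
    have xc: "x \<in> carrier G" using x Mc by blast
    have "x \<in> M0" using x tr car fix_iff[OF xc] by (auto simp: M0_def)
    then show ?thesis using M0F in_F xc x by simp
  qed
  have "coprime (ord y0) (card F)"
    using eqs prime_imp_coprime[OF qs(1) nd_F(1)] prime_imp_coprime[OF qs(2) nd_F(2)] by simp
  then have oy: "GA.K.ord (?h y0) = q * s" using quotient_ord_coprime[OF F(1,2) eqs(1)] eqs(2) by simp
  \<comment> \<open>If the \<open>p\<close>-part \<open>c\<close> lies outside \<open>F\<close>, the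
    commuting pair survives in \<open>G Mod F\<close>. Otherwise \<open>c\<close> lies in
    \<open>S\<close> and centralises \<open>R\<close>, so a fixed point of \<open>d\<close> on the
    section would lift to an element of \<open>R\<close> commuting with \<open>d\<close> and
    \<open>c\<close>.\<close>
  have edge: "\<exists>d\<in>carrier (G Mod F). GA.K.ord d = u \<and> ((\<forall>v\<in>carrier ?Q. act d v = v \<longrightarrow> v = \<one>\<^bsub>?Q\<^esub>)
      \<or> (\<exists>c\<in>carrier (G Mod F). GA.K.ord c = p \<and> GA.K.commutes d c))" if u: "u \<in> {q, s}" for u
  proof -
    have up: "prime u" "u \<noteq> p" "u \<noteq> r" "\<not> u dvd card F" using u qs nd_F by auto
    obtain y where y: "y \<in> carrier G" "ord y = p * u" using epu[OF u] by blast
    define d where "d = y [^] p"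
    define c where "c = y [^] u"
    have pos: "0 < p" "0 < u" using rp(2) up(1) prime_gt_0_nat by blast+
    have d: "d \<in> carrier G" "ord d = u" using ord_pow[OF y(1), of p] y pos by (simp_all add: d_def)
    have c: "c \<in> carrier G" "ord c = p" using ord_pow[OF y(1), of u] y pos by (simp_all add: c_def)
    have dc: "commutes d c" unfolding d_def c_def using y(1) by (intro commutes_pow2) auto
    have hd: "?h d \<in> carrier (G Mod F)" "GA.K.ord (?h d) = u"
      using quotient_ord_coprime[OF F(1,2) d(1)] d prime_imp_coprime[OF up(1,4)] h.hom_closed by auto
    show ?thesis
    proof (cases "c \<in> F")
      case False
      have "?h c [^]\<^bsub>G Mod F\<^esub> p = \<one>\<^bsub>G Mod F\<^esub>" using h.hom_nat_pow[OF c(1), of p] c pow_ord_eq_1 h.hom_one by metis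
      then have "GA.K.ord (?h c) = p"
        using GA.K.ord_eq_prime[OF rp(2) h.hom_closed[OF c(1)]] in_F[OF c(1)] False by blast
      moreover have "GA.K.commutes (?h d) (?h c)"
        unfolding GA.K.commutes_def using h.hom_mult c d dc[unfolded commutes_def] by metis
      ultimately show ?thesis using hd h.hom_closed[OF c(1)] by blast
    next
      case True
      then obtain x z where xz: "x \<in> R" "z \<in> S" "c = x \<otimes> z" using F(3) by blast
      have xzc: "x \<in> carrier G" "z \<in> carrier G" using xz Rc Sc by auto
      have com: "commutes x z" using RS xz by blast
      have "c [^] (p * p ^ j) = \<one>" using c pow_eq_id by simp
      moreover have "c [^] (p * p ^ j) = x [^] (p * p ^ j) \<otimes> z [^] (p * p ^ j)"
        using xz(3) pow_mult_commutes[OF com xzc] by simp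
      moreover have "z [^] (p * p ^ j) = \<one>" using pow_card_eq_one[OF S(1) xz(2)] S(2) by simp
      ultimately have "x [^] (p ^ Suc j) = \<one>" using xzc by simp
      then have "ord x dvd p ^ Suc j" using pow_eq_id xzc by blast
      moreover have "ord x dvd r ^ i" using ord_dvd_card[OF R(1) xz(1)] R(3) by simp
      moreover have "coprime (p ^ Suc j) (r ^ i)" using rp primes_coprime[of p r] by simp
      ultimately have "ord x = 1" by (metis coprime_common_divisor_nat)
      then have cS: "c \<in> S" using ord_eq_1 xzc xz by auto
      have "w = \<one>\<^bsub>?Q\<^esub>" if w: "w \<in> carrier ?Q" "act (?h d) w = w" for w
      proof (rule ccontr)
        assume w1: "w \<noteq> \<one>\<^bsub>?Q\<^esub>"
        obtain v where v: "v \<in> V1" "w = V2 #> v" using w car by auto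
        have vc: "v \<in> carrier G" using v V1c by blast
        have vV2: "v \<notin> V2" using w1 v rcoset_eq_self_iff[OF V2(1) vc] by auto
        have fx: "cnj d v \<otimes> inv v \<in> V2" using fix_iff[OF d(1) v(1)] w v by simp
        have uV2: "\<not> u dvd card V2"
        proof
          assume "u dvd card V2"
          then have "u dvd r ^ k" using card_subgroup_dvd[OF V2(1) sV1 V21] cV1 dvd_trans by metis
          then show False using up rp prime_dvd_power primes_dvd_imp_eq by blast
        qed
        have "invariant {d} V2" using V2(2) d(1) by (auto intro: invariant_mono)
        then obtain n where n: "n \<in> V2" "commutes d (n \<otimes> v)"
          using lift_commutes[OF V2(1) _ d up(1) uV2 vc fx] by blast
        have nc: "n \<in> carrier G" using n V2c by blast
        have nvR: "n \<otimes> v \<in> R" using n v V21 V1R R(1) by (meson subgroup.m_closed subsetD)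
        have "n \<otimes> v \<noteq> \<one>"
        proof
          assume e: "n \<otimes> v = \<one>"
          have "inv n \<otimes> (n \<otimes> v) = inv n" using e nc by simp
          then have "v = inv n" using nc vc by simp
          then show False using vV2 n V2(1) by (simp add: subgroup.m_inv_closed)
        qed
        then obtain m :: nat where m: "ord ((n \<otimes> v) [^] m) = r" using p_element_power[OF R(1,3) rp(1) nvR] by blast
        have nvc: "n \<otimes> v \<in> carrier G" using nc vc by simp
        have "commutes d ((n \<otimes> v) [^] m)" using n(2) d nvc commutes_pow by blast
        moreover have "commutes c ((n \<otimes> v) [^] m)"
          using RS[OF subgroup_pow[OF R(1) nvR] cS] by (rule commutes_sym)
        ultimately show False
          using triple_commuting[OF d(1) c(1) nat_pow_closed[OF nvc] d(2) c(2) m up(1) rp(2) rp(1) up(2,3) rp(3)[symmetric] dc] by blast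
      qed
      then show ?thesis using hd by blast
    qed
  qed
  show False
    by (rule GA.no_faithful_chief_factor[OF rp(2) rp(3)[symmetric] A1 A2 A3 Aab Aex faith qs(1,5,4) qs(2,7,6) qs(3)[symmetric]
          h.hom_closed[OF eqs(1)] oy edge])
qed

end

section \<open>Radicals, and the hypothetical counterexample\<close>

context fin_group
begin

text \<open>The radical \<open>O_q(G)\<close>: a normal \<open>q\<close>-subgroup of largest order
  absorbs any other, since the product of the two is again a normal
  \<open>q\<close>-subgroup.\<close>

lemma radical_exists:
  assumes q: "prime q"
  obtains Q i where "subgroup Q G" "invariant (carrier G) Q" "card Q = q ^ i"
    "\<And>N k. subgroup N G \<Longrightarrow> invariant (carrier G) N \<Longrightarrow> card N = q ^ k \<Longrightarrow> N \<subseteq> Q"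
proof -
  let ?P = "\<lambda>N. subgroup N G \<and> invariant (carrier G) N \<and> (\<exists>i. card N = q ^ i)"
  have "?P {\<one>}" using triv_subgroup by (auto simp: invariant_one intro: exI[of _ 0])
  moreover have "\<forall>N. ?P N \<longrightarrow> card N < Suc (card (carrier G))"
    using fin card_mono subgroup.subset by (metis less_Suc_eq_le)
  ultimately obtain Q where Q: "?P Q" and greatest: "\<And>N. ?P N \<Longrightarrow> card N \<le> card Q"
    using ex_has_greatest_nat[of ?P "{\<one>}" card "Suc (card (carrier G))"] by blast
  have sQ: "subgroup Q G" and iQ: "invariant (carrier G) Q" using Q by auto
  obtain i where cQ: "card Q = q ^ i" using Q by blast
  have Qc: "Q \<subseteq> carrier G" using sQ subgroup.subset by blast
  have "N \<subseteq> Q" if N: "subgroup N G" "invariant (carrier G) N" "card N = q ^ k" for N k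
  proof -
    have Nc: "N \<subseteq> carrier G" using N subgroup.subset by blast
    let ?S = "{a \<otimes> b | a b. a \<in> Q \<and> b \<in> N}"
    have S: "subgroup ?S G" using subgroup_set_mult[OF sQ N(1)] N(2) Qc by (auto intro: invariant_mono)
    have "\<exists>m. x [^] (q ^ m) = \<one>" if x: "x \<in> ?S" for x
    proof -
      obtain a b where ab: "a \<in> Q" "b \<in> N" "x = a \<otimes> b" using x by blast
      have c: "a \<in> carrier G" "b \<in> carrier G" using ab Qc Nc by auto
      have "invariant {b} Q" using iQ c by (auto intro: invariant_mono)
      then obtain a' where a': "a' \<in> Q" "x [^] (q ^ k) = a' \<otimes> b [^] (q ^ k)"
        using mult_pow_mod[OF sQ _ c(2) ab(1)] ab(3) by blast
      have "b [^] (q ^ k) = \<one>" using pow_card_eq_one[OF N(1) ab(2)] N(3) by simp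
      then have "x [^] (q ^ k) = a'" using a' Qc by auto
      then have "(x [^] (q ^ k)) [^] (q ^ i) = \<one>" using pow_card_eq_one[OF sQ a'(1)] cQ by simp
      then have "x [^] (q ^ k * q ^ i) = \<one>" using ab(3) c by (simp add: nat_pow_pow)
      then show ?thesis by (metis power_add)
    qed
    then obtain n where n: "card ?S = q ^ n" using prime_power_card[OF q S] by blast
    have iS: "invariant (carrier G) ?S"
    proof -
      have "cnj u (a \<otimes> b) \<in> ?S" if "u \<in> carrier G" "a \<in> Q" "b \<in> N" for u a b
      proof -
        have "cnj u (a \<otimes> b) = cnj u a \<otimes> cnj u b" using that Qc Nc by (simp add: cnj_mult subset_iff)
        moreover have "cnj u a \<in> Q" "cnj u b \<in> N" using that iQ N(2) by (simp_all add: invariant_def)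
        ultimately show ?thesis by blast
      qed
      then show ?thesis by (auto simp: invariant_def)
    qed
    have QS: "Q \<subseteq> ?S"
    proof
      fix a assume a: "a \<in> Q"
      then have "a = a \<otimes> \<one>" using Qc by auto
      then show "a \<in> ?S" using a subgroup.one_closed[OF N(1)] by blast
    qed
    have NS: "N \<subseteq> ?S"
    proof
      fix b assume b: "b \<in> N"
      then have "b = \<one> \<otimes> b" using Nc by auto
      then show "b \<in> ?S" using b subgroup.one_closed[OF sQ] by blast
    qed
    have "card ?S \<le> card Q" using greatest[of ?S] S iS n by blast
    then have "?S = Q" using card_seteq[OF finite_subgroup[OF S] QS] by blast
    then show ?thesis using NS by simp
  qed
  then show thesis using that[OF sQ iQ cQ] by blast
qed

lemma centre_normal:
  assumes R: "subgroup R G" "invariant (carrier G) R" "card R = r ^ i" "prime r" "R \<noteq> {\<one>}"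
  obtains V k where "subgroup V G" "invariant (carrier G) V" "card V = r ^ k" "V \<noteq> {\<one>}" "V \<subseteq> R"
    "\<And>v x. v \<in> V \<Longrightarrow> x \<in> R \<Longrightarrow> commutes x v"
proof -
  have Rc: "R \<subseteq> carrier G" using R subgroup.subset by blast
  define V where "V = R \<inter> cent R"
  have V: "subgroup V G" unfolding V_def using R(1) cent_subgroup[OF Rc] by (rule subgroups_Inter_pair)
  have Vi: "invariant (carrier G) V" unfolding V_def using R(2) invariant_cent[OF Rc R(2)] by (rule invariant_Int)
  obtain z where z: "z \<in> R" "z \<noteq> \<one>" "\<forall>t\<in>R. commutes t z"
    using pgroup_centre[OF R(1,3,4,1,3,5) invariant_self[OF R(1)]] by blast
  then have "z \<in> V" using Rc by (auto simp: V_def cent_def intro: commutes_sym)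
  then have Vn: "V \<noteq> {\<one>}" using z by blast
  have "card V dvd r ^ i" using card_subgroup_dvd[OF V R(1)] R(3) by (simp add: V_def)
  then obtain k where k: "card V = r ^ k" using R(4) by (auto simp: divides_primepow_nat)
  show thesis
    by (rule that[OF V Vi k Vn]) (auto simp: V_def cent_def intro: commutes_sym)
qed

lemma ord_restrict:
  assumes H: "subgroup H G" and g: "g \<in> H" shows "group.ord (G\<lparr>carrier := H\<rparr>) g = ord g"
proof -
  interpret H: group "G\<lparr>carrier := H\<rparr>" using H by (rule subgroup_imp_group)
  have "g [^]\<^bsub>G\<lparr>carrier := H\<rparr>\<^esub> n = g [^] n" for n :: nat by (simp add: nat_pow_def)
  then show ?thesis using g H subgroup.mem_carrier H.ord_unique[of g "ord g"] pow_eq_id[of g] by fastforce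
qed

end

text \<open>The counterexample to be refuted. In contrast to \<open>good_group\<close>, it is used
  only for the whole group, never for a subgroup or a quotient.\<close>

locale linked_group = good_group +
  assumes linked: "\<And>p q. prime p \<Longrightarrow> prime q \<Longrightarrow> p \<noteq> q \<Longrightarrow> p dvd card (carrier G) \<Longrightarrow>
      q dvd card (carrier G) \<Longrightarrow> \<exists>g\<in>carrier G. ord g = p * q"
    and four: "4 \<le> card (prime_factors (card (carrier G)))"
begin

definition pr :: "nat \<Rightarrow> bool" where "pr p \<longleftrightarrow> prime p \<and> p dvd card (carrier G)"

lemma pr_prime: "pr p \<Longrightarrow> prime p" by (simp add: pr_def)

lemma pr_ord: "g \<in> carrier G \<Longrightarrow> prime (ord g) \<Longrightarrow> pr (ord g)"
  using ord_dvd_order by (simp add: pr_def)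

lemma pr_set: "prime_factors (card (carrier G)) = {p. pr p}"
  using card_subgroup_pos[OF subgroup_self] by (auto simp: pr_def in_prime_factors_iff)

lemma fourth_prime: "\<exists>s. pr s \<and> s \<noteq> a \<and> s \<noteq> b \<and> s \<noteq> c"
proof (rule ccontr)
  assume "\<not> ?thesis"
  then have "{p. pr p} \<subseteq> {a, b, c}" by blast
  then have "card {p. pr p} \<le> card {a, b, c}" by (intro card_mono) auto
  also have "\<dots> \<le> 3" by (simp add: card_insert_if)
  finally show False using four pr_set by simp
qed

lemma linked_pair:
  assumes "pr p" "pr q" "p \<noteq> q"
  obtains x y where "x \<in> carrier G" "ord x = p" "y \<in> carrier G" "ord y = q" "commutes x y"
proof -
  obtain g where g: "g \<in> carrier G" "ord g = p * q" using linked[of p q] assms unfolding pr_def by blast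
  have pos: "0 < p" "0 < q" using assms pr_prime prime_gt_0_nat by blast+
  have "ord (g [^] q) = p" "ord (g [^] p) = q"
    using ord_pow[OF g(1), of q] ord_pow[OF g(1), of p] g pos by simp_all
  moreover have "commutes (g [^] q) (g [^] p)" using g(1) by (intro commutes_pow2) auto
  ultimately show thesis using that g by (metis nat_pow_closed)
qed

text \<open>The prime 2 would divide \<open>s - 1\<close> for any other prime \<open>s\<close>.
  Oddness makes \<open>q * (q - 1) div 2\<close> a multiple of \<open>q\<close>, which is used in a
  power formula of class two.\<close>

lemma odd_prime: assumes "pr q" shows "odd q"
proof
  assume "even q"
  then have q2: "q = 2" using primes_dvd_imp_eq[OF two_is_prime_nat pr_prime[OF assms]] by simp
  obtain s where s: "pr s" "s \<noteq> 2" using fourth_prime by blast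
  then have "2 < s" using prime_ge_2_nat[OF pr_prime[OF s(1)]] by simp
  then have "odd s" using prime_odd_nat pr_prime s(1) by blast
  then have "2 dvd s - 1" by simp
  then show False using prime_cond[of 2 s] s assms q2 by (auto simp: pr_def)
qed

text \<open>Either some \<open>p\<close>-element of \<open>M\<close> fails to centralise
  \<open>R\<close>, which averaging excludes, or \<open>M\<close> is the direct product of
  \<open>R\<close> and a normal \<open>p\<close>-subgroup; the latter lies in \<open>P\<close>, so
  \<open>M\<close> would equal \<open>F\<close>. The case \<open>P = {\<one>}\<close> is allowed and
  is what forces a second radical.\<close>

lemma p_chief_factor_noncentral:
  assumes rp: "pr r" "pr p" "r \<noteq> p"
    and R: "subgroup R G" "invariant (carrier G) R" "card R = r ^ i"
    and P: "subgroup P G" "invariant (carrier G) P" "card P = p ^ j"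
    and maxP: "\<And>N k. subgroup N G \<Longrightarrow> invariant (carrier G) N \<Longrightarrow> card N = p ^ k \<Longrightarrow> N \<subseteq> P"
    and RP: "\<And>x y. x \<in> R \<Longrightarrow> y \<in> P \<Longrightarrow> commutes x y"
    and F: "subgroup F G" "invariant (carrier G) F" "F = {x \<otimes> y | x y. x \<in> R \<and> y \<in> P}"
    and M: "subgroup M G" "invariant (carrier G) M" "F \<subset> M"
    and exM: "\<And>x. x \<in> M \<Longrightarrow> x [^] p \<in> F" and coM: "\<And>x y. x \<in> M \<Longrightarrow> y \<in> M \<Longrightarrow> cnj x y \<otimes> inv y \<in> F"
    and minM: "\<And>N. subgroup N G \<Longrightarrow> invariant (carrier G) N \<Longrightarrow> F \<subseteq> N \<Longrightarrow> N \<subseteq> M \<Longrightarrow> N = F \<or> N = M"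
  shows False
proof -
  have Rc: "R \<subseteq> carrier G" and Pc: "P \<subseteq> carrier G" and Mc: "M \<subseteq> carrier G"
    using R P M subgroup.subset by blast+
  have primes: "prime r" "prime p" using rp pr_prime by blast+
  have RM: "R \<subseteq> M"
  proof
    fix x assume x: "x \<in> R"
    then have "x = x \<otimes> \<one>" using Rc by auto
    then have "x \<in> F" using x subgroup.one_closed[OF P(1)] F(3) by blast
    then show "x \<in> M" using M(3) by blast
  qed
  show False
  proof (cases "\<exists>x\<in>M. \<exists>l. x [^] (p ^ l) = \<one> \<and> (\<exists>z\<in>R. \<not> commutes x z)")
    case True
    then obtain x0 l z0 where nc: "x0 \<in> M" "x0 [^] (p ^ l) = \<one>" "z0 \<in> R" "\<not> commutes x0 z0" by blast
    obtain q where q: "pr q" "q \<noteq> r" "q \<noteq> p" using fourth_prime by blast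
    obtain s where s: "pr s" "s \<noteq> r" "s \<noteq> p" "s \<noteq> q" using fourth_prime by blast
    obtain y0 where y0: "y0 \<in> carrier G" "ord y0 = q * s" using linked[of q s] q s unfolding pr_def by blast
    have epu: "\<exists>y\<in>carrier G. ord y = p * u" if "u \<in> {q, s}" for u
      using linked[of p u] that q s rp unfolding pr_def by blast
    have qsp: "prime q" "prime s" using q s pr_prime by blast+
    show False
      by (rule no_chief_factor_over_radicals[OF primes rp(3) R P(1,3) RP F M exM coM minM nc
            qsp s(4)[symmetric] q(2,3) s(2,3) y0 epu])
  next
    case False
    have ndR: "\<not> p dvd card R" using R(3) primes rp(3) by (metis prime_dvd_power primes_dvd_imp_eq)
    have pw: "x [^] (p ^ Suc j) \<in> R" if x: "x \<in> M" for x
    proof -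
      have xc: "x \<in> carrier G" using x Mc by blast
      obtain a b where ab: "a \<in> R" "b \<in> P" "x [^] p = a \<otimes> b" using exM[OF x] F(3) by blast
      have c: "a \<in> carrier G" "b \<in> carrier G" using ab Rc Pc by auto
      have "x [^] (p ^ Suc j) = (x [^] p) [^] (p ^ j)" using xc by (simp add: nat_pow_pow)
      also have "\<dots> = a [^] (p ^ j) \<otimes> b [^] (p ^ j)" using ab RP c by (simp add: pow_mult_commutes)
      also have "b [^] (p ^ j) = \<one>" using pow_card_eq_one[OF P(1) ab(2)] P(3) by simp
      finally have "x [^] (p ^ Suc j) = a [^] (p ^ j)" using c by simp
      then show ?thesis using subgroup_pow[OF R(1) ab(1)] by simp
    qed
    have iMR: "invariant M R" using R(2) Mc by (rule invariant_mono)
    show False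
    proof (rule central_p_complement[OF M(1) R(1) RM iMR primes(2) ndR pw])
      show "commutes x z" if "x \<in> M" "x [^] (p ^ m) = \<one>" "z \<in> R" for x z m using False that by blast
      fix T n assume T: "subgroup T G" "T \<subseteq> M" "card T = p ^ n"
        "\<And>x m. x \<in> M \<Longrightarrow> x [^] (p ^ m) = \<one> \<Longrightarrow> x \<in> T"
        "\<And>x. x \<in> M \<Longrightarrow> \<exists>z\<in>R. \<exists>y\<in>T. x = z \<otimes> y"
      have "invariant (carrier G) T"
        using p_elements_invariant[OF T(2) Mc T(4) T(1,3) M(2)] by simp
      then have "T \<subseteq> P" using maxP T by blast
      then have "M \<subseteq> F" using T(5) F(3) by blast
      then show False using M(3) by blast
    qed
  qed
qed

text \<open>Otherwise all subgroups of order \<open>s\<close> are conjugate, and every linked pair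
  involving \<open>s\<close> can be moved to one fixed \<open>b\<close>. The centraliser of
  \<open>b\<close> then has order divisible by three further primes, so it contains an element
  involving two of them, and \<open>b\<close> adds the third.\<close>

lemma indep_exists:
  assumes s: "pr s"
  shows "\<exists>x y. indep s x y"
proof (rule ccontr)
  assume no: "\<not> (\<exists>x y. indep s x y)"
  have sp: "prime s" using s pr_prime by blast
  obtain p where p: "pr p" "p \<noteq> s" using fourth_prime by blast
  obtain q where q: "pr q" "q \<noteq> s" "q \<noteq> p" using fourth_prime by blast
  obtain r where r: "pr r" "r \<noteq> s" "r \<noteq> p" "r \<noteq> q" using fourth_prime by blast
  obtain b where b: "b \<in> carrier G" "ord b = s" using cauchy[OF sp subgroup_self] s by (auto simp: pr_def)
  let ?X = "cent {b}"
  have X: "subgroup ?X G" using b by (intro cent_subgroup) auto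
  have dv: "u dvd card ?X" if u: "pr u" "u \<noteq> s" for u
  proof -
    obtain x y where xy: "x \<in> carrier G" "ord x = s" "y \<in> carrier G" "ord y = u" "commutes x y"
      using linked_pair[OF s u(1)] u(2) by metis
    obtain g i where g: "g \<in> carrier G" "b = cnj g (x [^] (i::nat))"
      using prime_order_conjugate[OF sp _ xy(1,2) b] no by blast
    have "commutes (cnj g (x [^] i)) (cnj g y)"
      using cnj_commutes_iff[OF g(1)] xy commutes_pow2[OF xy(5,1,3), of i 1] by simp
    then have "cnj g y \<in> ?X" using g xy by (auto simp: cent_def intro: commutes_sym)
    then have "ord (cnj g y) dvd card ?X" by (rule ord_dvd_card[OF X])
    then show ?thesis using g xy by simp
  qed
  interpret X: good_group "G\<lparr>carrier := ?X\<rparr>" by (rule good_subgroup[OF X])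
  have "\<exists>h\<in>carrier (G\<lparr>carrier := ?X\<rparr>). \<exists>u\<in>{p, q, r}. \<exists>v\<in>{p, q, r}. u \<noteq> v \<and> u dvd X.ord h \<and> v dvd X.ord h"
    using p q r dv pr_prime by (intro X.two_of_three_primes) auto
  then obtain h u v where h: "h \<in> ?X" "u \<in> {p, q, r}" "v \<in> {p, q, r}" "u \<noteq> v" "u dvd ord h" "v dvd ord h"
    using ord_restrict[OF X] by auto
  have hc: "h \<in> carrier G" "commutes h b" using h by (auto simp: cent_def)
  have uv: "prime u" "prime v" "u \<noteq> s" "v \<noteq> s" using h p q r pr_prime by auto
  define h1 where "h1 = h [^] (ord h div u)"
  define h2 where "h2 = h [^] (ord h div v)"
  have h12: "h1 \<in> carrier G" "ord h1 = u" "h2 \<in> carrier G" "ord h2 = v"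
    using ord_pow_div[OF hc(1)] uv h hc by (simp_all add: h1_def h2_def)
  have "commutes h1 h2" unfolding h1_def h2_def using hc by (intro commutes_pow2) auto
  moreover have "commutes h1 b" "commutes h2 b"
    unfolding h1_def h2_def using hc b by (auto intro: commutes_sym commutes_pow)
  ultimately show False
    using triple_commuting[OF h12(1,3) b(1) h12(2,4) b(2) uv(1,2) sp h(4) uv(3,4)] by blast
qed

end

text \<open>\<open>R\<close> and \<open>P\<close> are the full radicals \<open>O_r(G)\<close> and
  \<open>O_p(G)\<close>. The assumptions are symmetric, so that each result about \<open>R\<close>
  yields one about \<open>P\<close> through \<open>swap\<close>.\<close>

locale two_radicals = linked_group +
  fixes R P r p i j
  assumes r: "pr r" and p: "pr p" and r_neq_p: "r \<noteq> p"
    and R: "subgroup R G" "invariant (carrier G) R" "card R = r ^ i" "R \<noteq> {\<one>}"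
    and P: "subgroup P G" "invariant (carrier G) P" "card P = p ^ j" "P \<noteq> {\<one>}"
    and maxR: "\<And>N k. subgroup N G \<Longrightarrow> invariant (carrier G) N \<Longrightarrow> card N = r ^ k \<Longrightarrow> N \<subseteq> R"
    and maxP: "\<And>N k. subgroup N G \<Longrightarrow> invariant (carrier G) N \<Longrightarrow> card N = p ^ k \<Longrightarrow> N \<subseteq> P"
begin

definition F where "F = {x \<otimes> y | x y. x \<in> R \<and> y \<in> P}"

lemma r_prime: "prime r" and p_prime: "prime p" using r p pr_prime by blast+

lemma Rc: "R \<subseteq> carrier G" and Pc: "P \<subseteq> carrier G"
  using R P subgroup.subset by blast+

lemma RP_commute:
  assumes a: "a \<in> R" and b: "b \<in> P" shows "commutes a b"
proof -
  have c: "a \<in> carrier G" "b \<in> carrier G" using a b Rc Pc by auto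
  let ?w = "cnj a b \<otimes> inv b"
  have w1: "?w \<in> P" using a b P c by (simp add: invariant_def subgroup.m_closed subgroup.m_inv_closed)
  have "?w = a \<otimes> cnj b (inv a)" using c by (simp add: cnj_def m_assoc)
  moreover have "cnj b (inv a) \<in> R" using a c R by (simp add: invariant_def subgroup.m_inv_closed)
  ultimately have w2: "?w \<in> R" using a R(1) subgroup.m_closed by metis
  have "ord ?w dvd r ^ i" "ord ?w dvd p ^ j"
    using ord_dvd_card[OF R(1) w2] ord_dvd_card[OF P(1) w1] R(3) P(3) by simp_all
  moreover have "coprime (r ^ i) (p ^ j)" using r_prime p_prime r_neq_p primes_coprime[of r p] by simp
  ultimately have "ord ?w = 1" by (metis coprime_common_divisor_nat)
  then have "?w = \<one>" using ord_eq_1 c by simp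
  then have "cnj a b = b" using c by (metis cnj_closed inv_closed inv_equality inv_inv)
  then show ?thesis using c cnj_eq_iff by blast
qed

lemma F_subgroup: "subgroup F G"
  unfolding F_def using subgroup_set_mult[OF R(1) P(1)] P(2) Rc by (auto intro: invariant_mono)

lemma Fc: "F \<subseteq> carrier G" using F_subgroup subgroup.subset by blast

lemma F_invariant: "invariant (carrier G) F"
proof -
  have "cnj u (a \<otimes> b) \<in> F" if "u \<in> carrier G" "a \<in> R" "b \<in> P" for u a b
  proof -
    have "cnj u (a \<otimes> b) = cnj u a \<otimes> cnj u b" using that Rc Pc by (simp add: cnj_mult subset_iff)
    moreover have "cnj u a \<in> R" "cnj u b \<in> P" using that R(2) P(2) by (simp_all add: invariant_def)
    ultimately show ?thesis unfolding F_def by blast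
  qed
  then show ?thesis by (auto simp: invariant_def F_def)
qed

lemma F_pow_R:
  assumes f: "f \<in> F" and n: "f [^] (r ^ n) = \<one>" shows "f \<in> R"
proof -
  obtain x y where xy: "x \<in> R" "y \<in> P" "f = x \<otimes> y" using f F_def by blast
  have c: "x \<in> carrier G" "y \<in> carrier G" using xy Rc Pc by auto
  have "f [^] (r ^ n * r ^ i) = (f [^] (r ^ n)) [^] (r ^ i)" using f Fc by (simp add: nat_pow_pow subset_iff)
  then have "\<one> = f [^] (r ^ n * r ^ i)" using n by simp
  also have "\<dots> = x [^] (r ^ n * r ^ i) \<otimes> y [^] (r ^ n * r ^ i)"
    using xy pow_mult_commutes[OF RP_commute[OF xy(1,2)] c] by simp
  also have "x [^] (r ^ n * r ^ i) = \<one>" using pow_card_eq_one[OF R(1) xy(1)] R(3) by simp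
  finally have "y [^] (r ^ (n + i)) = \<one>" using c by (simp add: power_add)
  then have "ord y dvd r ^ (n + i)" using pow_eq_id c by blast
  moreover have "ord y dvd p ^ j" using ord_dvd_card[OF P(1) xy(2)] P(3) by simp
  moreover have "coprime (r ^ (n + i)) (p ^ j)" using r_prime p_prime r_neq_p primes_coprime[of r p] by simp
  ultimately have "ord y = 1" by (metis coprime_common_divisor_nat)
  then show ?thesis using ord_eq_1 c xy by auto
qed

lemma R_sub_F: "R \<subseteq> F"
proof
  fix x assume x: "x \<in> R"
  then have "x = x \<otimes> \<one>" using Rc by auto
  then show "x \<in> F" using x subgroup.one_closed[OF P(1)] F_def by blast
qed

lemma swap: "two_radicals G P R p r j i"
  by (intro two_radicals.intro two_radicals_axioms.intro linked_group_axioms)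
    (rule p r r_neq_p[symmetric] P R | erule (2) maxP | erule (2) maxR)+

lemma swap_F: "two_radicals.F G P R = F"
proof -
  interpret s: two_radicals G P R p r j i by (rule swap)
  show ?thesis unfolding s.F_def F_def using RP_commute unfolding commutes_def by metis
qed

lemma F_pow_P: "f \<in> F \<Longrightarrow> f [^] (p ^ n) = \<one> \<Longrightarrow> f \<in> P"
  using two_radicals.F_pow_R[OF swap] swap_F by blast

lemma F_primes: assumes u: "prime u" "u dvd card F" shows "u = r \<or> u = p"
proof -
  obtain f where f: "f \<in> F" "ord f = u" using cauchy[OF u(1) F_subgroup u(2)] by blast
  obtain x y where xy: "x \<in> R" "y \<in> P" "f = x \<otimes> y" using f F_def by blast
  have c: "x \<in> carrier G" "y \<in> carrier G" using xy Rc Pc by auto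
  have "f [^] (r ^ i * p ^ j) = x [^] (r ^ i * p ^ j) \<otimes> y [^] (r ^ i * p ^ j)"
    using xy pow_mult_commutes[OF RP_commute[OF xy(1,2)] c] by simp
  also have "\<dots> = \<one>" using pow_card_eq_one[OF R(1) xy(1)] pow_card_eq_one[OF P(1) xy(2)] R(3) P(3) by simp
  finally have "u dvd r ^ i * p ^ j" using f Fc pow_eq_id by blast
  then show ?thesis using u r_prime p_prime by (metis prime_dvd_mult_iff prime_dvd_power primes_dvd_imp_eq)
qed

lemma chief_over_F:
  assumes M: "subgroup M G" "invariant (carrier G) M" "F \<subset> M" "prime t"
    and exM: "\<And>x. x \<in> M \<Longrightarrow> x [^] t \<in> F" and coM: "\<And>x y. x \<in> M \<Longrightarrow> y \<in> M \<Longrightarrow> cnj x y \<otimes> inv y \<in> F"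
    and minM: "\<And>N. subgroup N G \<Longrightarrow> invariant (carrier G) N \<Longrightarrow> F \<subseteq> N \<Longrightarrow> N \<subseteq> M \<Longrightarrow> N = F \<or> N = M"
  shows "t \<noteq> r \<and> t \<noteq> p"
proof -
  have FPR: "F = {x \<otimes> y | x y. x \<in> P \<and> y \<in> R}"
    using swap_F two_radicals.F_def[OF swap] by simp
  have "t \<noteq> p"
  proof
    assume tp: "t = p"
    show False
      by (rule p_chief_factor_noncentral[OF r p r_neq_p R(1-3) P(1-3) maxP RP_commute F_subgroup F_invariant F_def
            M(1-3) exM[unfolded tp] coM minM])
  qed
  moreover have "t \<noteq> r"
  proof
    assume tr: "t = r"
    show False
      by (rule p_chief_factor_noncentral[OF p r r_neq_p[symmetric] P(1-3) R(1-3) maxR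
            commutes_sym[OF RP_commute] F_subgroup F_invariant FPR M(1-3) exM[unfolded tr] coM minM])
  qed
  ultimately show ?thesis by blast
qed

end

text \<open>The second correction is made inside \<open>N \<inter> cent {x}\<close>, which
  \<open>y\<close> normalises because it commutes with \<open>x\<close>; so commutation with
  \<open>x\<close> is not lost.\<close>

lemma (in fin_group) lift_commutes_two:
  assumes N: "subgroup N G" "invariant (carrier G) N" and x: "x \<in> carrier G" "ord x = u" "prime u" "\<not> u dvd card N"
    and y: "y \<in> carrier G" "ord y = v" "prime v" "\<not> v dvd card N" and xy: "commutes x y"
    and g: "g \<in> carrier G" "g \<notin> N" "g [^] t \<in> N" "prime t" "\<not> t dvd card N"
    and c: "cnj x g \<otimes> inv g \<in> N" "cnj y g \<otimes> inv g \<in> N"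
  shows "\<exists>h. h \<in> carrier G \<and> ord h = t \<and> commutes x h \<and> commutes y h \<and> h \<otimes> inv g \<in> N \<and> h \<notin> N"
proof -
  have Nc: "N \<subseteq> carrier G" using N(1) subgroup.subset by blast
  have inv: "invariant S N" if "S \<subseteq> carrier G" for S using N(2) that by (rule invariant_mono)
  obtain h where h: "h \<in> carrier G" "ord h = t" "commutes x h" "h \<otimes> inv g \<in> N" "h \<notin> N"
    using lift_commutes_prime[OF N(1) inv x(1-4) g c(1)] x(1) g(1) by auto
  define C where "C = N \<inter> cent {x}"
  have Cs: "subgroup C G" unfolding C_def using N(1) cent_subgroup[of "{x}"] x(1) by (intro subgroups_Inter_pair) auto
  have CN: "C \<subseteq> N" by (auto simp: C_def)
  have Ci: "cnj z w \<in> C" if z: "z \<in> carrier G" "commutes x z" and w: "w \<in> C" for z w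
  proof -
    have wc: "w \<in> carrier G" using w Nc CN by blast
    have "cnj z x = x" using cnj_eq_iff z x(1) commutes_sym by blast
    then have "commutes (cnj z w) x" using cnj_commutes_iff[OF z(1) wc x(1)] w by (simp add: C_def cent_def)
    then show ?thesis using w N(2) z wc by (simp add: C_def cent_def invariant_def)
  qed
  have nd: "\<not> l dvd card C" if "\<not> l dvd card N" for l
    using that card_subgroup_dvd[OF Cs N(1) CN] dvd_trans by blast
  have hC: "cnj y h \<otimes> inv h \<in> C"
  proof -
    have eq: "h = (h \<otimes> inv g) \<otimes> g" using h g by (simp add: m_assoc)
    define n where "n = h \<otimes> inv g"
    have n: "n \<in> N" "n \<in> carrier G" "h = n \<otimes> g" using h g eq by (auto simp: n_def)
    have "cnj y h \<otimes> inv h = cnj y n \<otimes> (cnj y g \<otimes> inv g) \<otimes> inv n"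
      unfolding n(3) using n y(1) g(1) by (simp add: cnj_mult inv_mult_group m_assoc)
    moreover have "cnj y n \<in> N" using N(2) y(1) n by (simp add: invariant_def)
    ultimately have in_N: "cnj y h \<otimes> inv h \<in> N"
      using c(2) n N(1) by (simp add: subgroup.m_closed subgroup.m_inv_closed)
    have "cnj y x = x" using cnj_eq_iff y(1) x(1) xy commutes_sym by blast
    then have "commutes x (cnj y h)" using cnj_commutes_iff[OF y(1) x(1) h(1)] h(3) by simp
    then have "commutes x (cnj y h \<otimes> inv h)" using x(1) y(1) h by (intro commutes_mult commutes_inv) auto
    then show ?thesis using in_N Nc by (auto simp: C_def cent_def intro: commutes_sym)
  qed
  have hn: "h \<notin> C" using h(5) CN by blast
  have ht: "h [^] t \<in> C" using h(1,2) subgroup.one_closed[OF Cs] pow_ord_eq_1 by metis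
  have invC: "invariant {y, h} C" using Ci y(1) h(1,3) xy by (auto simp: invariant_def)
  obtain k where k: "k \<in> carrier G" "ord k = t" "commutes y k" "k \<otimes> inv h \<in> C"
    using lift_commutes_prime[OF Cs invC y(1-3) nd[OF y(4)] h(1) hn ht g(4) nd[OF g(5)] hC] by blast
  define m where "m = k \<otimes> inv h"
  have m: "m \<in> C" "m \<in> carrier G" "k = m \<otimes> h" using k h CN Nc by (auto simp: m_def m_assoc)
  have "commutes x m" using m(1) by (auto simp: C_def cent_def intro: commutes_sym)
  then have xk: "commutes x k" unfolding m(3) using h m x(1) by (intro commutes_mult) auto
  have "k \<otimes> inv g = m \<otimes> (h \<otimes> inv g)" unfolding m(3) using m h g by (simp add: m_assoc)
  then have kg: "k \<otimes> inv g \<in> N" using m(1) CN h(4) N(1) subgroup.m_closed by fastforce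
  have "k \<notin> N"
  proof
    assume "k \<in> N"
    then have "inv (k \<otimes> inv g) \<otimes> k \<in> N" using kg N(1) by (simp add: subgroup.m_closed subgroup.m_inv_closed)
    then show False using k(1) g(1,2) by (simp add: inv_mult_group m_assoc)
  qed
  then show ?thesis using k xk kg by blast
qed

section \<open>Fixed points on the two radicals\<close>

context two_radicals
begin

lemma r_element: assumes "f \<in> R" "f \<noteq> \<one>" shows "\<exists>m::nat. ord (f [^] m) = r"
  using p_element_power[OF R(1,3) r_prime assms] .

text \<open>\<open>R\<close> and \<open>P\<close> centralise each other, so powers of
  \<open>v\<close> and \<open>w\<close> form a commuting triple with \<open>g\<close>.\<close>

lemma fixes_both_radicals:
  assumes g: "g \<in> carrier G" "ord g = l" "prime l" "l \<noteq> r" "l \<noteq> p"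
    and v: "v \<in> R" "v \<noteq> \<one>" "commutes g v" and w: "w \<in> P" "w \<noteq> \<one>" "commutes g w"
  shows False
proof -
  obtain m n :: nat where m: "ord (v [^] m) = r" and n: "ord (w [^] n) = p"
    using r_element[OF v(1,2)] p_element_power[OF P(1,3) p_prime w(1,2)] by blast
  have c: "v \<in> carrier G" "w \<in> carrier G" using v w Rc Pc by auto
  show False
    using triple_commuting[OF g(1) nat_pow_closed[OF c(1)] nat_pow_closed[OF c(2)] g(2) m n g(3) r_prime p_prime g(4,5) r_neq_p
        commutes_pow[OF v(3) g(1) c(1)] commutes_pow[OF w(3) g(1) c(2)]
        commutes_pow2[OF RP_commute[OF v(1) w(1)] c]] .
qed

lemma indep_fixes_R:
  assumes xy: "indep l x y" and l: "prime l" "l \<noteq> r" and T: "subgroup T G" "T \<subseteq> R" "T \<noteq> {\<one>}" "invariant {x, y} T"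
  obtains e w where "e = y \<or> (\<exists>i::nat. e = x \<otimes> y [^] i)" "e \<in> carrier G" "ord e = l" "w \<in> T" "w \<noteq> \<one>" "commutes e w"
proof -
  have "card T dvd r ^ i" using card_subgroup_dvd[OF T(1) R(1) T(2)] R(3) by simp
  then obtain k where "card T = r ^ k" using r_prime by (auto simp: divides_primepow_nat)
  then show thesis using noncyclic_fixes_pgroup[OF T(1) _ T(3) r_prime l xy T(4)] that by blast
qed

text \<open>The pair acts on the centraliser of \<open>a\<close> in \<open>R\<close>. If that were
  nontrivial, an element of order \<open>l\<close> would fix a point of it, and together with
  \<open>a\<close> this is a commuting triple of orders \<open>q\<close>, \<open>l\<close>,
  \<open>r\<close>.\<close>

lemma indep_centraliser_R:
  assumes xy: "indep l x y" and l: "prime l" "l \<noteq> r" and a: "a \<in> carrier G" "ord a = q" "prime q" "q \<noteq> r" "q \<noteq> l"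
    and c: "commutes a x" "commutes a y" and f: "f \<in> R" "commutes a f"
  shows "f = \<one>"
proof (rule ccontr)
  assume f1: "f \<noteq> \<one>"
  have x: "x \<in> carrier G" "y \<in> carrier G" using xy by (auto simp: indep_def)
  define T where "T = R \<inter> cent {a}"
  have Ts: "subgroup T G" unfolding T_def using R(1) cent_subgroup[of "{a}"] a(1) by (intro subgroups_Inter_pair) auto
  have fT: "f \<in> T" using f Rc by (auto simp: T_def cent_def intro: commutes_sym)
  have inv: "invariant {x, y} T"
  proof -
    have "cnj z w \<in> T" if z: "z \<in> {x, y}" and w: "w \<in> T" for z w
    proof -
      have zc: "z \<in> carrier G" "commutes z a" using z x c commutes_sym by auto
      have wc: "w \<in> carrier G" using w Rc by (auto simp: T_def)
      have "cnj z a = a" using cnj_eq_iff zc a(1) by blast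
      then have "commutes (cnj z w) a" using cnj_commutes_iff[OF zc(1) wc a(1)] w by (simp add: T_def cent_def)
      then show ?thesis using w R(2) zc wc by (simp add: T_def cent_def invariant_def)
    qed
    then show ?thesis by (simp add: invariant_def)
  qed
  obtain e w where e: "e = y \<or> (\<exists>i::nat. e = x \<otimes> y [^] i)" "e \<in> carrier G" "ord e = l" and w: "w \<in> T" "w \<noteq> \<one>" "commutes e w"
    by (rule indep_fixes_R[OF xy l Ts _ _ inv]) (use fT f1 in \<open>auto simp: T_def\<close>)
  have wR: "w \<in> R" and wa: "commutes a w" using w by (auto simp: T_def cent_def intro: commutes_sym)
  have wc: "w \<in> carrier G" using wR Rc by blast
  have ea: "commutes a e" using e(1) c x a(1) by (auto intro: commutes_mult commutes_pow)
  obtain m :: nat where m: "ord (w [^] m) = r" using r_element[OF wR w(2)] by blast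
  show False
    using triple_commuting[OF a(1) e(2) nat_pow_closed[OF wc] a(2) e(3) m a(3) l(1) r_prime a(5,4) l(2) ea
        commutes_pow[OF wa a(1) wc] commutes_pow[OF w(3) e(2) wc]] .
qed

lemmas indep_centraliser_P = two_radicals.indep_centraliser_R[OF swap]

lemma F_centraliser:
  assumes a: "a \<in> carrier G" and aR: "\<And>f. f \<in> R \<Longrightarrow> commutes a f \<Longrightarrow> f = \<one>"
    and aP: "\<And>f. f \<in> P \<Longrightarrow> commutes a f \<Longrightarrow> f = \<one>" and f: "f \<in> F" "commutes a f"
  shows "f = \<one>"
proof (rule ccontr)
  assume f1: "f \<noteq> \<one>"
  have fc: "f \<in> carrier G" using f Fc by blast
  have "ord f \<noteq> 1" using f1 ord_eq_1 fc by blast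
  then obtain u where u: "prime u" "u dvd ord f" using prime_factor_nat by blast
  define h where "h = f [^] (ord f div u)"
  have h: "ord h = u" "h \<in> F" "h \<in> carrier G" "commutes a h"
    using ord_pow_div[OF fc u] subgroup_pow[OF F_subgroup f(1)] fc commutes_pow[OF f(2) a fc] by (simp_all add: h_def)
  have "u = r \<or> u = p" using F_primes[OF u(1)] ord_dvd_card[OF F_subgroup h(2)] h(1) by simp
  then have "h \<in> R \<or> h \<in> P"
    using F_pow_R[OF h(2), of 1] F_pow_P[OF h(2), of 1] h pow_ord_eq_1[OF h(3)] by auto
  then have "h = \<one>" using aR aP h(4) by blast
  then show False using h(1) u(1) by (metis not_prime_1 ord_id)
qed

text \<open>Otherwise \<open>b\<close> acts without fixed points on the centre \<open>V\<close> of
  \<open>R\<close>, so its commutators with \<open>E\<close> centralise \<open>V\<close>. Two of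
  these commutators are independent, and their span contains an element of order \<open>q\<close>
  fixing a point of \<open>P\<close>; it also centralises \<open>V\<close>, which is
  impossible.\<close>

lemma fixed_by_noncommuting:
  assumes E: "subgroup E G" and ab: "\<And>x y. x \<in> E \<Longrightarrow> y \<in> E \<Longrightarrow> commutes x y" and ex: "\<And>x. x \<in> E \<Longrightarrow> x [^] q = \<one>"
    and q: "prime q" "q \<noteq> r" "q \<noteq> p" and s: "prime s" "s \<noteq> q"
    and b: "b \<in> carrier G" "ord b = s" "invariant {b} E" and x: "x \<in> E" "\<not> commutes b x"
  shows "\<exists>v\<in>R. v \<noteq> \<one> \<and> commutes b v"
proof (rule ccontr)
  assume no: "\<not> ?thesis"
  have Ec: "E \<subseteq> carrier G" using E subgroup.subset by blast
  have bs: "b [^] s = \<one>" using b(1,2) pow_ord_eq_1 by blast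
  obtain V k where V: "subgroup V G" "invariant (carrier G) V" "card V = r ^ k" "V \<noteq> {\<one>}" "V \<subseteq> R"
    and VR: "\<And>v x. v \<in> V \<Longrightarrow> x \<in> R \<Longrightarrow> commutes x v"
    using centre_normal[OF R(1-3) r_prime R(4)] by metis
  have Vc: "V \<subseteq> carrier G" using V(1) subgroup.subset by blast
  have self: "G\<lparr>carrier := carrier G\<rparr> = G" by simp
  have Vcom: "commutes x y" if "x \<in> V" "y \<in> V" for x y using VR that V(5) by blast
  interpret A: aut_action G "G\<lparr>carrier := V\<rparr>" cnj
    using conj_aut_action[OF subgroup_self V(1,2) Vcom] unfolding self .
  obtain n where cE: "card E = q ^ n" using prime_power_card[OF q(1) E] ex by (metis power_one_right)
  have cop: "coprime (card E) (card (carrier (G\<lparr>carrier := V\<rparr>)))"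
    using cE V(3) q r_prime primes_coprime[of q r] by simp
  have sE: "\<not> s dvd card E" using cE s q(1) by (metis prime_dvd_power primes_dvd_imp_eq)
  have act: "cnj (inv y \<otimes> cnj b y) v = v" if y: "y \<in> E" and v: "v \<in> V" for y v
  proof (rule A.commutator_acts_trivially[OF E _ ab b(1,2) s(1) b(3) sE cop _ y])
    show "finite E" using E by simp
    show "v \<in> carrier (G\<lparr>carrier := V\<rparr>)" using v by simp
    fix w assume w: "w \<in> carrier (G\<lparr>carrier := V\<rparr>)" "cnj b w = w"
    then have "commutes b w" using cnj_eq_iff[OF b(1)] Vc by auto
    then show "w = \<one>\<^bsub>G\<lparr>carrier := V\<rparr>\<^esub>" using no w V(5) by auto
  qed
  have xc: "x \<in> carrier G" using x Ec by blast
  define n where "n = inv x \<otimes> cnj b x"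
  have bx: "cnj b x = x \<otimes> n" using xc b(1) by (simp add: n_def)
  have nE: "n \<in> E" using x(1) E b(3) by (simp add: n_def invariant_def subgroup.m_closed subgroup.m_inv_closed)
  have nc: "n \<in> carrier G" using nE Ec by blast
  have nbn: "\<not> commutes b n"
  proof
    assume bn: "commutes b n"
    have "x = x \<otimes> n [^] s" using cnj_pow_shift[OF b(1) xc nc bx bn, of s] bs xc by simp
    then have "n [^] s = \<one>" using l_cancel_one'[OF xc nat_pow_closed[OF nc]] by blast
    then have "ord n dvd s" "ord n dvd q" using pow_eq_id nc ex[OF nE] by blast+
    then have "ord n = 1" using s q(1) by (metis prime_nat_iff)
    then have "n = \<one>" using ord_eq_1 nc by blast
    then have "cnj b x = x" using bx xc by simp
    then show False using cnj_eq_iff[OF b(1) xc] x(2) by blast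
  qed
  have n1: "n \<noteq> \<one>" using nbn commutes_one[OF b(1)] by auto
  have on: "ord n = q" using ord_eq_prime[OF q(1) nc ex[OF nE] n1] .
  define m where "m = cnj b n"
  have mE: "m \<in> E" using nE b(3) by (simp add: m_def invariant_def)
  have mc: "m \<in> carrier G" using mE Ec by blast
  have om: "ord m = q" using on b(1) nc by (simp add: m_def)
  \<comment> \<open>If \<open>b\<close> carried \<open>n\<close> to a power of itself, the
    arithmetic condition would make \<open>b\<close> centralise \<open>n\<close>.\<close>
  have "m \<noteq> n [^] i" for i :: nat
  proof
    assume mi: "m = n [^] i"
    have "cnj b n \<otimes> inv n \<in> {\<one>}"
      by (rule cyclic_section_central[OF triv_subgroup _ b(1) nc _ on q(1), where k = i])
        (use n1 mi nc b(1) in \<open>auto simp: invariant_def m_def[symmetric]\<close>)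
    then have "cnj b n = n" using nc b(1) by (metis cnj_closed inv_closed inv_equality inv_inv singletonD)
    then show False using nbn cnj_eq_iff[OF b(1) nc] by blast
  qed
  then have ind: "indep q n m" using nc mc on om ab[OF nE mE] by (auto simp: indep_def)
  have Vn: "commutes n v" if "v \<in> V" for v
    using act[OF x(1) that] cnj_eq_iff[OF nc, of v] that Vc by (auto simp: n_def)
  have Vm: "commutes m v" if v: "v \<in> V" for v
  proof -
    have c: "v \<in> carrier G" using v Vc by blast
    have "cnj (inv b) v \<in> V" using V(2) v b(1) by (simp add: invariant_def)
    then have "commutes (cnj b n) (cnj b (cnj (inv b) v))"
      using Vn cnj_commutes_iff[OF b(1) nc, of "cnj (inv b) v"] c b(1) by (metis cnj_closed inv_closed)
    then show ?thesis using c b(1) by (simp add: m_def)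
  qed
  have invP: "invariant {n, m} P" using P(2) nc mc by (auto intro: invariant_mono)
  obtain e w where e: "e = m \<or> (\<exists>i::nat. e = n \<otimes> m [^] i)" "e \<in> carrier G" "ord e = q"
      and w: "w \<in> P" "w \<noteq> \<one>" "commutes e w"
    using two_radicals.indep_fixes_R[OF swap ind q(1,3) P(1) subset_refl P(4) invP] by metis
  obtain v where v: "v \<in> V" "v \<noteq> \<one>" using V(1,4) subgroup.one_closed by blast
  have vc: "v \<in> carrier G" using v Vc by blast
  have "commutes v e" using e(1) Vn[OF v(1)] Vm[OF v(1)] vc nc mc
    by (auto intro!: commutes_mult commutes_pow intro: commutes_sym)
  then have "commutes e v" by (rule commutes_sym)
  then show False using fixes_both_radicals[OF e(2,3) q _ v(2) _ w] v V(5) by blast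
qed

lemma abelian_centralised:
  assumes "subgroup E G" "\<And>x y. x \<in> E \<Longrightarrow> y \<in> E \<Longrightarrow> commutes x y" "\<And>x. x \<in> E \<Longrightarrow> x [^] q = \<one>"
    and "prime q" "q \<noteq> r" "q \<noteq> p" "prime s" "s \<noteq> q" "s \<noteq> r" "s \<noteq> p"
    and "b \<in> carrier G" "ord b = s" "invariant {b} E" "x \<in> E"
  shows "commutes b x"
proof (rule ccontr)
  assume n: "\<not> commutes b x"
  have "\<exists>v\<in>R. v \<noteq> \<one> \<and> commutes b v"
    by (rule fixed_by_noncommuting[OF assms(1-8,11-14) n])
  moreover have "\<exists>v\<in>P. v \<noteq> \<one> \<and> commutes b v"
    by (rule two_radicals.fixed_by_noncommuting[OF swap assms(1-4,6,5,7,8,11-14) n])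
  ultimately show False using fixes_both_radicals[OF assms(11,12,7,9,10)] by blast
qed

text \<open>\<open>V\<close> is the centre of \<open>R\<close>, presented as the section of
  \<open>V\<close> by \<open>{\<one>}\<close> so that the results on sections apply.
  \<open>F\<close> acts trivially: \<open>R\<close> centralises its centre, and \<open>P\<close>
  centralises \<open>R\<close>.\<close>

lemma centre_action:
  obtains V act where "subgroup V G" "invariant (carrier G) V" "V \<noteq> {\<one>}" "V \<subseteq> R"
    "\<And>f v. f \<in> F \<Longrightarrow> v \<in> V \<Longrightarrow> commutes f v"
    "good_action (G Mod F) (G\<lparr>carrier := V\<rparr> Mod {\<one>}) act r"
    "carrier (G\<lparr>carrier := V\<rparr> Mod {\<one>}) = (\<lambda>v. {\<one>} #> v) ` V"
    "\<And>g v. g \<in> carrier G \<Longrightarrow> v \<in> V \<Longrightarrow> act (F #> g) ({\<one>} #> v) = {\<one>} #> v \<longleftrightarrow> commutes g v"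
proof -
  obtain V k where V: "subgroup V G" "invariant (carrier G) V" "card V = r ^ k" "V \<noteq> {\<one>}" "V \<subseteq> R"
    and VR: "\<And>v x. v \<in> V \<Longrightarrow> x \<in> R \<Longrightarrow> commutes x v"
    using centre_normal[OF R(1-3) r_prime R(4)] by metis
  have Vc: "V \<subseteq> carrier G" using V(1) subgroup.subset by blast
  have one: "\<one> \<in> V" using V(1) subgroup.one_closed by blast
  have FV: "commutes f v" if f: "f \<in> F" and v: "v \<in> V" for f v
  proof -
    obtain a c where ac: "a \<in> R" "c \<in> P" "f = a \<otimes> c" using f F_def by blast
    have "commutes v a" "commutes v c" using VR[OF v ac(1)] RP_commute[OF _ ac(2), of v] v V(5) commutes_sym by blast+
    then have "commutes v (a \<otimes> c)" using v ac Vc Rc Pc by (intro commutes_mult) auto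
    then show ?thesis using ac(3) commutes_sym by simp
  qed
  have ps: "{\<one>} \<subset> V" using one V(4) by blast
  have ab: "\<forall>x\<in>V. \<forall>y\<in>V. cnj x y \<otimes> inv y \<in> {\<one>}"
  proof (intro ballI)
    fix x y assume xy: "x \<in> V" "y \<in> V"
    then have "commutes x y" using VR V(5) by blast
    then show "cnj x y \<otimes> inv y \<in> {\<one>}" using commutes_imp_mem[OF triv_subgroup] xy Vc by (meson subsetD)
  qed
  have tr: "cnj f v \<otimes> inv v \<in> {\<one>}" if "f \<in> F" "v \<in> V" for f v
    using commutes_imp_mem[OF triv_subgroup _ _ FV[OF that]] that Fc Vc by (meson subsetD)
  have i1: "invariant (carrier G) {\<one>}" by (simp add: invariant_one)
  define act where "act = (\<lambda>X Y. cnj (SOME g. g \<in> X) ` Y)"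
  have ga: "good_action (G Mod F) (G\<lparr>carrier := V\<rparr> Mod {\<one>}) act r"
    unfolding act_def by (rule section_good_action[OF V(1) triv_subgroup ps V(2) i1 ab F_subgroup F_invariant tr V(3) r_prime])
  have actD: "act (F #> g) ({\<one>} #> v) = {\<one>} #> cnj g v" if "g \<in> carrier G" "v \<in> V" for g v
    unfolding act_def
    by (rule section_quotient_action(2)[OF V(1) triv_subgroup psubset_imp_subset[OF ps] V(2) i1 ab F_subgroup F_invariant tr that])
  have iff: "act (F #> g) ({\<one>} #> v) = {\<one>} #> v \<longleftrightarrow> commutes g v" if gv: "g \<in> carrier G" "v \<in> V" for g v
  proof -
    have vc: "v \<in> carrier G" using gv Vc by blast
    have "{\<one>} #> cnj g v = {\<one>} #> v \<longleftrightarrow> cnj g v = v"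
      using gv(1) vc by (auto simp: r_coset_def)
    then show ?thesis using actD[OF gv] cnj_eq_iff[OF gv(1) vc] by simp
  qed
  have car: "carrier (G\<lparr>carrier := V\<rparr> Mod {\<one>}) = (\<lambda>v. {\<one>} #> v) ` V"
    using section_quotient(2)[OF V(1) triv_subgroup psubset_imp_subset[OF ps] invariant_one[OF Vc]] .
  show thesis using that[OF V(1,2,4,5) FV ga car iff] by blast
qed

text \<open>The argument of \<open>fixed_by_noncommuting\<close> with a chief factor in place of
  \<open>E\<close>. One nontrivial commutator \<open>d\<close> centralising \<open>V\<close> is
  enough now: the centraliser of \<open>V\<close> in \<open>M\<close> is normal and exceeds
  \<open>F\<close>, so it is all of \<open>M\<close>.\<close>

lemma chief_fixed_by_noncommuting:
  assumes M: "subgroup M G" "invariant (carrier G) M" "F \<subset> M" and q: "prime q" "q \<noteq> r" "q \<noteq> p"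
    and exM: "\<And>x. x \<in> M \<Longrightarrow> x [^] q \<in> F" and coM: "\<And>x y. x \<in> M \<Longrightarrow> y \<in> M \<Longrightarrow> cnj x y \<otimes> inv y \<in> F"
    and minM: "\<And>N. subgroup N G \<Longrightarrow> invariant (carrier G) N \<Longrightarrow> F \<subseteq> N \<Longrightarrow> N \<subseteq> M \<Longrightarrow> N = F \<or> N = M"
    and xy: "x0 \<in> M" "y0 \<in> M" "indep q x0 y0"
    and b: "b \<in> carrier G" "ord b = s" "prime s" "s \<noteq> q" "s \<noteq> r" "s \<noteq> p" and m: "m \<in> M" "cnj b m \<otimes> inv m \<notin> F"
  shows "\<exists>v\<in>R. v \<noteq> \<one> \<and> commutes b v"
proof (rule ccontr)
  assume no: "\<not> ?thesis"
  have Mc: "M \<subseteq> carrier G" using M(1) subgroup.subset by blast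
  have mc: "m \<in> carrier G" using m Mc by blast
  obtain V act where V: "subgroup V G" "invariant (carrier G) V" "V \<noteq> {\<one>}" "V \<subseteq> R"
    and FV: "\<And>f v. f \<in> F \<Longrightarrow> v \<in> V \<Longrightarrow> commutes f v"
    and ga: "good_action (G Mod F) (G\<lparr>carrier := V\<rparr> Mod {\<one>}) act r"
    and car: "carrier (G\<lparr>carrier := V\<rparr> Mod {\<one>}) = (\<lambda>v. {\<one>} #> v) ` V"
    and iff: "\<And>g v. g \<in> carrier G \<Longrightarrow> v \<in> V \<Longrightarrow> act (F #> g) ({\<one>} #> v) = {\<one>} #> v \<longleftrightarrow> commutes g v"
    using centre_action by metis
  have Vc: "V \<subseteq> carrier G" using V(1) subgroup.subset by blast
  interpret GA: good_action "G Mod F" "G\<lparr>carrier := V\<rparr> Mod {\<one>}" act r by (rule ga)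
  interpret h: group_hom G "G Mod F" "\<lambda>x. F #> x" by (rule good_quotient(2)[OF F_subgroup F_invariant])
  let ?h = "\<lambda>x. F #> x"
  have nF: "\<not> l dvd card F" if "prime l" "l \<noteq> r" "l \<noteq> p" for l using F_primes that by blast
  define A where "A = ?h ` M"
  have A1: "subgroup A (G Mod F)" unfolding A_def using h.subgroup_img_is_subgroup[OF M(1)] .
  have hcnj: "GA.K.cnj (?h g) (?h x) = ?h (cnj g x)" if "g \<in> carrier G" "x \<in> carrier G" for g x
    using that by (simp add: GA.K.cnj_def cnj_def h.hom_mult h.hom_inv del: mult_FactGroup)
  have Aab: "GA.K.commutes X Y" if XY: "X \<in> A" "Y \<in> A" for X Y
  proof -
    obtain x y where xy: "x \<in> M" "X = ?h x" "y \<in> M" "Y = ?h y" using XY by (auto simp: A_def)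
    have c: "x \<in> carrier G" "y \<in> carrier G" using xy Mc by auto
    have "?h (cnj x y) = ?h y" using rcoset_eq_iff[OF F_subgroup] coM[OF xy(1,3)] c by simp
    then have "GA.K.cnj X Y = Y" using hcnj c xy by simp
    then show ?thesis using GA.K.cnj_eq_iff h.hom_closed c xy by blast
  qed
  have Aex: "X [^]\<^bsub>G Mod F\<^esub> q = \<one>\<^bsub>G Mod F\<^esub>" if X: "X \<in> A" for X
  proof -
    obtain x where x: "x \<in> M" "X = ?h x" using X by (auto simp: A_def)
    have xc: "x \<in> carrier G" using x Mc by blast
    have "?h (x [^] q) = \<one>\<^bsub>G Mod F\<^esub>" using rcoset_eq_self_iff[OF F_subgroup] exM[OF x(1)] xc by simp
    then show ?thesis using h.hom_nat_pow[OF xc, of q] x(2) by simp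
  qed
  have fA: "finite A" using A1 by simp
  obtain n where cA: "card A = q ^ n" using GA.K.prime_power_card[OF q(1) A1] Aex by (metis power_one_right)
  have copA: "coprime (card A) (card (carrier (G\<lparr>carrier := V\<rparr> Mod {\<one>})))"
    using cA GA.r_group q r_prime primes_coprime[of q r] by auto
  have sA: "\<not> s dvd card A" using cA b(3,4) q(1) by (metis prime_dvd_power primes_dvd_imp_eq)
  have hb: "?h b \<in> carrier (G Mod F)" "GA.K.ord (?h b) = s"
    using quotient_ord_coprime[OF F_subgroup F_invariant b(1)] prime_imp_coprime[OF b(3) nF[OF b(3,5,6)]] b h.hom_closed by auto
  have invA: "GA.K.invariant {?h b} A"
    using hcnj b(1) M(2) Mc by (auto simp: GA.K.invariant_def A_def invariant_def)
  define d where "d = inv m \<otimes> cnj b m"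
  have dM: "d \<in> M" using m M(1,2) b(1) by (simp add: d_def invariant_def subgroup.m_closed subgroup.m_inv_closed)
  have dc: "d \<in> carrier G" using dM Mc by blast
  have hd: "inv\<^bsub>G Mod F\<^esub> (?h m) \<otimes>\<^bsub>G Mod F\<^esub> GA.K.cnj (?h b) (?h m) = ?h d"
    using hcnj[OF b(1) mc] mc b(1) by (simp add: d_def h.hom_mult h.hom_inv del: mult_FactGroup)
  have dV: "commutes d v" if v: "v \<in> V" for v
  proof -
    have "act (?h d) ({\<one>} #> v) = {\<one>} #> v"
      unfolding hd[symmetric]
    proof (rule GA.commutator_acts_trivially[OF A1 fA Aab hb b(3) invA sA copA])
      show "?h m \<in> A" using m by (auto simp: A_def)
      show "{\<one>} #> v \<in> carrier (G\<lparr>carrier := V\<rparr> Mod {\<one>})" using v car by blast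
      fix w assume w: "w \<in> carrier (G\<lparr>carrier := V\<rparr> Mod {\<one>})" "act (?h b) w = w"
      then obtain z where z: "z \<in> V" "w = {\<one>} #> z" using car by auto
      then have "commutes b z" using iff[OF b(1) z(1)] w by simp
      then have "z = \<one>" using no z V(4) by blast
      then show "w = \<one>\<^bsub>G\<lparr>carrier := V\<rparr> Mod {\<one>}\<^esub>" using z(2) by simp
    qed
    then show ?thesis using iff[OF dc v] by simp
  qed
  define D where "D = M \<inter> cent V"
  have Ds: "subgroup D G" unfolding D_def using M(1) cent_subgroup[OF Vc] by (rule subgroups_Inter_pair)
  have Di: "invariant (carrier G) D" unfolding D_def using M(2) invariant_cent[OF Vc V(2)] by (rule invariant_Int)
  have FD: "F \<subseteq> D" using M(3) FV Fc by (auto simp: D_def cent_def)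
  have dD: "d \<in> D" using dM dV dc by (auto simp: D_def cent_def)
  have "d \<notin> F"
  proof
    assume "d \<in> F"
    then have "cnj m d \<in> F" using F_invariant mc by (simp add: invariant_def)
    moreover have "cnj m d = cnj b m \<otimes> inv m" using mc b(1) by (simp add: d_def cnj_def m_assoc)
    ultimately show False using m(2) by simp
  qed
  then have "D = M" using minM[OF Ds Di FD] dD by (auto simp: D_def)
  then have MV: "commutes x v" if "x \<in> M" "v \<in> V" for x v using that by (auto simp: D_def cent_def)
  have xyc: "x0 \<in> carrier G" "y0 \<in> carrier G" using xy Mc by auto
  have invP: "invariant {x0, y0} P" using P(2) xyc by (auto intro: invariant_mono)
  obtain e w where e: "e = y0 \<or> (\<exists>i::nat. e = x0 \<otimes> y0 [^] i)" "e \<in> carrier G" "ord e = q"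
      and w: "w \<in> P" "w \<noteq> \<one>" "commutes e w"
    using two_radicals.indep_fixes_R[OF swap xy(3) q(1,3) P(1) subset_refl P(4) invP] by metis
  have eM: "e \<in> M" using e(1) xy M(1) by (auto intro: subgroup.m_closed subgroup_pow)
  obtain v where v: "v \<in> V" "v \<noteq> \<one>" using V(1,3) subgroup.one_closed by blast
  show False using fixes_both_radicals[OF e(2,3) q _ v(2) MV[OF eM v(1)] w] v(1) V(4) by blast
qed

text \<open>Elements of a further prime order \<open>s\<close> centralise the chief factor, else
  they would fix points of both radicals. One of them fixes a nontrivial point of the centre of
  \<open>R\<close>; averaging that point over \<open>x0\<close> and \<open>y0\<close>, which commute
  with it modulo \<open>F\<close>, leaves a point fixed by elements of orders \<open>s\<close> and
  \<open>q\<close> that commute.\<close>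

lemma chief_over_F_cyclic:
  assumes M: "subgroup M G" "invariant (carrier G) M" "F \<subset> M" and q: "prime q" "q \<noteq> r" "q \<noteq> p"
    and exM: "\<And>x. x \<in> M \<Longrightarrow> x [^] q \<in> F" and coM: "\<And>x y. x \<in> M \<Longrightarrow> y \<in> M \<Longrightarrow> cnj x y \<otimes> inv y \<in> F"
    and minM: "\<And>N. subgroup N G \<Longrightarrow> invariant (carrier G) N \<Longrightarrow> F \<subseteq> N \<Longrightarrow> N \<subseteq> M \<Longrightarrow> N = F \<or> N = M"
    and xy: "x0 \<in> M" "y0 \<in> M" "indep q x0 y0"
  shows False
proof -
  obtain s where s: "pr s" "s \<noteq> q" "s \<noteq> r" "s \<noteq> p" using fourth_prime by blast
  have sp: "prime s" using s pr_prime by blast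
  have centr: "cnj b m \<otimes> inv m \<in> F" if b: "b \<in> carrier G" "ord b = s" and m: "m \<in> M" for b m
  proof (rule ccontr)
    assume n: "cnj b m \<otimes> inv m \<notin> F"
    have "\<exists>v\<in>R. v \<noteq> \<one> \<and> commutes b v"
      by (rule chief_fixed_by_noncommuting[OF M q exM coM minM xy b sp s(2-4) m n])
    moreover have "\<exists>v\<in>P. v \<noteq> \<one> \<and> commutes b v"
      by (rule two_radicals.chief_fixed_by_noncommuting[OF swap, unfolded swap_F, OF M q(1,3,2) exM coM minM xy b sp s(2,4,3) m n])
    ultimately show False using fixes_both_radicals[OF b sp s(3,4)] by blast
  qed
  obtain V act where V: "subgroup V G" "invariant (carrier G) V" "V \<noteq> {\<one>}" "V \<subseteq> R"
    and ga: "good_action (G Mod F) (G\<lparr>carrier := V\<rparr> Mod {\<one>}) act r"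
    and car: "carrier (G\<lparr>carrier := V\<rparr> Mod {\<one>}) = (\<lambda>v. {\<one>} #> v) ` V"
    and iff: "\<And>g v. g \<in> carrier G \<Longrightarrow> v \<in> V \<Longrightarrow> act (F #> g) ({\<one>} #> v) = {\<one>} #> v \<longleftrightarrow> commutes g v"
    using centre_action by metis
  have Vc: "V \<subseteq> carrier G" using V(1) subgroup.subset by blast
  interpret GA: good_action "G Mod F" "G\<lparr>carrier := V\<rparr> Mod {\<one>}" act r by (rule ga)
  interpret h: group_hom G "G Mod F" "\<lambda>x. F #> x" by (rule good_quotient(2)[OF F_subgroup F_invariant])
  let ?h = "\<lambda>x. F #> x"
  have nF: "\<not> l dvd card F" if "prime l" "l \<noteq> r" "l \<noteq> p" for l using F_primes that by blast
  have hcnj: "GA.K.cnj (?h g) (?h x) = ?h (cnj g x)" if "g \<in> carrier G" "x \<in> carrier G" for g x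
    using that by (simp add: GA.K.cnj_def cnj_def h.hom_mult h.hom_inv del: mult_FactGroup)
  have hcom: "GA.K.commutes (?h g) (?h x)" if gx: "g \<in> carrier G" "x \<in> carrier G" "cnj g x \<otimes> inv x \<in> F" for g x
  proof -
    have "?h (cnj g x) = ?h x" using rcoset_eq_iff[OF F_subgroup] gx by simp
    then show ?thesis using hcnj[OF gx(1,2)] GA.K.cnj_eq_iff h.hom_closed gx by metis
  qed
  have x0: "x0 \<in> carrier G" "ord x0 = q" and y0: "y0 \<in> carrier G" "ord y0 = q" and cxy: "commutes x0 y0"
    and ne: "\<And>i::nat. y0 \<noteq> x0 [^] i" using xy(3) by (auto simp: indep_def)
  have hord: "GA.K.ord (?h g) = l" if "g \<in> carrier G" "ord g = l" "prime l" "l \<noteq> r" "l \<noteq> p" for g l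
    using quotient_ord_coprime[OF F_subgroup F_invariant that(1)] prime_imp_coprime[OF that(3) nF[OF that(3-5)]] that(2) by simp
  \<comment> \<open>If \<open>y0\<close> became a power of \<open>x0\<close> modulo
    \<open>F\<close>, their quotient would be an element of \<open>F\<close> with order dividing
    \<open>q\<close>, hence trivial.\<close>
  have ind: "GA.K.indep q (?h x0) (?h y0)"
  proof -
    have "?h y0 \<noteq> ?h x0 [^]\<^bsub>G Mod F\<^esub> i" for i :: nat
    proof
      assume "?h y0 = ?h x0 [^]\<^bsub>G Mod F\<^esub> i"
      then have "?h y0 = ?h (x0 [^] i)" using h.hom_nat_pow[OF x0(1), of i] by simp
      then have z: "y0 \<otimes> inv (x0 [^] i) \<in> F" using rcoset_eq_iff[OF F_subgroup] x0 y0 by simp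
      let ?z = "y0 \<otimes> inv (x0 [^] i)"
      have zc: "?z \<in> carrier G" using x0 y0 by simp
      have "commutes y0 (inv (x0 [^] i))" using cxy x0 y0 by (intro commutes_inv commutes_pow commutes_sym[OF cxy]) auto
      then have "?z [^] q = y0 [^] q \<otimes> inv (x0 [^] i) [^] q" using x0 y0 by (intro pow_mult_commutes) auto
      also have "inv (x0 [^] i) [^] q = inv ((x0 [^] q) [^] i)" using x0(1) by (simp add: nat_pow_inv nat_pow_pow mult.commute)
      finally have "?z [^] q = \<one>" using x0 y0 pow_ord_eq_1[OF x0(1)] pow_ord_eq_1[OF y0(1)] by simp
      then have "ord ?z dvd q" using pow_eq_id zc by blast
      moreover have "ord ?z dvd card F" using ord_dvd_card[OF F_subgroup z] .
      ultimately have "ord ?z = 1" using nF[OF q] q(1) by (metis prime_nat_iff)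
      then have "?z = \<one>" using ord_eq_1 zc by blast
      then have "y0 = x0 [^] i" using x0 y0 by (metis inv_closed inv_equality inv_inv nat_pow_closed)
      then show False using ne by blast
    qed
    moreover have "GA.K.commutes (?h x0) (?h y0)"
      using hcom[OF x0(1) y0(1) commutes_imp_mem[OF F_subgroup x0(1) y0(1) cxy]] .
    ultimately show ?thesis
      using hord[OF x0 q] hord[OF y0 q] h.hom_closed x0 y0 by (simp add: GA.K.indep_def)
  qed
  \<comment> \<open>An independent pair of order \<open>s\<close> in \<open>G\<close> is the source
    of an element \<open>b\<close> of order \<open>s\<close> with a nontrivial fixed point in
    \<open>V\<close>.\<close>
  obtain e1 e2 where e12: "indep s e1 e2" using indep_exists[OF s(1)] by blast
  have ec: "e1 \<in> carrier G" "e2 \<in> carrier G" using e12 by (auto simp: indep_def)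
  have invV: "invariant {e1, e2} V" using V(2) ec by (auto intro: invariant_mono)
  obtain b v where b: "b \<in> carrier G" "ord b = s" and v: "v \<in> V" "v \<noteq> \<one>" "commutes b v"
    using indep_fixes_R[OF e12 sp s(3) V(1,4,3) invV] by metis
  have vQ: "{\<one>} #> v \<in> carrier (G\<lparr>carrier := V\<rparr> Mod {\<one>})" using car v by blast
  have vc: "v \<in> carrier G" using v Vc by blast
  have v1: "{\<one>} #> v \<noteq> \<one>\<^bsub>G\<lparr>carrier := V\<rparr> Mod {\<one>}\<^esub>" using v(2) vc by (auto simp: r_coset_def)
  have bv: "act (?h b) ({\<one>} #> v) = {\<one>} #> v" using iff[OF b(1) v(1)] v(3) by simp
  have hb: "?h b \<in> carrier (G Mod F)" using b h.hom_closed by blast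
  have bx: "GA.K.commutes (?h b) (?h x0)" "GA.K.commutes (?h b) (?h y0)"
    using hcom[OF b(1) x0(1) centr[OF b xy(1)]] hcom[OF b(1) y0(1) centr[OF b xy(2)]] by blast+
  obtain e w where e: "e = ?h y0 \<or> (\<exists>i::nat. e = ?h x0 \<otimes>\<^bsub>G Mod F\<^esub> ?h y0 [^]\<^bsub>G Mod F\<^esub> i)"
      "e \<in> carrier (G Mod F)" "GA.K.ord e = q" and w: "w \<in> carrier (G\<lparr>carrier := V\<rparr> Mod {\<one>})"
      "w \<noteq> \<one>\<^bsub>G\<lparr>carrier := V\<rparr> Mod {\<one>}\<^esub>" "act e w = w"
    and wc: "\<forall>c\<in>carrier (G Mod F). GA.K.commutes c (?h x0) \<longrightarrow> GA.K.commutes c (?h y0) \<longrightarrow>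
      act c ({\<one>} #> v) = {\<one>} #> v \<longrightarrow> act c w = w"
    using GA.noncyclic_fixes[OF q(1,2) ind vQ v1] by (elim exE conjE) (rule that; assumption)
  have bw: "act (?h b) w = w" using wc[rule_format, OF hb bx bv] .
  have be: "GA.K.commutes (?h b) e"
    using e(1) bx hb h.hom_closed[OF x0(1)] h.hom_closed[OF y0(1)] by (auto intro!: GA.K.commutes_mult GA.K.commutes_pow simp del: mult_FactGroup)
  show False
    using GA.fixed_commuting[OF hb e(2) be hord[OF b sp s(3,4)] e(3) sp q(1) s(3) q(2) s(2) w(1) bw w(3)] w(2) by blast
qed

end

section \<open>Central elements modulo the radicals\<close>

context two_radicals
begin

definition central_mod :: "'a \<Rightarrow> bool" where
  "central_mod a \<longleftrightarrow> a \<in> carrier G \<and> a \<notin> F \<and> (\<forall>g\<in>carrier G. cnj g a \<otimes> inv a \<in> F)"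

lemma not_dvd_card_F: "prime l \<Longrightarrow> l \<noteq> r \<Longrightarrow> l \<noteq> p \<Longrightarrow> \<not> l dvd card F"
  using F_primes by blast

lemma invariant_F: "S \<subseteq> carrier G \<Longrightarrow> invariant S F"
  using F_invariant by (rule invariant_mono)

lemma chief_central:
  assumes M: "subgroup M G" "invariant (carrier G) M" "F \<subset> M" and t: "prime t"
    and exM: "\<And>x. x \<in> M \<Longrightarrow> x [^] t \<in> F" and coM: "\<And>x y. x \<in> M \<Longrightarrow> y \<in> M \<Longrightarrow> cnj x y \<otimes> inv y \<in> F"
    and minM: "\<And>N. subgroup N G \<Longrightarrow> invariant (carrier G) N \<Longrightarrow> F \<subseteq> N \<Longrightarrow> N \<subseteq> M \<Longrightarrow> N = F \<or> N = M"
  shows "t \<noteq> r \<and> t \<noteq> p \<and> (\<exists>e. central_mod e \<and> ord e = t)"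
proof -
  have Mc: "M \<subseteq> carrier G" using M(1) subgroup.subset by blast
  have tr: "t \<noteq> r" "t \<noteq> p" using chief_over_F[OF M t exM coM minM] by blast+
  have ni: "\<not> (\<exists>x\<in>M. \<exists>y\<in>M. indep t x y)"
    using chief_over_F_cyclic[OF M t tr exM coM minM] by blast
  obtain e where e: "e \<in> M" "ord e = t" "e \<notin> F" "\<And>g. g \<in> M \<Longrightarrow> \<exists>i::nat. g \<otimes> inv (e [^] i) \<in> F"
    using elementary_quotient[OF F_subgroup M(1) _ _ invariant_F[OF Mc] t not_dvd_card_F[OF t tr] exM coM] M(3) ni
    by blast
  have ec: "e \<in> carrier G" using e(1) Mc by blast
  have "cnj g e \<otimes> inv e \<in> F" if g: "g \<in> carrier G" for g
  proof -
    have "cnj g e \<in> M" using M(2) g e(1) by (simp add: invariant_def)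
    then obtain k :: nat where "cnj g e \<otimes> inv (e [^] k) \<in> F" using e(4) by blast
    then show ?thesis
      using cyclic_section_central[OF F_subgroup invariant_F g ec e(3,2) t] ec g by blast
  qed
  then show ?thesis using tr e ec unfolding central_mod_def by blast
qed

lemma central_shift:
  assumes a: "central_mod a" and f: "f \<in> F" shows "central_mod (f \<otimes> a)"
proof -
  have c: "a \<in> carrier G" "f \<in> carrier G" using a f Fc by (auto simp: central_mod_def)
  have "f \<otimes> a \<notin> F"
  proof
    assume "f \<otimes> a \<in> F"
    then have "inv f \<otimes> (f \<otimes> a) \<in> F" using f F_subgroup by (meson subgroup.m_closed subgroup.m_inv_closed)
    then show False using c a by (simp add: central_mod_def)
  qed
  moreover have "cnj g (f \<otimes> a) \<otimes> inv (f \<otimes> a) \<in> F" if g: "g \<in> carrier G" for g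
  proof -
    have "cnj g (f \<otimes> a) \<otimes> inv (f \<otimes> a) = cnj g f \<otimes> (cnj g a \<otimes> inv a) \<otimes> inv f"
      using c g by (simp add: cnj_mult inv_mult_group m_assoc)
    moreover have "cnj g f \<in> F" using F_invariant g f by (simp add: invariant_def)
    moreover have "cnj g a \<otimes> inv a \<in> F" using a g by (simp add: central_mod_def)
    ultimately show ?thesis using f F_subgroup by (simp add: subgroup.m_closed subgroup.m_inv_closed)
  qed
  ultimately show ?thesis using c unfolding central_mod_def by simp
qed

lemma central_triple:
  assumes a: "central_mod a" "ord a = q" "prime q" and x: "x \<in> carrier G" "x \<notin> F" "ord x = s" "prime s"
    and y: "y \<in> carrier G" "y \<notin> F" "ord y = t" "prime t" and ne: "s \<noteq> t" "s \<noteq> q" "t \<noteq> q"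
    and c: "cnj x y \<otimes> inv y \<in> F"
  shows False
  using triple_modulo[OF F_subgroup F_invariant x(1) y(1) _ x(2) y(2) _ x(3) y(3) a(2) x(4) y(4) a(3) ne c] a(1) x(1) y(1)
  unfolding central_mod_def by blast

text \<open>Realise the pair \<open>s\<close>, \<open>r\<close> by commuting \<open>x\<close> and
  \<open>y\<close>. If \<open>y\<close> survived modulo \<open>F\<close>, then \<open>x\<close>,
  \<open>y\<close> and the central \<open>a\<close> would be a triple there; so \<open>y\<close>
  lies in \<open>F\<close>, and as an \<open>r\<close>-element in \<open>R\<close>.\<close>

lemma central_fixes_R:
  assumes a: "central_mod a" "ord a = q" "pr q" "q \<noteq> r" and s: "pr s" "s \<noteq> q" "s \<noteq> r" "s \<noteq> p"
  shows "\<exists>b c. b \<in> carrier G \<and> ord b = s \<and> c \<in> R \<and> c \<noteq> \<one> \<and> commutes b c"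
proof -
  obtain x y where xy: "x \<in> carrier G" "ord x = s" "y \<in> carrier G" "ord y = r" "commutes x y"
    using linked_pair[OF s(1) r s(3)] by metis
  have "x \<notin> F" using ord_dvd_card[OF F_subgroup, of x] xy(2) not_dvd_card_F[OF pr_prime[OF s(1)] s(3,4)] by blast
  then have yF: "y \<in> F"
    using central_triple[OF a(1,2) pr_prime[OF a(3)] xy(1) _ xy(2) pr_prime[OF s(1)] xy(3) _ xy(4) r_prime s(3,2) a(4)[symmetric]
        commutes_imp_mem[OF F_subgroup xy(1,3,5)]] by blast
  have "y [^] (r ^ 1) = \<one>" using pow_ord_eq_1[OF xy(3)] xy(4) by simp
  then have "y \<in> R" by (rule F_pow_R[OF yF])
  moreover have "y \<noteq> \<one>" using xy(4) r_prime by (metis not_prime_1 ord_id)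
  ultimately show ?thesis using xy by blast
qed

text \<open>Inside its coset of \<open>F\<close> the given element is moved to one that commutes
  with an independent pair of a further prime order \<open>s\<close>. By
  \<open>indep_centraliser_R\<close> and its twin this \<open>a\<close> has no fixed points on
  either radical.\<close>

lemma central_regular:
  assumes a0: "central_mod a0" "ord a0 = q" and q: "pr q" "q \<noteq> r" "q \<noteq> p"
  shows "\<exists>a. central_mod a \<and> ord a = q \<and> (\<forall>f\<in>F. commutes a f \<longrightarrow> f = \<one>)"
proof -
  have qp: "prime q" using q pr_prime by blast
  obtain s where s: "pr s" "s \<noteq> q" "s \<noteq> r" "s \<noteq> p" using fourth_prime by blast
  have sp: "prime s" using s pr_prime by blast
  obtain x y where ind: "indep s x y" using indep_exists[OF s(1)] by blast
  then have x: "x \<in> carrier G" "ord x = s" and y: "y \<in> carrier G" "ord y = s" and xy: "commutes x y"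
    by (auto simp: indep_def)
  have a0c: "a0 \<in> carrier G" "a0 \<notin> F" using a0 by (auto simp: central_mod_def)
  have a0q: "a0 [^] q \<in> F" using pow_ord_eq_1[OF a0c(1)] a0(2) subgroup.one_closed[OF F_subgroup] by simp
  note nds = not_dvd_card_F[OF sp s(3,4)]
  have comm: "cnj x a0 \<otimes> inv a0 \<in> F" "cnj y a0 \<otimes> inv a0 \<in> F" using a0(1) x y unfolding central_mod_def by blast+
  obtain a where a: "a \<in> carrier G" "ord a = q" "commutes x a" "commutes y a" "a \<otimes> inv a0 \<in> F"
    using lift_commutes_two[OF F_subgroup F_invariant x sp nds y sp nds xy a0c a0q qp not_dvd_card_F[OF qp q(2,3)] comm] by blast
  have "a = (a \<otimes> inv a0) \<otimes> a0" using a a0c by (simp add: m_assoc)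
  then have cm: "central_mod a" using central_shift[OF a0(1) a(5)] by simp
  have aR: "f = \<one>" if "f \<in> R" "commutes a f" for f
    using indep_centraliser_R[OF ind sp s(3) a(1,2) qp q(2) s(2)[symmetric] commutes_sym[OF a(3)] commutes_sym[OF a(4)] that] .
  have aP: "f = \<one>" if "f \<in> P" "commutes a f" for f
    using indep_centraliser_P[OF ind sp s(4) a(1,2) qp q(3) s(2)[symmetric] commutes_sym[OF a(3)] commutes_sym[OF a(4)] that] .
  show ?thesis using F_centraliser[OF a(1) aR aP] cm a(2) by blast
qed

end

text \<open>\<open>regular\<close> says that the centraliser of \<open>a\<close> meets
  \<open>F\<close> trivially; with centrality modulo \<open>F\<close> this makes \<open>B\<close> a
  complement of \<open>F\<close>.\<close>

locale central_element = two_radicals +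
  fixes a q
  assumes q: "pr q" "q \<noteq> r" "q \<noteq> p" and a: "central_mod a" "ord a = q"
    and regular: "\<And>f. f \<in> F \<Longrightarrow> commutes a f \<Longrightarrow> f = \<one>"
begin

definition B where "B = cent {a}"

lemma q_prime: "prime q" using q pr_prime by blast

lemma ac: "a \<in> carrier G" using a by (simp add: central_mod_def)

lemma B_subgroup: "subgroup B G"
  unfolding B_def using ac by (intro cent_subgroup) auto

lemma Bc: "B \<subseteq> carrier G" using B_subgroup subgroup.subset by blast

lemma B_commutes: "x \<in> B \<Longrightarrow> commutes a x"
  by (auto simp: B_def cent_def intro: commutes_sym)

lemma mem_B: "x \<in> carrier G \<Longrightarrow> commutes a x \<Longrightarrow> x \<in> B"
  by (auto simp: B_def cent_def intro: commutes_sym)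

lemma B_Int_F: "x \<in> B \<Longrightarrow> x \<in> F \<Longrightarrow> x = \<one>"
  using regular B_commutes by blast

text \<open>The map sending \<open>f\<close> to its commutator with \<open>a\<close> takes
  \<open>F\<close> into \<open>F\<close> by centrality, is injective by \<open>regular\<close>, and
  is therefore onto.\<close>

lemma coset_conjugate:
  assumes z: "z \<in> carrier G" "z \<otimes> inv a \<in> F" shows "\<exists>f\<in>F. z = cnj f a"
proof -
  let ?g = "\<lambda>f. cnj f a \<otimes> inv a"
  have inj: "inj_on ?g F"
  proof (rule inj_onI)
    fix f h assume fh: "f \<in> F" "h \<in> F" "?g f = ?g h"
    have c: "f \<in> carrier G" "h \<in> carrier G" using fh Fc by auto
    have "cnj f a = cnj h a" using fh(3) c ac by simp
    then have "cnj (inv h) (cnj f a) = a" using c ac by simp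
    then have "cnj (inv h \<otimes> f) a = a" using c ac by (simp add: cnj_cnj)
    then have "commutes (inv h \<otimes> f) a" using cnj_eq_iff c ac by simp
    then have "inv h \<otimes> f = \<one>"
      using regular[of "inv h \<otimes> f"] fh F_subgroup commutes_sym by (simp add: subgroup.m_closed subgroup.m_inv_closed)
    then have "inv (inv h) = f" using c by (intro inv_equality) (auto simp: inv_comm)
    then show "f = h" using c by simp
  qed
  have "?g ` F \<subseteq> F"
  proof
    fix x assume "x \<in> ?g ` F"
    then obtain f where f: "f \<in> F" "x = ?g f" by blast
    have "f \<in> carrier G" using f Fc by blast
    then show "x \<in> F" using a(1) f(2) unfolding central_mod_def by blast
  qed
  then have "?g ` F = F" using inj finite_subgroup[OF F_subgroup] by (intro endo_inj_surj) auto
  then obtain f where f: "f \<in> F" "z \<otimes> inv a = ?g f" using z(2) by auto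
  have "f \<in> carrier G" using f Fc by blast
  then have "z = cnj f a" using f(2) z(1) ac by simp
  then show ?thesis using f(1) by blast
qed

text \<open>A Frattini argument: all conjugates of \<open>a\<close> lie in one coset of
  \<open>F\<close>, on which \<open>F\<close> is already transitive.\<close>

lemma decompose:
  assumes g: "g \<in> carrier G" shows "\<exists>f\<in>F. \<exists>h\<in>B. g = f \<otimes> h"
proof -
  have "cnj g a \<otimes> inv a \<in> F" using a(1) g unfolding central_mod_def by blast
  then obtain f where f: "f \<in> F" "cnj g a = cnj f a" using coset_conjugate g ac by (metis cnj_closed)
  have fc: "f \<in> carrier G" using f Fc by blast
  have "cnj (inv f) (cnj g a) = a" using f fc ac by simp
  then have "cnj (inv f \<otimes> g) a = a" using fc g ac by (simp add: cnj_cnj)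
  then have "commutes (inv f \<otimes> g) a" using cnj_eq_iff fc g ac by simp
  then have "inv f \<otimes> g \<in> B" using mem_B fc g commutes_sym by simp
  moreover have "g = f \<otimes> (inv f \<otimes> g)" using fc g by simp
  ultimately show ?thesis using f(1) by blast
qed

text \<open>Coprimeness makes \<open>y\<close> commute with some element of the coset of
  \<open>a\<close>, and that element is conjugate to \<open>a\<close> under
  \<open>F\<close>.\<close>

lemma conjugate_into_B:
  assumes y: "y \<in> carrier G" "ord y = u" "prime u" "u \<noteq> r" "u \<noteq> p"
  shows "\<exists>f\<in>F. cnj f y \<in> B"
proof -
  have "cnj y a \<otimes> inv a \<in> F" using a(1) y unfolding central_mod_def by blast
  then obtain n where n: "n \<in> F" "commutes y (n \<otimes> a)"
    using lift_commutes[OF F_subgroup invariant_F y(1-3) not_dvd_card_F[OF y(3-5)] ac] y(1) by blast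
  have nc: "n \<in> carrier G" using n Fc by blast
  have "(n \<otimes> a) \<otimes> inv a \<in> F" using n nc ac by (simp add: m_assoc)
  then obtain f where f: "f \<in> F" "n \<otimes> a = cnj f a" using coset_conjugate nc ac by (metis m_closed)
  have fc: "f \<in> carrier G" using f Fc by blast
  have "commutes y (cnj f a)" using n f by simp
  then have "commutes (cnj (inv f) y) (cnj (inv f) (cnj f a))"
    using cnj_commutes_iff[of "inv f" y "cnj f a"] fc y ac by (metis cnj_closed inv_closed)
  then have "commutes (cnj (inv f) y) a" using fc ac by simp
  then have "cnj (inv f) y \<in> B" using mem_B fc y commutes_sym by simp
  then show ?thesis using f F_subgroup by (meson subgroup.m_inv_closed)
qed

text \<open>Otherwise \<open>a\<close> and \<open>z\<close> are an independent pair commuting with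
  \<open>b\<close>, which excludes a nontrivial fixed point of \<open>b\<close> in
  \<open>R\<close>.\<close>

lemma centralised_order_q:
  assumes b: "b \<in> B" "ord b = s" "prime s" "s \<noteq> q" "s \<noteq> r" and c: "c \<in> R" "c \<noteq> \<one>" "commutes b c"
    and z: "z \<in> B" "ord z = q" "commutes b z"
  shows "\<exists>i::nat. z = a [^] i"
proof (rule ccontr)
  assume n: "\<not> ?thesis"
  have zc: "z \<in> carrier G" and bc: "b \<in> carrier G" using z b Bc by auto
  have "indep q a z" using n ac a(2) zc z(2) B_commutes[OF z(1)] by (auto simp: indep_def)
  then show False
    using indep_centraliser_R[OF _ q_prime q(2) bc b(2,3,5,4) commutes_sym[OF B_commutes[OF b(1)]] z(3) c(1,3)] c(2) by blast
qed

text \<open>Some element of order \<open>q\<close> in the span of \<open>x\<close> and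
  \<open>a\<close> fixes a nontrivial point of \<open>R\<close>. It is not \<open>a\<close>, by
  regularity, so it is \<open>x\<close> times a power of \<open>a\<close>; the shift makes it
  conjugate to \<open>x\<close> under \<open>B\<close>.\<close>

lemma fixes_R_of_shift:
  assumes x: "x \<in> B" "ord x = q" and g: "g \<in> B" and z: "z = a [^] (l::nat)" "z \<noteq> \<one>" "cnj g x = x \<otimes> z"
  shows "\<exists>v\<in>R. v \<noteq> \<one> \<and> commutes x v"
proof -
  have xc: "x \<in> carrier G" and gc: "g \<in> carrier G" using x g Bc by auto
  have zc: "z \<in> carrier G" using z ac by simp
  have gz: "commutes g z" using z(1) commutes_pow[OF commutes_sym[OF B_commutes[OF g]] gc ac] by simp
  obtain k :: nat where k: "z [^] k = a" using prime_ord_pow_eq(2)[OF q_prime a(2) ac] z by metis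
  have "a \<noteq> x [^] m" for m :: nat
  proof
    assume am: "a = x [^] m"
    have "x [^] m \<noteq> \<one>" using am a(2) q_prime by (metis not_prime_1 ord_id)
    then obtain m' :: nat where "(x [^] m) [^] m' = x" using prime_ord_pow_eq(2)[OF q_prime x(2) xc] by blast
    then have xa: "x = a [^] m'" using am by simp
    have "commutes g (a [^] m')" using commutes_pow[OF commutes_sym[OF B_commutes[OF g]] gc ac] .
    then have "commutes g x" using xa by simp
    then have "cnj g x = x" using cnj_eq_iff gc xc by blast
    then have "x = x \<otimes> z" using z(3) by simp
    then show False using z(2) l_cancel_one'[OF xc zc] by blast
  qed
  then have ind: "indep q x a" using xc ac x a(2) commutes_sym[OF B_commutes[OF x(1)]] by (auto simp: indep_def)
  have invR: "invariant {x, a} R" using R(2) xc ac by (auto intro: invariant_mono)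
  obtain e w where e: "e = a \<or> (\<exists>m::nat. e = x \<otimes> a [^] m)" and w: "w \<in> R" "w \<noteq> \<one>" "commutes e w"
    using indep_fixes_R[OF ind q_prime q(2) R(1) subset_refl R(4) invR] by metis
  have wc: "w \<in> carrier G" using w Rc by blast
  have "e \<noteq> a" using regular[of w] w R_sub_F by blast
  then obtain m :: nat where m: "e = x \<otimes> a [^] m" using e by blast
  \<comment> \<open>Each application of \<open>g\<close> multiplies \<open>x\<close> by
    \<open>z\<close>, and \<open>z [^] k = a\<close>; so \<open>k * m\<close> applications produce
    \<open>x \<otimes> a [^] m\<close>.\<close>
  define h where "h = g [^] (k * m)"
  have hc: "h \<in> carrier G" using gc by (simp add: h_def)
  have "cnj h x = x \<otimes> z [^] (k * m)"
    unfolding h_def by (rule cnj_pow_shift[OF gc xc zc z(3) gz])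
  also have "z [^] (k * m) = a [^] m" using k zc by (metis nat_pow_pow)
  finally have "commutes (cnj h x) w" using m w(3) by simp
  then have "commutes (cnj (inv h) (cnj h x)) (cnj (inv h) w)"
    using cnj_commutes_iff[of "inv h" "cnj h x" w] hc xc wc by (metis cnj_closed inv_closed)
  then have "commutes x (cnj (inv h) w)" using hc xc by simp
  moreover have "cnj (inv h) w \<in> R" using R(2) hc w by (simp add: invariant_def)
  moreover have "cnj (inv h) w \<noteq> \<one>" using w(2) hc wc by (metis cnj_inv_cnj(2) cnj_one)
  ultimately show ?thesis by blast
qed

lemma cswap: "central_element G P R p r j i a q"
proof -
  interpret s: two_radicals G P R p r j i by (rule swap)
  show ?thesis
    by unfold_locales (use q a regular swap_F in \<open>auto simp: s.central_mod_def central_mod_def\<close>)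
qed

lemma no_shift:
  assumes "x \<in> B" "ord x = q" "g \<in> B" "z = a [^] (l::nat)" "z \<noteq> \<one>" "cnj g x = x \<otimes> z"
  shows False
proof -
  have "\<exists>v\<in>R. v \<noteq> \<one> \<and> commutes x v" using fixes_R_of_shift[OF assms] .
  moreover have "\<exists>v\<in>P. v \<noteq> \<one> \<and> commutes x v"
    using central_element.fixes_R_of_shift[OF cswap] assms unfolding central_element.B_def[OF cswap] B_def by blast
  ultimately show False using fixes_both_radicals[of x q] assms(1,2) Bc q_prime q(2,3) by blast
qed

text \<open>A minimal counterexample \<open>D\<close> has class at most two over the subgroup
  \<open>D0\<close> centralised by \<open>b\<close>. A commutator of \<open>b\<close> then has order
  \<open>q\<close>: if it is central in \<open>D\<close>, it lies in an abelian group of exponent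
  \<open>q\<close> normalised by \<open>b\<close>; if not, conjugation shifts it by a power of
  \<open>a\<close>. Both are excluded.\<close>

lemma normal_q_subgroup_centralised:
  assumes s: "prime s" "s \<noteq> q" "s \<noteq> r" "s \<noteq> p" and b: "b \<in> B" "ord b = s" and c: "c \<in> R" "c \<noteq> \<one>" "commutes b c"
    and Q: "subgroup Q G" "Q \<subseteq> B" "invariant B Q" "card Q = q ^ k" and x: "x \<in> Q"
  shows "commutes b x"
proof (rule ccontr)
  assume nx: "\<not> commutes b x"
  define cen where "cen N \<longleftrightarrow> (\<forall>x\<in>N. commutes b x)" for N
  let ?P = "\<lambda>N. subgroup N G \<and> invariant B N \<and> N \<subseteq> Q \<and> \<not> cen N"
  have "?P Q" using Q x nx by (auto simp: cen_def)
  then obtain D where D: "?P D" and least: "\<And>N. ?P N \<Longrightarrow> card D \<le> card N"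
    using ex_has_least_nat[of ?P Q card] by blast
  have sD: "subgroup D G" and iD: "invariant B D" and DQ: "D \<subseteq> Q" and ncD: "\<not> cen D" using D by auto
  have DB: "D \<subseteq> B" using DQ Q by blast
  have Dc: "D \<subseteq> carrier G" using DB Bc by blast
  have bc: "b \<in> carrier G" using b Bc by blast
  have bs: "b [^] s = \<one>" using b(2) bc pow_ord_eq_1 by blast
  have smaller: "cen N" if "subgroup N G" "invariant B N" "N \<subset> D" for N
  proof (rule ccontr)
    assume "\<not> cen N"
    then have "card D \<le> card N" using least that DQ by blast
    then show False using that(3) finite_subgroup[OF sD] by (metis psubset_card_mono leD)
  qed
  have bD: "cnj b y \<in> D" if "y \<in> D" for y using iD b(1) that by (simp add: invariant_def)
  have qelt: "ord y dvd q ^ k" if "y \<in> D" for y using ord_dvd_card[OF Q(1), of y] that DQ Q(4) by auto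
  have D1: "D \<noteq> {\<one>}"
  proof
    assume "D = {\<one>}"
    then show False using ncD bc by (simp add: cen_def)
  qed
  obtain D0 t where D0: "subgroup D0 G" "invariant B D0" "D0 \<subset> D" and t: "prime (t::nat)"
    and exD: "\<And>x. x \<in> D \<Longrightarrow> x [^] t \<in> D0" and coD: "\<And>x y. x \<in> D \<Longrightarrow> y \<in> D \<Longrightarrow> cnj x y \<otimes> inv y \<in> D0"
    by (rule maximal_invariant_below[OF solv Bc DB sD iD D1]) auto
  have D0c: "D0 \<subseteq> carrier G" using D0(3) Dc by blast
  have tq: "t = q"
  proof -
    obtain y where y: "y \<in> D" "y \<notin> D0" using D0(3) by blast
    have yc: "y \<in> carrier G" using y Dc by blast
    have "y [^] ord y \<in> D0" using yc subgroup.one_closed[OF D0(1)] by simp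
    then have "t dvd ord y" using pow_mem_imp_dvd[OF D0(1) t yc y(2) exD[OF y(1)]] by blast
    then have "t dvd q ^ k" using qelt[OF y(1)] dvd_trans by blast
    then show ?thesis using t q_prime prime_dvd_power primes_dvd_imp_eq by blast
  qed
  have cen0: "commutes b w" if "w \<in> D0" for w using smaller[OF D0] that by (simp add: cen_def)
  \<comment> \<open>Coprime action: if \<open>b\<close> fixes its commutator with \<open>y\<close>,
    that commutator has order dividing \<open>s\<close>, yet lies in a
    \<open>q\<close>-group.\<close>
  have shift: "commutes b y" if y: "y \<in> D" and n: "commutes b (inv y \<otimes> cnj b y)" for y
  proof -
    have yc: "y \<in> carrier G" using y Dc by blast
    define n where "n = inv y \<otimes> cnj b y"
    have nD: "n \<in> D" using y bD sD by (simp add: n_def subgroup.m_closed subgroup.m_inv_closed)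
    have nc: "n \<in> carrier G" using nD Dc by blast
    have bxy: "cnj b y = y \<otimes> n" using yc bc by (simp add: n_def)
    have "y = y \<otimes> n [^] s" using cnj_pow_shift[OF bc yc nc bxy, of s] n n_def bs yc by simp
    then have "n [^] s = \<one>" using l_cancel_one'[OF yc nat_pow_closed[OF nc]] by blast
    then have "ord n dvd s" using pow_eq_id nc by blast
    moreover have "coprime s (q ^ k)" using s(1,2) q_prime primes_coprime[of s q] by simp
    ultimately have "ord n = 1" using qelt[OF nD] by (metis coprime_common_divisor_nat)
    then have "n = \<one>" using ord_eq_1 nc by blast
    then have "cnj b y = y" using bxy yc by simp
    then show ?thesis using cnj_eq_iff bc yc by blast
  qed
  \<comment> \<open>In the manner of the three subgroups lemma: \<open>b\<close> centralises
    \<open>D0\<close>, so all commutators of \<open>D\<close> with \<open>b\<close> centralise it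
    too. Were the centraliser of \<open>D0\<close> in \<open>D\<close> proper, \<open>b\<close>
    would centralise it by minimality, hence these commutators, and then \<open>D\<close> by
    \<open>shift\<close>.\<close>
  have D0cent: "commutes y w" if y: "y \<in> D" and w: "w \<in> D0" for y w
  proof -
    define C where "C = D \<inter> cent D0"
    have Cs: "subgroup C G" unfolding C_def using sD cent_subgroup[OF D0c] by (rule subgroups_Inter_pair)
    have Ci: "invariant B C"
    proof -
      have "commutes (cnj g z) v" if gz: "g \<in> B" "z \<in> C" "v \<in> D0" for g z v
      proof -
        have cc: "g \<in> carrier G" "z \<in> carrier G" "v \<in> carrier G" using gz Bc Dc D0c by (auto simp: C_def)
        have "inv g \<in> B" using gz(1) B_subgroup by (simp add: subgroup.m_inv_closed)
        then have "cnj (inv g) v \<in> D0" using D0(2) gz(3) by (simp add: invariant_def)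
        then have "commutes z (cnj (inv g) v)" using gz(2) by (simp add: C_def cent_def)
        then have "commutes (cnj g z) (cnj g (cnj (inv g) v))"
          using cnj_commutes_iff[of g z "cnj (inv g) v"] cc by (metis cnj_closed inv_closed)
        then show ?thesis using cc by simp
      qed
      then show ?thesis using iD Bc Dc by (auto simp: invariant_def C_def cent_def)
    qed
    have nC: "inv z \<otimes> cnj b z \<in> C" if z: "z \<in> D" for z
    proof -
      have zc: "z \<in> carrier G" using z Dc by blast
      have zB: "z \<in> B" using z DB by blast
      have "commutes (inv z \<otimes> cnj b z) v" if v: "v \<in> D0" for v
      proof -
        have vc: "v \<in> carrier G" using v D0c by blast
        have zv: "cnj z v \<in> D0" using D0(2) zB v by (simp add: invariant_def)
        have fixv: "cnj b v = v" using cen0[OF v] cnj_eq_iff bc vc by blast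
        have "cnj (cnj b z) v = cnj (cnj b z) (cnj b v)" using fixv by simp
        also have "\<dots> = cnj b (cnj z v)" using bc zc vc by (simp add: cnj_def inv_mult_group m_assoc)
        also have "\<dots> = cnj z v" using cen0[OF zv] cnj_eq_iff bc zc vc by simp
        finally have e: "cnj (cnj b z) v = cnj z v" .
        have "cnj (inv z \<otimes> cnj b z) v = cnj (inv z) (cnj (cnj b z) v)" using zc bc vc by (simp add: cnj_cnj)
        also have "\<dots> = v" using e zc vc by simp
        finally show ?thesis using cnj_eq_iff zc bc vc by simp
      qed
      moreover have "inv z \<otimes> cnj b z \<in> D" using z bD sD by (simp add: subgroup.m_closed subgroup.m_inv_closed)
      ultimately show ?thesis using Dc by (auto simp: C_def cent_def)
    qed
    have "C = D"
    proof (rule ccontr)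
      assume "C \<noteq> D"
      then have "C \<subset> D" by (auto simp: C_def)
      then have "cen C" using smaller Cs Ci by blast
      then have "cen D" using shift nC by (simp add: cen_def)
      then show False using ncD by blast
    qed
    then show ?thesis using y w by (auto simp: C_def cent_def)
  qed
  obtain x1 where x1: "x1 \<in> D" "\<not> commutes b x1" using ncD by (auto simp: cen_def)
  have x1c: "x1 \<in> carrier G" using x1 Dc by blast
  define y where "y = inv x1 \<otimes> cnj b x1"
  have yD: "y \<in> D" using x1 bD sD by (simp add: y_def subgroup.m_closed subgroup.m_inv_closed)
  have yc: "y \<in> carrier G" using yD Dc by blast
  have nby: "\<not> commutes b y" using shift[OF x1(1)] x1(2) by (auto simp: y_def)
  have bx1: "cnj b x1 = x1 \<otimes> y" using x1c bc by (simp add: y_def)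
  define w where "w = cnj y x1 \<otimes> inv x1"
  have w: "w \<in> D0" using coD[OF yD x1(1)] by (simp add: w_def)
  have wc: "w \<in> carrier G" using w D0c by blast
  have yx: "y \<otimes> x1 = w \<otimes> (x1 \<otimes> y)" using yc x1c by (simp add: w_def cnj_def m_assoc)
  have wx: "w \<otimes> x1 = x1 \<otimes> w" "w \<otimes> y = y \<otimes> w"
    using D0cent[OF x1(1) w] D0cent[OF yD w] by (simp_all add: commutes_def)
  have ynx: "y [^] n \<otimes> x1 = w [^] n \<otimes> (x1 \<otimes> y [^] n)" for n :: nat
  proof (induction n)
    case (Suc n)
    have cwn: "w [^] n \<otimes> y = y \<otimes> w [^] n"
      using commutes_pow[of y w n] wx(2) yc wc by (simp add: commutes_def)
    have "y [^] Suc n \<otimes> x1 = y \<otimes> (y [^] n \<otimes> x1)" using yc x1c by (metis m_assoc nat_pow_Suc2 nat_pow_closed)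
    also have "\<dots> = y \<otimes> w [^] n \<otimes> (x1 \<otimes> y [^] n)" using Suc yc x1c wc by (simp add: m_assoc)
    also have "\<dots> = w [^] n \<otimes> y \<otimes> (x1 \<otimes> y [^] n)" using cwn by simp
    also have "\<dots> = w [^] n \<otimes> (y \<otimes> x1) \<otimes> y [^] n" using yc x1c wc by (simp add: m_assoc)
    also have "\<dots> = w [^] n \<otimes> w \<otimes> (x1 \<otimes> (y \<otimes> y [^] n))" using yx yc x1c wc by (simp add: m_assoc)
    also have "y \<otimes> y [^] n = y [^] Suc n" using yc by (metis nat_pow_Suc2)
    finally show ?case using wc by simp
  qed (use x1c yc in simp)
  \<comment> \<open>The power formula of class two; it applies because the commutator
    \<open>w\<close> of \<open>y\<close> and \<open>x1\<close> commutes with both.\<close>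
  have class2: "(x1 \<otimes> y) [^] n = w [^] (n * (n - 1) div 2) \<otimes> (x1 [^] n \<otimes> y [^] n)" for n :: nat
  proof (induction n)
    case (Suc n)
    let ?m = "n * (n - 1) div 2"
    have cw: "commutes (w [^] n) (x1 [^] n)" using wx(1) wc x1c by (intro commutes_pow2) (auto simp: commutes_def)
    have "(x1 \<otimes> y) [^] Suc n = w [^] ?m \<otimes> (x1 [^] n \<otimes> (y [^] n \<otimes> x1) \<otimes> y)"
      using Suc x1c yc wc by (simp add: m_assoc)
    also have "x1 [^] n \<otimes> (y [^] n \<otimes> x1) = (x1 [^] n \<otimes> w [^] n) \<otimes> (x1 \<otimes> y [^] n)"
      using ynx x1c yc wc by (simp add: m_assoc)
    also have "x1 [^] n \<otimes> w [^] n = w [^] n \<otimes> x1 [^] n" using cw by (simp add: commutes_def)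
    also have "w [^] ?m \<otimes> (w [^] n \<otimes> x1 [^] n \<otimes> (x1 \<otimes> y [^] n) \<otimes> y) =
        (w [^] ?m \<otimes> w [^] n) \<otimes> (x1 [^] Suc n \<otimes> y [^] Suc n)"
      using x1c yc wc by (simp add: m_assoc)
    also have "w [^] ?m \<otimes> w [^] n = w [^] (?m + n)" using wc by (simp add: nat_pow_mult)
    also have "?m + n = Suc n * (Suc n - 1) div 2"
    proof -
      have "even (n * (n - 1))" by (cases n) auto
      then obtain h where h: "n * (n - 1) = 2 * h" by (rule evenE)
      have "Suc n * n = n * (n - 1) + 2 * n" by (cases n) (auto simp: algebra_simps)
      then show ?thesis using h by simp
    qed
    finally show ?case .
  qed (use x1c yc wc in simp)
  \<comment> \<open>Conjugation by \<open>y\<close> multiplies \<open>x1\<close> by \<open>w\<close>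
    but fixes \<open>x1 [^] q\<close>, which lies in \<open>D0\<close>.\<close>
  have wq: "w [^] q = \<one>"
  proof -
    have xq: "x1 [^] q \<in> D0" using exD[OF x1(1)] tq by simp
    have "(x1 \<otimes> w) [^] q = cnj y x1 [^] q"
    proof -
      have "cnj y x1 = w \<otimes> x1" using yc x1c by (simp add: w_def m_assoc)
      then show ?thesis using wx by simp
    qed
    also have "\<dots> = cnj y (x1 [^] q)" using yc x1c by (simp add: cnj_pow)
    also have "\<dots> = x1 [^] q" using D0cent[OF yD xq] cnj_eq_iff yc x1c by simp
    finally have "(x1 \<otimes> w) [^] q = x1 [^] q" .
    moreover have "(x1 \<otimes> w) [^] q = x1 [^] q \<otimes> w [^] q"
      using pow_mult_commutes[of x1 w q] wx(1) x1c wc by (simp add: commutes_def)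
    ultimately show ?thesis using l_cancel_one[OF nat_pow_closed[OF x1c] nat_pow_closed[OF wc]] by metis
  qed
  \<comment> \<open>Conjugation by \<open>b\<close> turns \<open>x1\<close> into
    \<open>x1 \<otimes> y\<close> and fixes \<open>x1 [^] q\<close>. The power formula compares the
    two, and for odd \<open>q\<close> its factor in \<open>w\<close> vanishes.\<close>
  have yq: "y [^] q = \<one>"
  proof -
    have "odd q" using odd_prime q(1) by blast
    then have "q dvd q * (q - 1) div 2" by (simp add: div_mult_swap[symmetric])
    then have "w [^] (q * (q - 1) div 2) = \<one>" using wq wc by (metis dvd_def nat_pow_one nat_pow_pow)
    then have "(x1 \<otimes> y) [^] q = x1 [^] q \<otimes> y [^] q" using class2[of q] x1c yc by simp
    moreover have "(x1 \<otimes> y) [^] q = x1 [^] q"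
    proof -
      have "(x1 \<otimes> y) [^] q = cnj b (x1 [^] q)" using bx1 bc x1c by (simp add: cnj_pow)
      then show ?thesis using cen0[of "x1 [^] q"] exD[OF x1(1)] tq cnj_eq_iff bc x1c by simp
    qed
    ultimately show ?thesis using l_cancel_one[OF nat_pow_closed[OF x1c] nat_pow_closed[OF yc]] by metis
  qed
  have y1: "y \<noteq> \<one>" using nby commutes_one[OF bc] by auto
  have oy: "ord y = q" using ord_eq_prime[OF q_prime yc yq y1] .
  show False
  proof (cases "\<forall>g\<in>D. commutes g y")
    case True
    \<comment> \<open>The elements of exponent \<open>q\<close> in the centre of \<open>D\<close>:
      abelian and normalised by \<open>b\<close>, so \<open>abelian_centralised\<close>
      applies.\<close>
    define E where "E = {z \<in> D. (\<forall>g\<in>D. commutes g z) \<and> z [^] q = \<one>}"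
    have Ec: "E \<subseteq> carrier G" using Dc by (auto simp: E_def)
    have Es: "subgroup E G"
    proof (rule subgroupI)
      show "E \<subseteq> carrier G" by (rule Ec)
      have "y \<in> E" using yD True yq by (simp add: E_def)
      then show "E \<noteq> {}" by blast
      show "inv z \<in> E" if "z \<in> E" for z
        using that sD Dc by (auto simp: E_def subgroup.m_inv_closed nat_pow_inv subset_iff intro!: commutes_inv)
      show "z \<otimes> z' \<in> E" if zz: "z \<in> E" "z' \<in> E" for z z'
      proof -
        have cc: "z \<in> carrier G" "z' \<in> carrier G" using zz Ec by auto
        have "(z \<otimes> z') [^] q = \<one>" using pow_mult_commutes[of z z' q] zz cc by (simp add: E_def)
        then show ?thesis using zz cc sD Dc by (auto simp: E_def subgroup.m_closed subset_iff intro!: commutes_mult)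
      qed
    qed
    have Ei: "invariant {b} E"
    proof -
      have "cnj b z \<in> E" if z: "z \<in> E" for z
      proof -
        have zc: "z \<in> carrier G" using z Ec by blast
        have "commutes g (cnj b z)" if g: "g \<in> D" for g
        proof -
          have gc: "g \<in> carrier G" using g Dc by blast
          have "inv b \<in> B" using b(1) B_subgroup by (simp add: subgroup.m_inv_closed)
          then have "cnj (inv b) g \<in> D" using iD g by (simp add: invariant_def)
          then have "commutes (cnj (inv b) g) z" using z by (simp add: E_def)
          then have "commutes (cnj b (cnj (inv b) g)) (cnj b z)"
            using cnj_commutes_iff[of b "cnj (inv b) g" z] bc gc zc by (metis cnj_closed inv_closed)
          then show ?thesis using bc gc by simp
        qed
        moreover have "cnj b z [^] q = \<one>" using z zc bc by (simp add: E_def cnj_pow[symmetric])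
        ultimately show ?thesis using z bD by (simp add: E_def)
      qed
      then show ?thesis by (simp add: invariant_def)
    qed
    have "commutes b y"
    proof (rule abelian_centralised[OF Es _ _ q_prime q(2,3) s bc b(2) Ei])
      show "y \<in> E" using yD True yq by (simp add: E_def)
    qed (auto simp: E_def)
    then show False using nby by blast
  next
    case False
    then obtain g where g: "g \<in> D" "\<not> commutes g y" by blast
    have gc: "g \<in> carrier G" using g Dc by blast
    \<comment> \<open>\<open>z\<close> is a nontrivial commutator in \<open>D0\<close> of order
      \<open>q\<close>, centralised by \<open>b\<close>, hence a power of \<open>a\<close>; so
      \<open>g\<close> shifts \<open>y\<close> by a power of \<open>a\<close>.\<close>
    define z where "z = cnj g y \<otimes> inv y"
    have z: "z \<in> D0" using coD[OF g(1) yD] by (simp add: z_def)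
    have zc: "z \<in> carrier G" using z D0c by blast
    have gy: "cnj g y = z \<otimes> y" using gc yc by (simp add: z_def m_assoc)
    have zy: "z \<otimes> y = y \<otimes> z" using D0cent[OF yD z] by (simp add: commutes_def)
    have z1: "z \<noteq> \<one>"
    proof
      assume "z = \<one>"
      then have "cnj g y = y" using gy yc by simp
      then show False using g(2) cnj_eq_iff gc yc by blast
    qed
    have "(z \<otimes> y) [^] q = \<one>" using gy gc yc yq cnj_pow[OF gc yc, of q] by simp
    moreover have "(z \<otimes> y) [^] q = z [^] q \<otimes> y [^] q" using pow_mult_commutes[of z y q] zy zc yc by (simp add: commutes_def)
    ultimately have "z [^] q = \<one>" using yq zc by simp
    then have oz: "ord z = q" using ord_eq_prime[OF q_prime zc _ z1] by blast
    have zB: "z \<in> B" using z D0(3) DB by blast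
    obtain l :: nat where l: "z = a [^] l"
      using centralised_order_q[OF b s(1-3) c zB oz cen0[OF z]] by blast
    show False using no_shift[OF _ oy _ l z1, of g] yD g(1) DB gy zy by auto
  qed
qed

end

section \<open>Radicals and the Fitting subgroup of a subgroup\<close>

context fin_group
begin

lemma restrict_subgroup_iff:
  assumes "subgroup B G" shows "subgroup N (G\<lparr>carrier := B\<rparr>) \<longleftrightarrow> subgroup N G \<and> N \<subseteq> B"
proof
  assume N: "subgroup N (G\<lparr>carrier := B\<rparr>)"
  then show "subgroup N G \<and> N \<subseteq> B" using incl_subgroup[OF assms N] subgroup.subset[OF N] by simp
next
  assume "subgroup N G \<and> N \<subseteq> B"
  then show "subgroup N (G\<lparr>carrier := B\<rparr>)" using subgroup_incl[of N B] assms by blast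
qed

lemma restrict_invariant_iff:
  assumes B: "subgroup B G" shows "group.invariant (G\<lparr>carrier := B\<rparr>) B N \<longleftrightarrow> invariant B N"
proof -
  interpret H: fin_group "G\<lparr>carrier := B\<rparr>" by (rule restrict_fin_group[OF B])
  have "H.cnj g x = cnj g x" if "g \<in> B" for g x using m_inv_consistent[OF B that] by (simp add: H.cnj_def cnj_def)
  then show ?thesis by (simp add: H.invariant_def invariant_def)
qed

lemma radical_in_subgroup:
  assumes B: "subgroup B G" and q: "prime q"
  obtains Q i where "subgroup Q G" "Q \<subseteq> B" "invariant B Q" "card Q = q ^ i"
    "\<And>N k. subgroup N G \<Longrightarrow> N \<subseteq> B \<Longrightarrow> invariant B N \<Longrightarrow> card N = q ^ k \<Longrightarrow> N \<subseteq> Q"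
proof -
  interpret H: fin_group "G\<lparr>carrier := B\<rparr>" by (rule restrict_fin_group[OF B])
  show thesis
  proof (rule H.radical_exists[OF q])
    fix Q i assume Q: "subgroup Q (G\<lparr>carrier := B\<rparr>)" "H.invariant (carrier (G\<lparr>carrier := B\<rparr>)) Q" "card Q = q ^ i"
      and max: "\<And>N k. subgroup N (G\<lparr>carrier := B\<rparr>) \<Longrightarrow> H.invariant (carrier (G\<lparr>carrier := B\<rparr>)) N \<Longrightarrow>
        card N = q ^ k \<Longrightarrow> N \<subseteq> Q"
    show thesis
    proof (rule that)
      show "N \<subseteq> Q" if "subgroup N G" "N \<subseteq> B" "invariant B N" "card N = q ^ k" for N k
        using max that by (simp add: restrict_subgroup_iff[OF B] restrict_invariant_iff[OF B])
    qed (use Q in \<open>simp_all add: restrict_subgroup_iff[OF B] restrict_invariant_iff[OF B]\<close>)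
  qed
qed

lemma fitting_centralizer_in_subgroup:
  assumes solv: "solvable G" and B: "subgroup B G"
    and Q: "subgroup Q G" "Q \<subseteq> B" "invariant B Q" "card Q = q ^ i" "prime q"
    and S: "subgroup S G" "S \<subseteq> B" "invariant B S" "card S = s ^ j" "prime s" and qs: "q \<noteq> s"
    and maxQ: "\<And>N k. subgroup N G \<Longrightarrow> N \<subseteq> B \<Longrightarrow> invariant B N \<Longrightarrow> card N = q ^ k \<Longrightarrow> N \<subseteq> Q"
    and maxS: "\<And>N k. subgroup N G \<Longrightarrow> N \<subseteq> B \<Longrightarrow> invariant B N \<Longrightarrow> card N = s ^ k \<Longrightarrow> N \<subseteq> S"
    and other: "\<And>N k t. prime t \<Longrightarrow> t \<noteq> q \<Longrightarrow> t \<noteq> s \<Longrightarrow> subgroup N G \<Longrightarrow> N \<subseteq> B \<Longrightarrow> invariant B N \<Longrightarrow>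
      card N = t ^ k \<Longrightarrow> N = {\<one>}"
    and x: "x \<in> B" "\<And>a. a \<in> Q \<Longrightarrow> commutes x a" "\<And>a. a \<in> S \<Longrightarrow> commutes x a"
  shows "\<exists>a\<in>Q. \<exists>b\<in>S. x = a \<otimes> b"
proof -
  interpret H: fin_group "G\<lparr>carrier := B\<rparr>" by (rule restrict_fin_group[OF B])
  have c: "H.commutes = commutes" by (simp add: fun_eq_iff H.commutes_def commutes_def)
  note iff = restrict_subgroup_iff[OF B] restrict_invariant_iff[OF B]
  have "\<exists>a\<in>Q. \<exists>b\<in>S. x = a \<otimes>\<^bsub>G\<lparr>carrier := B\<rparr>\<^esub> b"
  proof (rule H.fitting_centralizer[OF solvable_subgroup[OF solv B] _ _ Q(4,5) _ _ S(4,5) qs])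
    show "N \<subseteq> Q" if "subgroup N (G\<lparr>carrier := B\<rparr>)" "H.invariant (carrier (G\<lparr>carrier := B\<rparr>)) N" "card N = q ^ k" for N k
      using that maxQ by (simp add: iff)
    show "N \<subseteq> S" if "subgroup N (G\<lparr>carrier := B\<rparr>)" "H.invariant (carrier (G\<lparr>carrier := B\<rparr>)) N" "card N = s ^ k" for N k
      using that maxS by (simp add: iff)
    show "N = {\<one>\<^bsub>G\<lparr>carrier := B\<rparr>\<^esub>}" if "prime t" "t \<noteq> q" "t \<noteq> s" "subgroup N (G\<lparr>carrier := B\<rparr>)"
        "H.invariant (carrier (G\<lparr>carrier := B\<rparr>)) N" "card N = t ^ k" for N k t
      using that other by (simp add: iff)
  qed (use Q S x c in \<open>simp_all add: iff\<close>)
  then show ?thesis by simp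
qed

end

lemma (in two_radicals) central_conjugate:
  assumes e: "central_mod e" and f: "f \<in> F" shows "central_mod (cnj f e)"
proof -
  have c: "e \<in> carrier G" "f \<in> carrier G" using e f Fc by (auto simp: central_mod_def)
  have "cnj f e \<otimes> inv e \<in> F" using e c(2) by (simp add: central_mod_def)
  then have "central_mod ((cnj f e \<otimes> inv e) \<otimes> e)" using central_shift[OF e] by blast
  then show ?thesis using c by (simp add: m_assoc)
qed

context central_element
begin

text \<open>Since \<open>G = F B\<close>, the product of \<open>N\<close> and \<open>F\<close> is
  normal in \<open>G\<close>, and it exceeds \<open>F\<close> because \<open>B\<close> meets
  \<open>F\<close> trivially. A chief factor above \<open>F\<close> inside it belongs to the prime
  \<open>t\<close>, and \<open>chief_central\<close> applies.\<close>

lemma normal_subgroup_of_B: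
  assumes N: "subgroup N G" "N \<subseteq> B" "invariant B N" "card N = t ^ k" "N \<noteq> {\<one>}" and t: "prime t"
  shows "t \<noteq> r \<and> t \<noteq> p \<and> (\<exists>e. central_mod e \<and> ord e = t)"
proof -
  have Nc: "N \<subseteq> carrier G" using N(2) Bc by blast
  define W where "W = {n \<otimes> f | n f. n \<in> N \<and> f \<in> F}"
  have W: "subgroup W G" unfolding W_def by (rule subgroup_set_mult[OF N(1) F_subgroup invariant_F[OF Nc]])
  have cF: "cnj g f \<in> F" if "g \<in> carrier G" "f \<in> F" for g f using F_invariant that by (simp add: invariant_def)
  have "cnj g (n \<otimes> f) \<in> W" if g: "g \<in> carrier G" and n: "n \<in> N" and f: "f \<in> F" for g n f
  proof -
    obtain h b where h: "h \<in> F" "b \<in> B" "g = h \<otimes> b" using decompose[OF g] by blast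
    define m where "m = cnj b n"
    have m: "m \<in> N" using N(3) h(2) n by (simp add: m_def invariant_def)
    have c: "m \<in> carrier G" "n \<in> carrier G" "f \<in> carrier G" "h \<in> carrier G" "b \<in> carrier G"
      using m n f h Nc Fc Bc by auto
    \<comment> \<open>The part of \<open>g\<close> in \<open>B\<close> keeps \<open>n\<close> inside
      \<open>N\<close>; the part \<open>h\<close> in \<open>F\<close> is moved past \<open>m\<close>
      and absorbed by \<open>F\<close>.\<close>
    have "cnj g (n \<otimes> f) = m \<otimes> (cnj (inv m) h \<otimes> inv h \<otimes> cnj g f)"
      using c g by (simp add: cnj_mult h(3) m_def[symmetric] cnj_cnj[symmetric]) (simp add: cnj_def m_assoc)
    moreover have "cnj (inv m) h \<otimes> inv h \<otimes> cnj g f \<in> F"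
      using cF[of "inv m" h] cF[OF g f] h(1) c(1) F_subgroup by (simp add: subgroup.m_closed subgroup.m_inv_closed)
    ultimately show ?thesis using m unfolding W_def by blast
  qed
  then have Wi: "invariant (carrier G) W" by (auto simp: invariant_def W_def)
  have FW: "F \<subseteq> W"
  proof
    fix f assume f: "f \<in> F"
    then have "f = \<one> \<otimes> f" using Fc by auto
    then show "f \<in> W" using f subgroup.one_closed[OF N(1)] unfolding W_def by blast
  qed
  obtain n where n: "n \<in> N" "n \<noteq> \<one>" using N(1,5) subgroup.one_closed by blast
  have "n = n \<otimes> \<one>" using n Nc by auto
  then have "n \<in> W" using n subgroup.one_closed[OF F_subgroup] unfolding W_def by blast
  moreover have "n \<notin> F" using B_Int_F n N(2) by blast
  ultimately have FW': "F \<subset> W" using FW by blast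
  show ?thesis
  proof (rule chief_factor[OF solv subset_refl _ F_subgroup F_invariant W Wi FW'])
    show "W \<subseteq> carrier G" using W subgroup.subset by blast
    fix M u assume M: "subgroup M G" "invariant (carrier G) M" "F \<subset> M" "M \<subseteq> W" "prime (u::nat)"
      and exM: "\<And>x. x \<in> M \<Longrightarrow> x [^] u \<in> F" and coM: "\<And>x y. x \<in> M \<Longrightarrow> y \<in> M \<Longrightarrow> cnj x y \<otimes> inv y \<in> F"
      and minM: "\<And>N. subgroup N G \<Longrightarrow> invariant (carrier G) N \<Longrightarrow> F \<subseteq> N \<Longrightarrow> N \<subseteq> M \<Longrightarrow> N = F \<or> N = M"
    obtain y where y: "y \<in> M" "y \<notin> F" using M(3) by blast
    then obtain m f where mf: "m \<in> N" "f \<in> F" "y = m \<otimes> f" using M(4) unfolding W_def by blast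
    have c: "m \<in> carrier G" "f \<in> carrier G" using mf Nc Fc by auto
    have "y = cnj m f \<otimes> m" using mf(3) c by (simp add: cnj_def m_assoc)
    then obtain x' where "x' \<in> F" "y [^] (t ^ k) = x' \<otimes> m [^] (t ^ k)"
      using mult_pow_mod[OF F_subgroup invariant_F c(1) cF[OF c(1) mf(2)], of "t ^ k"] c(1) by auto
    moreover have "m [^] (t ^ k) = \<one>" using pow_card_eq_one[OF N(1) mf(1)] N(4) by simp
    ultimately have "y [^] (t ^ k) \<in> F" using Fc by auto
    then have "u dvd t ^ k"
      using pow_mem_imp_dvd[OF F_subgroup M(5) _ y(2) exM[OF y(1)]] mf(3) c by simp
    then have "u = t" using M(5) t prime_dvd_power primes_dvd_imp_eq by blast
    then show ?thesis using chief_central[OF M(1-3,5) exM coM minM] by simp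
  qed
qed

text \<open>Otherwise elements of orders \<open>t\<close> and \<open>q\<close>, both central modulo
  \<open>F\<close>, and any element of order \<open>s\<close> would form a triple modulo
  \<open>F\<close>.\<close>

lemma normal_subgroup_of_B_prime:
  assumes s: "pr s" "s \<noteq> q" "s \<noteq> r" "s \<noteq> p"
    and N: "subgroup N G" "N \<subseteq> B" "invariant B N" "card N = t ^ k" and t: "prime t" "t \<noteq> q" "t \<noteq> s"
  shows "N = {\<one>}"
proof (rule ccontr)
  assume "N \<noteq> {\<one>}"
  then obtain e where e: "central_mod e" "ord e = t" "t \<noteq> r" "t \<noteq> p" using normal_subgroup_of_B[OF N _ t(1)] by blast
  have sp: "prime s" using s pr_prime by blast
  obtain b where b: "b \<in> carrier G" "ord b = s" using linked_pair[OF s(1) q(1) s(2)] by metis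
  have bF: "b \<notin> F" using ord_dvd_card[OF F_subgroup, of b] b(2) not_dvd_card_F[OF sp s(3,4)] by blast
  have aF: "a \<notin> F" and co: "cnj b a \<otimes> inv a \<in> F" using a(1) b(1) by (simp_all add: central_mod_def)
  show False
    using central_triple[OF e(1,2) t(1) b(1) bF b(2) sp ac aF a(2) q_prime s(2) t(3)[symmetric] t(2)[symmetric] co] .
qed

text \<open>A regular \<open>d\<close> of order \<open>s\<close> can be conjugated into
  \<open>B\<close>. Commutators of \<open>B\<close> with \<open>d\<close> lie in \<open>B\<close>
  and in \<open>F\<close>, hence vanish; conversely commutators of \<open>cent {d}\<close> with
  \<open>a\<close> lie in \<open>F\<close> and commute with \<open>d\<close>, hence vanish. So the
  complement \<open>B\<close> is the same for both primes.\<close>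

lemma second_central_element:
  assumes s: "pr s" "s \<noteq> q" "s \<noteq> r" "s \<noteq> p" and e: "central_mod e" "ord e = s"
  shows "\<exists>d. central_element G R P r p i j d s \<and> cent {d} = B"
proof -
  obtain d0 where d0: "central_mod d0" "ord d0 = s" "\<And>f. f \<in> F \<Longrightarrow> commutes d0 f \<Longrightarrow> f = \<one>"
    using central_regular[OF e s(1,3,4)] by blast
  have d0c: "d0 \<in> carrier G" using d0(1) by (simp add: central_mod_def)
  obtain f where f: "f \<in> F" "cnj f d0 \<in> B"
    using conjugate_into_B[OF d0c d0(2) pr_prime[OF s(1)] s(3,4)] by blast
  have fc: "f \<in> carrier G" using f Fc by blast
  define d where "d = cnj f d0"
  have dB: "d \<in> B" using f by (simp add: d_def)
  have dc: "d \<in> carrier G" using dB Bc by blast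
  have dm: "central_mod d" unfolding d_def by (rule central_conjugate[OF d0(1) f(1)])
  have reg: "h = \<one>" if h: "h \<in> F" "commutes d h" for h
  proof -
    have hc: "h \<in> carrier G" using h Fc by blast
    have "commutes (cnj f d0) (cnj f (cnj (inv f) h))" using h(2) fc hc by (simp add: d_def)
    then have "commutes d0 (cnj (inv f) h)" using cnj_commutes_iff[OF fc d0c, of "cnj (inv f) h"] fc hc by simp
    moreover have "cnj (inv f) h \<in> F" using F_invariant fc h(1) by (simp add: invariant_def)
    ultimately have "cnj (inv f) h = \<one>" using d0(3) by blast
    then have "cnj f \<one> = h" using cnj_inv_cnj(2)[OF fc hc] by simp
    then show ?thesis using fc by simp
  qed
  have "central_element G R P r p i j d s"
    by unfold_locales (use s dm d0 reg d_def fc d0c in auto)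
  moreover have "cent {d} = B"
  proof
    show "B \<subseteq> cent {d}"
    proof
      fix g assume g: "g \<in> B"
      have gc: "g \<in> carrier G" using g Bc by blast
      have "cnj g d \<otimes> inv d \<in> B"
        using g dB B_subgroup by (simp add: cnj_def subgroup.m_closed subgroup.m_inv_closed)
      moreover have "cnj g d \<otimes> inv d \<in> F" using dm gc by (simp add: central_mod_def)
      ultimately have "cnj g d \<otimes> inv d = \<one>" using B_Int_F by blast
      then have "cnj g d = d" using gc dc by (metis cnj_closed inv_closed inv_equality inv_inv)
      then show "g \<in> cent {d}" using cnj_eq_iff[OF gc dc] gc by (simp add: cent_def)
    qed
    show "cent {d} \<subseteq> B"
    proof
      fix g assume "g \<in> cent {d}"
      then have gc: "g \<in> carrier G" and gd: "commutes d g" by (auto simp: cent_def intro: commutes_sym)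
      have da: "commutes d a" using commutes_sym[OF B_commutes[OF dB]] .
      have "commutes d (cnj g a \<otimes> inv a)"
        using gd da dc gc ac by (simp add: cnj_def commutes_mult commutes_inv)
      moreover have "cnj g a \<otimes> inv a \<in> F" using a(1) gc by (simp add: central_mod_def)
      ultimately have "cnj g a \<otimes> inv a = \<one>" using reg by blast
      then have "cnj g a = a" using gc ac by (metis cnj_closed inv_closed inv_equality inv_inv)
      then show "g \<in> B" using cnj_eq_iff[OF gc ac] mem_B[OF gc] commutes_sym by blast
    qed
  qed
  ultimately show ?thesis by blast
qed

lemma fixing_element_of_B:
  assumes e: "central_mod e" "ord e = l" "pr l" "l \<noteq> r" and s: "pr s" "s \<noteq> l" "s \<noteq> r" "s \<noteq> p"
  obtains b c where "b \<in> B" "ord b = s" "c \<in> R" "c \<noteq> \<one>" "commutes b c"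
proof -
  obtain b0 c0 where b0: "b0 \<in> carrier G" "ord b0 = s" and c0: "c0 \<in> R" "c0 \<noteq> \<one>" "commutes b0 c0"
    using central_fixes_R[OF e s] by blast
  obtain f where f: "f \<in> F" "cnj f b0 \<in> B" using conjugate_into_B[OF b0 pr_prime[OF s(1)] s(3,4)] by blast
  have c: "f \<in> carrier G" "c0 \<in> carrier G" using f c0 Fc Rc by auto
  have "cnj f c0 \<in> R" using R(2) c c0(1) by (simp add: invariant_def)
  moreover have "cnj f c0 \<noteq> \<one>" using c0(2) c by (metis cnj_inv_cnj(1) cnj_one inv_closed)
  moreover have "commutes (cnj f b0) (cnj f c0)" using c0(3) cnj_commutes_iff c b0(1) by blast
  ultimately show thesis using f(2) b0 c(1) by (intro that[of "cnj f b0" "cnj f c0"]) simp_all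
qed

text \<open>The commutator \<open>u\<close> of \<open>b\<close> and \<open>x\<close> centralises
  \<open>Q\<close> because \<open>b\<close> does and \<open>S\<close> because \<open>x\<close> does,
  so \<open>QS\<close> splits it into a \<open>q\<close>-part and an \<open>s\<close>-part.
  Comparing \<open>u\<close> with the orders of \<open>b\<close> and \<open>x\<close> kills both
  parts.\<close>

lemma commuting_from_radicals:
  assumes s: "prime s" "s \<noteq> q" and b: "b \<in> B" "ord b = s" and x: "x \<in> B" "ord x = q"
    and Q: "subgroup Q G" "Q \<subseteq> B" "invariant B Q" "card Q = q ^ k"
    and S: "subgroup S G" "S \<subseteq> B" "invariant B S" "card S = s ^ l"
    and bQ: "\<And>y. y \<in> Q \<Longrightarrow> commutes b y" and xS: "\<And>y. y \<in> S \<Longrightarrow> commutes x y"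
    and QS: "\<And>u. u \<in> B \<Longrightarrow> (\<And>y. y \<in> Q \<Longrightarrow> commutes u y) \<Longrightarrow> (\<And>y. y \<in> S \<Longrightarrow> commutes u y) \<Longrightarrow>
      \<exists>y\<in>Q. \<exists>z\<in>S. u = y \<otimes> z"
  shows "commutes b x"
proof -
  have bc: "b \<in> carrier G" and xc: "x \<in> carrier G" using b x Bc by auto
  have Qc: "Q \<subseteq> carrier G" and Sc: "S \<subseteq> carrier G" using Q S Bc by auto
  have ib: "inv b \<in> B" and ix: "inv x \<in> B" using b x B_subgroup by (simp_all add: subgroup.m_inv_closed)
  define u where "u = inv b \<otimes> cnj (inv x) b"
  \<comment> \<open>The two readings of \<open>u\<close>: the definition shows a product of
    \<open>inv b\<close> with a conjugate of \<open>b\<close>, this one a conjugate of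
    \<open>inv x\<close> times \<open>x\<close>.\<close>
  have u2: "u = cnj (inv b) (inv x) \<otimes> x" using bc xc by (simp add: u_def cnj_def m_assoc)
  have uB: "u \<in> B" using b(1) x(1) ib ix B_subgroup by (simp add: u_def cnj_def subgroup.m_closed subgroup.m_inv_closed)
  have conj: "commutes (cnj g h) y" if g: "g \<in> B" "inv g \<in> B" "h \<in> carrier G" and T: "invariant B T" "T \<subseteq> carrier G"
    and hT: "\<And>y. y \<in> T \<Longrightarrow> commutes h y" and y: "y \<in> T" for g h T y
  proof -
    have c: "g \<in> carrier G" "y \<in> carrier G" using g y T Bc by auto
    have "commutes h (cnj (inv g) y)" using hT T(1) g(2) y by (simp add: invariant_def)
    then have "commutes (cnj g h) (cnj g (cnj (inv g) y))" using cnj_commutes_iff[of g h "cnj (inv g) y"] c g(3) by simp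
    then show ?thesis using c by simp
  qed
  have "commutes u y" if y: "y \<in> Q" for y
  proof -
    have yc: "y \<in> carrier G" using y Qc by blast
    have "commutes y b" using bQ[OF y] by (rule commutes_sym)
    moreover have "commutes y (cnj (inv x) b)"
      using conj[OF ix _ bc Q(3) Qc bQ y] x(1) xc by (simp add: commutes_sym)
    ultimately have "commutes y u" using yc bc xc by (simp add: u_def commutes_mult commutes_inv)
    then show ?thesis by (rule commutes_sym)
  qed
  moreover have "commutes u y" if y: "y \<in> S" for y
  proof -
    have yc: "y \<in> carrier G" using y Sc by blast
    have ixS: "commutes (inv x) z" if z: "z \<in> S" for z
      using commutes_inv[OF commutes_sym[OF xS[OF z]]] z Sc xc by (auto intro: commutes_sym)
    have "commutes y x" using xS[OF y] by (rule commutes_sym)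
    moreover have "commutes y (cnj (inv b) (inv x))"
      using conj[OF ib _ inv_closed[OF xc] S(3) Sc ixS y] b(1) bc by (simp add: commutes_sym)
    ultimately have "commutes y u" using yc bc xc by (simp add: u2 commutes_mult)
    then show ?thesis by (rule commutes_sym)
  qed
  ultimately obtain y z where yz: "y \<in> Q" "z \<in> S" "u = y \<otimes> z" using QS[OF uB] by blast
  have c: "y \<in> carrier G" "z \<in> carrier G" using yz Qc Sc by auto
  have cop: "coprime (q ^ k) (s ^ l)" "coprime s (q ^ k)" "coprime q (s ^ l)"
    using primes_coprime[of q s] primes_coprime[of s q] s q_prime by auto
  have yq: "ord y dvd q ^ k" using ord_dvd_card[OF Q(1) yz(1)] Q(4) by simp
  have zs: "ord z dvd s ^ l" using ord_dvd_card[OF S(1) yz(2)] S(4) by simp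
  have bs: "b [^] s = \<one>" using pow_ord_eq_1[OF bc] b(2) by simp
  have "y = \<one>"
  proof -
    \<comment> \<open>\<open>b \<otimes> u\<close> is a conjugate of \<open>b\<close>, so its
      \<open>s\<close>-th power is trivial. Written as \<open>?d \<otimes> z\<close>, its
      \<open>s\<close>-th power is \<open>y [^] s\<close> modulo \<open>S\<close>; hence
      \<open>y [^] s\<close> lies in both \<open>Q\<close> and \<open>S\<close>.\<close>
    let ?d = "b \<otimes> y"
    have dc: "?d \<in> carrier G" using bc c by simp
    have dB: "?d \<in> B" using b(1) yz(1) Q(2) B_subgroup by (auto simp: subgroup.m_closed)
    have zS: "cnj ?d z \<in> S" using S(3) dB yz(2) by (simp add: invariant_def)
    have "cnj ?d z \<otimes> ?d = ?d \<otimes> z" using dc c by (simp add: cnj_def m_assoc)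
    also have "\<dots> = cnj (inv x) b"
    proof -
      have "?d \<otimes> z = b \<otimes> u" using yz(3) bc c by (simp add: m_assoc)
      then show ?thesis using bc xc by (simp add: u_def)
    qed
    finally have eq: "cnj ?d z \<otimes> ?d = cnj (inv x) b" .
    have "(cnj (inv x) b) [^] s = \<one>" using cnj_pow[of "inv x" b s] bs bc xc by simp
    moreover obtain z' where z': "z' \<in> S" "(cnj ?d z \<otimes> ?d) [^] s = z' \<otimes> ?d [^] s"
      using mult_pow_mod[OF S(1) invariant_mono[OF S(3)] dc zS, of s] dB by auto
    moreover have "?d [^] s = y [^] s" using pow_mult_commutes[OF bQ[OF yz(1)] bc c(1)] bs c by simp
    ultimately have e1: "z' \<otimes> y [^] s = \<one>" using eq by simp
    have z'c: "z' \<in> carrier G" using z' Sc by blast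
    have "inv (y [^] s) = z'" using e1 z'c c by (intro inv_equality) auto
    then have "inv z' = y [^] s" using c by (metis inv_inv nat_pow_closed)
    then have ys: "y [^] s \<in> S" using z'(1) S(1) by (metis subgroup.m_inv_closed)
    have "ord (y [^] s) dvd q ^ k" using ord_dvd_card[OF Q(1) subgroup_pow[OF Q(1) yz(1)]] Q(4) by simp
    moreover have "ord (y [^] s) dvd s ^ l" using ord_dvd_card[OF S(1) ys] S(4) by simp
    ultimately have "ord (y [^] s) = 1" using cop(1) coprime_common_divisor_nat by blast
    then have "y [^] s = \<one>" using ord_eq_1 c by simp
    then have "ord y dvd s" using pow_eq_id c by blast
    then have "ord y = 1" using yq cop(2) coprime_common_divisor_nat by blast
    then show ?thesis using ord_eq_1 c by simp
  qed
  then have uz: "u = z" using yz(3) c by simp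
  \<comment> \<open>Likewise \<open>z \<otimes> inv x\<close> is a conjugate of
    \<open>inv x\<close>, and as \<open>z\<close> commutes with \<open>x\<close> its
    \<open>q\<close>-th power is \<open>z [^] q\<close>.\<close>
  have "z \<otimes> inv x = cnj (inv b) (inv x)" using uz[symmetric] u2 bc xc by (simp add: m_assoc)
  moreover have "cnj (inv b) (inv x) [^] q = \<one>"
    using cnj_pow[of "inv b" "inv x" q] pow_ord_eq_1[OF xc] x(2) bc xc by (simp add: nat_pow_inv)
  moreover have "(z \<otimes> inv x) [^] q = z [^] q \<otimes> inv x [^] q"
    using pow_mult_commutes[OF commutes_inv[OF commutes_sym[OF xS[OF yz(2)]] c(2) xc]] c xc by simp
  moreover have "inv x [^] q = \<one>" using pow_ord_eq_1[OF xc] x(2) xc by (simp add: nat_pow_inv)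
  ultimately have "z [^] q = \<one>" using c by simp
  then have "ord z dvd q" using pow_eq_id c by blast
  then have "ord z = 1" using zs cop(3) coprime_common_divisor_nat by blast
  then have "u = \<one>" using ord_eq_1 c uz by simp
  then have "b \<otimes> (inv b \<otimes> cnj (inv x) b) = b" using bc by (simp add: u_def)
  then have "cnj (inv x) b = b" using bc xc by simp
  then have "commutes b (inv x)" using cnj_eq_iff bc xc commutes_sym inv_closed by metis
  then have "commutes b (inv (inv x))" using commutes_inv bc xc by blast
  then show ?thesis using xc by simp
qed

lemma contradiction: False
proof -
  obtain s where s: "pr s" "s \<noteq> q" "s \<noteq> r" "s \<noteq> p" using fourth_prime by blast
  have sp: "prime s" using s pr_prime by blast
  obtain b c where b: "b \<in> B" "ord b = s" and c: "c \<in> R" "c \<noteq> \<one>" "commutes b c"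
    using fixing_element_of_B[OF a q(1,2) s] by blast
  have bc: "b \<in> carrier G" using b Bc by blast
  obtain Q k where Q: "subgroup Q G" "Q \<subseteq> B" "invariant B Q" "card Q = q ^ k"
    and maxQ: "\<And>N k. subgroup N G \<Longrightarrow> N \<subseteq> B \<Longrightarrow> invariant B N \<Longrightarrow> card N = q ^ k \<Longrightarrow> N \<subseteq> Q"
    by (rule radical_in_subgroup[OF B_subgroup q_prime]) blast
  obtain S l where S: "subgroup S G" "S \<subseteq> B" "invariant B S" "card S = s ^ l"
    and maxS: "\<And>N k. subgroup N G \<Longrightarrow> N \<subseteq> B \<Longrightarrow> invariant B N \<Longrightarrow> card N = s ^ k \<Longrightarrow> N \<subseteq> S"
    by (rule radical_in_subgroup[OF B_subgroup sp]) blast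
  have QS: "\<exists>y\<in>Q. \<exists>z\<in>S. u = y \<otimes> z"
    if "u \<in> B" "\<And>y. y \<in> Q \<Longrightarrow> commutes u y" "\<And>y. y \<in> S \<Longrightarrow> commutes u y" for u
    by (rule fitting_centralizer_in_subgroup[OF solv B_subgroup Q q_prime S sp s(2)[symmetric] maxQ maxS
          normal_subgroup_of_B_prime[OF s] that])
  have bQ: "commutes b y" if "y \<in> Q" for y
    by (rule normal_q_subgroup_centralised[OF sp s(2-4) b c Q that])
  have S1: "S \<noteq> {\<one>}"
  proof
    assume S1: "S = {\<one>}"
    then obtain y where y: "y \<in> Q" "b = y \<otimes> \<one>" using QS[OF b(1) bQ] bc by auto
    have "y \<in> carrier G" using y Q(2) Bc by blast
    then have "b \<in> Q" using y by simp
    then have "s dvd q ^ k" using ord_dvd_card[OF Q(1), of b] b(2) Q(4) by simp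
    then show False using sp q_prime s(2) prime_dvd_power primes_dvd_imp_eq by blast
  qed
  obtain e where e: "central_mod e" "ord e = s" using normal_subgroup_of_B[OF S S1 sp] by blast
  obtain d where d: "central_element G R P r p i j d s" "cent {d} = B"
    using second_central_element[OF s e] by blast
  interpret D: central_element G R P r p i j d s by (rule d(1))
  have DB: "D.B = B" using d(2) by (simp add: D.B_def)
  obtain x v where x: "x \<in> B" "ord x = q" and v: "v \<in> R" "v \<noteq> \<one>" "commutes x v"
    using fixing_element_of_B[OF e s(1,3) q(1) s(2)[symmetric] q(2,3)] by blast
  have xS: "commutes x y" if "y \<in> S" for y
    using D.normal_q_subgroup_centralised[OF q_prime s(2)[symmetric] q(2,3) _ x(2) v S(1) _ _ S(4) that] x(1) S(2,3) DB by simp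
  have "commutes b x" by (rule commuting_from_radicals[OF sp s(2) b x Q S bQ xS QS])
  then obtain m :: nat where m: "x = a [^] m"
    using centralised_order_q[OF b sp s(2,3) c x] by blast
  have "x \<noteq> \<one>" using x(2) q_prime by (metis not_prime_1 ord_id)
  then obtain n :: nat where n: "x [^] n = a" using prime_ord_pow_eq(2)[OF q_prime a(2) ac, of m] m by auto
  have "x \<in> carrier G" "v \<in> carrier G" using x v Bc Rc by auto
  then have "commutes a v" using commutes_pow[OF commutes_sym[OF v(3)]] n commutes_sym by metis
  then show False using regular[of v] v R_sub_F by blast
qed

end

section \<open>Existence of two radicals and the final contradiction\<close>

context linked_group
begin

lemma two_radicals_False:
  assumes "two_radicals G R P r p i j" shows False
proof -
  interpret two_radicals G R P r p i j by (rule assms)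
  obtain s where s: "pr s" "s \<noteq> r" "s \<noteq> p" "s \<noteq> r" using fourth_prime by blast
  have "\<not> s dvd card F" using F_primes pr_prime s by blast
  then have "F \<noteq> carrier G" using s(1) by (auto simp: pr_def)
  then have sub: "F \<subset> carrier G" using Fc by blast
  have ci: "invariant (carrier G) (carrier G)" by (simp add: invariant_def)
  show False
  proof (rule chief_factor[OF solv subset_refl subset_refl F_subgroup F_invariant subgroup_self ci sub])
    fix M t assume M: "subgroup M G" "invariant (carrier G) M" "F \<subset> M" "M \<subseteq> carrier G" "prime (t::nat)"
      and exM: "\<And>x. x \<in> M \<Longrightarrow> x [^] t \<in> F" and coM: "\<And>x y. x \<in> M \<Longrightarrow> y \<in> M \<Longrightarrow> cnj x y \<otimes> inv y \<in> F"
      and minM: "\<And>N. subgroup N G \<Longrightarrow> invariant (carrier G) N \<Longrightarrow> F \<subseteq> N \<Longrightarrow> N \<subseteq> M \<Longrightarrow> N = F \<or> N = M"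
    obtain e where t: "t \<noteq> r" "t \<noteq> p" and e: "central_mod e" "ord e = t"
      using chief_central[OF M(1-3,5) exM coM minM] by blast
    have "e \<in> carrier G" using e(1) by (simp add: central_mod_def)
    then have pt: "pr t" using pr_ord[of e] e(2) M(5) by simp
    obtain a where a: "central_mod a" "ord a = t" "\<And>f. f \<in> F \<Longrightarrow> commutes a f \<Longrightarrow> f = \<one>"
      using central_regular[OF e pt t] by blast
    interpret central_element G R P r p i j a t
      by unfold_locales (use pt t a in auto)
    show False by (rule contradiction)
  qed
qed

text \<open>A minimal normal subgroup provides one nontrivial radical \<open>R\<close>. If it were
  the only one, the next chief factor above \<open>R\<close>, at a prime
  \<open>t \<noteq> r\<close>, would contradict \<open>p_chief_factor_noncentral\<close> with a
  trivial second radical.\<close>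

lemma linked_False: False
proof -
  have ci: "invariant (carrier G) (carrier G)" by (simp add: invariant_def)
  have oi: "invariant (carrier G) {\<one>}" by (simp add: invariant_one)
  obtain s where s: "pr s" using fourth_prime by blast
  have "{\<one>} \<noteq> carrier G"
  proof
    assume "{\<one>} = carrier G"
    then have "card (carrier G) = 1" by (metis is_singletonI is_singleton_altdef)
    then have "s = 1" using s by (simp add: pr_def)
    then show False using pr_prime[OF s] by simp
  qed
  then have sub: "{\<one>} \<subset> carrier G" by blast
  obtain r M where M: "subgroup M G" "invariant (carrier G) M" "M \<noteq> {\<one>}" "prime (r::nat)"
    and exM: "\<And>x. x \<in> M \<Longrightarrow> x [^] r = \<one>"
  proof (rule chief_factor[OF solv subset_refl subset_refl triv_subgroup oi subgroup_self ci sub])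
    fix M r assume "subgroup M G" "invariant (carrier G) M" "{\<one>} \<subset> M" "prime (r::nat)"
      "\<And>x. x \<in> M \<Longrightarrow> x [^] r \<in> {\<one>}"
    then show thesis by (intro that[of M r]) auto
  qed
  obtain x where x: "x \<in> M" "x \<noteq> \<one>" using M(1,3) subgroup.one_closed by blast
  have xc: "x \<in> carrier G" using x(1) M(1) subgroup.subset by blast
  have r: "pr r" using pr_ord[OF xc] ord_eq_prime[OF M(4) xc exM[OF x(1)] x(2)] M(4) by simp
  have "\<exists>k. y [^] (r ^ k) = \<one>" if "y \<in> M" for y using exM[OF that] by (metis power_one_right)
  then obtain n where n: "card M = r ^ n" using prime_power_card[OF M(4,1)] by blast
  obtain R i where R: "subgroup R G" "invariant (carrier G) R" "card R = r ^ i"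
    and maxR: "\<And>N k. subgroup N G \<Longrightarrow> invariant (carrier G) N \<Longrightarrow> card N = r ^ k \<Longrightarrow> N \<subseteq> R"
    by (rule radical_exists[OF M(4)]) blast
  have R1: "R \<noteq> {\<one>}" using maxR[OF M(1,2) n] x by blast
  have Rc: "R \<subseteq> carrier G" using R(1) subgroup.subset by blast
  \<comment> \<open>A second nontrivial radical would yield an instance of
    \<open>two_radicals\<close>, which is already refuted.\<close>
  have only: "N = {\<one>}" if N: "subgroup N G" "invariant (carrier G) N" "card N = p ^ k" and p: "pr p" "p \<noteq> r" for N k p
  proof (rule ccontr)
    assume N1: "N \<noteq> {\<one>}"
    obtain P j where P: "subgroup P G" "invariant (carrier G) P" "card P = p ^ j"
      and maxP: "\<And>N k. subgroup N G \<Longrightarrow> invariant (carrier G) N \<Longrightarrow> card N = p ^ k \<Longrightarrow> N \<subseteq> P"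
      by (rule radical_exists[OF pr_prime[OF p(1)]]) blast
    have P1: "P \<noteq> {\<one>}" using maxP[OF N] N1 subgroup.one_closed[OF N(1)] by blast
    have "two_radicals G R P r p i j"
      by (intro two_radicals.intro two_radicals_axioms.intro linked_group_axioms r p(1) p(2)[symmetric] R R1 P P1 maxR maxP)
    then show False by (rule two_radicals_False)
  qed
  obtain u where u: "pr u" "u \<noteq> r" using fourth_prime by blast
  have "\<not> u dvd card R"
    using R(3) u pr_prime[OF u(1)] M(4) by (metis prime_dvd_power primes_dvd_imp_eq)
  then have "R \<noteq> carrier G" using u(1) by (auto simp: pr_def)
  then have sub: "R \<subset> carrier G" using Rc by blast
  show False
  proof (rule chief_factor[OF solv subset_refl subset_refl R(1,2) subgroup_self ci sub])
    fix W t assume W: "subgroup W G" "invariant (carrier G) W" "R \<subset> W" "W \<subseteq> carrier G" "prime (t::nat)"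
      and exW: "\<And>x. x \<in> W \<Longrightarrow> x [^] t \<in> R" and coW: "\<And>x y. x \<in> W \<Longrightarrow> y \<in> W \<Longrightarrow> cnj x y \<otimes> inv y \<in> R"
      and minW: "\<And>N. subgroup N G \<Longrightarrow> invariant (carrier G) N \<Longrightarrow> R \<subseteq> N \<Longrightarrow> N \<subseteq> W \<Longrightarrow> N = R \<or> N = W"
    obtain w where w: "w \<in> W" "w \<notin> R" using W(3) by blast
    have wc: "w \<in> carrier G" using w W(4) by blast
    have "w [^] ord w \<in> R" using pow_ord_eq_1[OF wc] subgroup.one_closed[OF R(1)] by simp
    then have "t dvd ord w" using pow_mem_imp_dvd[OF R(1) W(5) wc w(2) exW[OF w(1)]] by blast
    then have t: "pr t" using W(5) ord_dvd_order[OF wc] dvd_trans unfolding pr_def by blast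
    \<comment> \<open>For \<open>t = r\<close> the subgroup \<open>W\<close> would be a normal
      \<open>r\<close>-subgroup larger than \<open>R\<close>.\<close>
    have "t \<noteq> r"
    proof
      assume tr: "t = r"
      have "y [^] (r ^ Suc i) = \<one>" if y: "y \<in> W" for y
      proof -
        have "(y [^] r) [^] (r ^ i) = \<one>" using pow_card_eq_one[OF R(1)] exW[OF y] R(3) tr by simp
        then show ?thesis using y W(4) by (auto simp: nat_pow_pow)
      qed
      then obtain n where "card W = r ^ n" using prime_power_card[OF M(4) W(1)] by blast
      then show False using maxR[OF W(1,2)] W(3) by blast
    qed
    \<comment> \<open>The degenerate case: \<open>{\<one>}\<close>, of order \<open>t ^ 0\<close>,
      serves as the \<open>t\<close>-radical, so the product of the two radicals is \<open>R\<close>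
      itself.\<close>
    moreover have "R = {x \<otimes> y | x y. x \<in> R \<and> y \<in> {\<one>}}" using Rc by force
    moreover have "card {\<one>} = t ^ 0" by simp
    moreover have "commutes x y" if "x \<in> R" "y \<in> {\<one>}" for x y using that Rc by auto
    moreover have "N \<subseteq> {\<one>}" if "subgroup N G" "invariant (carrier G) N" "card N = t ^ k" for N k
      using only[OF that t] \<open>t \<noteq> r\<close> by simp
    ultimately show False
      by (intro p_chief_factor_noncentral[OF r t _ R triv_subgroup oi _ _ _ R(1,2) _ W(1-3) exW coW minW, where j = 0]) auto
  qed
qed

end

theorem proposition1:
  fixes G :: "('a, 'b) monoid_scheme"
  assumes "group G"
    and "finite (carrier G)"
    and "solvable G"
    and "group_sigma G = 2"
    and "\<And>p q. \<lbrakk>p \<in> group_primes G; q \<in> group_primes G; p \<noteq> q\<rbrakk> \<Longrightarrow> \<not> p dvd q - 1"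
    and "\<And>p q. \<lbrakk>p \<in> group_primes G; q \<in> group_primes G; p \<noteq> q\<rbrakk> \<Longrightarrow> p * q \<in> element_orders G"
  shows "card (group_primes G) \<le> 3"
proof (rule ccontr)
  assume four: "\<not> card (group_primes G) \<le> 3"
  interpret fin_group G using assms(1,2) by (simp add: fin_group_def fin_group_axioms_def)
  have gp: "p \<in> group_primes G" if "prime p" "p dvd card (carrier G)" for p
    using that by (auto simp: group_primes_def Coset.order_def in_prime_factors_iff)
  have "card (prime_factors (ord g)) \<le> 2" if "g \<in> carrier G" for g
  proof -
    have "card (element_primes G g) \<le> group_sigma G"
      unfolding group_sigma_def using that by (intro Max_ge) auto
    then show ?thesis by (simp add: assms(4) element_primes_def)
  qed
  moreover have "\<exists>g\<in>carrier G. ord g = p * q"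
    if "prime p" "prime q" "p \<noteq> q" "p dvd card (carrier G)" "q dvd card (carrier G)" for p q
  proof -
    have "p * q \<in> ord ` carrier G" using assms(6)[OF gp gp] that by (simp add: element_orders_def)
    then show ?thesis by force
  qed
  moreover have "4 \<le> card (prime_factors (card (carrier G)))"
    using four by (simp add: group_primes_def Coset.order_def)
  ultimately interpret linked_group G
    using assms(3,5) gp by unfold_locales blast+
  show False by (rule linked_False)
qed

end
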